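(* Bott-Chern and Aeppli cohomology give contravariant functors $$H_{BC}:\{\text{almost complex manifolds}\}\to\{\text{bigraded-commutative }\mathbb{C}\text{-algebras}\},$$ $$H_{A}:\{\text{almost complex manifolds}\}\to\{\text{bigraded modules over }H_{BC}\},$$ together with natural transformations $$H_{BC}\to H_{Dol},\quad H_{BC}\to (H_{dR},F,\bar F),\quad H_{BC}\to H_{Dolbar},\quad H_{Dol}\to H_A,\quad (H_{dR},F,\bar F)\to H_A,\quad H_{Dolbar}\to H_A$$ forming a commutative diagram (the three composites $H_{BC}\to H_A$ agree), and natural $\mathbb{C}$-antilinear isomorphisms $H_{BC}^{p,q}(X)\cong H_{BC}^{q,p}(X)$ and $H_{A}^{p,q}(X)\cong H_A^{q,p}(X)$ for every almost complex manifold $X$ and all $p,q$.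
   Context: Morphisms of almost complex manifolds $(X,J)\to(X',J')$ are smooth maps $f$ with $df\circ J=J'\circ df$. For an almost complex manifold $X$ let $\mathcal{A}=\mathcal{A}_X=\bigoplus_{p,q}\mathcal{A}^{p,q}_X$ be the bigraded algebra of smooth complex-valued differential forms; $d=\bar\mu+\bar\partial+\partial+\mu$ with components of bidegrees $(-1,2),(0,1),(1,0),(2,-1)$. Put $$\mathcal{A}_s:=\ker\bar\mu\cap\ker\bar\partial^2\cap\ker\partial^2\cap\ker\mu,\qquad \mathcal{A}_q:=\mathcal{A}/(\operatorname{im}\bar\mu+\operatorname{im}\bar\partial^2+\operatorname{im}\partial^2+\operatorname{im}\mu).$$ With the maps induced by $\partial,\bar\partial$ these are double complexes ($\partial^2=\bar\partial^2=\partial\bar\partial+\bar\partial\partial=0$). Define $$H_{BC}(X):=\frac{\ker\partial\cap\ker\bar\partial}{\operatorname{im}\partial\bar\partial}\ \text{computed in }\mathcal{A}_s,\qquad H_A(X):=\frac{\ker\partial\bar\partial}{\operatorname{im}\partial+\operatorname{im}\bar\partial}\ \text{computed in }\mathcal{A}_q.$$ Moreover $H_{Dol}(X):=H_{\bar\partial}(H_{\bar\mu}(\mathcal{A}))$, $H_{Dolbar}(X):=H_{\partial}(H_{\mu}(\mathcal{A}))$, and $H_{dR}(X)=H_d(\mathcal{A})$. $F$ and $\bar F$ are the filtrations on $H_{dR}$ induced by the (Frölicher-type) spectral sequences $H_{Dol}\Rightarrow H_{dR}$ and $H_{Dolbar}\Rightarrow H_{dR}$: the first is the spectral sequence of the filtration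 $F^p\mathcal{A}^k=(\ker\bar\mu\cap\mathcal{A}^{p,k-p})\oplus\bigoplus_{i>p}\mathcal{A}^{i,k-i}$ of $(\mathcal{A},d)$, the second is obtained by exchanging the two gradings and replacing $\bar\mu$ by $\mu$. The natural transformations are the maps induced by $\mathcal{A}_s\hookrightarrow\mathcal{A}\twoheadrightarrow\mathcal{A}_q$ and the identity on forms. The algebra structure on $H_{BC}(X)$ and the $H_{BC}(X)$-module structure on $H_A(X)$ are induced by the wedge product. *)

theory Defs
  imports
    "HOL-Analysis.Analysis"
    "HOL-Algebra.Module"
    "HOL-Algebra.QuotRing"
    "HOL-Library.Function_Algebras"

begin

section \<open>Graded and filtered complex vector spaces, subquotients\<close>

text \<open>The complex numbers as a ring record, so that \<^const>\<open>module\<close> \<open>\<C>\<close> \<open>M\<close> says that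
  \<open>M\<close> is a complex vector space (the fields \<open>mult\<close>, \<open>one\<close> of \<open>M\<close> are irrelevant for this).\<close>

definition Cring :: "complex ring" (\<open>\<C>\<close>) where
  "\<C> = \<lparr>carrier = UNIV, mult = (*), one = 1, zero = 0, add = (+)\<rparr>"

type_synonym 'm cmod = "(complex, 'm) module"

definition sum_of :: "'m cmod \<Rightarrow> ('i \<Rightarrow> 'm set) \<Rightarrow> 'i set \<Rightarrow> 'm set" where
  "sum_of M G S = {finsum M x T | x T. finite T \<and> T \<subseteq> S \<and> (\<forall>i\<in>T. x i \<in> G i)}"

definition graded_space :: "'m cmod \<Rightarrow> ('i \<Rightarrow> 'm set) \<Rightarrow> bool" where
  "graded_space M G \<longleftrightarrow> Module.module \<C> M \<and> (\<forall>i. submodule (G i) \<C> M) \<and>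
     (\<forall>x\<in>carrier M. \<exists>!c. (\<forall>i. c i \<in> G i) \<and> finite {i. c i \<noteq> \<zero>\<^bsub>M\<^esub>} \<and>
        x = finsum M c {i. c i \<noteq> \<zero>\<^bsub>M\<^esub>})"

definition linear_hom :: "'m cmod \<Rightarrow> 'n cmod \<Rightarrow> ('m \<Rightarrow> 'n) \<Rightarrow> bool" where
  "linear_hom M N h \<longleftrightarrow> h \<in> carrier M \<rightarrow> carrier N \<and>
     (\<forall>x\<in>carrier M. \<forall>y\<in>carrier M. h (x \<oplus>\<^bsub>M\<^esub> y) = h x \<oplus>\<^bsub>N\<^esub> h y) \<and>
     (\<forall>a. \<forall>x\<in>carrier M. h (a \<odot>\<^bsub>M\<^esub> x) = a \<odot>\<^bsub>N\<^esub> h x)"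

definition graded_hom ::
  "'m cmod \<Rightarrow> ('i \<Rightarrow> 'm set) \<Rightarrow> 'n cmod \<Rightarrow> ('i \<Rightarrow> 'n set) \<Rightarrow> ('m \<Rightarrow> 'n) \<Rightarrow> bool" where
  "graded_hom M G N G' h \<longleftrightarrow> linear_hom M N h \<and> (\<forall>i. h ` G i \<subseteq> G' i)"

text \<open>Bigraded algebras, commutative up to the Koszul sign of the total degree.\<close>

definition bigraded_comm_algebra :: "'m cmod \<Rightarrow> (int \<times> int \<Rightarrow> 'm set) \<Rightarrow> bool" where
  "bigraded_comm_algebra M G \<longleftrightarrow> Ring.ring M \<and> graded_space M G \<and>
     (\<forall>a. \<forall>x\<in>carrier M. \<forall>y\<in>carrier M.
        (a \<odot>\<^bsub>M\<^esub> x) \<otimes>\<^bsub>M\<^esub> y = a \<odot>\<^bsub>M\<^esub> (x \<otimes>\<^bsub>M\<^esub> y) \<and>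
        x \<otimes>\<^bsub>M\<^esub> (a \<odot>\<^bsub>M\<^esub> y) = a \<odot>\<^bsub>M\<^esub> (x \<otimes>\<^bsub>M\<^esub> y)) \<and>
     \<one>\<^bsub>M\<^esub> \<in> G (0, 0) \<and>
     (\<forall>p q r s. \<forall>x\<in>G (p, q). \<forall>y\<in>G (r, s).
        x \<otimes>\<^bsub>M\<^esub> y \<in> G (p + r, q + s) \<and>
        x \<otimes>\<^bsub>M\<^esub> y = (-1) powi ((p + q) * (r + s)) \<odot>\<^bsub>M\<^esub> (y \<otimes>\<^bsub>M\<^esub> x))"

definition bigraded_algebra_hom ::
  "'m cmod \<Rightarrow> (int \<times> int \<Rightarrow> 'm set) \<Rightarrow> 'n cmod \<Rightarrow> (int \<times> int \<Rightarrow> 'n set) \<Rightarrow> ('m \<Rightarrow> 'n) \<Rightarrow> bool" where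
  "bigraded_algebra_hom M G N G' h \<longleftrightarrow> graded_hom M G N G' h \<and> h \<in> ring_hom M N"

definition bigraded_module ::
  "'r cmod \<Rightarrow> (int \<times> int \<Rightarrow> 'r set) \<Rightarrow> 'm cmod \<Rightarrow> (int \<times> int \<Rightarrow> 'm set) \<Rightarrow>
   ('r \<Rightarrow> 'm \<Rightarrow> 'm) \<Rightarrow> bool" where
  "bigraded_module R GR M G act \<longleftrightarrow> graded_space M G \<and>
     (\<forall>a\<in>carrier R. linear_hom M M (act a)) \<and>
     (\<forall>x\<in>carrier M. linear_hom R M (\<lambda>a. act a x)) \<and>
     (\<forall>a\<in>carrier R. \<forall>b\<in>carrier R. \<forall>x\<in>carrier M. act (a \<otimes>\<^bsub>R\<^esub> b) x = act a (act b x)) \<and>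
     (\<forall>x\<in>carrier M. act \<one>\<^bsub>R\<^esub> x = x) \<and>
     (\<forall>p q r s. \<forall>a\<in>GR (p, q). \<forall>x\<in>G (r, s). act a x \<in> G (p + r, q + s))"

text \<open>A graded space \<open>H = \<Oplus>\<^sub>k H k\<close> with two decreasing filtrations
  \<open>F p k\<close>, \<open>F' p k\<close> of each \<open>H k\<close>.\<close>

definition bifiltered_space ::
  "'m cmod \<Rightarrow> (int \<Rightarrow> 'm set) \<Rightarrow> (int \<Rightarrow> int \<Rightarrow> 'm set) \<Rightarrow> (int \<Rightarrow> int \<Rightarrow> 'm set) \<Rightarrow> bool" where
  "bifiltered_space M H F F' \<longleftrightarrow> graded_space M H \<and>
     (\<forall>p k. submodule (F p k) \<C> M \<and> F (p + 1) k \<subseteq> F p k \<and> F p k \<subseteq> H k) \<and>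
     (\<forall>p k. submodule (F' p k) \<C> M \<and> F' (p + 1) k \<subseteq> F' p k \<and> F' p k \<subseteq> H k)"

definition bifiltered_hom ::
  "'m cmod \<Rightarrow> (int \<Rightarrow> 'm set) \<Rightarrow> (int \<Rightarrow> int \<Rightarrow> 'm set) \<Rightarrow> (int \<Rightarrow> int \<Rightarrow> 'm set) \<Rightarrow>
   'n cmod \<Rightarrow> (int \<Rightarrow> 'n set) \<Rightarrow> (int \<Rightarrow> int \<Rightarrow> 'n set) \<Rightarrow> (int \<Rightarrow> int \<Rightarrow> 'n set) \<Rightarrow>
   ('m \<Rightarrow> 'n) \<Rightarrow> bool" where
  "bifiltered_hom M H F F' N K E E' h \<longleftrightarrow> graded_hom M H N K h \<and>
     (\<forall>p k. h ` F p k \<subseteq> E p k) \<and> (\<forall>p k. h ` F' p k \<subseteq> E' p k)"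

text \<open>A bigraded space is regarded as a bifiltered space by means of the following.\<close>

definition tot :: "'m cmod \<Rightarrow> (int \<times> int \<Rightarrow> 'm set) \<Rightarrow> int \<Rightarrow> 'm set" where
  "tot M G k = sum_of M G {(r, s). r + s = k}"

definition fil1 :: "'m cmod \<Rightarrow> (int \<times> int \<Rightarrow> 'm set) \<Rightarrow> int \<Rightarrow> int \<Rightarrow> 'm set" where
  "fil1 M G p k = sum_of M G {(r, s). r + s = k \<and> p \<le> r}"

definition fil2 :: "'m cmod \<Rightarrow> (int \<times> int \<Rightarrow> 'm set) \<Rightarrow> int \<Rightarrow> int \<Rightarrow> 'm set" where
  "fil2 M G q k = sum_of M G {(r, s). r + s = k \<and> q \<le> s}"

text \<open>The subquotient \<open>Z / B\<close> of \<open>M\<close>, whose elements are cosets. Its product is meaningful only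
  if \<open>Z\<close> is a subring of \<open>M\<close> with two-sided ideal \<open>B\<close>.\<close>

definition subquot :: "'m cmod \<Rightarrow> 'm set \<Rightarrow> 'm set \<Rightarrow> 'm set cmod" where
  "subquot M Z B = \<lparr>carrier = (\<lambda>x. B +>\<^bsub>M\<^esub> x) ` Z, mult = rcoset_mult M B, one = B +>\<^bsub>M\<^esub> \<one>\<^bsub>M\<^esub>,
     zero = B, add = set_add M, smult = (\<lambda>a C. \<Union>x\<in>C. B +>\<^bsub>M\<^esub> (a \<odot>\<^bsub>M\<^esub> x))\<rparr>"

definition subquot_gr :: "'m cmod \<Rightarrow> 'm set \<Rightarrow> 'm set \<Rightarrow> ('i \<Rightarrow> 'm set) \<Rightarrow> 'i \<Rightarrow> 'm set set" where
  "subquot_gr M Z B G i = (\<lambda>x. B +>\<^bsub>M\<^esub> x) ` (Z \<inter> G i)"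

text \<open>The map \<open>[x] \<mapsto> [h x]\<close> from cosets (of anything) to cosets of \<open>B\<close> in \<open>M\<close>. If this is
  not well defined on \<open>C\<close>, the value is not a coset of \<open>B\<close>.\<close>

definition induced :: "'n cmod \<Rightarrow> 'n set \<Rightarrow> ('m \<Rightarrow> 'n) \<Rightarrow> 'm set \<Rightarrow> 'n set" where
  "induced M B h C = (\<Union>x\<in>C. B +>\<^bsub>M\<^esub> h x)"

definition cocyc :: "'m cmod \<Rightarrow> ('m \<Rightarrow> 'm) \<Rightarrow> 'm set" where
  "cocyc M D = {x \<in> carrier M. D x = \<zero>\<^bsub>M\<^esub>}"

definition cobd :: "'m cmod \<Rightarrow> ('m \<Rightarrow> 'm) \<Rightarrow> 'm set" where
  "cobd M D = D ` carrier M"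

definition cohom :: "'m cmod \<Rightarrow> ('m \<Rightarrow> 'm) \<Rightarrow> 'm set cmod" where
  "cohom M D = subquot M (cocyc M D) (cobd M D)"

definition cohom_gr :: "'m cmod \<Rightarrow> ('m \<Rightarrow> 'm) \<Rightarrow> ('i \<Rightarrow> 'm set) \<Rightarrow> 'i \<Rightarrow> 'm set set" where
  "cohom_gr M D = subquot_gr M (cocyc M D) (cobd M D)"

text \<open>For a double complex \<open>(M, D, D')\<close>, \<open>bc_cocyc / bc_cobd\<close> is Bott--Chern and
  \<open>ae_cocyc / ae_cobd\<close> is Aeppli cohomology.\<close>

definition bc_cocyc :: "'m cmod \<Rightarrow> ('m \<Rightarrow> 'm) \<Rightarrow> ('m \<Rightarrow> 'm) \<Rightarrow> 'm set" where
  "bc_cocyc M D D' = cocyc M D \<inter> cocyc M D'"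

definition bc_cobd :: "'m cmod \<Rightarrow> ('m \<Rightarrow> 'm) \<Rightarrow> ('m \<Rightarrow> 'm) \<Rightarrow> 'm set" where
  "bc_cobd M D D' = cobd M (D \<circ> D')"

definition ae_cocyc :: "'m cmod \<Rightarrow> ('m \<Rightarrow> 'm) \<Rightarrow> ('m \<Rightarrow> 'm) \<Rightarrow> 'm set" where
  "ae_cocyc M D D' = cocyc M (D \<circ> D')"

definition ae_cobd :: "'m cmod \<Rightarrow> ('m \<Rightarrow> 'm) \<Rightarrow> ('m \<Rightarrow> 'm) \<Rightarrow> 'm set" where
  "ae_cobd M D D' = cobd M D <+>\<^bsub>M\<^esub> cobd M D'"


section \<open>Almost complex manifolds\<close>

text \<open>Used only for open \<open>S\<close>; the derivatives are those in the full space. A map is smooth if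
  its iterated directional derivatives, in all directions, exist and are differentiable.\<close>

primrec diff_order_on ::
  "nat \<Rightarrow> 'e::real_normed_vector set \<Rightarrow> ('e \<Rightarrow> 'f::real_normed_vector) \<Rightarrow> bool" where
  "diff_order_on 0 S f \<longleftrightarrow> continuous_on S f"
| "diff_order_on (Suc n) S f \<longleftrightarrow> (\<forall>x\<in>S. f differentiable (at x)) \<and>
     (\<forall>v. diff_order_on n S (\<lambda>x. frechet_derivative f (at x) v))"

definition smooth_on :: "'e::real_normed_vector set \<Rightarrow> ('e \<Rightarrow> 'f::real_normed_vector) \<Rightarrow> bool" where
  "smooth_on S f \<longleftrightarrow> (\<forall>n. diff_order_on n S f)"

text \<open>A chart is a pair \<open>(U, \<phi>)\<close>; only the values of \<open>\<phi>\<close> on \<open>U\<close> matter. The model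
  space \<open>'e\<close> is a finite-dimensional inner product space; the class \<open>euclidean_space\<close> would
  exclude dimension 0. The field \<open>acs\<close> gives the almost complex structure in each chart:
  \<open>acs X c u\<close> is the endomorphism of the tangent space at the point with coordinate \<open>u\<close>
  in the chart \<open>c\<close>, written in the coordinates of \<open>c\<close>.\<close>

type_synonym ('a, 'e) chart = "'a set \<times> ('a \<Rightarrow> 'e)"

record ('a, 'e) acm =
  mtop :: "'a topology"
  atlas :: "('a, 'e) chart set"
  acs :: "('a, 'e) chart \<Rightarrow> 'e \<Rightarrow> 'e \<Rightarrow> 'e"

definition cod :: "('a, 'e) chart \<Rightarrow> 'e set" where
  "cod c = snd c ` fst c"

definition param :: "('a, 'e) chart \<Rightarrow> 'e \<Rightarrow> 'a" where
  "param c = inv_into (fst c) (snd c)"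

text \<open>The coordinate expression of a map \<open>f\<close> with respect to two charts and its domain;
  for \<open>f = id\<close> these are the transition maps.\<close>

definition locrep :: "('a, 'e) chart \<Rightarrow> ('b, 'f) chart \<Rightarrow> ('a \<Rightarrow> 'b) \<Rightarrow> 'e \<Rightarrow> 'f" where
  "locrep c c' f = snd c' \<circ> f \<circ> param c"

definition locdom :: "('a, 'e) chart \<Rightarrow> ('b, 'f) chart \<Rightarrow> ('a \<Rightarrow> 'b) \<Rightarrow> 'e set" where
  "locdom c c' f = snd c ` (fst c \<inter> f -` fst c')"

definition smooth_manifold :: "('a, 'e::real_inner) acm \<Rightarrow> bool" where
  "smooth_manifold X \<longleftrightarrow> (\<exists>B::'e set. finite B \<and> span B = UNIV) \<and>
     Hausdorff_space (mtop X) \<and> second_countable (mtop X) \<and>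
     (\<Union>c\<in>atlas X. fst c) = topspace (mtop X) \<and>
     (\<forall>c\<in>atlas X. openin (mtop X) (fst c) \<and> open (cod c) \<and>
        homeomorphic_map (subtopology (mtop X) (fst c)) (top_of_set (cod c)) (snd c)) \<and>
     (\<forall>c\<in>atlas X. \<forall>c'\<in>atlas X. smooth_on (locdom c c' id) (locrep c c' id))"

definition almost_complex_manifold :: "('a, 'e::real_inner) acm \<Rightarrow> bool" where
  "almost_complex_manifold X \<longleftrightarrow> smooth_manifold X \<and>
     (\<forall>c\<in>atlas X. (\<forall>v. smooth_on (cod c) (\<lambda>u. acs X c u v)) \<and>
        (\<forall>u\<in>cod c. linear (acs X c u) \<and> (\<forall>v. acs X c u (acs X c u v) = - v))) \<and>
     (\<forall>c\<in>atlas X. \<forall>c'\<in>atlas X. \<forall>u\<in>locdom c c' id. \<forall>v.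
        frechet_derivative (locrep c c' id) (at u) (acs X c u v) =
        acs X c' (locrep c c' id u) (frechet_derivative (locrep c c' id) (at u) v))"

definition acm_morphism ::
  "('a, 'e::real_inner) acm \<Rightarrow> ('b, 'f::real_inner) acm \<Rightarrow> ('a \<Rightarrow> 'b) \<Rightarrow> bool" where
  "acm_morphism X Y f \<longleftrightarrow> continuous_map (mtop X) (mtop Y) f \<and>
     (\<forall>c\<in>atlas X. \<forall>c'\<in>atlas Y. smooth_on (locdom c c' f) (locrep c c' f) \<and>
        (\<forall>u\<in>locdom c c' f. \<forall>v.
           frechet_derivative (locrep c c' f) (at u) (acs X c u v) =
           acs Y c' (locrep c c' f u) (frechet_derivative (locrep c c' f) (at u) v)))"


section \<open>Differential forms\<close>

text \<open>An element of \<open>\<Oplus>\<^sub>k \<Lambda>\<^sup>k\<close> of the complexified dual of \<open>'e\<close> is a function on lists of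
  vectors whose restriction to lists of each length \<open>k\<close> is multilinear and alternating; for
  \<open>k\<close> above the dimension this restriction vanishes.\<close>

type_synonym 'e ext = "'e list \<Rightarrow> complex"

definition alternating :: "'e::real_vector ext \<Rightarrow> bool" where
  "alternating \<alpha> \<longleftrightarrow>
     (\<forall>vs. \<forall>i<length vs. linear (\<lambda>v. \<alpha> (vs[i := v]))) \<and>
     (\<forall>vs i j. i < j \<and> j < length vs \<and> vs ! i = vs ! j \<longrightarrow> \<alpha> vs = 0)"

text \<open>The exterior product as a sum over shuffles (the normalisation in which
  \<open>\<alpha>\<^sub>1 \<and> \<dots> \<and> \<alpha>\<^sub>k\<close> is a determinant for covectors \<open>\<alpha>\<^sub>i\<close>). The set \<open>S\<close> contains the
  positions of the arguments going to the first factor.\<close>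

definition shuffle_sign :: "nat \<Rightarrow> nat set \<Rightarrow> complex" where
  "shuffle_sign n S = (-1) ^ card {(i, j). i < j \<and> j < n \<and> i \<notin> S \<and> j \<in> S}"

definition ext_wedge :: "'e ext \<Rightarrow> 'e ext \<Rightarrow> 'e ext" where
  "ext_wedge \<alpha> \<beta> = (\<lambda>vs. \<Sum>S\<in>Pow {..<length vs}.
     shuffle_sign (length vs) S * \<alpha> (nths vs S) * \<beta> (nths vs (- S)))"

definition ext_one :: "'e ext" where
  "ext_one = (\<lambda>vs. if vs = [] then 1 else 0)"

definition covector :: "('e \<Rightarrow> complex) \<Rightarrow> 'e ext" where
  "covector a = (\<lambda>vs. case vs of [v] \<Rightarrow> a v | _ \<Rightarrow> 0)"

text \<open>\<open>\<Lambda>\<^sup>p\<^sup>,\<^sup>q\<close> of a real vector space with complex structure \<open>j\<close>: the complex span of the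
  products of \<open>p\<close> covectors of type (1,0) and \<open>q\<close> covectors of type (0,1).\<close>

definition ext_pq :: "('e::real_vector \<Rightarrow> 'e) \<Rightarrow> int \<Rightarrow> int \<Rightarrow> 'e ext set" where
  "ext_pq j p q = Modules.module.span (\<lambda>z \<alpha> vs. z * \<alpha> vs)
     {foldr ext_wedge (map covector (as @ bs)) ext_one | as bs.
        int (length as) = p \<and> int (length bs) = q \<and>
        (\<forall>a\<in>set as. linear a \<and> (\<forall>v. a (j v) = \<i> * a v)) \<and>
        (\<forall>b\<in>set bs. linear b \<and> (\<forall>v. b (j v) = - \<i> * b v))}"

definition ext_d :: "('e::real_normed_vector \<Rightarrow> 'e ext) \<Rightarrow> 'e \<Rightarrow> 'e ext" where
  "ext_d \<omega> u = (\<lambda>vs. \<Sum>i<length vs.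
     (-1) ^ i * frechet_derivative (\<lambda>y. \<omega> y (take i vs @ drop (Suc i) vs)) (at u) (vs ! i))"

text \<open>A differential form (of mixed degree) is given by its coordinate expressions in all charts,
  compatible under changes of charts and extended by 0 outside the charts.\<close>

type_synonym ('a, 'e) form = "('a, 'e) chart \<Rightarrow> 'e \<Rightarrow> 'e ext"

definition forms :: "('a, 'e::real_inner) acm \<Rightarrow> ('a, 'e) form set" where
  "forms X = {\<omega>.
     (\<forall>c u. c \<notin> atlas X \<or> u \<notin> cod c \<longrightarrow> \<omega> c u = 0) \<and>
     (\<forall>c\<in>atlas X. \<forall>u\<in>cod c. alternating (\<omega> c u)) \<and>
     (\<forall>c\<in>atlas X. \<forall>vs. smooth_on (cod c) (\<lambda>u. \<omega> c u vs)) \<and>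
     (\<forall>c\<in>atlas X. \<forall>c'\<in>atlas X. \<forall>u\<in>locdom c c' id. \<forall>vs.
        \<omega> c u vs = \<omega> c' (locrep c c' id u) (map (frechet_derivative (locrep c c' id) (at u)) vs))}"

definition wedge :: "('a, 'e) form \<Rightarrow> ('a, 'e) form \<Rightarrow> ('a, 'e) form" where
  "wedge \<omega> \<eta> = (\<lambda>c u. ext_wedge (\<omega> c u) (\<eta> c u))"

definition unit_form :: "('a, 'e) acm \<Rightarrow> ('a, 'e) form" where
  "unit_form X = (\<lambda>c u. if c \<in> atlas X \<and> u \<in> cod c then ext_one else 0)"

definition conj_form :: "('a, 'e) form \<Rightarrow> ('a, 'e) form" where
  "conj_form \<omega> = (\<lambda>c u vs. cnj (\<omega> c u vs))"

definition form_alg :: "('a, 'e::real_inner) acm \<Rightarrow> ('a, 'e) form cmod" (\<open>\<A>\<close>) where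
  "\<A> X = \<lparr>carrier = forms X, mult = wedge, one = unit_form X, zero = 0, add = (+),
     smult = (\<lambda>a \<omega> c u vs. a * \<omega> c u vs)\<rparr>"

definition form_deg :: "('a, 'e::real_inner) acm \<Rightarrow> int \<Rightarrow> ('a, 'e) form set" where
  "form_deg X k = {\<omega> \<in> forms X. \<forall>c u vs. int (length vs) \<noteq> k \<longrightarrow> \<omega> c u vs = 0}"

definition form_pq :: "('a, 'e::real_inner) acm \<Rightarrow> int \<times> int \<Rightarrow> ('a, 'e) form set" where
  "form_pq X = (\<lambda>(p, q). {\<omega> \<in> forms X. \<forall>c\<in>atlas X. \<forall>u\<in>cod c. \<omega> c u \<in> ext_pq (acs X c u) p q})"

definition ext_diff :: "('a, 'e::real_inner) acm \<Rightarrow> ('a, 'e) form \<Rightarrow> ('a, 'e) form" where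
  "ext_diff X \<omega> = (\<lambda>c u. if c \<in> atlas X \<and> u \<in> cod c then ext_d (\<omega> c) u else 0)"

definition pull ::
  "('a, 'e::real_inner) acm \<Rightarrow> ('b, 'f::real_inner) acm \<Rightarrow> ('a \<Rightarrow> 'b) \<Rightarrow> ('b, 'f) form \<Rightarrow> ('a, 'e) form" where
  "pull X Y f \<omega> = (\<lambda>c u vs. if c \<in> atlas X \<and> u \<in> cod c then
     (let c' = (SOME c'. c' \<in> atlas Y \<and> f (param c u) \<in> fst c')
      in \<omega> c' (locrep c c' f u) (map (frechet_derivative (locrep c c' f) (at u)) vs))
     else 0)"

text \<open>The components of a form with respect to \<open>\<A> = \<Oplus> \<A>\<^sup>p\<^sup>,\<^sup>q\<close>, and the component of
  bidegree \<open>(a, b)\<close> of the exterior derivative.\<close>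

definition component ::
  "('a, 'e::real_inner) acm \<Rightarrow> int \<times> int \<Rightarrow> ('a, 'e) form \<Rightarrow> ('a, 'e) form" where
  "component X i \<omega> = (THE \<eta>. (\<forall>i. \<eta> i \<in> form_pq X i) \<and> finite {i. \<eta> i \<noteq> 0} \<and>
     \<omega> = (\<Sum>i\<in>{i. \<eta> i \<noteq> 0}. \<eta> i)) i"

definition d_part ::
  "('a, 'e::real_inner) acm \<Rightarrow> int \<Rightarrow> int \<Rightarrow> ('a, 'e) form \<Rightarrow> ('a, 'e) form" where
  "d_part X a b \<omega> = (\<Sum>(p, q)\<in>{i. component X i \<omega> \<noteq> 0}.
     component X (p + a, q + b) (ext_diff X (component X (p, q) \<omega>)))"

definition mubar :: "('a, 'e::real_inner) acm \<Rightarrow> ('a, 'e) form \<Rightarrow> ('a, 'e) form" where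
  "mubar X = d_part X (-1) 2"

definition delbar :: "('a, 'e::real_inner) acm \<Rightarrow> ('a, 'e) form \<Rightarrow> ('a, 'e) form" where
  "delbar X = d_part X 0 1"

definition del :: "('a, 'e::real_inner) acm \<Rightarrow> ('a, 'e) form \<Rightarrow> ('a, 'e) form" where
  "del X = d_part X 1 0"

definition mu :: "('a, 'e::real_inner) acm \<Rightarrow> ('a, 'e) form \<Rightarrow> ('a, 'e) form" where
  "mu X = d_part X 2 (-1)"


section \<open>Cohomologies\<close>

subsection \<open>Bott--Chern cohomology\<close>

definition A_s :: "('a, 'e::real_inner) acm \<Rightarrow> ('a, 'e) form cmod" where
  "A_s X = (\<A> X)\<lparr>carrier := cocyc (\<A> X) (mubar X) \<inter> cocyc (\<A> X) (delbar X \<circ> delbar X)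
     \<inter> cocyc (\<A> X) (del X \<circ> del X) \<inter> cocyc (\<A> X) (mu X)\<rparr>"

definition BC_Z :: "('a, 'e::real_inner) acm \<Rightarrow> ('a, 'e) form set" where
  "BC_Z X = bc_cocyc (A_s X) (del X) (delbar X)"

definition BC_B :: "('a, 'e::real_inner) acm \<Rightarrow> ('a, 'e) form set" where
  "BC_B X = bc_cobd (A_s X) (del X) (delbar X)"

definition H_BC :: "('a, 'e::real_inner) acm \<Rightarrow> ('a, 'e) form set cmod" where
  "H_BC X = subquot (A_s X) (BC_Z X) (BC_B X)"

definition H_BC_pq :: "('a, 'e::real_inner) acm \<Rightarrow> int \<times> int \<Rightarrow> ('a, 'e) form set set" where
  "H_BC_pq X = subquot_gr (A_s X) (BC_Z X) (BC_B X) (form_pq X)"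

definition BC_pull ::
  "('a, 'e::real_inner) acm \<Rightarrow> ('b, 'f::real_inner) acm \<Rightarrow> ('a \<Rightarrow> 'b) \<Rightarrow>
   ('b, 'f) form set \<Rightarrow> ('a, 'e) form set" where
  "BC_pull X Y f = induced (A_s X) (BC_B X) (pull X Y f)"

definition BC_conj :: "('a, 'e::real_inner) acm \<Rightarrow> ('a, 'e) form set \<Rightarrow> ('a, 'e) form set" where
  "BC_conj X = induced (A_s X) (BC_B X) conj_form"

subsection \<open>Aeppli cohomology\<close>

definition I_q :: "('a, 'e::real_inner) acm \<Rightarrow> ('a, 'e) form set" where
  "I_q X = cobd (\<A> X) (mubar X) <+>\<^bsub>\<A> X\<^esub> cobd (\<A> X) (delbar X \<circ> delbar X)
     <+>\<^bsub>\<A> X\<^esub> cobd (\<A> X) (del X \<circ> del X) <+>\<^bsub>\<A> X\<^esub> cobd (\<A> X) (mu X)"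

definition A_q :: "('a, 'e::real_inner) acm \<Rightarrow> ('a, 'e) form set cmod" where
  "A_q X = subquot (\<A> X) (forms X) (I_q X)"

definition A_q_pq :: "('a, 'e::real_inner) acm \<Rightarrow> int \<times> int \<Rightarrow> ('a, 'e) form set set" where
  "A_q_pq X = subquot_gr (\<A> X) (forms X) (I_q X) (form_pq X)"

text \<open>The map \<open>A_q Y \<rightarrow> A_q X\<close> (or \<open>A_q X \<rightarrow> A_q X\<close>) induced by a map of forms.\<close>

definition to_q ::
  "('a, 'e::real_inner) acm \<Rightarrow> (('b, 'f) form \<Rightarrow> ('a, 'e) form) \<Rightarrow> ('b, 'f) form set \<Rightarrow> ('a, 'e) form set" where
  "to_q X h = induced (\<A> X) (I_q X) h"

definition AE_Z :: "('a, 'e::real_inner) acm \<Rightarrow> ('a, 'e) form set set" where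
  "AE_Z X = ae_cocyc (A_q X) (to_q X (del X)) (to_q X (delbar X))"

definition AE_B :: "('a, 'e::real_inner) acm \<Rightarrow> ('a, 'e) form set set" where
  "AE_B X = ae_cobd (A_q X) (to_q X (del X)) (to_q X (delbar X))"

definition H_A :: "('a, 'e::real_inner) acm \<Rightarrow> ('a, 'e) form set set cmod" where
  "H_A X = subquot (A_q X) (AE_Z X) (AE_B X)"

definition H_A_pq :: "('a, 'e::real_inner) acm \<Rightarrow> int \<times> int \<Rightarrow> ('a, 'e) form set set set" where
  "H_A_pq X = subquot_gr (A_q X) (AE_Z X) (AE_B X) (A_q_pq X)"

definition A_pull ::
  "('a, 'e::real_inner) acm \<Rightarrow> ('b, 'f::real_inner) acm \<Rightarrow> ('a \<Rightarrow> 'b) \<Rightarrow>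
   ('b, 'f) form set set \<Rightarrow> ('a, 'e) form set set" where
  "A_pull X Y f = induced (A_q X) (AE_B X) (to_q X (pull X Y f))"

definition A_conj :: "('a, 'e::real_inner) acm \<Rightarrow> ('a, 'e) form set set \<Rightarrow> ('a, 'e) form set set" where
  "A_conj X = induced (A_q X) (AE_B X) (to_q X conj_form)"

text \<open>The action \<open>[a] [w] = [a \<and> w]\<close> of Bott--Chern on Aeppli cohomology.\<close>

definition BC_act ::
  "('a, 'e::real_inner) acm \<Rightarrow> ('a, 'e) form set \<Rightarrow> ('a, 'e) form set set \<Rightarrow> ('a, 'e) form set set" where
  "BC_act X C W = (\<Union>a\<in>C. induced (A_q X) (AE_B X) (to_q X (wedge a)) W)"

subsection \<open>Dolbeault cohomology and its conjugate\<close>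

text \<open>Both are instances of \<open>H\<^sub>E (H\<^sub>D \<A>)\<close>, for \<open>(D, E) = (mubar, delbar)\<close> and
  \<open>(D, E) = (mu, del)\<close>.\<close>

definition H1 :: "('a, 'e::real_inner) acm \<Rightarrow> (('a, 'e) form \<Rightarrow> ('a, 'e) form) \<Rightarrow> ('a, 'e) form set cmod" where
  "H1 X D = cohom (\<A> X) D"

definition to_H1 ::
  "('a, 'e::real_inner) acm \<Rightarrow> (('a, 'e) form \<Rightarrow> ('a, 'e) form) \<Rightarrow>
   (('b, 'f) form \<Rightarrow> ('a, 'e) form) \<Rightarrow> ('b, 'f) form set \<Rightarrow> ('a, 'e) form set" where
  "to_H1 X D h = induced (\<A> X) (cobd (\<A> X) D) h"

definition H2 ::
  "('a, 'e::real_inner) acm \<Rightarrow> (('a, 'e) form \<Rightarrow> ('a, 'e) form) \<Rightarrow>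
   (('a, 'e) form \<Rightarrow> ('a, 'e) form) \<Rightarrow> ('a, 'e) form set set cmod" where
  "H2 X D E = cohom (H1 X D) (to_H1 X D E)"

definition H2_pq ::
  "('a, 'e::real_inner) acm \<Rightarrow> (('a, 'e) form \<Rightarrow> ('a, 'e) form) \<Rightarrow>
   (('a, 'e) form \<Rightarrow> ('a, 'e) form) \<Rightarrow> int \<times> int \<Rightarrow> ('a, 'e) form set set set" where
  "H2_pq X D E = cohom_gr (H1 X D) (to_H1 X D E) (cohom_gr (\<A> X) D (form_pq X))"

definition H2_pull ::
  "('a, 'e::real_inner) acm \<Rightarrow> (('a, 'e) form \<Rightarrow> ('a, 'e) form) \<Rightarrow>
   (('a, 'e) form \<Rightarrow> ('a, 'e) form) \<Rightarrow> ('b, 'f::real_inner) acm \<Rightarrow> ('a \<Rightarrow> 'b) \<Rightarrow>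
   ('b, 'f) form set set \<Rightarrow> ('a, 'e) form set set" where
  "H2_pull X D E Y f = induced (H1 X D) (cobd (H1 X D) (to_H1 X D E)) (to_H1 X D (pull X Y f))"

abbreviation "H_Dol X \<equiv> H2 X (mubar X) (delbar X)"
abbreviation "H_Dol_pq X \<equiv> H2_pq X (mubar X) (delbar X)"
abbreviation "Dol_pull X Y f \<equiv> H2_pull X (mubar X) (delbar X) Y f"

abbreviation "H_Dolbar X \<equiv> H2 X (mu X) (del X)"
abbreviation "H_Dolbar_pq X \<equiv> H2_pq X (mu X) (del X)"
abbreviation "Dolbar_pull X Y f \<equiv> H2_pull X (mu X) (del X) Y f"

subsection \<open>De Rham cohomology and its two filtrations\<close>

definition H_dR :: "('a, 'e::real_inner) acm \<Rightarrow> ('a, 'e) form set cmod" where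
  "H_dR X = cohom (\<A> X) (ext_diff X)"

definition H_dR_deg :: "('a, 'e::real_inner) acm \<Rightarrow> int \<Rightarrow> ('a, 'e) form set set" where
  "H_dR_deg X = cohom_gr (\<A> X) (ext_diff X) (form_deg X)"

definition dR_pull ::
  "('a, 'e::real_inner) acm \<Rightarrow> ('b, 'f::real_inner) acm \<Rightarrow> ('a \<Rightarrow> 'b) \<Rightarrow>
   ('b, 'f) form set \<Rightarrow> ('a, 'e) form set" where
  "dR_pull X Y f = induced (\<A> X) (cobd (\<A> X) (ext_diff X)) (pull X Y f)"

definition form_F :: "('a, 'e::real_inner) acm \<Rightarrow> int \<Rightarrow> int \<Rightarrow> ('a, 'e) form set" where
  "form_F X p k = (cocyc (\<A> X) (mubar X) \<inter> form_pq X (p, k - p))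
     <+>\<^bsub>\<A> X\<^esub> sum_of (\<A> X) (form_pq X) {(i, j). i + j = k \<and> p < i}"

definition form_Fbar :: "('a, 'e::real_inner) acm \<Rightarrow> int \<Rightarrow> int \<Rightarrow> ('a, 'e) form set" where
  "form_Fbar X q k = (cocyc (\<A> X) (mu X) \<inter> form_pq X (k - q, q))
     <+>\<^bsub>\<A> X\<^esub> sum_of (\<A> X) (form_pq X) {(i, j). i + j = k \<and> q < j}"

text \<open>The filtrations on cohomology: \<open>F\<^sup>p H\<^sup>k\<close> consists of the classes represented by closed
  elements of \<open>F\<^sup>p \<A>\<^sup>k\<close>.\<close>

definition dR_F :: "('a, 'e::real_inner) acm \<Rightarrow> int \<Rightarrow> int \<Rightarrow> ('a, 'e) form set set" where
  "dR_F X p = cohom_gr (\<A> X) (ext_diff X) (form_F X p)"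

definition dR_Fbar :: "('a, 'e::real_inner) acm \<Rightarrow> int \<Rightarrow> int \<Rightarrow> ('a, 'e) form set set" where
  "dR_Fbar X q = cohom_gr (\<A> X) (ext_diff X) (form_Fbar X q)"

subsection \<open>The natural transformations\<close>

definition BC_to_H2 ::
  "('a, 'e::real_inner) acm \<Rightarrow> (('a, 'e) form \<Rightarrow> ('a, 'e) form) \<Rightarrow>
   (('a, 'e) form \<Rightarrow> ('a, 'e) form) \<Rightarrow> ('a, 'e) form set \<Rightarrow> ('a, 'e) form set set" where
  "BC_to_H2 X D E = induced (H1 X D) (cobd (H1 X D) (to_H1 X D E)) (\<lambda>\<omega>. cobd (\<A> X) D +>\<^bsub>\<A> X\<^esub> \<omega>)"

text \<open>On elements, \<open>[[\<omega>]] \<mapsto> [[\<omega>]]\<close> for both \<open>H_Dol\<close> and \<open>H_Dolbar\<close>; the target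
  determines the formula.\<close>

definition H2_to_A :: "('a, 'e::real_inner) acm \<Rightarrow> ('a, 'e) form set set \<Rightarrow> ('a, 'e) form set set" where
  "H2_to_A X = induced (A_q X) (AE_B X) (to_q X id)"

abbreviation "BC_to_Dol X \<equiv> BC_to_H2 X (mubar X) (delbar X)"
abbreviation "BC_to_Dolbar X \<equiv> BC_to_H2 X (mu X) (del X)"

definition BC_to_dR :: "('a, 'e::real_inner) acm \<Rightarrow> ('a, 'e) form set \<Rightarrow> ('a, 'e) form set" where
  "BC_to_dR X = induced (\<A> X) (cobd (\<A> X) (ext_diff X)) id"

definition dR_to_A :: "('a, 'e::real_inner) acm \<Rightarrow> ('a, 'e) form set \<Rightarrow> ('a, 'e) form set set" where
  "dR_to_A X = induced (A_q X) (AE_B X) (\<lambda>\<omega>. I_q X +>\<^bsub>\<A> X\<^esub> \<omega>)"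

definition antilinear_iso_on ::
  "'m cmod \<Rightarrow> 'm set \<Rightarrow> 'm set \<Rightarrow> ('m \<Rightarrow> 'm) \<Rightarrow> bool" where
  "antilinear_iso_on M V W h \<longleftrightarrow> bij_betw h V W \<and>
     (\<forall>x\<in>V. \<forall>y\<in>V. h (x \<oplus>\<^bsub>M\<^esub> y) = h x \<oplus>\<^bsub>M\<^esub> h y) \<and>
     (\<forall>a. \<forall>x\<in>V. h (a \<odot>\<^bsub>M\<^esub> x) = cnj a \<odot>\<^bsub>M\<^esub> h x)"

end

theory Submission
  imports Defs
begin


text \<open>
  All five cohomologies are built from the algebra of forms by taking kernels, images and cosets,
  and every map in the theorem is induced by a map of forms: a pullback, complex conjugation, the
  product with a fixed form, or the identity. The statement therefore splits into a part about
  forms and a part about subquotients.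

  \<^bold>\<open>Forms.\<close> The facts needed are: forms are an algebra, pullback is a functorial
  homomorphism, \<open>d\<close> squares to zero, satisfies the Leibniz rule and commutes with pullback and with
  conjugation; forms are the direct sum of their components of type \<open>(p, q)\<close>; and \<open>d\<close> only has
  components of bidegrees \<open>(-1, 2), (0, 1), (1, 0), (2, -1)\<close>. The exterior algebra is treated by
  recursion on the list of arguments, through the contraction \<open>iota v\<close> with the first argument:
  \<open>iota v\<close> is an antiderivation of the wedge product (\<open>iota_wedge\<close>), and
  \<open>iota v (d \<omega>) = D\<^sub>v \<omega> - d (iota v \<omega>)\<close> (\<open>iota_ext_d\<close>), so that
  identities follow by induction on the number of arguments. Naturality of \<open>d\<close>
  (\<open>ext_d_pull\<close>) comes from the symmetry of second derivatives.

  The type decomposition rests on rotations. If \<open>R\<^sub>\<theta> = cos \<theta> + sin \<theta> J\<close>, then a form of type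
  \<open>(p, q)\<close> is multiplied by \<open>exp (\<i> (p - q) \<theta>)\<close> under pullback by \<open>R\<^sub>\<theta>\<close>. The component of type
  \<open>(p, q)\<close> is thus a Fourier coefficient in \<open>\<theta>\<close>, and a finite average over roots of unity computes
  it (\<open>proj_pq\<close>); this formula makes it evident that components of smooth forms are smooth and that
  they are compatible with pullback. The same method bounds the components of \<open>d\<close>: for \<open>\<omega>\<close> of pure
  type, \<open>d \<omega>\<close> evaluated on rotated vectors is a trigonometric polynomial with four frequencies only
  (\<open>ext_d_rot_trig\<close>), because \<open>J\<close> is differentiated at most once.

  \<^bold>\<open>Subquotients.\<close> Sorting \<open>d\<^sup>2 = 0\<close> by bidegree gives seven quadratic relations between the four
  operators, and all inclusions needed between cocycles and coboundaries are consequences of these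
  (locale \<open>almost_double_complex\<close>). For example, a Bott--Chern coboundary \<open>del (delbar x)\<close> with
  \<open>x\<close> in \<open>A_s\<close> equals \<open>d (delbar x)\<close> and also \<open>- delbar (del x)\<close> with \<open>mubar (del x) = 0\<close>, hence is
  a coboundary in de Rham and in Dolbeault cohomology; dually a closed form \<open>\<omega>\<close> satisfies
  \<open>del (delbar \<omega>) = - del (mubar \<omega> + del \<omega> + mu \<omega>)\<close>, which vanishes in \<open>A_q\<close>. The products are well defined
  by the Leibniz rule.

  Each cohomology is a quotient of a space of cocyclic forms by a subspace, even where the definition
  takes cosets twice. The relation \<open>represents Z B Q q\<close> records this: \<open>q\<close> maps \<open>Z\<close> onto \<open>Q\<close>
  with kernel \<open>B\<close>. Every map then has the form \<open>q \<omega> \<mapsto> q' (h \<omega>)\<close>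
  (\<open>induced_coset\<close>), and functoriality, naturality and commutativity of the diagram hold because
  they hold for the maps \<open>h\<close> on forms. Gradings and filtrations pass to the quotients because the
  subspaces are stable under taking components.
\<close>

section \<open>Complex vector spaces, subquotients and gradings\<close>

text \<open>Forms are functions with complex values, so a class with instances for functions equips forms,
  exterior algebras and complex numbers with the same linear structure.\<close>

class complex_vector = ab_group_add +
  fixes cscale :: "complex \<Rightarrow> 'a \<Rightarrow> 'a" (infixr \<open>*\<^sub>C\<close> 75)
  assumes cscale_add_right: "a *\<^sub>C (x + y) = a *\<^sub>C x + a *\<^sub>C y"
    and cscale_add_left: "(a + b) *\<^sub>C x = a *\<^sub>C x + b *\<^sub>C x"
    and cscale_cscale: "a *\<^sub>C b *\<^sub>C x = (a * b) *\<^sub>C x"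
    and cscale_one: "1 *\<^sub>C x = x"

instantiation complex :: complex_vector
begin
definition "a *\<^sub>C x = a * (x :: complex)"
instance by standard (auto simp: cscale_complex_def algebra_simps)
end

instantiation "fun" :: (type, complex_vector) complex_vector
begin
definition "a *\<^sub>C f = (\<lambda>x. a *\<^sub>C f x)"
instance by standard
  (auto simp: cscale_fun_def fun_eq_iff cscale_add_right cscale_add_left cscale_cscale cscale_one)
end

global_interpretation cv: vector_space "cscale :: complex \<Rightarrow> 'a::complex_vector \<Rightarrow> 'a"
  by unfold_locales (simp_all add: cscale_add_right cscale_add_left cscale_cscale cscale_one)

definition lin_on :: "'v::complex_vector set \<Rightarrow> ('v \<Rightarrow> 'w::complex_vector) \<Rightarrow> bool" where
  "lin_on V h \<longleftrightarrow> (\<forall>x\<in>V. \<forall>y\<in>V. h (x + y) = h x + h y) \<and> (\<forall>a. \<forall>x\<in>V. h (a *\<^sub>C x) = a *\<^sub>C h x)"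

text \<open>Conjugation is additive but not linear, and maps of cosets are well defined as soon as they are additive
  and respect the subspaces.\<close>

definition add_on :: "'v::complex_vector set \<Rightarrow> ('v \<Rightarrow> 'w::complex_vector) \<Rightarrow> bool" where
  "add_on V h \<longleftrightarrow> (\<forall>x\<in>V. \<forall>y\<in>V. h (x + y) = h x + h y)"

lemma lin_on_add_on: "lin_on V h \<Longrightarrow> add_on V h"
  by (simp add: lin_on_def add_on_def)

lemma add_onD: "add_on V h \<Longrightarrow> x \<in> V \<Longrightarrow> y \<in> V \<Longrightarrow> h (x + y) = h x + h y"
  by (simp add: add_on_def)

lemma lin_on_scale: "lin_on V h \<Longrightarrow> x \<in> V \<Longrightarrow> h (a *\<^sub>C x) = a *\<^sub>C h x"
  by (simp add: lin_on_def)

lemma lin_on_subset: "lin_on V h \<Longrightarrow> W \<subseteq> V \<Longrightarrow> lin_on W h"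
  unfolding lin_on_def by blast

lemma add_on_subset: "add_on V h \<Longrightarrow> W \<subseteq> V \<Longrightarrow> add_on W h"
  unfolding add_on_def by blast

lemma add_on_0: assumes "add_on V h" "cv.subspace V" shows "h 0 = 0"
proof -
  have "h (0 + 0) = h 0 + h 0" by (intro add_onD[OF assms(1)] cv.subspace_0 assms)
  then show ?thesis by simp
qed

lemma add_on_diff:
  assumes "add_on V h" "cv.subspace V" "x \<in> V" "y \<in> V" shows "h (x - y) = h x - h y"
proof -
  have "h ((x - y) + y) = h (x - y) + h y"
    using assms by (intro add_onD[OF assms(1)] cv.subspace_diff) auto
  then show ?thesis by simp
qed

lemma add_on_sum:
  assumes "add_on V h" "cv.subspace V" "\<And>i. i \<in> I \<Longrightarrow> x i \<in> V"
  shows "h (\<Sum>i\<in>I. x i) = (\<Sum>i\<in>I. h (x i))"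
  using assms(3)
proof (induction I rule: infinite_finite_induct)
  case (insert i I)
  then show ?case
    using add_onD[OF assms(1), of "x i" "sum x I"] cv.subspace_sum[OF assms(2), of I x] by auto
qed (use add_on_0[OF assms(1,2)] in auto)

lemma kernel_subspace:
  assumes "lin_on V h" "cv.subspace V" shows "cv.subspace {x \<in> V. h x = 0}"
  using assms add_on_0[OF lin_on_add_on[OF assms(1)] assms(2)]
  by (auto simp: cv.subspace_def lin_on_def)

lemma image_subspace:
  assumes "lin_on V h" "cv.subspace V" shows "cv.subspace (h ` V)"
proof (rule cv.subspaceI)
  show "0 \<in> h ` V"
    using add_on_0[OF lin_on_add_on[OF assms(1)] assms(2)] cv.subspace_0[OF assms(2)] by force
next
  fix x y assume "x \<in> h ` V" "y \<in> h ` V"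
  then obtain a b where ab: "a \<in> V" "b \<in> V" "x = h a" "y = h b" by auto
  then have "x + y = h (a + b)" using assms(1) by (auto simp: lin_on_def)
  then show "x + y \<in> h ` V" using ab cv.subspace_add[OF assms(2)] by blast
next
  fix c x assume "x \<in> h ` V"
  then obtain a where a: "a \<in> V" "x = h a" by auto
  then have "c *\<^sub>C x = h (c *\<^sub>C a)" using assms(1) by (auto simp: lin_on_def)
  then show "c *\<^sub>C x \<in> h ` V" using a cv.subspace_scale[OF assms(2)] by blast
qed

subsection \<open>Quotients represented by forms\<close>

text \<open>The quotient \<open>Z / B\<close> of spaces of forms, presented by the map \<open>q\<close> from representatives to
  elements of an arbitrary carrier. The elements of \<open>Q\<close> may be cosets, or cosets of cosets.\<close>

definition represents ::
  "'v::complex_vector set \<Rightarrow> 'v::complex_vector set \<Rightarrow> 'q cmod \<Rightarrow> ('v \<Rightarrow> 'q) \<Rightarrow> bool" where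
  "represents Z B Q q \<longleftrightarrow> cv.subspace Z \<and> cv.subspace B \<and> B \<subseteq> Z \<and>
     carrier Q = q ` Z \<and> \<zero>\<^bsub>Q\<^esub> = q 0 \<and>
     (\<forall>x\<in>Z. \<forall>y\<in>Z. q x \<oplus>\<^bsub>Q\<^esub> q y = q (x + y)) \<and>
     (\<forall>a. \<forall>x\<in>Z. a \<odot>\<^bsub>Q\<^esub> q x = q (a *\<^sub>C x)) \<and>
     (\<forall>x\<in>Z. \<forall>y\<in>Z. q x = q y \<longleftrightarrow> x - y \<in> B)"

lemma represents_carrier: "represents Z B Q q \<Longrightarrow> carrier Q = q ` Z"
  and represents_zero: "represents Z B Q q \<Longrightarrow> \<zero>\<^bsub>Q\<^esub> = q 0"
  and represents_add: "represents Z B Q q \<Longrightarrow> x \<in> Z \<Longrightarrow> y \<in> Z \<Longrightarrow> q x \<oplus>\<^bsub>Q\<^esub> q y = q (x + y)"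
  and represents_smult: "represents Z B Q q \<Longrightarrow> x \<in> Z \<Longrightarrow> a \<odot>\<^bsub>Q\<^esub> q x = q (a *\<^sub>C x)"
  and represents_eq: "represents Z B Q q \<Longrightarrow> x \<in> Z \<Longrightarrow> y \<in> Z \<Longrightarrow> q x = q y \<longleftrightarrow> x - y \<in> B"
  and represents_subspaces: "represents Z B Q q \<Longrightarrow> cv.subspace Z"
    "represents Z B Q q \<Longrightarrow> cv.subspace B" "represents Z B Q q \<Longrightarrow> B \<subseteq> Z"
  by (simp_all add: represents_def)

lemma represents_eq_zero: "represents Z B Q q \<Longrightarrow> x \<in> Z \<Longrightarrow> q x = \<zero>\<^bsub>Q\<^esub> \<longleftrightarrow> x \<in> B"
  using represents_eq[of Z B Q q x 0] represents_zero[of Z B Q q] cv.subspace_0[of Z]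
  by (simp add: represents_subspaces)

lemma cring_Cring: "cring \<C>"
proof (rule cringI)
  show "abelian_group \<C>"
  proof (rule abelian_groupI)
    show "\<exists>y\<in>carrier \<C>. y \<oplus>\<^bsub>\<C>\<^esub> x = \<zero>\<^bsub>\<C>\<^esub>" for x
      by (simp add: Cring_def exI[of _ "- x"])
  qed (simp_all add: Cring_def)
  show "comm_monoid \<C>"
    by (rule comm_monoidI) (auto simp: Cring_def)
qed (auto simp: Cring_def algebra_simps)

lemma represents_module:
  assumes r: "represents Z B Q q" shows "Module.module \<C> Q"
proof (rule moduleI[OF cring_Cring])
  note [simp] = represents_carrier[OF r] represents_zero[OF r] represents_add[OF r] represents_smult[OF r]
  note [simp] = cv.subspace_add[OF represents_subspaces(1)[OF r]]
    cv.subspace_scale[OF represents_subspaces(1)[OF r]] cv.subspace_0[OF represents_subspaces(1)[OF r]]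
    cv.subspace_neg[OF represents_subspaces(1)[OF r]]
  show "abelian_group Q"
  proof (rule abelian_groupI)
    fix x assume "x \<in> carrier Q"
    then obtain w where w: "w \<in> Z" "x = q w" by auto
    then have "q (- w) \<oplus>\<^bsub>Q\<^esub> x = \<zero>\<^bsub>Q\<^esub>" by simp
    moreover have "q (- w) \<in> carrier Q" using w by simp
    ultimately show "\<exists>y\<in>carrier Q. y \<oplus>\<^bsub>Q\<^esub> x = \<zero>\<^bsub>Q\<^esub>" by (rule rev_bexI[rotated])
  qed (auto simp: ac_simps)
qed (use represents_subspaces(1)[OF r] in \<open>auto simp: Cring_def cscale_add_right cscale_add_left cscale_cscale
    cscale_one represents_carrier[OF r] represents_add[OF r] represents_smult[OF r] cv.subspace_add cv.subspace_scale\<close>)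

lemma represents_submodule:
  assumes r: "represents Z B Q q" and V: "cv.subspace V" "V \<subseteq> Z"
  shows "submodule (q ` V) \<C> Q"
proof (rule module.submoduleI[OF represents_module[OF r]])
  interpret Q: abelian_group Q using represents_module[OF r] by (simp add: Module.module_def)
  show "q ` V \<subseteq> carrier Q" using V represents_carrier[OF r] by auto
  show "\<zero>\<^bsub>Q\<^esub> \<in> q ` V" using V represents_zero[OF r] cv.subspace_0 by force
  show "\<ominus>\<^bsub>Q\<^esub> a \<in> q ` V" if "a \<in> q ` V" for a
  proof -
    from that obtain w where w: "w \<in> V" "a = q w" by auto
    have "\<ominus>\<^bsub>Q\<^esub> a = q (- w)"
    proof (rule Q.minus_equality)
      show "q (- w) \<oplus>\<^bsub>Q\<^esub> a = \<zero>\<^bsub>Q\<^esub>"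
        using w V represents_add[OF r, of "- w" w] represents_zero[OF r] cv.subspace_neg[OF V(1)]
        by auto
    qed (use w V represents_carrier[OF r] cv.subspace_neg[OF V(1)] in auto)
    then show ?thesis using w cv.subspace_neg[OF V(1)] by auto
  qed
  show "a \<oplus>\<^bsub>Q\<^esub> b \<in> q ` V" if ab: "a \<in> q ` V" "b \<in> q ` V" for a b
  proof -
    from ab obtain x y where "x \<in> V" "y \<in> V" "a = q x" "b = q y" by auto
    then show ?thesis
      using V represents_add[OF r, of x y] cv.subspace_add[OF V(1), of x y] by auto
  qed
  show "a \<odot>\<^bsub>Q\<^esub> b \<in> q ` V" if b: "b \<in> q ` V" for a b
  proof -
    from b obtain y where "y \<in> V" "b = q y" by auto
    then show ?thesis
      using V represents_smult[OF r, of y a] cv.subspace_scale[OF V(1), of y a] by auto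
  qed
qed

lemma represents_finsum:
  assumes r: "represents Z B Q q" and x: "\<And>i. i \<in> T \<Longrightarrow> x i \<in> Z" and T: "finite T"
  shows "finsum Q (\<lambda>i. q (x i)) T = q (\<Sum>i\<in>T. x i)"
proof -
  interpret Q: abelian_group Q using represents_module[OF r] by (simp add: Module.module_def)
  show ?thesis using T x
  proof (induction T rule: finite_induct)
    case (insert i T)
    then show ?case
      using represents_carrier[OF r] cv.subspace_sum[OF represents_subspaces(1)[OF r], of T x]
      by (subst Q.finsum_insert) (auto simp: represents_add[OF r])
  qed (simp add: represents_zero[OF r])
qed

text \<open>A coset in \<open>Q\<close> is the image of a coset of forms. This makes iterated subquotients computable.\<close>

lemma coset_image:
  assumes r: "represents Z B Q q" and W: "cv.subspace W" "W \<subseteq> Z" and x: "x \<in> Z"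
  shows "(q ` W) +>\<^bsub>Q\<^esub> q x = q ` {y. y - x \<in> W}"
proof -
  have "(q ` W) +>\<^bsub>Q\<^esub> q x = (\<Union>w\<in>W. {q w \<oplus>\<^bsub>Q\<^esub> q x})" by (simp add: a_r_coset_def')
  also have "\<dots> = (\<Union>w\<in>W. {q (w + x)})"
    using W(2) x represents_add[OF r] by (intro SUP_cong) auto
  also have "\<dots> = q ` ((\<lambda>w. w + x) ` W)" by auto
  also have "(\<lambda>w. w + x) ` W = {y. y - x \<in> W}"
  proof (intro subset_antisym subsetI)
    fix y assume "y \<in> {y. y - x \<in> W}"
    then have "y = (y - x) + x" "y - x \<in> W" by auto
    then show "y \<in> (\<lambda>w. w + x) ` W" by (rule image_eqI)
  qed auto
  finally show ?thesis .
qed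

lemma translate_subset: "cv.subspace Z \<Longrightarrow> W \<subseteq> Z \<Longrightarrow> x \<in> Z \<Longrightarrow> y - x \<in> W \<Longrightarrow> y \<in> Z"
  using cv.subspace_add[of Z "y - x" x] by auto

text \<open>A subquotient of a quotient of \<open>Z\<close> is again a quotient of a subspace of \<open>Z\<close>; \<open>B\<close> disappears
  because it is contained in \<open>W\<close>. Iterating this turns the cohomology of a cohomology into a single
  quotient of forms.\<close>

lemma represents_subquot:
  assumes r: "represents Z B Q q" and V: "cv.subspace V" and W: "cv.subspace W"
    and sub: "B \<subseteq> W" "W \<subseteq> V" "V \<subseteq> Z"
  shows "represents V W (subquot Q (q ` V) (q ` W)) (\<lambda>x. (q ` W) +>\<^bsub>Q\<^esub> q x)"
proof -
  note Z = represents_subspaces(1)[OF r]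
  have WZ: "W \<subseteq> Z" using sub by simp
  have co: "(q ` W) +>\<^bsub>Q\<^esub> q x = q ` {y. y - x \<in> W}" if "x \<in> V" for x
    using coset_image[OF r W WZ, of x] sub that by blast
  have in_V: "y \<in> V" if "x \<in> V" "y - x \<in> W" for x y
    using translate_subset[OF V sub(2) that] .
  have eq: "(q ` W) +>\<^bsub>Q\<^esub> q x = (q ` W) +>\<^bsub>Q\<^esub> q y \<longleftrightarrow> x - y \<in> W" if xy: "x \<in> V" "y \<in> V" for x y
  proof
    assume "(q ` W) +>\<^bsub>Q\<^esub> q x = (q ` W) +>\<^bsub>Q\<^esub> q y"
    then have "q ` {z. z - x \<in> W} = q ` {z. z - y \<in> W}" using co xy by auto
    moreover have "x \<in> {z. z - x \<in> W}" using cv.subspace_0[OF W] by simp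
    ultimately obtain z where z: "z - y \<in> W" "q x = q z" by (metis (no_types, lifting) imageE imageI mem_Collect_eq)
    then have "x - z \<in> B" using represents_eq[OF r, of x z] xy in_V[of y z] sub by auto
    then have "(x - z) + (z - y) \<in> W" using z sub cv.subspace_add[OF W] by blast
    then show "x - y \<in> W" by simp
  next
    assume "x - y \<in> W"
    then have "z - x \<in> W \<longleftrightarrow> z - y \<in> W" for z
      using cv.subspace_add[OF W, of "z - x" "x - y"] cv.subspace_diff[OF W, of "z - y" "x - y"] by auto
    then show "(q ` W) +>\<^bsub>Q\<^esub> q x = (q ` W) +>\<^bsub>Q\<^esub> q y" using co xy by auto
  qed
  have add: "(q ` W +>\<^bsub>Q\<^esub> q x) <+>\<^bsub>Q\<^esub> (q ` W +>\<^bsub>Q\<^esub> q y) = (q ` W) +>\<^bsub>Q\<^esub> q (x + y)" if xy: "x \<in> V" "y \<in> V" for x y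
  proof -
    have "(q ` W +>\<^bsub>Q\<^esub> q x) <+>\<^bsub>Q\<^esub> (q ` W +>\<^bsub>Q\<^esub> q y) =
      {q a \<oplus>\<^bsub>Q\<^esub> q b | a b. a - x \<in> W \<and> b - y \<in> W}"
      unfolding set_add_def' co[OF xy(1)] co[OF xy(2)] by blast
    also have "\<dots> = {q (a + b) | a b. a - x \<in> W \<and> b - y \<in> W}"
    proof -
      have "q a \<oplus>\<^bsub>Q\<^esub> q b = q (a + b)" if "a - x \<in> W" "b - y \<in> W" for a b
        using represents_add[OF r, of a b] in_V[OF xy(1) that(1)] in_V[OF xy(2) that(2)] sub(3) by blast
      then show ?thesis by (intro Collect_cong ex_cong1) auto
    qed
    also have "\<dots> = q ` {z. z - (x + y) \<in> W}"
    proof (intro subset_antisym subsetI)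
      fix t assume "t \<in> {q (a + b) | a b. a - x \<in> W \<and> b - y \<in> W}"
      then obtain a b where "t = q (a + b)" "a - x \<in> W" "b - y \<in> W" by auto
      moreover from this have "(a + b) - (x + y) \<in> W"
        using cv.subspace_add[OF W, of "a - x" "b - y"] by (simp add: algebra_simps)
      ultimately show "t \<in> q ` {z. z - (x + y) \<in> W}" by blast
    next
      fix t assume "t \<in> q ` {z. z - (x + y) \<in> W}"
      then obtain z where "t = q ((z - y) + y)" "(z - y) - x \<in> W" by (auto simp: algebra_simps)
      moreover have "y - y \<in> W" using cv.subspace_0[OF W] by simp
      ultimately show "t \<in> {q (a + b) | a b. a - x \<in> W \<and> b - y \<in> W}" by blast
    qed
    finally show ?thesis using co[of "x + y"] xy cv.subspace_add[OF V] by auto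
  qed
  have smult: "(\<Union>C\<in>(q ` W +>\<^bsub>Q\<^esub> q x). (q ` W) +>\<^bsub>Q\<^esub> (a \<odot>\<^bsub>Q\<^esub> C)) = (q ` W) +>\<^bsub>Q\<^esub> q (a *\<^sub>C x)"
    if x: "x \<in> V" for a x
  proof -
    have "(q ` W) +>\<^bsub>Q\<^esub> (a \<odot>\<^bsub>Q\<^esub> q y) = (q ` W) +>\<^bsub>Q\<^esub> q (a *\<^sub>C x)" if y: "y - x \<in> W" for y
    proof -
      have yV: "y \<in> V" using in_V x y by blast
      then have "a \<odot>\<^bsub>Q\<^esub> q y = q (a *\<^sub>C y)" using represents_smult[OF r] sub by blast
      moreover have "a *\<^sub>C y - a *\<^sub>C x \<in> W"
        using cv.subspace_scale[OF W y, of a] by (simp add: cv.scale_right_diff_distrib)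
      ultimately show ?thesis using eq yV x cv.subspace_scale[OF V] by simp
    qed
    moreover have "x - x \<in> W" using cv.subspace_0[OF W] by simp
    ultimately show ?thesis unfolding co[OF x] by blast
  qed
  have "q ` W = (q ` W) +>\<^bsub>Q\<^esub> q 0"
    using co[of 0] cv.subspace_0[OF V] by simp
  then show ?thesis
    using V W sub eq add smult by (simp add: represents_def subquot_def image_image)
qed

text \<open>The map \<open>induced\<close> takes a union over all representatives. If \<open>h\<close> respects the subspaces then all
  members of this union coincide. The hypothesis on \<open>H\<close> leaves open whether \<open>H\<close> acts on forms or on
  cosets of forms, so the lemma can be applied twice in succession.\<close>

lemma induced_coset:
  assumes r: "represents Z B Q q" and V: "cv.subspace V" and W: "cv.subspace W"
    and sub: "W \<subseteq> V" "V \<subseteq> Z"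
    and t: "represents V' W' Q' t"
    and h: "add_on V h" "\<And>y. y \<in> V \<Longrightarrow> h y \<in> V'" "\<And>y. y \<in> W \<Longrightarrow> h y \<in> W'"
    and H: "\<And>y. y \<in> V \<Longrightarrow> B'' +>\<^bsub>N\<^esub> H (q y) = t (h y)"
    and x: "x \<in> V"
  shows "induced N B'' H ((q ` W) +>\<^bsub>Q\<^esub> q x) = t (h x)"
proof -
  have co: "(q ` W) +>\<^bsub>Q\<^esub> q x = q ` {y. y - x \<in> W}"
    using coset_image[OF r W, of x] sub x by blast
  have "B'' +>\<^bsub>N\<^esub> H (q y) = t (h x)" if y: "y - x \<in> W" for y
  proof -
    have yV: "y \<in> V" using translate_subset[OF V sub(1) x y] .
    have "h y - h x = h (y - x)" using add_on_diff[OF h(1) V yV x] by simp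
    then have "t (h y) = t (h x)" using represents_eq[OF t] h yV x y by auto
    then show ?thesis using H[OF yV] by simp
  qed
  moreover have "x - x \<in> W" using cv.subspace_0[OF W] by simp
  ultimately show ?thesis unfolding induced_def co by blast
qed

text \<open>The pieces of the induced grading are the classes of homogeneous cocycles: a cocycle
  with the same class as a homogeneous form differs from it by an element of \<open>B\<close>, so that the form
  is a cocycle itself.\<close>

lemma subquot_gr_image:
  assumes r: "represents Z B Q q" and V: "cv.subspace V" "B \<subseteq> V" "V \<subseteq> Z"
    and G: "G' i = q ` (Z \<inter> G i)"
  shows "subquot_gr Q (q ` V) (q ` W) G' i = (\<lambda>x. (q ` W) +>\<^bsub>Q\<^esub> q x) ` (V \<inter> G i)"
proof -
  have "q ` V \<inter> q ` (Z \<inter> G i) = q ` (V \<inter> G i)"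
  proof (intro subset_antisym subsetI)
    fix t assume "t \<in> q ` V \<inter> q ` (Z \<inter> G i)"
    then obtain y g where y: "y \<in> V" "g \<in> Z" "g \<in> G i" "t = q g" "q y = q g" by auto
    then have "y - g \<in> V" using represents_eq[OF r, of y g] V by auto
    then have "y - (y - g) \<in> V" using cv.subspace_diff[OF V(1)] y by blast
    then show "t \<in> q ` (V \<inter> G i)" using y by simp
  qed (use V in auto)
  then show ?thesis by (simp add: subquot_gr_def G image_image)
qed

lemma linear_hom_represents:
  assumes r: "represents Z B Q q" "represents Z' B' Q' q'"
    and h: "lin_on Z h" "\<And>x. x \<in> Z \<Longrightarrow> h x \<in> Z'" and H: "\<And>x. x \<in> Z \<Longrightarrow> H (q x) = q' (h x)"
  shows "linear_hom Q Q' H"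
  unfolding linear_hom_def represents_carrier[OF r(1)] represents_carrier[OF r(2)]
  using h by (auto simp: H represents_add[OF r(1)] represents_smult[OF r(1)] represents_add[OF r(2)]
      represents_smult[OF r(2)] lin_on_def cv.subspace_add[OF represents_subspaces(1)[OF r(1)]]
      cv.subspace_scale[OF represents_subspaces(1)[OF r(1)]])

subsection \<open>Gradings by projections\<close>

text \<open>A grading of \<open>V\<close>, given by its projections.\<close>

definition splits :: "'v::complex_vector set \<Rightarrow> ('i \<Rightarrow> 'v \<Rightarrow> 'v) \<Rightarrow> bool" where
  "splits V P \<longleftrightarrow> cv.subspace V \<and> (\<forall>i. lin_on V (P i)) \<and> (\<forall>i. \<forall>x\<in>V. P i x \<in> V) \<and>
     (\<forall>i j. \<forall>x\<in>V. P i (P j x) = (if i = j then P j x else 0)) \<and>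
     (\<forall>x\<in>V. finite {i. P i x \<noteq> 0} \<and> (\<Sum>i\<in>{i. P i x \<noteq> 0}. P i x) = x)"

lemma splits_subspace: "splits V P \<Longrightarrow> cv.subspace V"
  and splits_lin: "splits V P \<Longrightarrow> lin_on V (P i)"
  and splits_closed: "splits V P \<Longrightarrow> x \<in> V \<Longrightarrow> P i x \<in> V"
  and splits_proj: "splits V P \<Longrightarrow> x \<in> V \<Longrightarrow> P i (P j x) = (if i = j then P j x else 0)"
  and splits_finite: "splits V P \<Longrightarrow> x \<in> V \<Longrightarrow> finite {i. P i x \<noteq> 0}"
  and splits_sum: "splits V P \<Longrightarrow> x \<in> V \<Longrightarrow> (\<Sum>i\<in>{i. P i x \<noteq> 0}. P i x) = x"
  by (simp_all add: splits_def)

lemma splits_add_on: "splits V P \<Longrightarrow> add_on V (P i)"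
  by (simp add: splits_lin lin_on_add_on)

lemma splits_restrict:
  assumes s: "splits V P" and Z: "cv.subspace Z" "Z \<subseteq> V" "\<And>i x. x \<in> Z \<Longrightarrow> P i x \<in> Z"
  shows "splits Z P"
proof -
  have lin: "lin_on Z (P i)" for i using lin_on_subset[OF splits_lin[OF s] Z(2)] .
  show ?thesis
    unfolding splits_def
    by (intro conjI allI ballI lin Z(1) Z(3) splits_proj[OF s] splits_finite[OF s] splits_sum[OF s])
      (use Z(2) in blast)+
qed

lemma splits_sum_superset:
  assumes "splits V P" "x \<in> V" "finite T" "{i. P i x \<noteq> 0} \<subseteq> T"
  shows "(\<Sum>i\<in>T. P i x) = x"
proof -
  have "(\<Sum>i\<in>T. P i x) = (\<Sum>i\<in>{i. P i x \<noteq> 0}. P i x)"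
    using assms by (intro sum.mono_neutral_right) auto
  then show ?thesis using splits_sum[OF assms(1,2)] by simp
qed

lemma splits_eqI:
  assumes "splits V P" "x \<in> V" "y \<in> V" "\<And>i. P i x = P i y" shows "x = y"
proof -
  have "x = (\<Sum>i\<in>{i. P i x \<noteq> 0}. P i x)" by (rule splits_sum[OF assms(1,2), symmetric])
  also have "\<dots> = (\<Sum>i\<in>{i. P i y \<noteq> 0}. P i y)" unfolding assms(4) ..
  also have "\<dots> = y" by (rule splits_sum[OF assms(1,3)])
  finally show ?thesis .
qed

lemma splits_piece_subspace:
  assumes s: "splits V P" shows "cv.subspace {x \<in> V. P i x = x}"
proof (rule cv.subspaceI)
  note V = splits_subspace[OF s]
  show "0 \<in> {x \<in> V. P i x = x}"
    using cv.subspace_0[OF V] add_on_0[OF splits_add_on[OF s] V] by simp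
  show "x + y \<in> {x \<in> V. P i x = x}" if "x \<in> {x \<in> V. P i x = x}" "y \<in> {x \<in> V. P i x = x}" for x y
    using that cv.subspace_add[OF V] add_onD[OF splits_add_on[OF s]] by simp
  show "c *\<^sub>C x \<in> {x \<in> V. P i x = x}" if "x \<in> {x \<in> V. P i x = x}" for c x
    using that cv.subspace_scale[OF V] lin_on_scale[OF splits_lin[OF s]] by simp
qed

lemma splits_supp_subspace:
  assumes s: "splits V P" shows "cv.subspace {x \<in> V. \<forall>i. i \<notin> S \<longrightarrow> P i x = 0}"
proof (rule cv.subspaceI)
  note V = splits_subspace[OF s]
  show "0 \<in> {x \<in> V. \<forall>i. i \<notin> S \<longrightarrow> P i x = 0}"
    using cv.subspace_0[OF V] add_on_0[OF splits_add_on[OF s] V] by simp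
  show "x + y \<in> {x \<in> V. \<forall>i. i \<notin> S \<longrightarrow> P i x = 0}"
    if "x \<in> {x \<in> V. \<forall>i. i \<notin> S \<longrightarrow> P i x = 0}" "y \<in> {x \<in> V. \<forall>i. i \<notin> S \<longrightarrow> P i x = 0}" for x y
    using that cv.subspace_add[OF V] add_onD[OF splits_add_on[OF s]] by simp
  show "c *\<^sub>C x \<in> {x \<in> V. \<forall>i. i \<notin> S \<longrightarrow> P i x = 0}"
    if "x \<in> {x \<in> V. \<forall>i. i \<notin> S \<longrightarrow> P i x = 0}" for c x
    using that cv.subspace_scale[OF V] lin_on_scale[OF splits_lin[OF s]] by simp
qed

lemma splits_of_pieces:
  assumes s: "splits V P" and T: "finite T" "\<And>i. i \<in> T \<Longrightarrow> x i \<in> V \<and> P i (x i) = x i"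
  shows "P j (\<Sum>i\<in>T. x i) = (if j \<in> T then x j else 0)"
proof -
  have "P j (\<Sum>i\<in>T. x i) = (\<Sum>i\<in>T. P j (x i))"
    using T by (intro add_on_sum[OF splits_add_on[OF s] splits_subspace[OF s]]) auto
  also have "\<dots> = (\<Sum>i\<in>T. if j = i then x i else 0)"
  proof (intro sum.cong refl)
    fix i assume "i \<in> T"
    then show "P j (x i) = (if j = i then x i else 0)"
      using T(2)[of i] splits_proj[OF s, of "x i" j i] by simp
  qed
  finally show ?thesis using T by simp
qed

text \<open>A grading descends to a quotient by a subspace that contains the components of its elements.
  Uniqueness of the decomposition is the comparison of components modulo \<open>B\<close>.\<close>

lemma graded_space_represents:
  assumes r: "represents Z B Q q" and s: "splits Z P" and B: "\<And>i x. x \<in> B \<Longrightarrow> P i x \<in> B"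
    and Gr: "\<And>i. Gr i = q ` {x \<in> Z. P i x = x}"
  shows "graded_space Q Gr"
proof -
  interpret Q: abelian_group Q using represents_module[OF r] by (simp add: Module.module_def)
  note Z = splits_subspace[OF s]
  have "\<exists>!c. (\<forall>i. c i \<in> Gr i) \<and> finite {i. c i \<noteq> \<zero>\<^bsub>Q\<^esub>} \<and> q \<omega> = finsum Q c {i. c i \<noteq> \<zero>\<^bsub>Q\<^esub>}"
    if \<omega>: "\<omega> \<in> Z" for \<omega>
  proof (rule ex1I[of _ "\<lambda>i. q (P i \<omega>)"], intro conjI allI)
    let ?c = "\<lambda>i. q (P i \<omega>)" and ?S = "{i. P i \<omega> \<noteq> 0}"
    have S: "{i. ?c i \<noteq> \<zero>\<^bsub>Q\<^esub>} \<subseteq> ?S" using represents_zero[OF r] by auto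
    show "?c i \<in> Gr i" for i
      unfolding Gr using splits_closed[OF s \<omega>] splits_proj[OF s \<omega>, of i i] by force
    show "finite {i. ?c i \<noteq> \<zero>\<^bsub>Q\<^esub>}" using finite_subset[OF S splits_finite[OF s \<omega>]] .
    have "finsum Q ?c {i. ?c i \<noteq> \<zero>\<^bsub>Q\<^esub>} = finsum Q ?c ?S"
      using S splits_finite[OF s \<omega>] splits_closed[OF s \<omega>] represents_carrier[OF r]
      by (intro Q.add.finprod_mono_neutral_cong_left) auto
    also have "\<dots> = q \<omega>"
      using represents_finsum[OF r, of ?S "\<lambda>i. P i \<omega>"] splits_closed[OF s \<omega>] splits_finite[OF s \<omega>]
        splits_sum[OF s \<omega>] by simp
    finally show "q \<omega> = finsum Q ?c {i. ?c i \<noteq> \<zero>\<^bsub>Q\<^esub>}" by simp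
  next
    fix c assume c: "(\<forall>i. c i \<in> Gr i) \<and> finite {i. c i \<noteq> \<zero>\<^bsub>Q\<^esub>} \<and> q \<omega> = finsum Q c {i. c i \<noteq> \<zero>\<^bsub>Q\<^esub>}"
    then have "\<forall>i. \<exists>x. x \<in> Z \<and> P i x = x \<and> c i = q x" unfolding Gr by blast
    then obtain x where x: "\<And>i. x i \<in> Z" "\<And>i. P i (x i) = x i" "\<And>i. c i = q (x i)" by metis
    let ?T = "{i. c i \<noteq> \<zero>\<^bsub>Q\<^esub>}"
    have "q \<omega> = finsum Q (\<lambda>i. q (x i)) ?T" using c x(3) by presburger
    also have "\<dots> = q (\<Sum>i\<in>?T. x i)" using c x by (intro represents_finsum[OF r]) auto
    finally have "\<omega> - (\<Sum>i\<in>?T. x i) \<in> B"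
      using represents_eq[OF r \<omega>, of "\<Sum>i\<in>?T. x i"] cv.subspace_sum[OF Z, of ?T x] x(1) by blast
    then have "P j (\<omega> - (\<Sum>i\<in>?T. x i)) \<in> B" for j by (rule B)
    moreover have "P j (\<omega> - (\<Sum>i\<in>?T. x i)) = P j \<omega> - (if j \<in> ?T then x j else 0)" for j
      using add_on_diff[OF splits_add_on[OF s] Z \<omega>, of "\<Sum>i\<in>?T. x i" j] cv.subspace_sum[OF Z, of ?T x]
        splits_of_pieces[OF s, of ?T x j] c x by auto
    ultimately have "q (P j \<omega>) = q (if j \<in> ?T then x j else 0)" for j
      using represents_eq[OF r, of "P j \<omega>" "if j \<in> ?T then x j else 0"] splits_closed[OF s \<omega>] x(1)
        cv.subspace_0[OF Z] by auto
    then show "c = (\<lambda>i. q (P i \<omega>))"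
      using x(3) represents_zero[OF r] by (auto simp: fun_eq_iff)
  qed
  moreover have "submodule (Gr i) \<C> Q" for i
    unfolding Gr using splits_piece_subspace[OF s] by (intro represents_submodule[OF r]) auto
  ultimately show ?thesis
    using represents_module[OF r] by (auto simp: graded_space_def represents_carrier[OF r])
qed

lemma sum_of_represents:
  assumes r: "represents Z B Q q" and s: "splits Z P" and Gr: "\<And>i. Gr i = q ` {x \<in> Z. P i x = x}"
  shows "sum_of Q Gr S = q ` {x \<in> Z. \<forall>i. i \<notin> S \<longrightarrow> P i x = 0}"
proof (intro subset_antisym subsetI)
  interpret Q: abelian_group Q using represents_module[OF r] by (simp add: Module.module_def)
  note Z = splits_subspace[OF s]
  fix t assume "t \<in> sum_of Q Gr S"
  then obtain c T where T: "finite T" "T \<subseteq> S" "t = finsum Q c T" "\<forall>i\<in>T. c i \<in> Gr i"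
    unfolding sum_of_def by auto
  then have "\<forall>i\<in>T. \<exists>x. x \<in> Z \<and> P i x = x \<and> c i = q x" unfolding Gr by blast
  then obtain x where x: "\<And>i. i \<in> T \<Longrightarrow> x i \<in> Z" "\<And>i. i \<in> T \<Longrightarrow> P i (x i) = x i" "\<And>i. i \<in> T \<Longrightarrow> c i = q (x i)"
    by metis
  have "t = finsum Q (\<lambda>i. q (x i)) T"
    unfolding T(3) using x represents_carrier[OF r] by (intro Q.finsum_cong') auto
  also have "\<dots> = q (\<Sum>i\<in>T. x i)" using T x by (intro represents_finsum[OF r]) auto
  finally show "t \<in> q ` {x \<in> Z. \<forall>i. i \<notin> S \<longrightarrow> P i x = 0}"
    using cv.subspace_sum[OF Z, of T x] x splits_of_pieces[OF s T(1), of x] T(2) by force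
next
  fix t assume "t \<in> q ` {x \<in> Z. \<forall>i. i \<notin> S \<longrightarrow> P i x = 0}"
  then obtain x where x: "t = q x" "x \<in> Z" "\<forall>i. i \<notin> S \<longrightarrow> P i x = 0" by auto
  let ?T = "{i. P i x \<noteq> 0}"
  have "t = finsum Q (\<lambda>i. q (P i x)) ?T"
    using represents_finsum[OF r, of ?T "\<lambda>i. P i x"] splits_closed[OF s x(2)] splits_finite[OF s x(2)]
      splits_sum[OF s x(2)] x(1) by simp
  moreover have "\<forall>i\<in>?T. q (P i x) \<in> Gr i"
    unfolding Gr using splits_closed[OF s x(2)] splits_proj[OF s x(2)] by force
  ultimately show "t \<in> sum_of Q Gr S"
    unfolding sum_of_def using splits_finite[OF s x(2)] x(3) by (intro CollectI exI[of _ "\<lambda>i. q (P i x)"] exI[of _ ?T]) auto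
qed



section \<open>Exterior algebra by recursion on the argument list\<close>

definition iota :: "'e \<Rightarrow> 'e ext \<Rightarrow> 'e ext" where
  "iota v \<alpha> = (\<lambda>vs. \<alpha> (v # vs))"

definition ext_sign :: "'e ext \<Rightarrow> 'e ext" where
  "ext_sign \<alpha> = (\<lambda>vs. (-1) ^ length vs * \<alpha> vs)"

definition ext_pull :: "('e \<Rightarrow> 'f) \<Rightarrow> 'f ext \<Rightarrow> 'e ext" where
  "ext_pull L \<alpha> = (\<lambda>vs. \<alpha> (map L vs))"

text \<open>The sum \<open>\<Sum> (-1)\<^sup>i g(v\<^sub>i)(\<dots>, v\<^sub>i omitted, \<dots>)\<close>, of which the exterior derivative and the product
  with a covector are instances.\<close>

fun asum :: "('e \<Rightarrow> 'e ext) \<Rightarrow> 'e ext" where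
  "asum g [] = 0"
| "asum g (v # vs) = g v vs - asum (\<lambda>w. iota v (g w)) vs"

text \<open>The sum of the values of \<open>\<alpha>\<close> in which one argument \<open>fst p\<close> is replaced by \<open>snd p\<close>. It arises
  when \<open>\<alpha>\<close> is evaluated on moving vectors and the value is differentiated.\<close>

fun der :: "'e ext \<Rightarrow> ('e \<times> 'e) list \<Rightarrow> complex" where
  "der \<alpha> [] = 0"
| "der \<alpha> (p # ps) = \<alpha> (snd p # map fst ps) + der (iota (fst p) \<alpha>) ps"

lemma iota_apply: "iota v \<alpha> vs = \<alpha> (v # vs)" by (simp add: iota_def)

lemma ext_fun_simps [simp]:
  "(\<alpha> + \<beta>) vs = \<alpha> vs + \<beta> vs" "(- \<alpha>) vs = - \<alpha> vs" "(\<alpha> - \<beta>) vs = \<alpha> vs - \<beta> vs" "(0 :: 'e ext) vs = 0"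
  "(a *\<^sub>C \<alpha>) vs = a * \<alpha> vs" for \<alpha> \<beta> :: "'e ext"
  by (simp_all add: cscale_fun_def cscale_complex_def)

lemma iota_simps [simp]:
  "iota v (\<alpha> + \<beta>) = iota v \<alpha> + iota v \<beta>" "iota v 0 = 0" "iota v (a *\<^sub>C \<alpha>) = a *\<^sub>C iota v \<alpha>"
  "iota v (\<alpha> - \<beta>) = iota v \<alpha> - iota v \<beta>" "iota v (- \<alpha>) = - iota v \<alpha>"
  "iota v (ext_sign \<alpha>) = - ext_sign (iota v \<alpha>)"
  "iota v (ext_pull L \<beta>') = ext_pull L (iota (L v) \<beta>')"
  by (auto simp: iota_def ext_sign_def ext_pull_def fun_eq_iff)

lemma ext_pull_minus: "ext_pull L (- \<alpha>) = - ext_pull L \<alpha>"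
  by (simp add: ext_pull_def fun_eq_iff)

lemma ext_sign_simps [simp]:
  "ext_sign (\<alpha> + \<beta>) = ext_sign \<alpha> + ext_sign \<beta>" "ext_sign 0 = 0" "ext_sign (a *\<^sub>C \<alpha>) = a *\<^sub>C ext_sign \<alpha>"
  "ext_sign (\<alpha> - \<beta>) = ext_sign \<alpha> - ext_sign \<beta>" "ext_sign (- \<alpha>) = - ext_sign \<alpha>"
  "ext_sign (ext_sign \<alpha>) = \<alpha>"
  by (auto simp: ext_sign_def fun_eq_iff algebra_simps simp flip: power_add mult.assoc)

subsection \<open>The alternating sum over removed arguments\<close>

lemma asum_eq_sum: "asum g vs = (\<Sum>i<length vs. (-1) ^ i * g (vs ! i) (take i vs @ drop (Suc i) vs))"
proof (induction vs arbitrary: g)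
  case (Cons v vs)
  have "(\<Sum>i<length (v # vs). (-1) ^ i * g ((v # vs) ! i) (take i (v # vs) @ drop (Suc i) (v # vs))) =
    g v vs + (\<Sum>i<length vs. - ((-1) ^ i * iota v (g (vs ! i)) (take i vs @ drop (Suc i) vs)))"
    by (simp add: sum.lessThan_Suc_shift iota_def del: sum.lessThan_Suc)
  also have "\<dots> = asum g (v # vs)" by (simp add: Cons.IH sum_negf)
  finally show ?case by simp
qed simp

lemma asum_linear:
  "asum (\<lambda>w. g w + h w) vs = asum g vs + asum h vs"
  "asum (\<lambda>w. a *\<^sub>C g w) vs = a * asum g vs"
  "asum (\<lambda>w. g w - h w) vs = asum g vs - asum h vs"
  "asum (\<lambda>w. - g w) vs = - asum g vs"
  "asum (\<lambda>w. 0) vs = 0"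
  unfolding asum_eq_sum
  by (simp_all add: algebra_simps sum.distrib sum_subtractf sum_negf sum_distrib_left)

lemma asum_map: "asum g (map L vs) = asum (\<lambda>w ws. g (L w) (map L ws)) vs"
  unfolding asum_eq_sum by (simp add: take_map drop_map)

lemma ext_d_asum: "ext_d \<omega> u = asum (\<lambda>w ws. frechet_derivative (\<lambda>y. \<omega> y ws) (at u) w)"
  by (simp add: ext_d_def asum_eq_sum fun_eq_iff)

subsection \<open>The wedge product\<close>

lemma shuffle_sign_insert_0: "shuffle_sign (Suc n) (insert 0 (Suc ` T)) = shuffle_sign n T"
proof -
  have "{(i, j). i < j \<and> j < Suc n \<and> i \<notin> insert 0 (Suc ` T) \<and> j \<in> insert 0 (Suc ` T)} =
    map_prod Suc Suc ` {(i, j). i < j \<and> j < n \<and> i \<notin> T \<and> j \<in> T}"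
  proof (intro subset_antisym subsetI)
    fix p assume "p \<in> {(i, j). i < j \<and> j < Suc n \<and> i \<notin> insert 0 (Suc ` T) \<and> j \<in> insert 0 (Suc ` T)}"
    then obtain i j where p: "p = (i, j)" "i < j" "j < Suc n" "i \<notin> insert 0 (Suc ` T)" "j \<in> insert 0 (Suc ` T)"
      by auto
    then obtain i' j' where "i = Suc i'" "j = Suc j'" by (cases i; cases j) auto
    then show "p \<in> map_prod Suc Suc ` {(i, j). i < j \<and> j < n \<and> i \<notin> T \<and> j \<in> T}" using p by auto
  qed auto
  then show ?thesis
    unfolding shuffle_sign_def by (simp add: card_image prod.inj_map inj_on_subset[of _ UNIV])
qed

lemma shuffle_sign_Suc:
  assumes T: "T \<subseteq> {..<n}"
  shows "shuffle_sign (Suc n) (Suc ` T) = (-1) ^ card T * shuffle_sign n T"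
proof -
  let ?A = "map_prod Suc Suc ` {(i, j). i < j \<and> j < n \<and> i \<notin> T \<and> j \<in> T}"
  let ?B = "(\<lambda>j. (0 :: nat, Suc j)) ` T"
  have "{(i, j). i < j \<and> j < Suc n \<and> i \<notin> Suc ` T \<and> j \<in> Suc ` T} = ?B \<union> ?A"
  proof (intro subset_antisym subsetI)
    fix p assume "p \<in> {(i, j). i < j \<and> j < Suc n \<and> i \<notin> Suc ` T \<and> j \<in> Suc ` T}"
    then obtain i j where p: "p = (i, Suc j)" "i < Suc j" "j < n" "i \<notin> Suc ` T" "j \<in> T" by auto
    then show "p \<in> ?B \<union> ?A" by (cases i) auto
  qed (use T in auto)
  moreover have fin: "finite ?B" "finite ?A"
    using finite_subset[OF T] by (auto intro!: finite_imageI intro: finite_subset[of _ "{..<n} \<times> {..<n}"])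
  moreover have dis: "?B \<inter> ?A = {}" by auto
  moreover have "card ?B = card T" by (rule card_image) (auto simp: inj_on_def)
  moreover have "card ?A = card {(i, j). i < j \<and> j < n \<and> i \<notin> T \<and> j \<in> T}"
    by (rule card_image) (simp add: prod.inj_map inj_on_subset[of _ UNIV])
  ultimately show ?thesis
    unfolding shuffle_sign_def by (simp only: card_Un_disjoint[OF fin dis] power_add)
qed

lemma ext_wedge_Nil [simp]: "ext_wedge \<alpha> \<beta> [] = \<alpha> [] * \<beta> []"
  by (simp add: ext_wedge_def shuffle_sign_def)

text \<open>The shuffles are split according to the factor that receives the first argument. If it is the
  second one, then the argument is moved past all arguments of the first factor, which explains the sign.\<close>

lemma ext_wedge_Cons:
  "ext_wedge \<alpha> \<beta> (v # vs) = ext_wedge (iota v \<alpha>) \<beta> vs + ext_wedge (ext_sign \<alpha>) (iota v \<beta>) vs"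
proof -
  let ?n = "length vs"
  let ?f = "\<lambda>S. shuffle_sign (Suc ?n) S * \<alpha> (nths (v # vs) S) * \<beta> (nths (v # vs) (- S))"
  have P: "Pow {..<Suc ?n} = (`) Suc ` Pow {..<?n} \<union> (\<lambda>T. insert 0 (Suc ` T)) ` Pow {..<?n}"
    by (simp only: lessThan_Suc_eq_insert_0 Pow_insert image_Pow_surj[OF refl, symmetric] image_image)
  have i1: "inj_on ((`) Suc) (Pow {..<?n})" by (simp add: inj_on_def inj_image_eq_iff)
  have i2: "inj_on (\<lambda>T. insert 0 (Suc ` T)) (Pow {..<?n})"
  proof (rule inj_onI)
    fix S T assume "insert 0 (Suc ` S) = insert 0 (Suc ` T)"
    then have "insert 0 (Suc ` S) - {0} = insert 0 (Suc ` T) - {0}" by simp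
    then show "S = T" by (simp add: inj_image_eq_iff)
  qed
  have "ext_wedge \<alpha> \<beta> (v # vs) = (\<Sum>S\<in>(`) Suc ` Pow {..<?n} \<union> (\<lambda>T. insert 0 (Suc ` T)) ` Pow {..<?n}. ?f S)"
    by (simp only: ext_wedge_def length_Cons P)
  also have "\<dots> = (\<Sum>S\<in>(`) Suc ` Pow {..<?n}. ?f S) + (\<Sum>S\<in>(\<lambda>T. insert 0 (Suc ` T)) ` Pow {..<?n}. ?f S)"
    by (rule sum.union_disjoint) auto
  also have "\<dots> = (\<Sum>T\<in>Pow {..<?n}. ?f (Suc ` T)) + (\<Sum>T\<in>Pow {..<?n}. ?f (insert 0 (Suc ` T)))"
    by (simp only: sum.reindex[OF i1] sum.reindex[OF i2] comp_def)
  also have "(\<Sum>T\<in>Pow {..<?n}. ?f (insert 0 (Suc ` T))) = ext_wedge (iota v \<alpha>) \<beta> vs"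
    unfolding ext_wedge_def
  proof (intro sum.cong refl)
    fix T
    have "{j. Suc j \<in> insert 0 (Suc ` T)} = T" "{j. Suc j \<in> - insert 0 (Suc ` T)} = - T" by auto
    then show "?f (insert 0 (Suc ` T)) = shuffle_sign ?n T * iota v \<alpha> (nths vs T) * \<beta> (nths vs (- T))"
      by (simp add: shuffle_sign_insert_0 nths_Cons iota_def)
  qed
  also have "(\<Sum>T\<in>Pow {..<?n}. ?f (Suc ` T)) = ext_wedge (ext_sign \<alpha>) (iota v \<beta>) vs"
    unfolding ext_wedge_def
  proof (intro sum.cong refl)
    fix T assume T: "T \<in> Pow {..<?n}"
    have "{j. Suc j \<in> Suc ` T} = T" "{j. Suc j \<in> - (Suc ` T)} = - T" by auto
    moreover have "{i. i < ?n \<and> i \<in> T} = T" using T by auto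
    ultimately show "?f (Suc ` T) = shuffle_sign ?n T * ext_sign \<alpha> (nths vs T) * iota v \<beta> (nths vs (- T))"
      using T by (simp add: shuffle_sign_Suc nths_Cons iota_def ext_sign_def length_nths image_iff)
  qed
  finally show ?thesis by simp
qed

lemma iota_wedge [simp]: "iota v (ext_wedge \<alpha> \<beta>) = ext_wedge (iota v \<alpha>) \<beta> + ext_wedge (ext_sign \<alpha>) (iota v \<beta>)"
  by (simp add: fun_eq_iff iota_apply ext_wedge_Cons)

lemma ext_wedge_linear [simp]:
  "ext_wedge (\<alpha> + \<alpha>') \<beta> = ext_wedge \<alpha> \<beta> + ext_wedge \<alpha>' \<beta>"
  "ext_wedge (\<alpha> - \<alpha>') \<beta> = ext_wedge \<alpha> \<beta> - ext_wedge \<alpha>' \<beta>"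
  "ext_wedge \<alpha> (\<beta> + \<beta>') = ext_wedge \<alpha> \<beta> + ext_wedge \<alpha> \<beta>'"
  "ext_wedge \<alpha> (\<beta> - \<beta>') = ext_wedge \<alpha> \<beta> - ext_wedge \<alpha> \<beta>'"
  "ext_wedge (- \<alpha>) \<beta> = - ext_wedge \<alpha> \<beta>"  "ext_wedge \<alpha> (- \<beta>) = - ext_wedge \<alpha> \<beta>"
  "ext_wedge (a *\<^sub>C \<alpha>) \<beta> = a *\<^sub>C ext_wedge \<alpha> \<beta>" "ext_wedge \<alpha> (a *\<^sub>C \<beta>) = a *\<^sub>C ext_wedge \<alpha> \<beta>"
  "ext_wedge 0 \<beta> = 0" "ext_wedge \<alpha> 0 = 0"
  unfolding fun_eq_iff ext_wedge_def
  by (simp_all add: algebra_simps sum.distrib sum_subtractf sum_negf sum_distrib_left)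

lemma ext_sign_wedge [simp]: "ext_sign (ext_wedge \<alpha> \<beta>) = ext_wedge (ext_sign \<alpha>) (ext_sign \<beta>)"
proof
  show "ext_sign (ext_wedge \<alpha> \<beta>) vs = ext_wedge (ext_sign \<alpha>) (ext_sign \<beta>) vs" for vs
  proof (induction vs arbitrary: \<alpha> \<beta>)
    case (Cons v vs)
    have "ext_sign (ext_wedge \<alpha> \<beta>) (v # vs) = - ext_sign (iota v (ext_wedge \<alpha> \<beta>)) vs"
      by (simp add: ext_sign_def iota_apply del: iota_wedge)
    then show ?case by (simp add: Cons.IH ext_wedge_Cons)
  qed (simp add: ext_sign_def)
qed

lemma ext_wedge_assoc: "ext_wedge (ext_wedge \<alpha> \<beta>) \<gamma> = ext_wedge \<alpha> (ext_wedge \<beta> \<gamma>)"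
proof
  show "ext_wedge (ext_wedge \<alpha> \<beta>) \<gamma> vs = ext_wedge \<alpha> (ext_wedge \<beta> \<gamma>) vs" for vs
    by (induction vs arbitrary: \<alpha> \<beta> \<gamma>) (simp_all add: ext_wedge_Cons)
qed

lemma iota_one [simp]: "iota v ext_one = 0" and ext_sign_one [simp]: "ext_sign ext_one = ext_one"
  by (auto simp: iota_def ext_one_def ext_sign_def fun_eq_iff)

lemma ext_wedge_one_left: "ext_wedge ext_one \<beta> = \<beta>"
proof
  show "ext_wedge ext_one \<beta> vs = \<beta> vs" for vs
    by (induction vs arbitrary: \<beta>) (simp_all add: ext_wedge_Cons iota_apply, simp add: ext_one_def)
qed

lemma ext_wedge_one_right: "ext_wedge \<alpha> ext_one = \<alpha>"
proof
  show "ext_wedge \<alpha> ext_one vs = \<alpha> vs" for vs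
    by (induction vs arbitrary: \<alpha>) (simp_all add: ext_wedge_Cons iota_apply, simp add: ext_one_def)
qed

lemma ext_wedge_pull: "ext_pull L (ext_wedge \<alpha> \<beta>) = ext_wedge (ext_pull L \<alpha>) (ext_pull L \<beta>)"
  by (simp add: ext_pull_def ext_wedge_def fun_eq_iff nths_map)

definition deg_in :: "int \<Rightarrow> 'e ext \<Rightarrow> bool" where
  "deg_in k \<alpha> \<longleftrightarrow> (\<forall>vs. int (length vs) \<noteq> k \<longrightarrow> \<alpha> vs = 0)"

lemma deg_in_iota: "deg_in k \<alpha> \<Longrightarrow> deg_in (k - 1) (iota v \<alpha>)"
  by (auto simp: deg_in_def iota_def)

lemma ext_sign_deg: "deg_in k \<alpha> \<Longrightarrow> ext_sign \<alpha> = (-1) powi k *\<^sub>C \<alpha>"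
  by (force simp: deg_in_def ext_sign_def fun_eq_iff)

lemma deg_in_wedge:
  assumes "deg_in k \<alpha>" "deg_in l \<beta>" shows "deg_in (k + l) (ext_wedge \<alpha> \<beta>)"
  unfolding deg_in_def ext_wedge_def
proof (intro allI impI sum.neutral ballI)
  fix vs :: "'a list" and S
  assume vs: "int (length vs) \<noteq> k + l"
  have "length (nths vs S) + length (nths vs (- S)) = length vs"
  proof (induction vs arbitrary: S)
    case (Cons v vs)
    have "{j. Suc j \<in> - S} = - {j. Suc j \<in> S}" by auto
    then show ?case using Cons.IH[of "{j. Suc j \<in> S}"] by (simp add: nths_Cons)
  qed simp
  then have "\<alpha> (nths vs S) = 0 \<or> \<beta> (nths vs (- S)) = 0"
    using assms vs unfolding deg_in_def by (metis of_nat_add)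
  then show "shuffle_sign (length vs) S * \<alpha> (nths vs S) * \<beta> (nths vs (- S)) = 0" by auto
qed

lemma minus_one_powi: "(-1 :: complex) powi (m + n) = (-1) powi m * (-1) powi n"
    "(-1 :: complex) powi (m - n) = (-1) powi m * (-1) powi n"
    "(-1 :: complex) powi m * (-1) powi m = 1"
proof -
  have "(-1 :: complex) powi m \<in> {1, -1}" for m by (simp add: power_int_def minus_one_power_iff inverse_eq_divide)
  moreover show "(-1 :: complex) powi (m + n) = (-1) powi m * (-1) powi n" for m n by (simp add: power_int_add)
  ultimately show "(-1 :: complex) powi m * (-1) powi m = 1" for m by (metis insertE mult_minus1 singletonD mult_1 minus_minus)
  then show "(-1 :: complex) powi (m - n) = (-1) powi m * (-1) powi n"
    by (simp add: power_int_diff field_simps)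
qed

text \<open>By induction on the arguments: contraction lowers the degree of one factor, and the
  signs in the antiderivation rule account for the change of the exponent.\<close>

lemma ext_wedge_comm:
  assumes "deg_in k \<alpha>" "deg_in l \<beta>"
  shows "ext_wedge \<alpha> \<beta> = (-1) powi (k * l) *\<^sub>C ext_wedge \<beta> \<alpha>"
proof
  show "ext_wedge \<alpha> \<beta> vs = ((-1) powi (k * l) *\<^sub>C ext_wedge \<beta> \<alpha>) vs" for vs
    using assms
  proof (induction vs arbitrary: \<alpha> \<beta> k l)
    case Nil
    then show ?case by (cases "k = 0"; cases "l = 0") (auto simp: deg_in_def)
  next
    case (Cons v vs)
    have "ext_wedge \<alpha> \<beta> (v # vs) = ext_wedge (iota v \<alpha>) \<beta> vs + (-1) powi k * ext_wedge \<alpha> (iota v \<beta>) vs"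
      by (simp add: ext_wedge_Cons ext_sign_deg[OF Cons.prems(1)])
    also have "\<dots> = (-1) powi ((k - 1) * l) * ext_wedge \<beta> (iota v \<alpha>) vs
        + (-1) powi k * ((-1) powi (k * (l - 1)) * ext_wedge (iota v \<beta>) \<alpha> vs)"
      using Cons.IH[OF deg_in_iota[OF Cons.prems(1)] Cons.prems(2)]
        Cons.IH[OF Cons.prems(1) deg_in_iota[OF Cons.prems(2)]] by simp
    also have "\<dots> = (-1) powi (k * l) * (ext_wedge (iota v \<beta>) \<alpha> vs + (-1) powi l * ext_wedge \<beta> (iota v \<alpha>) vs)"
    proof -
      have "(-1 :: complex) powi ((k - 1) * l) = (-1) powi (k * l) * (-1) powi l"
        "(-1 :: complex) powi (k * (l - 1)) = (-1) powi (k * l) * (-1) powi k"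
        by (simp_all add: left_diff_distrib right_diff_distrib minus_one_powi)
      then show ?thesis using minus_one_powi(3)[of k] by (simp add: algebra_simps)
    qed
    finally show ?case by (simp add: ext_wedge_Cons ext_sign_deg[OF Cons.prems(2)])
  qed
qed

lemma wedge_covector: "ext_wedge (covector a) \<beta> vs = asum (\<lambda>w. a w *\<^sub>C \<beta>) vs"
proof (induction vs arbitrary: \<beta>)
  case (Cons v vs)
  have "iota v (covector a) = a v *\<^sub>C ext_one" "ext_sign (covector a) = - covector a"
    by (auto simp: iota_def covector_def ext_one_def ext_sign_def fun_eq_iff split: list.splits)
  then have "ext_wedge (covector a) \<beta> (v # vs) = a v * \<beta> vs - ext_wedge (covector a) (iota v \<beta>) vs"
    by (simp only: ext_wedge_Cons ext_wedge_linear ext_wedge_one_left ext_fun_simps) simp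
  also have "\<dots> = a v * \<beta> vs - asum (\<lambda>w. a w *\<^sub>C iota v \<beta>) vs" by (simp only: Cons.IH)
  also have "\<dots> = asum (\<lambda>w. a w *\<^sub>C \<beta>) (v # vs)" by (simp only: asum.simps iota_simps ext_fun_simps)
  finally show ?case .
qed (simp add: covector_def)

lemma deg_in_covector: "deg_in 1 (covector a)"
  by (auto simp: deg_in_def covector_def split: list.splits)

lemma covector_anticomm: "ext_wedge (covector a) (covector b) = - ext_wedge (covector b) (covector a)"
  using ext_wedge_comm[OF deg_in_covector[of a] deg_in_covector[of b]] by (simp add: fun_eq_iff)

subsection \<open>Alternating forms\<close>

lemma alternatingI:
  fixes \<alpha> :: "'e::real_vector ext"
  assumes lin: "\<And>xs ys. linear (\<lambda>v. \<alpha> (xs @ v # ys))" and adj: "\<And>xs v ys. \<alpha> (xs @ v # v # ys) = 0"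
  shows "alternating \<alpha>"
proof -
  have swap: "\<alpha> (xs @ u # v # ys) = - \<alpha> (xs @ v # u # ys)" for xs u v ys
  proof -
    have "\<alpha> (xs @ (u + v) # (u + v) # ys) = \<alpha> (xs @ u # u # ys) + \<alpha> (xs @ u # v # ys)
        + (\<alpha> (xs @ v # u # ys) + \<alpha> (xs @ v # v # ys))"
      using linear_add[OF lin[of xs "(u + v) # ys"], of u v] linear_add[OF lin[of "xs @ [u]" ys], of u v]
        linear_add[OF lin[of "xs @ [v]" ys], of u v] by simp
    then show ?thesis by (simp add: adj add_eq_0_iff2)
  qed
  have rep: "\<alpha> (xs @ v # zs @ v # ys) = 0" for xs v zs ys
  proof (induction zs arbitrary: xs)
    case (Cons z zs)
    then show ?case using swap[of xs v z "zs @ v # ys"] Cons.IH[of "xs @ [z]"] by simp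
  qed (simp add: adj)
  show ?thesis unfolding alternating_def
  proof (intro conjI allI impI)
    fix vs :: "'e list" and i assume "i < length vs"
    then show "linear (\<lambda>v. \<alpha> (vs[i := v]))" using lin by (simp add: upd_conv_take_nth_drop)
  next
    fix vs :: "'e list" and i j assume ij: "i < j \<and> j < length vs \<and> vs ! i = vs ! j"
    then have "vs = take j vs @ vs ! j # drop (Suc j) vs" by (simp add: id_take_nth_drop)
    moreover have "take j vs = take i (take j vs) @ take j vs ! i # drop (Suc i) (take j vs)"
      using ij by (intro id_take_nth_drop) simp
    ultimately have "vs = take i (take j vs) @ vs ! i # drop (Suc i) (take j vs) @ vs ! i # drop (Suc j) vs"
      using ij by (metis append.assoc append_Cons nth_take)
    then show "\<alpha> vs = 0" using rep by metis
  qed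
qed

lemma alternating_linear: assumes "alternating \<alpha>" shows "linear (\<lambda>v. \<alpha> (xs @ v # ys))"
  using assms unfolding alternating_def
  by (elim conjE allE[of _ "xs @ undefined # ys"] allE[of _ "length xs"]) simp

lemma alternating_linear_hd: "alternating \<alpha> \<Longrightarrow> linear (\<lambda>v. \<alpha> (v # ys))"
  using alternating_linear[of \<alpha> "[]"] by simp

lemma alternating_adj: assumes "alternating \<alpha>" shows "\<alpha> (xs @ v # v # ys) = 0"
proof -
  have "length xs < Suc (length xs) \<and> Suc (length xs) < length (xs @ v # v # ys) \<and>
    (xs @ v # v # ys) ! length xs = (xs @ v # v # ys) ! Suc (length xs)" by (simp add: nth_append)
  then show ?thesis using assms unfolding alternating_def by blast
qed

text \<open>Polarisation: the form vanishes on \<open>u + v, u + v\<close>.\<close>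

lemma alternating_swap: assumes "alternating \<alpha>" shows "\<alpha> (u # v # ys) = - \<alpha> (v # u # ys)"
proof -
  have "\<alpha> ((u + v) # (u + v) # ys) = \<alpha> (u # u # ys) + \<alpha> (u # v # ys)
      + (\<alpha> (v # u # ys) + \<alpha> (v # v # ys))"
    using linear_add[OF alternating_linear[OF assms, of "[]" "(u + v) # ys"], of u v]
      linear_add[OF alternating_linear[OF assms, of "[u]" ys], of u v]
      linear_add[OF alternating_linear[OF assms, of "[v]" ys], of u v] by simp
  then show ?thesis using alternating_adj[OF assms, of "[]"] by (simp add: add_eq_0_iff2)
qed

lemma alternating_iota: "alternating \<alpha> \<Longrightarrow> alternating (iota v \<alpha>)"
  using alternating_linear[of \<alpha> "v # _"] alternating_adj[of \<alpha> "v # _"]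
  by (intro alternatingI) (simp_all add: iota_apply)

lemma iota_linear:
  assumes "alternating \<alpha>"
  shows "iota (v + w) \<alpha> = iota v \<alpha> + iota w \<alpha>" "iota (r *\<^sub>R v) \<alpha> = of_real r *\<^sub>C iota v \<alpha>"
  using linear_add[OF alternating_linear_hd[OF assms]] linear_scale[OF alternating_linear_hd[OF assms]]
  by (auto simp: fun_eq_iff iota_apply scaleR_conv_of_real)

lemma alternating_add: "alternating \<alpha> \<Longrightarrow> alternating \<beta> \<Longrightarrow> alternating (\<alpha> + \<beta>)"
  by (intro alternatingI) (simp_all add: alternating_linear alternating_adj linear_compose_add)

lemma linear_cmult: "linear f \<Longrightarrow> linear (\<lambda>x. (a :: complex) * f x)"
  by (auto simp: linear_iff algebra_simps)

lemma alternating_cscale: "alternating \<alpha> \<Longrightarrow> alternating (a *\<^sub>C \<alpha>)"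
  by (intro alternatingI) (simp_all add: alternating_linear alternating_adj linear_cmult)

lemma alternating_0: "alternating 0"
  by (intro alternatingI) (simp_all add: linear_iff)

lemma alternating_one: "alternating ext_one"
  by (intro alternatingI) (simp_all add: ext_one_def linear_iff)

lemma alternating_by_length:
  assumes "\<And>k. alternating (\<alpha> k)" shows "alternating (\<lambda>vs. \<alpha> (length vs) vs)"
  using assms by (intro alternatingI) (simp_all add: alternating_linear alternating_adj)

lemma alternating_sign: "alternating \<alpha> \<Longrightarrow> alternating (ext_sign \<alpha>)"
  unfolding ext_sign_def
  using alternating_by_length[of "\<lambda>k. (-1) ^ k *\<^sub>C \<alpha>"] by (simp add: alternating_cscale)

lemma alternating_pull: assumes "alternating \<alpha>" "linear L" shows "alternating (ext_pull L \<alpha>)"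
proof (rule alternatingI)
  show "linear (\<lambda>v. ext_pull L \<alpha> (xs @ v # ys))" for xs ys
    using linear_compose[OF assms(2) alternating_linear[OF assms(1), of "map L xs" "map L ys"]]
    by (simp add: ext_pull_def o_def)
qed (simp add: ext_pull_def alternating_adj assms)

lemma alternating_covector: "linear a \<Longrightarrow> alternating (covector a)"
proof (rule alternatingI)
  have eq: "covector a (xs @ v # ys) = (if xs = [] \<and> ys = [] then a v else 0)" for xs v ys
    by (cases xs; cases ys; cases "tl xs") (auto simp: covector_def)
  assume "linear a"
  then show "linear (\<lambda>v. covector a (xs @ v # ys))" for xs ys by (auto simp: eq linear_iff)
  show "covector a (xs @ v # v # ys) = 0" for xs v ys by (simp add: eq)
qed

lemma alternating_wedge:
  assumes "alternating \<alpha>" "alternating \<beta>" shows "alternating (ext_wedge \<alpha> \<beta>)"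
proof (rule alternatingI)
  show "linear (\<lambda>v. ext_wedge \<alpha> \<beta> (xs @ v # ys))" for xs ys
    using assms
  proof (induction xs arbitrary: \<alpha> \<beta>)
    case Nil
    then show ?case
      by (auto simp: linear_iff ext_wedge_Cons iota_linear scaleR_conv_of_real algebra_simps)
  next
    case (Cons x xs)
    then show ?case
      by (auto simp: ext_wedge_Cons intro!: linear_compose_add Cons.IH alternating_iota alternating_sign)
  qed
  show "ext_wedge \<alpha> \<beta> (xs @ v # v # ys) = 0" for xs v ys
    using assms
  proof (induction xs arbitrary: \<alpha> \<beta>)
    case Nil
    then have "iota v (iota v \<alpha>) = 0" "iota v (iota v \<beta>) = 0"
      using alternating_adj[of _ "[]"] by (auto simp: fun_eq_iff iota_apply)
    then show ?case by (simp add: ext_wedge_Cons)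
  next
    case (Cons x xs)
    then show ?case
      by (simp add: ext_wedge_Cons Cons.IH alternating_iota alternating_sign)
  qed
qed

lemma alternating_asum:
  assumes "\<And>w. alternating (g w)" "\<And>ws. linear (\<lambda>w. g w ws)" shows "alternating (asum g)"
proof (rule alternatingI)
  show "linear (\<lambda>v. asum g (xs @ v # ys))" for xs ys
    using assms
  proof (induction xs arbitrary: g)
    case Nil
    have "linear (\<lambda>v. asum (\<lambda>w. iota v (g w)) ys)"
      by (intro linearI) (simp_all add: iota_linear Nil.prems asum_linear scaleR_conv_of_real)
    then show ?case using Nil.prems(2) by (simp add: linear_compose_sub)
  next
    case (Cons x xs)
    have "linear (\<lambda>v. asum (\<lambda>w. iota x (g w)) (xs @ v # ys))"
      using Cons.prems by (intro Cons.IH) (simp_all add: alternating_iota, simp add: iota_def)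
    then show ?case using alternating_linear[OF Cons.prems(1)] by (simp add: linear_compose_sub)
  qed
  show "asum g (xs @ v # v # ys) = 0" for xs v ys
    using assms
  proof (induction xs arbitrary: g)
    case Nil
    then have "iota v (iota v (g w)) = 0" for w
      using alternating_adj[OF Nil.prems(1), of w "[]"] by (auto simp: fun_eq_iff iota_apply)
    then show ?case by (simp add: iota_apply asum_linear)
  next
    case (Cons x xs)
    have "asum (\<lambda>w. iota x (g w)) (xs @ v # v # ys) = 0"
      using Cons.prems by (intro Cons.IH) (simp_all add: alternating_iota, simp add: iota_def)
    then show ?case using alternating_adj[OF Cons.prems(1)] by simp
  qed
qed

lemma iota_swap: "alternating \<alpha> \<Longrightarrow> iota v (iota w \<alpha>) = - iota w (iota v \<alpha>)"
  unfolding fun_eq_iff iota_apply ext_fun_simps by (blast intro: alternating_swap)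

text \<open>Euler's identity \<open>\<Sum>\<^sub>b b\<^sup>* \<and> iota b \<alpha> = k \<alpha>\<close> for forms of degree \<open>k\<close>, written without a basis. It
  allows induction on the degree.\<close>

lemma asum_euler:
  assumes "alternating \<alpha>" shows "asum (\<lambda>w. iota w \<alpha>) vs = of_nat (length vs) * \<alpha> vs"
  using assms
proof (induction vs arbitrary: \<alpha>)
  case (Cons v vs)
  have "asum (\<lambda>w. iota w \<alpha>) (v # vs) = iota v \<alpha> vs + asum (\<lambda>w. iota w (iota v \<alpha>)) vs"
    by (simp only: asum.simps iota_swap[OF Cons.prems, of v] asum_linear diff_minus_eq_add)
  then show ?case
    using Cons.IH[OF alternating_iota[OF Cons.prems]] by (simp add: iota_apply[of v] algebra_simps)
qed simp

subsection \<open>The derivation of an alternating form along an endomorphism\<close>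

lemma der_pull: "der (ext_pull L \<alpha>) ps = der \<alpha> (map (map_prod L L) ps)"
proof (induction ps arbitrary: \<alpha>)
  case (Cons p ps)
  have "ext_pull L \<alpha> (snd p # map fst ps) = \<alpha> (L (snd p) # map fst (map (map_prod L L) ps))"
    by (simp add: ext_pull_def)
  then show ?case by (simp only: der.simps iota_simps Cons.IH list.map fst_map_prod snd_map_prod)
qed simp

lemma der_add:
  assumes "alternating \<alpha>"
  shows "der \<alpha> (map (\<lambda>x. (f x, g x + h x)) xs) = der \<alpha> (map (\<lambda>x. (f x, g x)) xs) + der \<alpha> (map (\<lambda>x. (f x, h x)) xs)"
  using assms
proof (induction xs arbitrary: \<alpha>)
  case (Cons x xs)
  then show ?case
    using Cons.IH[OF alternating_iota[OF Cons.prems]]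
    by (simp add: linear_add[OF alternating_linear_hd[OF Cons.prems]] o_def)
qed simp

lemma der_scaleR:
  assumes "alternating \<alpha>"
  shows "der \<alpha> (map (\<lambda>x. (f x, r *\<^sub>R g x)) xs) = of_real r * der \<alpha> (map (\<lambda>x. (f x, g x)) xs)"
  using assms
proof (induction xs arbitrary: \<alpha>)
  case (Cons x xs)
  then show ?case
    using Cons.IH[OF alternating_iota[OF Cons.prems]]
    by (simp add: linear_scale[OF alternating_linear_hd[OF Cons.prems]] o_def scaleR_conv_of_real algebra_simps)
qed simp

lemma der_cscale: "der (a *\<^sub>C \<alpha>) ps = a * der \<alpha> ps"
  by (induction ps arbitrary: \<alpha>) (simp_all add: algebra_simps)

lemma der_eq_asum:
  assumes "alternating \<alpha>"
  shows "der \<alpha> (map (\<lambda>w. (L w, H w)) vs) = asum (\<lambda>w. ext_pull L (iota (H w) \<alpha>)) vs"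
  using assms
proof (induction vs arbitrary: \<alpha>)
  case (Cons v vs)
  have "asum (\<lambda>w. ext_pull L (iota (H w) \<alpha>)) (v # vs) =
      ext_pull L (iota (H v) \<alpha>) vs + asum (\<lambda>w. ext_pull L (iota (H w) (iota (L v) \<alpha>))) vs"
    by (simp only: asum.simps iota_simps iota_swap[OF Cons.prems, of "L v"] ext_pull_minus asum_linear
        diff_minus_eq_add)
  also have "ext_pull L (iota (H v) \<alpha>) vs = \<alpha> (H v # map L vs)" by (simp add: ext_pull_def iota_def)
  finally show ?case
    using Cons.IH[OF alternating_iota[OF Cons.prems]] by (simp add: o_def)
qed simp

text \<open>The term with argument \<open>v\<close> replaced by \<open>H w v\<close> and \<open>w\<close> removed cancels the one with the roles of
  \<open>v\<close> and \<open>w\<close> exchanged. Applied to a second derivative \<open>H\<close>, this is the reason why the exterior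
  derivative commutes with pullback.\<close>

lemma asum_der_symmetric:
  assumes "alternating \<alpha>" "\<And>v w. H v w = H w v"
  shows "asum (\<lambda>w ws. der \<alpha> (map (\<lambda>x. (L x, H w x)) ws)) vs = 0"
  using assms(1)
proof (induction vs arbitrary: \<alpha>)
  case (Cons v vs)
  have "iota v (\<lambda>ws. der \<alpha> (map (\<lambda>x. (L x, H w x)) ws)) =
    ext_pull L (iota (H v w) \<alpha>) + (\<lambda>ws. der (iota (L v) \<alpha>) (map (\<lambda>x. (L x, H w x)) ws))" for w
    by (auto simp: fun_eq_iff iota_apply ext_pull_def o_def assms(2)[of v w])
  then show ?case
    using Cons.IH[OF alternating_iota[OF Cons.prems]]
    by (simp add: asum_linear der_eq_asum[OF Cons.prems])
qed simp



section \<open>Smooth functions on open subsets of a finite-dimensional space\<close>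

abbreviation fd :: "('e::real_normed_vector \<Rightarrow> 'f::real_normed_vector) \<Rightarrow> 'e \<Rightarrow> 'e \<Rightarrow> 'f" where
  "fd f x \<equiv> frechet_derivative f (at x)"

lemma has_fd: "f differentiable (at x) \<Longrightarrow> (f has_derivative fd f x) (at x)"
  by (simp add: frechet_derivative_works)

lemma fd_eq: "(f has_derivative f') (at x) \<Longrightarrow> fd f x = f'"
  by (metis frechet_derivative_at)

lemma linear_fd: "f differentiable (at x) \<Longrightarrow> linear (fd f x)"
  by (rule linear_frechet_derivative)

lemma fd_cong:
  assumes "open S" "x \<in> S" "\<And>y. y \<in> S \<Longrightarrow> f y = g y" shows "fd f x = fd g x"
proof -
  have "(f has_derivative f') (at x) \<longleftrightarrow> (g has_derivative f') (at x)" for f'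
    using has_derivative_transform_within_open[of f f' x UNIV S g]
      has_derivative_transform_within_open[of g f' x UNIV S f] assms by auto
  then show ?thesis by (simp add: frechet_derivative_def)
qed

lemma differentiable_cong:
  assumes "open S" "x \<in> S" "\<And>y. y \<in> S \<Longrightarrow> f y = g y" "g differentiable (at x)"
  shows "f differentiable (at x)"
proof -
  have "(f has_derivative fd g x) (at x)"
    using has_derivative_transform_within_open[OF has_fd[OF assms(4)] assms(1,2)] assms(3) by simp
  then show ?thesis unfolding differentiable_def by blast
qed

lemma fd_agree:
  assumes "open S" "x \<in> S" "\<forall>y\<in>S. h y = k y" "(k has_derivative k') (at x)"
  shows "h differentiable (at x)" "fd h x = k'"
  using differentiable_cong[OF assms(1,2), of h k] fd_cong[OF assms(1,2), of h k] assms(3) fd_eq[OF assms(4)]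
    differentiableI[OF assms(4)] by auto

lemma smooth_on_differentiable: "smooth_on S f \<Longrightarrow> x \<in> S \<Longrightarrow> f differentiable (at x)"
  unfolding smooth_on_def by (metis diff_order_on.simps(2))

lemma smooth_on_has_fd: "smooth_on S f \<Longrightarrow> x \<in> S \<Longrightarrow> (f has_derivative fd f x) (at x)"
  by (intro has_fd smooth_on_differentiable)

lemma smooth_on_fd: "smooth_on S f \<Longrightarrow> smooth_on S (\<lambda>x. fd f x v)"
  unfolding smooth_on_def by (metis diff_order_on.simps(2))

lemma smooth_on_continuous: "smooth_on S f \<Longrightarrow> continuous_on S f"
  unfolding smooth_on_def by (metis diff_order_on.simps(1))

text \<open>Smoothness is the greatest predicate that implies differentiability and is inherited by
  directional derivatives. Closure properties below are proved by exhibiting such a predicate; this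
  avoids formulas for higher derivatives.\<close>

lemma smooth_on_coinduct:
  assumes P: "P f" and step: "\<And>f. P f \<Longrightarrow> (\<forall>x\<in>S. f differentiable (at x)) \<and> (\<forall>v. P (\<lambda>x. fd f x v))"
  shows "smooth_on S f"
proof -
  have "P f \<Longrightarrow> diff_order_on n S f" for n f
  proof (induction n arbitrary: f)
    case 0
    then have "isCont f x" if "x \<in> S" for x
      using step[OF 0] that differentiable_imp_continuous_within[of f x UNIV] by blast
    then show ?case by (simp add: continuous_at_imp_continuous_on)
  qed (use step in auto)
  then show ?thesis using P by (auto simp: smooth_on_def)
qed

lemma smooth_on_cong:
  assumes S: "open S" and g: "smooth_on S g" and fg: "\<And>x. x \<in> S \<Longrightarrow> f x = g x"
  shows "smooth_on S f"
proof (rule smooth_on_coinduct[where P = "\<lambda>f. \<exists>g. smooth_on S g \<and> (\<forall>x\<in>S. f x = g x)"])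
  fix f :: "'a \<Rightarrow> 'b" assume "\<exists>g. smooth_on S g \<and> (\<forall>x\<in>S. f x = g x)"
  then obtain g where g: "smooth_on S g" "\<forall>x\<in>S. f x = g x" by auto
  note * = fd_agree[OF S _ g(2) smooth_on_has_fd[OF g(1)]]
  show "(\<forall>x\<in>S. f differentiable (at x)) \<and> (\<forall>v. \<exists>g. smooth_on S g \<and> (\<forall>x\<in>S. fd f x v = g x))"
    using * smooth_on_fd[OF g(1)] by (intro conjI allI ballI exI[of _ "\<lambda>x. fd g x v" for v]) auto
qed (use g fg in auto)

lemma smooth_on_subset: "smooth_on S f \<Longrightarrow> T \<subseteq> S \<Longrightarrow> smooth_on T f"
  by (rule smooth_on_coinduct[where P = "smooth_on S"]) (auto intro: smooth_on_differentiable smooth_on_fd)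

lemma smooth_on_local:
  assumes "\<And>x. x \<in> S \<Longrightarrow> \<exists>T. open T \<and> x \<in> T \<and> smooth_on T f"
  shows "smooth_on S f"
proof (rule smooth_on_coinduct[where P = "\<lambda>f. \<forall>x\<in>S. \<exists>T. open T \<and> x \<in> T \<and> smooth_on T f"])
  fix f :: "'a \<Rightarrow> 'b" assume A: "\<forall>x\<in>S. \<exists>T. open T \<and> x \<in> T \<and> smooth_on T f"
  have "f differentiable (at x) \<and> (\<exists>T. open T \<and> x \<in> T \<and> smooth_on T (\<lambda>x. fd f x v))" if "x \<in> S" for x v
  proof -
    from bspec[OF A that] obtain T where T: "open T" "x \<in> T" "smooth_on T f" by (elim exE conjE)
    show ?thesis
      by (intro conjI exI[of _ T] T smooth_on_fd[OF T(3)] smooth_on_differentiable[OF T(3,2)])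
  qed
  then show "(\<forall>x\<in>S. f differentiable (at x)) \<and> (\<forall>v. \<forall>x\<in>S. \<exists>T. open T \<and> x \<in> T \<and> smooth_on T (\<lambda>x. fd f x v))"
    by simp
qed (use assms in auto)

lemma smooth_on_const: "smooth_on S (\<lambda>x. c)"
proof (rule smooth_on_coinduct[where P = "\<lambda>f. \<exists>c. f = (\<lambda>x. c)"])
  fix f :: "'a \<Rightarrow> 'b" assume "\<exists>c. f = (\<lambda>x. c)"
  then show "(\<forall>x\<in>S. f differentiable (at x)) \<and> (\<forall>v. \<exists>c. (\<lambda>x. fd f x v) = (\<lambda>x. c))" by auto
qed auto

lemma smooth_on_bounded_linear:
  assumes L: "bounded_linear L" and S: "open S" and f: "smooth_on S f"
  shows "smooth_on S (\<lambda>x. L (f x))"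
proof (rule smooth_on_coinduct[where P = "\<lambda>h. \<exists>f. smooth_on S f \<and> (\<forall>x\<in>S. h x = L (f x))"])
  fix h assume "\<exists>f. smooth_on S f \<and> (\<forall>x\<in>S. h x = L (f x))"
  then obtain f where f: "smooth_on S f" "\<forall>x\<in>S. h x = L (f x)" by auto
  have *: "((\<lambda>x. L (f x)) has_derivative (\<lambda>v. L (fd f x v))) (at x)" if "x \<in> S" for x
    using bounded_linear.has_derivative[OF L smooth_on_has_fd[OF f(1) that]] .
  show "(\<forall>x\<in>S. h differentiable (at x)) \<and> (\<forall>v. \<exists>f. smooth_on S f \<and> (\<forall>x\<in>S. fd h x v = L (f x)))"
    using fd_agree[OF S _ f(2) *] smooth_on_fd[OF f(1)]
    by (intro conjI allI ballI exI[of _ "\<lambda>x. fd f x v" for v]) auto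
qed (use f in auto)

lemma smooth_on_add:
  assumes S: "open S" and f: "smooth_on S f" "smooth_on S g"
  shows "smooth_on S (\<lambda>x. f x + g x)"
proof (rule smooth_on_coinduct[where P = "\<lambda>h. \<exists>f g. smooth_on S f \<and> smooth_on S g \<and> (\<forall>x\<in>S. h x = f x + g x)"])
  fix h assume "\<exists>f g. smooth_on S f \<and> smooth_on S g \<and> (\<forall>x\<in>S. h x = f x + g x)"
  then obtain f g where f: "smooth_on S f" "smooth_on S g" "\<forall>x\<in>S. h x = f x + g x" by auto
  have *: "((\<lambda>x. f x + g x) has_derivative (\<lambda>v. fd f x v + fd g x v)) (at x)" if "x \<in> S" for x
    using has_derivative_add[OF smooth_on_has_fd[OF f(1) that] smooth_on_has_fd[OF f(2) that]] .
  show "(\<forall>x\<in>S. h differentiable (at x)) \<and>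
      (\<forall>v. \<exists>f g. smooth_on S f \<and> smooth_on S g \<and> (\<forall>x\<in>S. fd h x v = f x + g x))"
    using fd_agree[OF S _ f(3) *] smooth_on_fd[OF f(1)] smooth_on_fd[OF f(2)]
    by (intro conjI allI ballI exI[of _ "\<lambda>x. fd f x v" for v] exI[of _ "\<lambda>x. fd g x v" for v]) auto
qed (use f in auto)

lemma smooth_on_sum:
  "open S \<Longrightarrow> (\<And>i. i \<in> I \<Longrightarrow> smooth_on S (f i)) \<Longrightarrow> smooth_on S (\<lambda>x. \<Sum>i\<in>I. f i x)"
  by (induction I rule: infinite_finite_induct) (simp_all add: smooth_on_const smooth_on_add)

text \<open>Sums of products of smooth functions: closed under differentiation by the product rule.\<close>

inductive bilinear_sum for S and pr where
  base: "smooth_on S f \<Longrightarrow> smooth_on S g \<Longrightarrow> \<forall>x\<in>S. h x = pr (f x) (g x) \<Longrightarrow> bilinear_sum S pr h"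
| add: "bilinear_sum S pr f \<Longrightarrow> bilinear_sum S pr g \<Longrightarrow> \<forall>x\<in>S. h x = f x + g x \<Longrightarrow> bilinear_sum S pr h"

lemma smooth_on_bilinear:
  assumes b: "bounded_bilinear pr" and S: "open S" and f: "smooth_on S f" "smooth_on S g"
  shows "smooth_on S (\<lambda>x. pr (f x) (g x))"
proof (rule smooth_on_coinduct[where P = "bilinear_sum S pr"])
  show "bilinear_sum S pr (\<lambda>x. pr (f x) (g x))" using f by (intro bilinear_sum.base) auto
  fix h assume "bilinear_sum S pr h"
  then show "(\<forall>x\<in>S. h differentiable (at x)) \<and> (\<forall>v. bilinear_sum S pr (\<lambda>x. fd h x v))"
  proof induction
    case (base f g h)
    have *: "((\<lambda>x. pr (f x) (g x)) has_derivative (\<lambda>v. pr (f x) (fd g x v) + pr (fd f x v) (g x))) (at x)"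
      if "x \<in> S" for x
      using bounded_bilinear.FDERIV[OF b smooth_on_has_fd[OF base(1) that] smooth_on_has_fd[OF base(2) that]] .
    note ** = fd_agree[OF S _ base(3) *]
    have 1: "bilinear_sum S pr (\<lambda>x. pr (f x) (fd g x v))" for v
      by (rule bilinear_sum.base[OF base(1) smooth_on_fd[OF base(2), of v]]) simp
    have 2: "bilinear_sum S pr (\<lambda>x. pr (fd f x v) (g x))" for v
      by (rule bilinear_sum.base[OF smooth_on_fd[OF base(1), of v] base(2)]) simp
    have "bilinear_sum S pr (\<lambda>x. fd h x v)" for v
      by (rule bilinear_sum.add[OF 1[of v] 2[of v]]) (simp add: **)
    then show ?case using **(1) by blast
  next
    case (add f g h)
    have *: "((\<lambda>x. f x + g x) has_derivative (\<lambda>v. fd f x v + fd g x v)) (at x)" if "x \<in> S" for x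
      using add that by (intro has_derivative_add has_fd) auto
    note ** = fd_agree[OF S _ add(3) *]
    have 1: "bilinear_sum S pr (\<lambda>x. fd f x v)" and 2: "bilinear_sum S pr (\<lambda>x. fd g x v)" for v
      using add.IH by simp_all
    have "bilinear_sum S pr (\<lambda>x. fd h x v)" for v
      by (rule bilinear_sum.add[OF 1[of v] 2[of v]]) (simp add: **)
    then show ?case using **(1) by blast
  qed
qed

lemmas smooth_on_mult = smooth_on_bilinear[OF bounded_bilinear_mult]
lemmas smooth_on_scaleR = smooth_on_bilinear[OF bounded_bilinear_scaleR]

subsection \<open>Orthogonal bases\<close>

definition coord :: "'e::real_inner \<Rightarrow> 'e \<Rightarrow> real" where
  "coord b v = (v \<bullet> b) / (b \<bullet> b)"

text \<open>An orthogonal basis without normalisation; coordinates are given by an explicit formula.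
  The model space may have dimension 0, which
  the class of Euclidean spaces excludes.\<close>

definition orth_basis :: "'e::real_inner set \<Rightarrow> bool" where
  "orth_basis E \<longleftrightarrow> finite E \<and> (\<forall>v. (\<Sum>b\<in>E. coord b v *\<^sub>R b) = v)"

lemma orth_basis_exists:
  fixes B :: "'e::real_inner set"
  assumes "finite B" "span B = UNIV" obtains E :: "'e set" where "orth_basis E"
proof -
  obtain E :: "'e set" where E: "finite E" "span E = UNIV" "pairwise orthogonal E"
    using basis_orthogonal[OF assms(1)] assms(2) by auto
  have "(\<Sum>b\<in>E. coord b v *\<^sub>R b) = v" for v
  proof -
    obtain a where a: "v = (\<Sum>b\<in>E. a b *\<^sub>R b)"
      using E(1,2) span_finite[of E] by (metis (mono_tags, lifting) UNIV_I imageE)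
    have *: "coord c v *\<^sub>R c = a c *\<^sub>R c" if c: "c \<in> E" for c
    proof -
      have "v \<bullet> c = (\<Sum>b\<in>E. a b * (b \<bullet> c))" by (simp add: a inner_sum_left)
      also have "\<dots> = (\<Sum>b\<in>E. if b = c then a c * (c \<bullet> c) else 0)"
      proof (intro sum.cong refl)
        fix b assume "b \<in> E"
        then show "a b * (b \<bullet> c) = (if b = c then a c * (c \<bullet> c) else 0)"
          using E(3) c by (auto simp: pairwise_def orthogonal_def)
      qed
      also have "\<dots> = a c * (c \<bullet> c)" using E(1) c by simp
      finally show ?thesis by (cases "c = 0") (simp_all add: coord_def)
    qed
    have "(\<Sum>b\<in>E. coord b v *\<^sub>R b) = (\<Sum>b\<in>E. a b *\<^sub>R b)" by (intro sum.cong refl *)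
    then show ?thesis using a by simp
  qed
  then show ?thesis using that[of E] E(1) by (simp add: orth_basis_def)
qed

lemma bounded_linear_coord: "bounded_linear (coord b)"
  unfolding coord_def by (rule bounded_linear_compose[OF bounded_linear_divide bounded_linear_inner_left])

lemma orth_basis_finite: "orth_basis E \<Longrightarrow> finite E" by (simp add: orth_basis_def)

lemma linear_expand:
  assumes E: "orth_basis E" and f: "linear f" shows "f v = (\<Sum>b\<in>E. coord b v *\<^sub>R f b)"
proof -
  have "f v = f (\<Sum>b\<in>E. coord b v *\<^sub>R b)" using E by (simp add: orth_basis_def)
  also have "\<dots> = (\<Sum>b\<in>E. coord b v *\<^sub>R f b)" by (simp add: linear_sum[OF f] linear_scale[OF f])
  finally show ?thesis .
qed

text \<open>Sums of terms \<open>a (g \<circ> f)\<close>. By the chain rule, in coordinates on the target of \<open>f\<close>, this class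
  is closed under differentiation.\<close>

inductive chain_sum for S T f where
  base: "smooth_on S a \<Longrightarrow> smooth_on T g \<Longrightarrow> \<forall>x\<in>S. h x = a x *\<^sub>R g (f x) \<Longrightarrow> chain_sum S T f h"
| add: "chain_sum S T f g \<Longrightarrow> chain_sum S T f g' \<Longrightarrow> \<forall>x\<in>S. h x = g x + g' x \<Longrightarrow> chain_sum S T f h"

lemma chain_sum_sum:
  "finite I \<Longrightarrow> (\<And>i. i \<in> I \<Longrightarrow> chain_sum S T f (h i)) \<Longrightarrow> chain_sum S T f (\<lambda>x. \<Sum>i\<in>I. h i x)"
proof (induction I rule: finite_induct)
  case empty
  show ?case
    by (rule chain_sum.base[OF smooth_on_const[of S "0::real"] smooth_on_const[of T 0]]) simp
next
  case (insert i I)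
  have 1: "chain_sum S T f (h i)" and 2: "chain_sum S T f (\<lambda>x. \<Sum>i\<in>I. h i x)" using insert by simp_all
  show ?case by (rule chain_sum.add[OF 1 2]) (simp add: insert.hyps)
qed

lemma has_derivative_chain:
  assumes "(f has_derivative f') (at x)" "(g has_derivative g') (at (f x))"
  shows "((\<lambda>x. g (f x)) has_derivative (\<lambda>v. g' (f' v))) (at x)"
  using diff_chain_at[OF assms] by (simp add: o_def)

lemma smooth_on_compose:
  fixes f :: "'e::real_normed_vector \<Rightarrow> 'f::real_inner" and g :: "'f \<Rightarrow> 'h::real_normed_vector"
    and E :: "'f set"
  assumes E: "orth_basis E" and S: "open S" and T: "open T" "\<And>x. x \<in> S \<Longrightarrow> f x \<in> T"
    and f: "smooth_on S f" and g: "smooth_on T g"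
  shows "smooth_on S (\<lambda>x. g (f x))"
proof (rule smooth_on_coinduct[where P = "chain_sum S T f"])
  show "chain_sum S T f (\<lambda>x. g (f x))"
    by (rule chain_sum.base[OF smooth_on_const[of S "1::real"] g]) simp
  fix h :: "'e \<Rightarrow> 'h" assume "chain_sum S T f h"
  then show "(\<forall>x\<in>S. h differentiable (at x)) \<and> (\<forall>v. chain_sum S T f (\<lambda>x. fd h x v))"
  proof induction
    case (base a g h)
    have *: "((\<lambda>x. a x *\<^sub>R g (f x)) has_derivative
        (\<lambda>v. a x *\<^sub>R fd g (f x) (fd f x v) + fd a x v *\<^sub>R g (f x))) (at x)"
      if "x \<in> S" for x
      using bounded_bilinear.FDERIV[OF bounded_bilinear_scaleR smooth_on_has_fd[OF base(1) that]
        has_derivative_chain[OF smooth_on_has_fd[OF f that] smooth_on_has_fd[OF base(2) T(2)[OF that]]]] .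
    have fdh: "fd h x v = (\<Sum>b\<in>E. (a x * coord b (fd f x v)) *\<^sub>R fd g (f x) b) + fd a x v *\<^sub>R g (f x)"
      if "x \<in> S" for x v
    proof -
      have "fd h x v = a x *\<^sub>R fd g (f x) (fd f x v) + fd a x v *\<^sub>R g (f x)"
        using fd_agree(2)[OF S that base(3) *[OF that]] by simp
      also have "fd g (f x) (fd f x v) = (\<Sum>b\<in>E. coord b (fd f x v) *\<^sub>R fd g (f x) b)"
        by (rule linear_expand[OF E linear_fd[OF smooth_on_differentiable[OF base(2) T(2)[OF that]]]])
      finally show ?thesis by (simp add: scaleR_sum_right)
    qed
    have "chain_sum S T f (\<lambda>x. fd h x v)" for v
    proof (rule chain_sum.add)
      show "chain_sum S T f (\<lambda>x. \<Sum>b\<in>E. (a x * coord b (fd f x v)) *\<^sub>R fd g (f x) b)"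
        using smooth_on_mult[OF S base(1) smooth_on_bounded_linear[OF bounded_linear_coord S smooth_on_fd[OF f]]]
          smooth_on_fd[OF base(2)]
        by (intro chain_sum_sum orth_basis_finite[OF E] chain_sum.base[where g = "\<lambda>y. fd g y _"]) auto
      show "chain_sum S T f (\<lambda>x. fd a x v *\<^sub>R g (f x))"
        by (rule chain_sum.base[OF smooth_on_fd[OF base(1), of v] base(2)]) simp
    qed (use fdh in auto)
    then show ?case using fd_agree(1)[OF S _ base(3) *] by blast
  next
    case (add g g' h)
    have *: "((\<lambda>x. g x + g' x) has_derivative (\<lambda>v. fd g x v + fd g' x v)) (at x)" if "x \<in> S" for x
      using add that by (intro has_derivative_add has_fd) auto
    note ** = fd_agree[OF S _ add(3) *]
    have 1: "chain_sum S T f (\<lambda>x. fd g x v)" and 2: "chain_sum S T f (\<lambda>x. fd g' x v)" for v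
      using add.IH by simp_all
    have "chain_sum S T f (\<lambda>x. fd h x v)" for v
      by (rule chain_sum.add[OF 1[of v] 2[of v]]) (simp add: **)
    then show ?case using **(1) by blast
  qed
qed

subsection \<open>Symmetry of second derivatives\<close>

text \<open>The mean value theorem, applied in the direction \<open>v\<close> and then in the direction \<open>w\<close>. The left hand
  side is symmetric in \<open>v\<close> and \<open>w\<close>.\<close>

lemma second_difference_mvt:
  fixes f :: "'e::real_normed_vector \<Rightarrow> real"
  assumes f: "smooth_on S f" and h: "0 < h"
    and S: "\<And>s t. 0 \<le> s \<Longrightarrow> s \<le> h \<Longrightarrow> 0 \<le> t \<Longrightarrow> t \<le> h \<Longrightarrow> x + s *\<^sub>R v + t *\<^sub>R w \<in> S"
  shows "\<exists>s t. 0 < s \<and> s < h \<and> 0 < t \<and> t < h \<and>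
    f (x + h *\<^sub>R v + h *\<^sub>R w) - f (x + h *\<^sub>R v) - f (x + h *\<^sub>R w) + f x =
    h * h * fd (\<lambda>y. fd f y v) (x + s *\<^sub>R v + t *\<^sub>R w) w"
proof -
  have D: "DERIV (\<lambda>s. g (p + s *\<^sub>R z)) s :> fd g (p + s *\<^sub>R z) z"
    if "smooth_on S g" "p + s *\<^sub>R z \<in> S" for g :: "'e \<Rightarrow> real" and p z s
  proof -
    note g = smooth_on_differentiable[OF that]
    have "((\<lambda>s. p + s *\<^sub>R z) has_derivative (\<lambda>s. s *\<^sub>R z)) (at s)" by (auto intro!: derivative_eq_intros)
    from has_derivative_chain[OF this has_fd[OF g]]
    show ?thesis
      by (simp add: has_field_derivative_def linear_scale[OF linear_fd[OF g]] mult.commute[of _ "fd g _ _"]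
          mult_commute_abs)
  qed
  let ?\<phi> = "\<lambda>s. f ((x + h *\<^sub>R w) + s *\<^sub>R v) - f (x + s *\<^sub>R v)"
  have "DERIV ?\<phi> s :> fd f ((x + h *\<^sub>R w) + s *\<^sub>R v) v - fd f (x + s *\<^sub>R v) v" if "0 \<le> s" "s \<le> h" for s
    using S[of s h] S[of s 0] h that by (intro DERIV_diff D[OF f]) (auto simp: algebra_simps)
  from MVT2[OF h this] obtain s where s: "0 < s" "s < h"
    "?\<phi> h - ?\<phi> 0 = (h - 0) * (fd f ((x + h *\<^sub>R w) + s *\<^sub>R v) v - fd f (x + s *\<^sub>R v) v)"
    by blast
  let ?\<psi> = "\<lambda>t. fd f ((x + s *\<^sub>R v) + t *\<^sub>R w) v"
  have "DERIV ?\<psi> t :> fd (\<lambda>y. fd f y v) ((x + s *\<^sub>R v) + t *\<^sub>R w) w" if "0 \<le> t" "t \<le> h" for t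
    using S[of s t] s that by (intro D[OF smooth_on_fd[OF f]]) auto
  from MVT2[OF h this] obtain t where t: "0 < t" "t < h"
    "?\<psi> h - ?\<psi> 0 = (h - 0) * fd (\<lambda>y. fd f y v) ((x + s *\<^sub>R v) + t *\<^sub>R w) w"
    by blast
  have "fd f ((x + h *\<^sub>R w) + s *\<^sub>R v) v - fd f (x + s *\<^sub>R v) v = ?\<psi> h - ?\<psi> 0" by (simp add: algebra_simps)
  then have "?\<phi> h - ?\<phi> 0 = h * h * fd (\<lambda>y. fd f y v) (x + s *\<^sub>R v + t *\<^sub>R w) w"
    using s(3) t(3) by simp
  moreover have "?\<phi> h - ?\<phi> 0 = f (x + h *\<^sub>R v + h *\<^sub>R w) - f (x + h *\<^sub>R v) - f (x + h *\<^sub>R w) + f x"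
    by (simp add: algebra_simps)
  ultimately show ?thesis using s(1,2) t(1,2) by metis
qed

text \<open>Both mixed derivatives are limits of the same second difference quotient.\<close>

lemma fd_commute_real:
  fixes f :: "'e::real_normed_vector \<Rightarrow> real"
  assumes S: "open S" and f: "smooth_on S f" and x: "x \<in> S"
  shows "fd (\<lambda>y. fd f y v) x w = fd (\<lambda>y. fd f y w) x v"
proof (rule ccontr)
  let ?A = "\<lambda>y. fd (\<lambda>y. fd f y v) y w" and ?B = "\<lambda>y. fd (\<lambda>y. fd f y w) y v"
  assume "?A x \<noteq> ?B x"
  then have e: "0 < \<bar>?A x - ?B x\<bar> / 2" (is "0 < ?e") by simp
  have "continuous_on S ?A" "continuous_on S ?B"
    by (intro smooth_on_continuous smooth_on_fd f)+
  then have "isCont ?A x" "isCont ?B x" using S x by (simp_all add: continuous_on_eq_continuous_at)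
  then obtain d1 d2 where d: "0 < d1" "\<And>y. dist y x < d1 \<Longrightarrow> dist (?A y) (?A x) < ?e"
    "0 < d2" "\<And>y. dist y x < d2 \<Longrightarrow> dist (?B y) (?B x) < ?e"
    using e unfolding continuous_at_eps_delta by (metis dist_commute)
  obtain d3 where d3: "0 < d3" "ball x d3 \<subseteq> S" using S x openE by blast
  define d where "d = min d1 (min d2 d3)"
  (* The whole parallelogram with sides h v and h w at x has to stay within distance d of x; the summand 1 avoids
     division by zero. *)
  define N where "N = norm v + norm w + 1"
  define h where "h = d / (2 * N)"
  have dpos: "0 < d" using d d3 by (simp add: d_def)
  have n: "0 < N" unfolding N_def by (smt (verit) norm_ge_zero)
  have h: "0 < h" using dpos n by (simp add: h_def)
  have near: "dist (x + s *\<^sub>R v + t *\<^sub>R w) x < d" if st: "0 \<le> s" "s \<le> h" "0 \<le> t" "t \<le> h" for s t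
  proof -
    have "dist (x + s *\<^sub>R v + t *\<^sub>R w) x \<le> norm (s *\<^sub>R v) + norm (t *\<^sub>R w)"
      using norm_triangle_ineq[of "s *\<^sub>R v" "t *\<^sub>R w"] by (simp add: dist_norm add.assoc)
    also have "\<dots> \<le> h * norm v + h * norm w" using st by (auto intro!: add_mono mult_right_mono)
    also have "\<dots> \<le> h * N" using h by (simp add: N_def algebra_simps)
    also have "\<dots> = d / 2" using n by (simp add: h_def)
    finally show ?thesis using dpos by linarith
  qed
  then have inS: "x + s *\<^sub>R v + t *\<^sub>R w \<in> S" if "0 \<le> s" "s \<le> h" "0 \<le> t" "t \<le> h" for s t
    using d3(2) that by (force simp: d_def dist_commute)
  have inS': "x + s *\<^sub>R w + t *\<^sub>R v \<in> S" if "0 \<le> s" "s \<le> h" "0 \<le> t" "t \<le> h" for s t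
    using inS[of t s] that by (simp add: algebra_simps)
  obtain s t where st: "0 < s" "s < h" "0 < t" "t < h"
    "f (x + h *\<^sub>R v + h *\<^sub>R w) - f (x + h *\<^sub>R v) - f (x + h *\<^sub>R w) + f x = h * h * ?A (x + s *\<^sub>R v + t *\<^sub>R w)"
    using second_difference_mvt[OF f h inS] by blast
  obtain s' t' where st': "0 < s'" "s' < h" "0 < t'" "t' < h"
    "f (x + h *\<^sub>R w + h *\<^sub>R v) - f (x + h *\<^sub>R w) - f (x + h *\<^sub>R v) + f x = h * h * ?B (x + s' *\<^sub>R w + t' *\<^sub>R v)"
    using second_difference_mvt[OF f h inS'] by blast
  have "h * h * ?A (x + s *\<^sub>R v + t *\<^sub>R w) = h * h * ?B (x + s' *\<^sub>R w + t' *\<^sub>R v)"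
    using st(5) st'(5) by (simp add: algebra_simps)
  then have "?A (x + s *\<^sub>R v + t *\<^sub>R w) = ?B (x + s' *\<^sub>R w + t' *\<^sub>R v)" using h by simp
  moreover have "dist (?A (x + s *\<^sub>R v + t *\<^sub>R w)) (?A x) < ?e"
    using near[of s t] st by (intro d(2)) (auto simp: d_def)
  moreover have "dist (?B (x + s' *\<^sub>R w + t' *\<^sub>R v)) (?B x) < ?e"
  proof (rule d(4))
    have eq: "x + s' *\<^sub>R w + t' *\<^sub>R v = x + t' *\<^sub>R v + s' *\<^sub>R w" by (simp add: algebra_simps)
    show "dist (x + s' *\<^sub>R w + t' *\<^sub>R v) x < d2"
      unfolding eq using near[of t' s'] st' by (auto simp: d_def)
  qed
  ultimately show False unfolding dist_real_def by (simp add: field_simps abs_if split: if_splits)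
qed

text \<open>Reduction to real functions by taking inner products.\<close>

lemma fd_commute:
  fixes f :: "'e::real_normed_vector \<Rightarrow> 'f::real_inner"
  assumes S: "open S" and f: "smooth_on S f" and x: "x \<in> S"
  shows "fd (\<lambda>y. fd f y v) x w = fd (\<lambda>y. fd f y w) x v"
proof -
  have 1: "fd (\<lambda>y. g y \<bullet> z) y u = fd g y u \<bullet> z" if "smooth_on S g" "y \<in> S" for g :: "'e \<Rightarrow> 'f" and y u z
    using fd_eq[OF bounded_linear.has_derivative[OF bounded_linear_inner_left smooth_on_has_fd[OF that]]] by metis
  have 2: "fd (\<lambda>y. fd f y v) x w \<bullet> z = fd (\<lambda>y. fd (\<lambda>y. f y \<bullet> z) y v) x w" for v w z
  proof -
    have "fd (\<lambda>y. fd (\<lambda>y. f y \<bullet> z) y v) x = fd (\<lambda>y. fd f y v \<bullet> z) x"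
      using 1[OF f] by (intro fd_cong[OF S x])
    then show ?thesis using 1[OF smooth_on_fd[OF f] x] by simp
  qed
  have "fd (\<lambda>y. fd f y v) x w \<bullet> z = fd (\<lambda>y. fd f y w) x v \<bullet> z" for z
    unfolding 2 by (rule fd_commute_real[OF S smooth_on_bounded_linear[OF bounded_linear_inner_left S f] x])
  then show ?thesis using vector_eq_rdot by blast
qed



section \<open>Fields of alternating forms and the exterior derivative\<close>

definition smooth_ext :: "'e::real_normed_vector set \<Rightarrow> ('e \<Rightarrow> 'f ext) \<Rightarrow> bool" where
  "smooth_ext S \<omega> \<longleftrightarrow> (\<forall>vs. smooth_on S (\<lambda>u. \<omega> u vs))"

abbreviation fd_ext :: "('e::real_normed_vector \<Rightarrow> 'f ext) \<Rightarrow> 'e \<Rightarrow> 'e \<Rightarrow> 'f ext" where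
  "fd_ext \<omega> u w \<equiv> (\<lambda>vs. fd (\<lambda>y. \<omega> y vs) u w)"

lemma smooth_extD: "smooth_ext S \<omega> \<Longrightarrow> smooth_on S (\<lambda>u. \<omega> u vs)"
  by (simp add: smooth_ext_def)

lemma smooth_ext_diff_at: "smooth_ext S \<omega> \<Longrightarrow> u \<in> S \<Longrightarrow> (\<lambda>u. \<omega> u vs) differentiable (at u)"
  by (intro smooth_on_differentiable[of S] smooth_extD)

lemma smooth_ext_iota: "smooth_ext S \<omega> \<Longrightarrow> smooth_ext S (\<lambda>u. iota v (\<omega> u))"
  by (simp add: smooth_ext_def iota_apply)

lemma smooth_on_cmult: "open S \<Longrightarrow> smooth_on S f \<Longrightarrow> smooth_on S (\<lambda>x. (c :: complex) * f x)"
  by (intro smooth_on_mult smooth_on_const)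

lemma smooth_ext_fd: "smooth_ext S \<omega> \<Longrightarrow> smooth_ext S (\<lambda>u. fd_ext \<omega> u w)"
  by (simp add: smooth_ext_def smooth_on_fd)

lemma smooth_ext_add: "open S \<Longrightarrow> smooth_ext S \<alpha> \<Longrightarrow> smooth_ext S \<beta> \<Longrightarrow> smooth_ext S (\<lambda>u. \<alpha> u + \<beta> u)"
  by (simp add: smooth_ext_def smooth_on_add)

lemma smooth_ext_cscale: "open S \<Longrightarrow> smooth_ext S \<alpha> \<Longrightarrow> smooth_ext S (\<lambda>u. a *\<^sub>C \<alpha> u)"
  by (simp add: smooth_ext_def smooth_on_cmult)

lemma smooth_ext_sign: "open S \<Longrightarrow> smooth_ext S \<alpha> \<Longrightarrow> smooth_ext S (\<lambda>u. ext_sign (\<alpha> u))"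
  by (simp add: smooth_ext_def ext_sign_def smooth_on_cmult)

lemma smooth_ext_wedge:
  "open S \<Longrightarrow> smooth_ext S \<alpha> \<Longrightarrow> smooth_ext S \<beta> \<Longrightarrow> smooth_ext S (\<lambda>u. ext_wedge (\<alpha> u) (\<beta> u))"
  unfolding smooth_ext_def ext_wedge_def
  by (intro allI smooth_on_sum smooth_on_mult smooth_on_const) auto

lemma fd_add:
  assumes "f differentiable (at x)" "g differentiable (at x)"
  shows "fd (\<lambda>y. f y + g y) x v = fd f x v + fd g x v"
  using fd_eq[OF has_derivative_add[OF has_fd[OF assms(1)] has_fd[OF assms(2)]]] by simp

lemma fd_sum:
  assumes "\<And>i. i \<in> I \<Longrightarrow> f i differentiable (at x)"
  shows "fd (\<lambda>y. \<Sum>i\<in>I. f i y) x v = (\<Sum>i\<in>I. fd (f i) x v)"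
  using fd_eq[OF has_derivative_sum[of I f "\<lambda>i. fd (f i) x" "at x"]] has_fd[OF assms] by simp

lemma fd_bilinear:
  assumes "bounded_bilinear pr" "f differentiable (at x)" "g differentiable (at x)"
  shows "fd (\<lambda>y. pr (f y) (g y)) x v = pr (f x) (fd g x v) + pr (fd f x v) (g x)"
  using fd_eq[OF bounded_bilinear.FDERIV[OF assms(1) has_fd[OF assms(2)] has_fd[OF assms(3)]]] by simp

lemma fd_cmult: "f differentiable (at x) \<Longrightarrow> fd (\<lambda>y. c * f y) x v = (c :: complex) * fd f x v"
  using fd_bilinear[OF bounded_bilinear_mult, of "\<lambda>_. c" x f v] by simp

lemma fd_bounded_linear:
  assumes "bounded_linear L" "f differentiable (at x)" shows "fd (\<lambda>y. L (f y)) x v = L (fd f x v)"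
  using fd_eq[OF bounded_linear.has_derivative[OF assms(1) has_fd[OF assms(2)]]] by simp

lemma fd_compose:
  assumes "f differentiable (at x)" "g differentiable (at (f x))"
  shows "fd (\<lambda>y. g (f y)) x v = fd g (f x) (fd f x v)"
  using fd_eq[OF has_derivative_chain[OF has_fd[OF assms(1)] has_fd[OF assms(2)]]] by simp

lemma alternating_fd:
  assumes S: "open S" "u \<in> S" and \<omega>: "smooth_ext S \<omega>" and alt: "\<And>y. y \<in> S \<Longrightarrow> alternating (\<omega> y)"
  shows "alternating (fd_ext \<omega> u w)"
proof (rule alternatingI)
  note d = smooth_ext_diff_at[OF \<omega> S(2)]
  fix xs ys
  show "linear (\<lambda>v. fd (\<lambda>y. \<omega> y (xs @ v # ys)) u w)"
  proof (rule linearI)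
    fix a b :: 'b and r
    have "fd (\<lambda>y. \<omega> y (xs @ (a + b) # ys)) u = fd (\<lambda>y. \<omega> y (xs @ a # ys) + \<omega> y (xs @ b # ys)) u"
      by (rule fd_cong[OF S linear_add[OF alternating_linear[OF alt]]])
    then show "fd (\<lambda>y. \<omega> y (xs @ (a + b) # ys)) u w =
        fd (\<lambda>y. \<omega> y (xs @ a # ys)) u w + fd (\<lambda>y. \<omega> y (xs @ b # ys)) u w"
      by (simp add: fd_add d)
    have "fd (\<lambda>y. \<omega> y (xs @ (r *\<^sub>R a) # ys)) u = fd (\<lambda>y. of_real r * \<omega> y (xs @ a # ys)) u"
      by (rule fd_cong[OF S]) (simp add: linear_scale[OF alternating_linear[OF alt]] scaleR_conv_of_real)
    then show "fd (\<lambda>y. \<omega> y (xs @ (r *\<^sub>R a) # ys)) u w = r *\<^sub>R fd (\<lambda>y. \<omega> y (xs @ a # ys)) u w"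
      by (simp add: fd_cmult d scaleR_conv_of_real)
  qed
  fix v
  have "fd (\<lambda>y. \<omega> y (xs @ v # v # ys)) u = fd (\<lambda>y. 0) u"
    by (rule fd_cong[OF S alternating_adj[OF alt]])
  then show "fd (\<lambda>y. \<omega> y (xs @ v # v # ys)) u w = 0" by simp
qed

subsection \<open>Evaluation of a field of forms on vector fields\<close>

lemma linear_der_iota: "alternating \<alpha> \<Longrightarrow> linear (\<lambda>v. der (iota v \<alpha>) ps)"
proof (intro linearI)
  have add: "der (\<alpha> + \<beta>) ps = der \<alpha> ps + der \<beta> ps" for \<alpha> \<beta> :: "'a ext"
    by (induction ps arbitrary: \<alpha> \<beta>) (simp_all add: algebra_simps)
  assume "alternating \<alpha>"
  then show "der (iota (v + w) \<alpha>) ps = der (iota v \<alpha>) ps + der (iota w \<alpha>) ps"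
    and "der (iota (r *\<^sub>R v) \<alpha>) ps = r *\<^sub>R der (iota v \<alpha>) ps" for v w r
    by (simp_all add: iota_linear add der_cscale scaleR_conv_of_real)
qed

context
  fixes S :: "'e::real_normed_vector set" and T :: "'f::real_inner set" and g :: "'e \<Rightarrow> 'f" and E :: "'f set"
  assumes E: "orth_basis E" and S: "open S" and T: "open T" "\<And>x. x \<in> S \<Longrightarrow> g x \<in> T" and g: "smooth_on S g"
begin

text \<open>Multilinearity lets the first vector be expanded in constant vectors, so that induction on the number of
  vectors reduces smoothness and the derivative of the value to the product rule.\<close>

lemma eval_expand:
  assumes "\<And>y. y \<in> T \<Longrightarrow> alternating (\<omega> y)" "y \<in> T"
  shows "\<omega> y (w # ws) = (\<Sum>b\<in>E. coord b w *\<^sub>R iota b (\<omega> y) ws)"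
  unfolding iota_apply by (rule linear_expand[OF E alternating_linear_hd[OF assms(1)[OF assms(2)]]])

lemma smooth_on_eval:
  fixes \<omega> :: "'f \<Rightarrow> 'f ext" and Ws :: "('e \<Rightarrow> 'f) list"
  assumes "smooth_ext T \<omega>" "\<And>y. y \<in> T \<Longrightarrow> alternating (\<omega> y)" "\<And>W. W \<in> set Ws \<Longrightarrow> smooth_on S W"
  shows "smooth_on S (\<lambda>u. \<omega> (g u) (map (\<lambda>W. W u) Ws))"
  using assms
proof (induction Ws arbitrary: \<omega>)
  case Nil
  then show ?case using smooth_on_compose[OF E S T g smooth_extD[OF Nil(1), of "[]"]] by simp
next
  case (Cons W Ws)
  have 1: "smooth_on S (\<lambda>u. iota b (\<omega> (g u)) (map (\<lambda>W. W u) Ws))" for b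
    using Cons.prems by (intro Cons.IH smooth_ext_iota alternating_iota) auto
  have 2: "smooth_on S (\<lambda>u. coord b (W u))" for b
    by (rule smooth_on_bounded_linear[OF bounded_linear_coord S Cons.prems(3)]) simp
  have "smooth_on S (\<lambda>u. \<Sum>b\<in>E. coord b (W u) *\<^sub>R iota b (\<omega> (g u)) (map (\<lambda>W. W u) Ws))"
    by (rule smooth_on_sum[OF S]) (rule smooth_on_scaleR[OF S 2 1])
  then show ?case
    by (rule smooth_on_cong[OF S]) (simp add: eval_expand[where \<omega> = \<omega>, OF Cons.prems(2) T(2)])
qed

text \<open>Evaluating a field of forms on moving vectors is smooth, and its derivative has one term for the
  motion of the point and the term \<open>der\<close> for the motion of the vectors. This rule is used for pullbacks, where the
  vectors are \<open>dF(v)\<close>, and for rotations, where they are \<open>R\<^sub>\<theta> v\<close>.\<close>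

lemma fd_eval:
  fixes \<omega> :: "'f \<Rightarrow> 'f ext" and Ws :: "('e \<Rightarrow> 'f) list"
  assumes "smooth_ext T \<omega>" "\<And>y. y \<in> T \<Longrightarrow> alternating (\<omega> y)" "\<And>W. W \<in> set Ws \<Longrightarrow> smooth_on S W" and x: "x \<in> S"
  shows "fd (\<lambda>u. \<omega> (g u) (map (\<lambda>W. W u) Ws)) x v =
    fd (\<lambda>y. \<omega> y (map (\<lambda>W. W x) Ws)) (g x) (fd g x v) + der (\<omega> (g x)) (map (\<lambda>W. (W x, fd W x v)) Ws)"
  using assms(1-3)
proof (induction Ws arbitrary: \<omega>)
  case Nil
  have "(\<lambda>y. \<omega> y []) differentiable (at (g x))" by (rule smooth_ext_diff_at[OF Nil(1) T(2)[OF x]])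
  from fd_compose[OF smooth_on_differentiable[OF g x] this] show ?case by simp
next
  case (Cons W Ws)
  let ?F = "\<lambda>b u. iota b (\<omega> (g u)) (map (\<lambda>W. W u) Ws)"
  let ?ws = "map (\<lambda>W. W x) Ws" and ?ps = "map (\<lambda>W. (W x, fd W x v)) Ws"
  have W: "smooth_on S W" using Cons.prems by simp
  have sF: "smooth_on S (?F b)" for b
    using Cons.prems by (intro smooth_on_eval[where \<omega> = "\<lambda>y. iota b (\<omega> y)"] smooth_ext_iota alternating_iota) auto
  have sc: "smooth_on S (\<lambda>u. coord b (W u))" for b
    by (rule smooth_on_bounded_linear[OF bounded_linear_coord S W])
  have alt: "alternating (\<omega> (g x))" using Cons.prems(2) T(2) x by blast
  have "fd (\<lambda>u. \<omega> (g u) (map (\<lambda>W. W u) (W # Ws))) x v = fd (\<lambda>u. \<Sum>b\<in>E. coord b (W u) *\<^sub>R ?F b u) x v"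
    by (subst fd_cong[OF S x, of _ "\<lambda>u. \<Sum>b\<in>E. coord b (W u) *\<^sub>R ?F b u"])
      (simp_all add: eval_expand[where \<omega> = \<omega>, OF Cons.prems(2) T(2)])
  also have "\<dots> = (\<Sum>b\<in>E. coord b (W x) *\<^sub>R fd (?F b) x v + coord b (fd W x v) *\<^sub>R ?F b x)"
    using smooth_on_differentiable[OF smooth_on_scaleR[OF S sc sF] x] smooth_on_differentiable[OF sc x]
      smooth_on_differentiable[OF sF x] smooth_on_differentiable[OF W x]
    by (simp add: fd_sum fd_bilinear[OF bounded_bilinear_scaleR] fd_bounded_linear[OF bounded_linear_coord])
  also have "\<dots> = (\<Sum>b\<in>E. coord b (W x) *\<^sub>R fd (\<lambda>y. \<omega> y (b # ?ws)) (g x) (fd g x v)) +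
      (\<Sum>b\<in>E. coord b (W x) *\<^sub>R der (iota b (\<omega> (g x))) ?ps) + (\<Sum>b\<in>E. coord b (fd W x v) *\<^sub>R ?F b x)"
  proof -
    have "fd (?F b) x v = fd (\<lambda>y. iota b (\<omega> y) ?ws) (g x) (fd g x v) + der (iota b (\<omega> (g x))) ?ps" for b
      using Cons.prems by (intro Cons.IH smooth_ext_iota alternating_iota) auto
    then show ?thesis by (simp add: sum.distrib scaleR_add_right iota_apply)
  qed
  also have "(\<Sum>b\<in>E. coord b (fd W x v) *\<^sub>R ?F b x) = \<omega> (g x) (fd W x v # ?ws)"
    using eval_expand[where \<omega> = \<omega>, OF Cons.prems(2) T(2)[OF x]] by simp
  also have "(\<Sum>b\<in>E. coord b (W x) *\<^sub>R der (iota b (\<omega> (g x))) ?ps) = der (iota (W x) (\<omega> (g x))) ?ps"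
    by (rule linear_expand[OF E linear_der_iota[OF alt], symmetric])
  also have "(\<Sum>b\<in>E. coord b (W x) *\<^sub>R fd (\<lambda>y. \<omega> y (b # ?ws)) (g x) (fd g x v)) =
      fd (\<lambda>y. \<omega> y (W x # ?ws)) (g x) (fd g x v)"
    using alternating_linear_hd[OF alternating_fd[OF T(1) T(2)[OF x] Cons.prems(1,2)]]
    by (intro linear_expand[OF E, symmetric]) auto
  finally show ?case by (simp add: o_def)
qed

end

subsection \<open>The exterior derivative\<close>

lemma ext_d_Cons: "ext_d \<omega> u (v # vs) = fd (\<lambda>y. \<omega> y vs) u v - ext_d (\<lambda>y. iota v (\<omega> y)) u vs"
  by (simp add: ext_d_asum iota_def)

text \<open>Cartan's formula for the constant vector field \<open>v\<close>.\<close>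

lemma iota_ext_d: "iota v (ext_d \<omega> u) = fd_ext \<omega> u v - ext_d (\<lambda>y. iota v (\<omega> y)) u"
  by (simp add: fun_eq_iff iota_apply ext_d_Cons)

lemma ext_d_cong:
  assumes "open S" "u \<in> S" "\<And>y. y \<in> S \<Longrightarrow> \<omega> y = \<eta> y" shows "ext_d \<omega> u = ext_d \<eta> u"
proof -
  have "fd (\<lambda>y. \<omega> y vs) u = fd (\<lambda>y. \<eta> y vs) u" for vs
    using assms(3) by (intro fd_cong[OF assms(1,2)]) simp
  then show ?thesis by (simp add: ext_d_def)
qed

lemma ext_d_add:
  assumes "smooth_ext S \<omega>" "smooth_ext S \<eta>" "u \<in> S"
  shows "ext_d (\<lambda>y. \<omega> y + \<eta> y) u = ext_d \<omega> u + ext_d \<eta> u"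
  using smooth_ext_diff_at[OF assms(1,3)] smooth_ext_diff_at[OF assms(2,3)]
  by (simp add: fun_eq_iff ext_d_def fd_add algebra_simps sum.distrib)

lemma ext_d_cscale:
  assumes "smooth_ext S \<omega>" "u \<in> S" shows "ext_d (\<lambda>y. a *\<^sub>C \<omega> y) u = a *\<^sub>C ext_d \<omega> u"
  using smooth_ext_diff_at[OF assms] by (simp add: fun_eq_iff ext_d_def fd_cmult sum_distrib_left algebra_simps)

lemma ext_d_diff:
  assumes S: "open S" and \<omega>: "smooth_ext S \<omega>" and \<eta>: "smooth_ext S \<eta>" and u: "u \<in> S"
  shows "ext_d (\<lambda>y. \<omega> y - \<eta> y) u = ext_d \<omega> u - ext_d \<eta> u"
proof -
  have "ext_d (\<lambda>y. \<omega> y + (-1) *\<^sub>C \<eta> y) u = ext_d \<omega> u + (-1) *\<^sub>C ext_d \<eta> u"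
    by (simp only: ext_d_add[OF \<omega> smooth_ext_cscale[OF S \<eta>] u] ext_d_cscale[OF \<eta> u])
  then show ?thesis by (simp add: cscale_one)
qed

lemma smooth_ext_d: "open S \<Longrightarrow> smooth_ext S \<omega> \<Longrightarrow> smooth_ext S (ext_d \<omega>)"
  unfolding smooth_ext_def ext_d_def
  by (intro allI smooth_on_sum smooth_on_mult smooth_on_const smooth_on_fd) auto

lemma alternating_ext_d:
  assumes "open S" "u \<in> S" "smooth_ext S \<omega>" "\<And>y. y \<in> S \<Longrightarrow> alternating (\<omega> y)"
  shows "alternating (ext_d \<omega> u)"
  unfolding ext_d_asum
  using linear_fd[OF smooth_ext_diff_at[OF assms(3,2)]] by (intro alternating_asum alternating_fd[OF assms]) auto

lemma ext_d_fd:
  assumes S: "open S" and \<omega>: "smooth_ext S \<omega>" and u: "u \<in> S"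
  shows "ext_d (\<lambda>y. fd_ext \<omega> y v) u vs = fd (\<lambda>y. ext_d \<omega> y vs) u v"
proof -
  have s: "smooth_on S (\<lambda>y. fd (\<lambda>y. \<omega> y ws) y w)" for ws w by (intro smooth_on_fd smooth_extD[OF \<omega>])
  have "fd (\<lambda>y. ext_d \<omega> y vs) u v = (\<Sum>i<length vs. (-1) ^ i *
      fd (\<lambda>y. fd (\<lambda>y. \<omega> y (take i vs @ drop (Suc i) vs)) y (vs ! i)) u v)"
    unfolding ext_d_def using smooth_on_differentiable[OF s u] smooth_on_differentiable[OF smooth_on_cmult[OF S s] u]
    by (simp add: fd_sum fd_cmult)
  also have "\<dots> = ext_d (\<lambda>y. fd_ext \<omega> y v) u vs"
    unfolding ext_d_def using fd_commute[OF S smooth_extD[OF \<omega>] u] by (intro sum.cong) auto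
  finally show ?thesis by simp
qed

text \<open>By Cartan's formula, \<open>iota v\<close> commutes with \<open>d d\<close>, since \<open>d\<close> commutes with derivatives in the
  direction \<open>v\<close>.\<close>

lemma ext_d_ext_d:
  assumes S: "open S" and \<omega>: "smooth_ext S \<omega>" and u: "u \<in> S" shows "ext_d (ext_d \<omega>) u vs = 0"
  using \<omega>
proof (induction vs arbitrary: \<omega>)
  case (Cons v vs)
  have "ext_d (ext_d \<omega>) u (v # vs) = fd (\<lambda>y. ext_d \<omega> y vs) u v - ext_d (\<lambda>y. iota v (ext_d \<omega> y)) u vs"
    by (rule ext_d_Cons)
  also have "ext_d (\<lambda>y. iota v (ext_d \<omega> y)) u vs =
      ext_d (\<lambda>y. fd_ext \<omega> y v) u vs - ext_d (ext_d (\<lambda>y. iota v (\<omega> y))) u vs"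
    using ext_d_diff[OF S smooth_ext_fd[OF Cons.prems] smooth_ext_d[OF S smooth_ext_iota[OF Cons.prems]] u]
    by (simp add: iota_ext_d)
  also have "ext_d (ext_d (\<lambda>y. iota v (\<omega> y))) u vs = 0" by (rule Cons.IH[OF smooth_ext_iota[OF Cons.prems]])
  finally show ?case using ext_d_fd[OF S Cons.prems u] by simp
qed (simp add: ext_d_def)

lemma fd_wedge:
  assumes S: "open S" and \<alpha>: "smooth_ext S \<alpha>" and \<beta>: "smooth_ext S \<beta>" and u: "u \<in> S"
  shows "fd (\<lambda>y. ext_wedge (\<alpha> y) (\<beta> y) vs) u v =
    ext_wedge (fd_ext \<alpha> u v) (\<beta> u) vs + ext_wedge (\<alpha> u) (fd_ext \<beta> u v) vs"
proof -
  note d = smooth_ext_diff_at[OF \<alpha> u] smooth_ext_diff_at[OF \<beta> u]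
  have "fd (\<lambda>y. c * \<alpha> y xs * \<beta> y ys) u v = c * fd (\<lambda>y. \<alpha> y xs) u v * \<beta> u ys + c * \<alpha> u xs * fd (\<lambda>y. \<beta> y ys) u v"
    for c xs ys
    using fd_bilinear[OF bounded_bilinear_mult, of "\<lambda>y. c * \<alpha> y xs" u "\<lambda>y. \<beta> y ys" v] d
    by (simp add: fd_cmult)
  moreover have "(\<lambda>y. c * \<alpha> y xs * \<beta> y ys) differentiable (at u)" for c xs ys
    using d by (intro differentiable_mult) auto
  ultimately show ?thesis unfolding ext_wedge_def by (simp add: fd_sum sum.distrib)
qed

lemma ext_d_sign:
  fixes \<alpha> :: "'e::real_normed_vector \<Rightarrow> 'e ext"
  assumes that: "smooth_ext S \<alpha>" and u: "u \<in> S"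
  shows "ext_d (\<lambda>y. ext_sign (\<alpha> y)) u = - ext_sign (ext_d \<alpha> u)"
proof
  fix vs :: "'e list"
  show "ext_d (\<lambda>y. ext_sign (\<alpha> y)) u vs = (- ext_sign (ext_d \<alpha> u)) vs"
    unfolding ext_d_def ext_sign_def ext_fun_simps sum_distrib_left sum_negf[symmetric]
  proof (intro sum.cong refl)
    fix i assume i: "i \<in> {..<length vs}"
    let ?ws = "take i vs @ drop (Suc i) vs"
    have "length vs = Suc (length ?ws)" using i by simp
    then have "(-1 :: complex) ^ length ?ws = - ((-1) ^ length vs)" by (simp only: power_Suc) simp
    then show "(-1) ^ i * fd (\<lambda>y. (-1) ^ length ?ws * \<alpha> y ?ws) u (vs ! i) =
        - ((-1) ^ length vs * ((-1) ^ i * fd (\<lambda>y. \<alpha> y ?ws) u (vs ! i)))"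
      using fd_cmult[OF smooth_ext_diff_at[OF that u], of "(-1) ^ length ?ws" ?ws "vs ! i"] by simp
  qed
qed

text \<open>Again by contraction: both sides satisfy the same recursion. The sign operator replaces the
  sign depending on the degree, so that the rule holds for forms of mixed degree.\<close>

lemma ext_d_wedge:
  assumes S: "open S" and u: "u \<in> S" and \<alpha>: "smooth_ext S \<alpha>" and \<beta>: "smooth_ext S \<beta>"
  shows "ext_d (\<lambda>y. ext_wedge (\<alpha> y) (\<beta> y)) u =
    ext_wedge (ext_d \<alpha> u) (\<beta> u) + ext_wedge (ext_sign (\<alpha> u)) (ext_d \<beta> u)"
proof
  show "ext_d (\<lambda>y. ext_wedge (\<alpha> y) (\<beta> y)) u vs =
    (ext_wedge (ext_d \<alpha> u) (\<beta> u) + ext_wedge (ext_sign (\<alpha> u)) (ext_d \<beta> u)) vs" for vs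
    using \<alpha> \<beta>
  proof (induction vs arbitrary: \<alpha> \<beta>)
    case (Cons v vs)
    note \<alpha> = Cons.prems(1) and \<beta> = Cons.prems(2)
    have "ext_d (\<lambda>y. iota v (ext_wedge (\<alpha> y) (\<beta> y))) u =
        ext_d (\<lambda>y. ext_wedge (iota v (\<alpha> y)) (\<beta> y)) u + ext_d (\<lambda>y. ext_wedge (ext_sign (\<alpha> y)) (iota v (\<beta> y))) u"
      using ext_d_add[OF smooth_ext_wedge[OF S smooth_ext_iota[OF \<alpha>] \<beta>]
          smooth_ext_wedge[OF S smooth_ext_sign[OF S \<alpha>] smooth_ext_iota[OF \<beta>]] u] by simp
    moreover have "ext_d (\<lambda>y. ext_wedge (ext_sign (\<alpha> y)) (iota v (\<beta> y))) u vs =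
        - ext_wedge (ext_sign (ext_d \<alpha> u)) (iota v (\<beta> u)) vs + ext_wedge (\<alpha> u) (ext_d (\<lambda>y. iota v (\<beta> y)) u) vs"
      using Cons.IH[OF smooth_ext_sign[OF S \<alpha>] smooth_ext_iota[OF \<beta>]]
      unfolding ext_d_sign[OF \<alpha> u] ext_wedge_linear ext_sign_simps by (simp only: ext_fun_simps)
    ultimately show ?case
      using Cons.IH[OF smooth_ext_iota[OF \<alpha>] \<beta>]
      by (simp add: ext_d_Cons[of "\<lambda>y. ext_wedge (\<alpha> y) (\<beta> y)"] fd_wedge[OF S \<alpha> \<beta> u] ext_wedge_Cons iota_ext_d)
  qed (simp add: ext_d_def)
qed

definition pull_ext :: "('e::real_normed_vector \<Rightarrow> 'f::real_normed_vector) \<Rightarrow> ('f \<Rightarrow> 'f ext) \<Rightarrow> 'e \<Rightarrow> 'e ext" where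
  "pull_ext F \<omega> u = ext_pull (fd F u) (\<omega> (F u))"

lemma fd_fields: "map (\<lambda>W. W u) (map (\<lambda>x u. fd F u x) vs) = map (fd F u) vs"
  by simp

lemma smooth_pull_ext:
  fixes F :: "'e::real_normed_vector \<Rightarrow> 'f::real_inner" and E :: "'f set"
  assumes E: "orth_basis E" and S: "open S" and T: "open T" "\<And>x. x \<in> S \<Longrightarrow> F x \<in> T" and F: "smooth_on S F"
    and \<omega>: "smooth_ext T \<omega>" "\<And>y. y \<in> T \<Longrightarrow> alternating (\<omega> y)"
  shows "smooth_ext S (pull_ext F \<omega>)"
proof -
  have "smooth_on S (\<lambda>u. \<omega> (F u) (map (\<lambda>W. W u) (map (\<lambda>x u. fd F u x) vs)))" for vs
    using smooth_on_fd[OF F] by (intro smooth_on_eval[OF E S T F \<omega>]) auto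
  then show ?thesis unfolding fd_fields by (simp add: smooth_ext_def pull_ext_def ext_pull_def)
qed

text \<open>The derivative of the pullback has a term that contains the second derivative of \<open>F\<close>, which drops out
  by symmetry (\<open>asum_der_symmetric\<close>).\<close>

lemma ext_d_pull:
  fixes F :: "'e::real_normed_vector \<Rightarrow> 'f::real_inner" and E :: "'f set"
  assumes E: "orth_basis E" and S: "open S" and T: "open T" "\<And>x. x \<in> S \<Longrightarrow> F x \<in> T" and F: "smooth_on S F"
    and \<omega>: "smooth_ext T \<omega>" "\<And>y. y \<in> T \<Longrightarrow> alternating (\<omega> y)" and u: "u \<in> S"
  shows "ext_d (pull_ext F \<omega>) u = pull_ext F (ext_d \<omega>) u"
proof
  fix vs
  have "fd (\<lambda>y. pull_ext F \<omega> y ws) u w = fd (\<lambda>y. \<omega> y (map (fd F u) ws)) (F u) (fd F u w) +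
      der (\<omega> (F u)) (map (\<lambda>x. (fd F u x, fd (\<lambda>y. fd F y x) u w)) ws)" for w ws
  proof -
    have "fd (\<lambda>u. \<omega> (F u) (map (\<lambda>W. W u) (map (\<lambda>x u. fd F u x) ws))) u w =
      fd (\<lambda>y. \<omega> y (map (\<lambda>W. W u) (map (\<lambda>x u. fd F u x) ws))) (F u) (fd F u w) +
      der (\<omega> (F u)) (map (\<lambda>W. (W u, fd W u w)) (map (\<lambda>x u. fd F u x) ws))"
      using smooth_on_fd[OF F] by (intro fd_eval[OF E S T F \<omega>]) (auto simp: u)
    then show ?thesis unfolding fd_fields by (simp add: pull_ext_def ext_pull_def o_def)
  qed
  then have "ext_d (pull_ext F \<omega>) u vs =
      asum ((\<lambda>w ws. fd (\<lambda>y. \<omega> y (map (fd F u) ws)) (F u) (fd F u w)) +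
        (\<lambda>w ws. der (\<omega> (F u)) (map (\<lambda>x. (fd F u x, fd (\<lambda>y. fd F y x) u w)) ws))) vs"
    by (simp add: ext_d_asum plus_fun_def)
  also have "\<dots> = asum (\<lambda>w ws. fd (\<lambda>y. \<omega> y (map (fd F u) ws)) (F u) (fd F u w)) vs +
      asum (\<lambda>w ws. der (\<omega> (F u)) (map (\<lambda>x. (fd F u x, fd (\<lambda>y. fd F y x) u w)) ws)) vs"
    unfolding asum_eq_sum by (simp add: algebra_simps sum.distrib)
  also have "asum (\<lambda>w ws. der (\<omega> (F u)) (map (\<lambda>x. (fd F u x, fd (\<lambda>y. fd F y x) u w)) ws)) vs = 0"
    by (rule asum_der_symmetric[OF \<omega>(2)[OF T(2)[OF u]]]) (rule fd_commute[OF S F u])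
  also have "asum (\<lambda>w ws. fd (\<lambda>y. \<omega> y (map (fd F u) ws)) (F u) (fd F u w)) vs = pull_ext F (ext_d \<omega>) u vs"
    by (simp add: pull_ext_def ext_pull_def ext_d_asum asum_map)
  finally show "ext_d (pull_ext F \<omega>) u vs = pull_ext F (ext_d \<omega>) u vs" by simp
qed



section \<open>The bidegree decomposition at a point\<close>

text \<open>Forms are functions of charts, points and vectors. The rewrite rules for functions would
  expand equations between forms into equations between values.\<close>

declare ext_fun_simps [simp del] plus_fun_apply [simp del] zero_fun_apply [simp del]

definition rot :: "('e::real_vector \<Rightarrow> 'e) \<Rightarrow> real \<Rightarrow> 'e \<Rightarrow> 'e" where
  "rot j \<theta> v = cos \<theta> *\<^sub>R v + sin \<theta> *\<^sub>R j v"

text \<open>Eigenforms for the circle action generated by the complex structure.\<close>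

definition has_weight :: "('e::real_vector \<Rightarrow> 'e) \<Rightarrow> int \<Rightarrow> 'e ext \<Rightarrow> bool" where
  "has_weight j w \<alpha> \<longleftrightarrow> (\<forall>\<theta>. ext_pull (rot j \<theta>) \<alpha> = cis (of_int w * \<theta>) *\<^sub>C \<alpha>)"

definition root_angle :: "nat \<Rightarrow> nat \<Rightarrow> real" where
  "root_angle n m = 2 * pi * of_nat m / of_nat n"

text \<open>The Fourier coefficient of \<open>\<theta> \<mapsto> R\<^sub>\<theta>\<^sup>* \<alpha>\<close> at frequency \<open>p - q\<close>, in degree \<open>p + q\<close>, computed as a mean over
  the \<open>n\<close>-th roots of unity. A form on \<open>k\<close> vectors has frequencies of absolute value at most \<open>k\<close>;
  the number \<open>n = 2 k + 5\<close> exceeds the sum of such a frequency and one of absolute value up to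
  \<open>k + 4\<close>, which leaves room for the frequencies that occur in the exterior derivative.\<close>

definition proj_pq :: "('e::real_vector \<Rightarrow> 'e) \<Rightarrow> int \<Rightarrow> int \<Rightarrow> 'e ext \<Rightarrow> 'e ext" where
  "proj_pq j p q \<alpha> vs = (if 0 \<le> p \<and> 0 \<le> q \<and> int (length vs) = p + q then
     (let n = 2 * length vs + 5 in
       (\<Sum>m<n. cis (of_int (q - p) * root_angle n m) * \<alpha> (map (rot j (root_angle n m)) vs)) / of_nat n)
     else 0)"

lemma linear_rot: "linear j \<Longrightarrow> linear (rot j \<theta>)"
  by (auto simp: rot_def linear_iff algebra_simps)

lemma rot_rot:
  assumes "linear j" "\<And>v. j (j v) = - v" shows "rot j a (rot j b v) = rot j (a + b) v"
  using assms by (simp add: rot_def linear_add linear_scale cos_add sin_add algebra_simps)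

lemma has_weight_wedge:
  assumes "has_weight j w \<alpha>" "has_weight j w' \<beta>" shows "has_weight j (w + w') (ext_wedge \<alpha> \<beta>)"
proof -
  have "cis (of_int w' * \<theta>) *\<^sub>C cis (of_int w * \<theta>) *\<^sub>C x = cis (of_int (w + w') * \<theta>) *\<^sub>C x"
    for \<theta> and x :: "'a ext"
    by (simp add: cscale_cscale cis_mult distrib_right add.commute)
  then show ?thesis
    using assms unfolding has_weight_def ext_wedge_pull by (simp only: ext_wedge_linear) blast
qed

lemma has_weight_one: "has_weight j 0 ext_one"
  by (auto simp: has_weight_def ext_pull_def ext_one_def fun_eq_iff ext_fun_simps cis_zero)

lemma has_weight_covector:
  assumes "linear a" "\<And>v. a (j v) = of_int w * \<i> * a v" "w = 1 \<or> w = - 1"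
  shows "has_weight j w (covector a)"
proof -
  have "a (rot j \<theta> v) = cis (of_int w * \<theta>) * a v" for \<theta> v
    using assms by (auto simp: rot_def linear_add linear_scale scaleR_conv_of_real complex_eq_iff)
  then show ?thesis
    unfolding has_weight_def by (auto simp: covector_def ext_pull_def fun_eq_iff ext_fun_simps split: list.splits)
qed

lemma has_weight_subspace: "cv.subspace {\<alpha>. has_weight j w \<alpha>}"
  by (rule cv.subspaceI) (auto simp: has_weight_def ext_pull_def fun_eq_iff ext_fun_simps algebra_simps)

lemma alternating_subspace: "cv.subspace {\<alpha>. alternating \<alpha>}"
  by (rule cv.subspaceI) (auto simp: alternating_0 alternating_add alternating_cscale)

lemma deg_in_subspace: "cv.subspace {\<alpha>. deg_in k \<alpha>}"
  by (rule cv.subspaceI) (auto simp: deg_in_def ext_fun_simps)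

lemma ext_pq_span:
  "ext_pq j p q = cv.span {foldr ext_wedge (map covector (as @ bs)) ext_one | as bs.
        int (length as) = p \<and> int (length bs) = q \<and>
        (\<forall>a\<in>set as. linear a \<and> (\<forall>v. a (j v) = \<i> * a v)) \<and>
        (\<forall>b\<in>set bs. linear b \<and> (\<forall>v. b (j v) = - \<i> * b v))}"
proof -
  have "(\<lambda>z \<alpha> vs. z * \<alpha> vs) = (cscale :: complex \<Rightarrow> 'a ext \<Rightarrow> 'a ext)" by (simp add: fun_eq_iff ext_fun_simps)
  then show ?thesis by (simp add: ext_pq_def)
qed

lemma ext_pq_subspace: "cv.subspace (ext_pq j p q)"
  unfolding ext_pq_span by (rule cv.subspace_span)

lemma ext_pq_neg: "p < 0 \<or> q < 0 \<Longrightarrow> ext_pq j p q = {0}"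
proof -
  assume "p < 0 \<or> q < 0"
  then have "{foldr ext_wedge (map covector (as @ bs)) ext_one | as bs.
        int (length as) = p \<and> int (length bs) = q \<and>
        (\<forall>a\<in>set as. linear a \<and> (\<forall>v. a (j v) = \<i> * a v)) \<and>
        (\<forall>b\<in>set bs. linear b \<and> (\<forall>v. b (j v) = - \<i> * b v))} = {}" by auto
  then show ?thesis unfolding ext_pq_span by (simp only: cv.span_empty)
qed

lemma ext_pq_weight:
  assumes "\<alpha> \<in> ext_pq j p q"
  shows "alternating \<alpha> \<and> deg_in (p + q) \<alpha> \<and> has_weight j (p - q) \<alpha>"
proof -
  have b: "alternating (foldr ext_wedge (map covector bs) ext_one) \<and>
      deg_in (int (length bs)) (foldr ext_wedge (map covector bs) ext_one) \<and>
      has_weight j (- int (length bs)) (foldr ext_wedge (map covector bs) ext_one)"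
    if "\<forall>b\<in>set bs. linear b \<and> (\<forall>v. b (j v) = - \<i> * b v)" for bs
    using that
  proof (induction bs)
    case (Cons b bs)
    have "has_weight j (- 1) (covector b)" using Cons.prems by (intro has_weight_covector) auto
    then have "has_weight j (- 1 + - int (length bs)) (ext_wedge (covector b) (foldr ext_wedge (map covector bs) ext_one))"
      using Cons by (intro has_weight_wedge) auto
    moreover have "deg_in (1 + int (length bs)) (ext_wedge (covector b) (foldr ext_wedge (map covector bs) ext_one))"
      using Cons by (intro deg_in_wedge deg_in_covector) auto
    ultimately show ?case using Cons by (auto intro: alternating_wedge alternating_covector)
  qed (auto simp: alternating_one has_weight_one, simp add: deg_in_def ext_one_def)
  have ab: "alternating (foldr ext_wedge (map covector (as @ bs)) ext_one) \<and>
      deg_in (int (length as) + int (length bs)) (foldr ext_wedge (map covector (as @ bs)) ext_one) \<and>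
      has_weight j (int (length as) - int (length bs)) (foldr ext_wedge (map covector (as @ bs)) ext_one)"
    if "\<forall>b\<in>set bs. linear b \<and> (\<forall>v. b (j v) = - \<i> * b v)" "\<forall>a\<in>set as. linear a \<and> (\<forall>v. a (j v) = \<i> * a v)" for as bs
    using that(2)
  proof (induction as)
    case Nil
    then show ?case using b[OF that(1)] by simp
  next
    case (Cons a as)
    let ?r = "foldr ext_wedge (map covector (as @ bs)) ext_one"
    have r: "alternating ?r" "deg_in (int (length as) + int (length bs)) ?r"
      "has_weight j (int (length as) - int (length bs)) ?r" using Cons by auto
    have "has_weight j 1 (covector a)" using Cons.prems by (intro has_weight_covector) auto
    note w = has_weight_wedge[OF this r(3)]
    have "1 + (int (length as) - int (length bs)) = int (length (a # as)) - int (length bs)"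
      "1 + (int (length as) + int (length bs)) = int (length (a # as)) + int (length bs)" by auto
    then show ?case
      using w deg_in_wedge[OF deg_in_covector[of a] r(2)] Cons.prems alternating_wedge[OF alternating_covector r(1), of a]
      by (simp add: ac_simps add_diff_eq)
  qed
  have "ext_pq j p q \<subseteq> {\<alpha>. alternating \<alpha>} \<inter> {\<alpha>. deg_in (p + q) \<alpha>} \<inter> {\<alpha>. has_weight j (p - q) \<alpha>}"
    unfolding ext_pq_span
    by (intro cv.span_minimal cv.subspace_inter has_weight_subspace alternating_subspace deg_in_subspace)
      (use ab in auto)
  then show ?thesis using assms by auto
qed

lemma wedge_10_ext_pq:
  assumes a: "linear a" "\<And>v. a (j v) = \<i> * a v" and \<beta>: "\<beta> \<in> ext_pq j p q"
  shows "ext_wedge (covector a) \<beta> \<in> ext_pq j (p + 1) q"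
proof -
  have "ext_pq j p q \<subseteq> {\<beta>. ext_wedge (covector a) \<beta> \<in> ext_pq j (p + 1) q}"
    unfolding ext_pq_span[of j p q]
  proof (rule cv.span_minimal)
    show "cv.subspace {\<beta>. ext_wedge (covector a) \<beta> \<in> ext_pq j (p + 1) q}"
      by (rule cv.subspaceI)
        (auto intro: cv.subspace_0 cv.subspace_add cv.subspace_scale ext_pq_subspace)
    show "{foldr ext_wedge (map covector (as @ bs)) ext_one | as bs.
        int (length as) = p \<and> int (length bs) = q \<and>
        (\<forall>a\<in>set as. linear a \<and> (\<forall>v. a (j v) = \<i> * a v)) \<and>
        (\<forall>b\<in>set bs. linear b \<and> (\<forall>v. b (j v) = - \<i> * b v))} \<subseteq> {\<beta>. ext_wedge (covector a) \<beta> \<in> ext_pq j (p + 1) q}"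
    proof clarsimp
      fix as bs
      assume "\<forall>a\<in>set as. linear a \<and> (\<forall>v. a (j v) = \<i> * a v)"
        "\<forall>b\<in>set bs. linear b \<and> (\<forall>v. b (j v) = - (\<i> * b v))"
      then have "foldr ext_wedge (map covector ((a # as) @ bs)) ext_one \<in> ext_pq j (int (length as) + 1) (int (length bs))"
        unfolding ext_pq_span by (intro cv.span_base CollectI exI[of _ "a # as"] exI[of _ bs]) (use a in auto)
      then show "ext_wedge (covector a) (foldr ext_wedge (map covector as) (foldr ext_wedge (map covector bs) ext_one))
          \<in> ext_pq j (int (length as) + 1) (int (length bs))" by simp
    qed
  qed
  then show ?thesis using \<beta> by auto
qed

lemma wedge_01_ext_pq:
  assumes b: "linear b" "\<And>v. b (j v) = - \<i> * b v" and \<beta>: "\<beta> \<in> ext_pq j p q"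
  shows "ext_wedge (covector b) \<beta> \<in> ext_pq j p (q + 1)"
proof -
  have move: "ext_wedge (covector b) (foldr ext_wedge (map covector as) r) =
      (-1) ^ length as *\<^sub>C foldr ext_wedge (map covector as) (ext_wedge (covector b) r)" for as r
  proof (induction as)
    case (Cons a as)
    let ?R = "foldr ext_wedge (map covector as) r"
    have "ext_wedge (covector b) (ext_wedge (covector a) ?R) = ext_wedge (ext_wedge (covector b) (covector a)) ?R"
      by (simp only: ext_wedge_assoc)
    also have "\<dots> = - ext_wedge (covector a) (ext_wedge (covector b) ?R)"
      by (subst covector_anticomm) (simp only: ext_wedge_linear ext_wedge_assoc)
    also have "\<dots> = (-1) *\<^sub>C (-1) ^ length as *\<^sub>C
        ext_wedge (covector a) (foldr ext_wedge (map covector as) (ext_wedge (covector b) r))"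
      unfolding Cons.IH ext_wedge_linear by (simp add: fun_eq_iff ext_fun_simps)
    finally show ?case by (simp add: cscale_cscale)
  qed (simp add: cscale_one)
  have "ext_pq j p q \<subseteq> {\<beta>. ext_wedge (covector b) \<beta> \<in> ext_pq j p (q + 1)}"
    unfolding ext_pq_span[of j p q]
  proof (rule cv.span_minimal)
    show "cv.subspace {\<beta>. ext_wedge (covector b) \<beta> \<in> ext_pq j p (q + 1)}"
      by (rule cv.subspaceI)
        (auto intro: cv.subspace_0 cv.subspace_add cv.subspace_scale ext_pq_subspace)
    show "{foldr ext_wedge (map covector (as @ bs)) ext_one | as bs.
        int (length as) = p \<and> int (length bs) = q \<and>
        (\<forall>a\<in>set as. linear a \<and> (\<forall>v. a (j v) = \<i> * a v)) \<and>
        (\<forall>b\<in>set bs. linear b \<and> (\<forall>v. b (j v) = - \<i> * b v))} \<subseteq> {\<beta>. ext_wedge (covector b) \<beta> \<in> ext_pq j p (q + 1)}"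
    proof clarsimp
      fix as bs
      assume "\<forall>a\<in>set as. linear a \<and> (\<forall>v. a (j v) = \<i> * a v)"
        "\<forall>b\<in>set bs. linear b \<and> (\<forall>v. b (j v) = - (\<i> * b v))"
      then have "foldr ext_wedge (map covector (as @ b # bs)) ext_one \<in> ext_pq j (int (length as)) (int (length bs) + 1)"
        unfolding ext_pq_span by (intro cv.span_base CollectI exI[of _ as] exI[of _ "b # bs"]) (use b in auto)
      then show "ext_wedge (covector b) (foldr ext_wedge (map covector as) (foldr ext_wedge (map covector bs) ext_one))
          \<in> ext_pq j (int (length as)) (int (length bs) + 1)"
        unfolding move[of as] by (intro cv.subspace_scale ext_pq_subspace) simp
    qed
  qed
  then show ?thesis using \<beta> by auto
qed

text \<open>The sum of all types of total degree \<open>k\<close>, for the proof that it exhausts the forms of degree \<open>k\<close>.\<close>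

definition sum_pq :: "('e::real_vector \<Rightarrow> 'e) \<Rightarrow> nat \<Rightarrow> 'e ext set" where
  "sum_pq j k = {\<Sum>p\<le>k. \<beta> p | \<beta>. \<forall>p\<le>k. \<beta> p \<in> ext_pq j (int p) (int k - int p)}"

lemma sum_pq_subspace: "cv.subspace (sum_pq j k)"
proof (rule cv.subspaceI)
  show "0 \<in> sum_pq j k"
    unfolding sum_pq_def by (intro CollectI exI[of _ "\<lambda>_. 0"]) (simp add: cv.subspace_0[OF ext_pq_subspace])
  fix x y assume "x \<in> sum_pq j k" "y \<in> sum_pq j k"
  then obtain \<beta> \<gamma> where "\<forall>p\<le>k. \<beta> p \<in> ext_pq j (int p) (int k - int p)" "x = (\<Sum>p\<le>k. \<beta> p)"
    "\<forall>p\<le>k. \<gamma> p \<in> ext_pq j (int p) (int k - int p)" "y = (\<Sum>p\<le>k. \<gamma> p)" by (auto simp: sum_pq_def)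
  then show "x + y \<in> sum_pq j k"
    unfolding sum_pq_def by (intro CollectI exI[of _ "\<lambda>p. \<beta> p + \<gamma> p"])
      (simp add: sum.distrib cv.subspace_add[OF ext_pq_subspace])
next
  fix c x assume "x \<in> sum_pq j k"
  then obtain \<beta> where "\<forall>p\<le>k. \<beta> p \<in> ext_pq j (int p) (int k - int p)" "x = (\<Sum>p\<le>k. \<beta> p)"
    by (auto simp: sum_pq_def)
  then show "c *\<^sub>C x \<in> sum_pq j k"
    unfolding sum_pq_def by (intro CollectI exI[of _ "\<lambda>p. c *\<^sub>C \<beta> p"])
      (simp add: cv.scale_sum_right cv.subspace_scale[OF ext_pq_subspace])
qed

lemma sum_ext_apply: "(\<Sum>i\<in>I. \<alpha> i) vs = (\<Sum>i\<in>I. (\<alpha> i :: 'e ext) vs)"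
  by (induction I rule: infinite_finite_induct) (simp_all add: ext_fun_simps)

lemma ext_wedge_sum_right: "ext_wedge \<alpha> (\<Sum>i\<in>I. \<beta> i) = (\<Sum>i\<in>I. ext_wedge \<alpha> (\<beta> i))"
  by (induction I rule: infinite_finite_induct) simp_all

text \<open>Induction on the degree by Euler's identity \<open>k \<alpha> = \<Sum>\<^sub>b b\<^sup>* \<and> iota b \<alpha>\<close>: each covector \<open>b\<^sup>*\<close> is the sum
  of one of type \<open>(1, 0)\<close> and one of type \<open>(0, 1)\<close>.\<close>

lemma alternating_in_sum_pq:
  fixes E :: "'e::real_inner set" and j :: "'e \<Rightarrow> 'e"
  assumes E: "orth_basis E" and j: "linear j" "\<And>v. j (j v) = - v"
    and \<alpha>: "alternating \<alpha>" "deg_in (int k) \<alpha>"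
  shows "\<alpha> \<in> sum_pq j k"
  using \<alpha>
proof (induction k arbitrary: \<alpha>)
  case 0
  have "\<alpha> = \<alpha> [] *\<^sub>C ext_one" using 0(2) by (auto simp: deg_in_def ext_one_def fun_eq_iff ext_fun_simps)
  moreover have "ext_one \<in> ext_pq j 0 0"
    unfolding ext_pq_span by (intro cv.span_base CollectI exI[of _ "[]"]) simp
  ultimately show ?case
    unfolding sum_pq_def using cv.subspace_scale[OF ext_pq_subspace, of ext_one j 0 0 "\<alpha> []"]
    by (intro CollectI exI[of _ "\<lambda>_. \<alpha>"]) auto
next
  case (Suc k)
  let ?c = "\<lambda>b v. complex_of_real (coord b v)"
  (* The coordinate covector of b is ?a 1 b + ?a (-1) b, of types (1, 0) and (0, 1). *)
  let ?a = "\<lambda>s b v. (?c b v - s * \<i> * ?c b (j v)) / 2"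
  have lc: "linear (coord b)" for b using bounded_linear.linear[OF bounded_linear_coord] .
  have la: "linear (?a s b)" for s b
    by (rule linearI) (simp_all add: linear_add[OF lc] linear_scale[OF lc] linear_add[OF j(1)] linear_scale[OF j(1)]
        scaleR_conv_of_real algebra_simps add_divide_distrib diff_divide_distrib)
  have a1: "?a 1 b (j v) = \<i> * ?a 1 b v" and a2: "?a (- 1) b (j v) = - \<i> * ?a (- 1) b v" for b v
    by (simp_all add: j(2) linear_neg[OF lc] field_simps)
  have iota: "iota b \<alpha> \<in> sum_pq j k" for b
    using deg_in_iota[OF Suc.prems(2)] by (intro Suc.IH alternating_iota[OF Suc.prems(1)]) simp
  have w: "ext_wedge (covector (?a s b)) (iota b \<alpha>) \<in> sum_pq j (Suc k)" if s: "s = 1 \<or> s = - 1" for s b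
  proof -
    obtain \<beta> where \<beta>: "\<forall>p\<le>k. \<beta> p \<in> ext_pq j (int p) (int k - int p)" "iota b \<alpha> = (\<Sum>p\<le>k. \<beta> p)"
      using iota[of b] by (auto simp: sum_pq_def)
    let ?w = "\<lambda>p. ext_wedge (covector (?a s b)) (\<beta> p)"
    have eq: "ext_wedge (covector (?a s b)) (iota b \<alpha>) = (\<Sum>p\<le>k. ?w p)" by (simp only: \<beta>(2) ext_wedge_sum_right)
    from s show ?thesis
    proof
      assume s: "s = 1"
      have "?w p \<in> ext_pq j (int (Suc p)) (int (Suc k) - int (Suc p))" if "p \<le> k" for p
      proof -
        have "?a s b (j v) = \<i> * ?a s b v" for v using a1[of b v] unfolding s .
        then have "?w p \<in> ext_pq j (int p + 1) (int k - int p)"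
          using \<beta>(1) that by (intro wedge_10_ext_pq la) auto
        then show ?thesis by (simp add: add.commute)
      qed
      then show ?thesis
        unfolding eq sum_pq_def
        by (intro CollectI exI[of _ "\<lambda>p. case p of 0 \<Rightarrow> 0 | Suc p \<Rightarrow> ?w p"])
          (auto simp: sum.atMost_Suc_shift cv.subspace_0[OF ext_pq_subspace] simp del: sum.atMost_Suc split: nat.split)
    next
      assume s: "s = - 1"
      have "?w p \<in> ext_pq j (int p) (int (Suc k) - int p)" if "p \<le> k" for p
      proof -
        have "?a s b (j v) = - \<i> * ?a s b v" for v using a2[of b v] unfolding s .
        then have "?w p \<in> ext_pq j (int p) (int k - int p + 1)"
          using \<beta>(1) that by (intro wedge_01_ext_pq la) auto
        moreover have "int k - int p + 1 = int (Suc k) - int p" by simp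
        ultimately show ?thesis by simp
      qed
      then show ?thesis
        unfolding eq sum_pq_def
        by (intro CollectI exI[of _ "\<lambda>p. if p = Suc k then 0 else ?w p"])
          (auto simp: cv.subspace_0[OF ext_pq_subspace] intro!: sum.cong)
    qed
  qed
  have "(\<Sum>b\<in>E. ext_wedge (covector (?a 1 b)) (iota b \<alpha>) + ext_wedge (covector (?a (- 1) b)) (iota b \<alpha>)) =
      of_nat (Suc k) *\<^sub>C \<alpha>" (is "?L = _")
  proof
    fix vs
    have "?L vs = (\<Sum>b\<in>E. asum (\<lambda>v. ?a 1 b v *\<^sub>C iota b \<alpha>) vs + asum (\<lambda>v. ?a (- 1) b v *\<^sub>C iota b \<alpha>) vs)"
      by (simp only: sum_ext_apply ext_fun_simps wedge_covector)
    also have "\<dots> = asum (\<lambda>v ws. \<Sum>b\<in>E. coord b v *\<^sub>R iota b \<alpha> ws) vs"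
      unfolding asum_eq_sum sum.distrib[symmetric]
      by (subst sum.swap) (simp add: sum_distrib_left scaleR_conv_of_real field_simps sum.distrib ext_fun_simps)
    also have "\<dots> = asum (\<lambda>v. iota v \<alpha>) vs"
    proof -
      have "iota v \<alpha> = (\<lambda>ws. \<Sum>b\<in>E. coord b v *\<^sub>R iota b \<alpha> ws)" for v
        unfolding fun_eq_iff iota_apply using linear_expand[OF E alternating_linear_hd[OF Suc.prems(1)]] by blast
      then show ?thesis by metis
    qed
    also have "\<dots> = (of_nat (Suc k) *\<^sub>C \<alpha>) vs"
      using Suc.prems(2) by (cases "length vs = Suc k") (auto simp: asum_euler[OF Suc.prems(1)] deg_in_def ext_fun_simps)
    finally show "?L vs = (of_nat (Suc k) *\<^sub>C \<alpha>) vs" .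
  qed
  moreover have "?L \<in> sum_pq j (Suc k)"
    by (rule cv.subspace_sum[OF sum_pq_subspace]) (intro cv.subspace_add[OF sum_pq_subspace] w; simp)
  ultimately have "(1 / of_nat (Suc k)) *\<^sub>C of_nat (Suc k) *\<^sub>C \<alpha> \<in> sum_pq j (Suc k)"
    using cv.subspace_scale[OF sum_pq_subspace] by metis
  then show ?case by (simp add: cscale_cscale cscale_one del: of_nat_Suc)
qed


subsection \<open>Projections by discrete Fourier analysis\<close>

text \<open>Orthogonality of characters, by the geometric series.\<close>

lemma root_sum:
  assumes n: "0 < n" "\<bar>k\<bar> < int n"
  shows "(\<Sum>m<n. cis (of_int k * root_angle n m)) = (if k = 0 then of_nat n else 0)"
proof (cases "k = 0")
  case False
  let ?z = "cis (2 * pi * of_int k / of_nat n)"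
  have pow: "cis (of_int k * root_angle n m) = ?z ^ m" for m
    by (simp add: Complex.DeMoivre root_angle_def mult_ac)
  have "?z \<noteq> 1"
  proof
    assume "?z = 1"
    then have "exp (\<i> * of_real (2 * pi * of_int k / of_nat n)) = 1" by (simp add: cis_conv_exp)
    then obtain i :: int where "2 * pi * of_int k / of_nat n = of_int (2 * i) * pi"
      by (auto simp: exp_eq_1)
    then have "real_of_int k = of_int i * of_nat n" using n by (simp add: field_simps)
    then have "real_of_int k = of_int (i * int n)" by simp
    then have k: "k = i * int n" by (simp only: of_int_eq_iff)
    then have "i \<noteq> 0" using False by auto
    then have "1 * int n \<le> \<bar>i\<bar> * int n" by (intro mult_right_mono) auto
    then show False using n k by (simp add: abs_mult)
  qed
  moreover have "?z ^ n = 1"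
  proof -
    have "?z ^ n = cis (2 * pi * of_int k)" using n by (simp add: Complex.DeMoivre)
    also have "\<dots> = 1" by (simp only: complex_eq_iff cis.simps one_complex.simps sin_int_2pin cos_int_2pin)
    finally show ?thesis .
  qed
  ultimately have "(\<Sum>m<n. ?z ^ m) = 0" by (simp add: geometric_sum)
  then show ?thesis using False by (simp add: pow)
qed (simp add: cis_zero)

lemma root_mean_cis:
  assumes "\<bar>k\<bar> + \<bar>l\<bar> < int n"
  shows "(\<Sum>m<n. cis (of_int (- l) * root_angle n m) * cis (of_int k * root_angle n m)) / of_nat n = (if k = l then 1 else 0)"
proof -
  have n: "0 < n" using assms by auto
  have "cis (of_int (- l) * root_angle n m) * cis (of_int k * root_angle n m) = cis (of_int (k - l) * root_angle n m)" for m
    by (simp add: cis_mult algebra_simps)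
  then show ?thesis using root_sum[OF n, of "k - l"] assms n by auto
qed

text \<open>The average extracts the coefficient of a trigonometric polynomial whose frequencies are too small for aliasing.\<close>

lemma proj_pq_trig:
  assumes T: "finite T" "\<And>\<theta>. \<alpha> (map (rot j \<theta>) vs) = (\<Sum>k\<in>T. K k * cis (of_int k * \<theta>))"
    and bound: "\<And>k. k \<in> T \<Longrightarrow> \<bar>k\<bar> \<le> int (length vs) + 4"
    and pq: "0 \<le> p" "0 \<le> q" "int (length vs) = p + q"
  shows "proj_pq j p q \<alpha> vs = (if p - q \<in> T then K (p - q) else 0)"
proof -
  let ?n = "2 * length vs + 5"
  have "proj_pq j p q \<alpha> vs = (\<Sum>m<?n. cis (of_int (q - p) * root_angle ?n m) *
      (\<Sum>k\<in>T. K k * cis (of_int k * root_angle ?n m))) / of_nat ?n"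
    using pq by (simp add: proj_pq_def T(2) Let_def)
  also have "\<dots> = (\<Sum>k\<in>T. K k * ((\<Sum>m<?n. cis (of_int (- (p - q)) * root_angle ?n m) * cis (of_int k * root_angle ?n m)) / of_nat ?n))"
    by (simp add: sum_distrib_left sum_divide_distrib sum.swap[of _ T] mult_ac)
  also have "\<dots> = (\<Sum>k\<in>T. K k * (if k = p - q then 1 else 0))"
  proof (intro sum.cong refl)
    fix k assume "k \<in> T"
    then have "\<bar>k\<bar> + \<bar>p - q\<bar> < int ?n" using bound[of k] pq by auto
    then show "K k * ((\<Sum>m<?n. cis (of_int (- (p - q)) * root_angle ?n m) * cis (of_int k * root_angle ?n m)) / of_nat ?n) =
      K k * (if k = p - q then 1 else 0)" by (simp only: root_mean_cis)
  qed
  also have "\<dots> = (if p - q \<in> T then K (p - q) else 0)"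
    using T(1) by (simp add: if_distrib[of "\<lambda>x. _ * x"] cong: if_cong)
  finally show ?thesis .
qed

lemma proj_pq_ext_pq:
  assumes \<beta>: "\<beta> \<in> ext_pq j p' q'"
  shows "proj_pq j p q \<beta> = (if p = p' \<and> q = q' then \<beta> else 0)"
proof (cases "0 \<le> p' \<and> 0 \<le> q'")
  case False
  then have "\<beta> = 0" using \<beta> ext_pq_neg[of p' q' j] by auto
  then show ?thesis by (simp add: proj_pq_def fun_eq_iff ext_fun_simps Let_def)
next
  case True
  note w = ext_pq_weight[OF \<beta>]
  have "proj_pq j p q \<beta> vs = (if p = p' \<and> q = q' then \<beta> vs else 0)" for vs
  proof (cases "0 \<le> p \<and> 0 \<le> q \<and> int (length vs) = p + q")
    case len: True
    show ?thesis
    proof (cases "int (length vs) = p' + q'")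
      case len': True
      have "\<beta> (map (rot j \<theta>) vs) = (\<Sum>k\<in>{p' - q'}. \<beta> vs * cis (of_int k * \<theta>))" for \<theta>
      proof -
        have "ext_pull (rot j \<theta>) \<beta> vs = (cis (of_int (p' - q') * \<theta>) *\<^sub>C \<beta>) vs"
          using w unfolding has_weight_def by metis
        then show ?thesis by (simp add: ext_pull_def ext_fun_simps)
      qed
      then have "proj_pq j p q \<beta> vs = (if p - q \<in> {p' - q'} then \<beta> vs else 0)"
        using len len' True by (intro proj_pq_trig) auto
      then show ?thesis using len len' by auto
    next
      case False
      then have "\<beta> vs = 0" "\<And>\<theta>. \<beta> (map (rot j \<theta>) vs) = 0" using w by (auto simp: deg_in_def)
      then show ?thesis by (simp add: proj_pq_def Let_def)
    qed
  next
    case False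
    then have "proj_pq j p q \<beta> vs = 0" by (auto simp: proj_pq_def)
    moreover have "p = p' \<and> q = q' \<Longrightarrow> \<beta> vs = 0" using False True w by (auto simp: deg_in_def)
    ultimately show ?thesis by auto
  qed
  then show ?thesis by (auto simp: fun_eq_iff ext_fun_simps)
qed

lemma proj_pq_add: "proj_pq j p q (\<alpha> + \<beta>) = proj_pq j p q \<alpha> + proj_pq j p q \<beta>"
  by (auto simp: fun_eq_iff ext_fun_simps proj_pq_def Let_def distrib_left sum.distrib add_divide_distrib)

lemma proj_pq_cscale: "proj_pq j p q (a *\<^sub>C \<alpha>) = a *\<^sub>C proj_pq j p q \<alpha>"
  by (auto simp: fun_eq_iff ext_fun_simps proj_pq_def Let_def sum_distrib_left mult_ac)

lemma proj_pq_0: "proj_pq j p q 0 = 0"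
  by (auto simp: fun_eq_iff ext_fun_simps proj_pq_def Let_def)

lemma proj_pq_sum: "proj_pq j p q (\<Sum>i\<in>I. \<alpha> i) = (\<Sum>i\<in>I. proj_pq j p q (\<alpha> i))"
  by (induction I rule: infinite_finite_induct) (simp_all add: proj_pq_0 proj_pq_add)

lemma proj_pq_truncate:
  "proj_pq j p q (\<lambda>vs. if int (length vs) = p + q then \<alpha> vs else 0) = proj_pq j p q \<alpha>"
  by (auto simp: fun_eq_iff proj_pq_def Let_def)

text \<open>A complex linear map intertwines the rotations.\<close>

lemma proj_pq_pull:
  assumes "linear L" "\<And>v. L (j v) = j' (L v)"
  shows "proj_pq j p q (ext_pull L \<alpha>) = ext_pull L (proj_pq j' p q \<alpha>)"
proof -
  have "L \<circ> rot j \<theta> = rot j' \<theta> \<circ> L" for \<theta>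
    using assms by (auto simp: rot_def linear_add linear_scale)
  then have "map L (map (rot j \<theta>) vs) = map (rot j' \<theta>) (map L vs)" for \<theta> vs by simp
  then show ?thesis by (simp add: fun_eq_iff proj_pq_def ext_pull_def Let_def del: map_map)
qed

lemma proj_pq_cnj: "proj_pq j p q (\<lambda>vs. cnj (\<alpha> vs)) = (\<lambda>vs. cnj (proj_pq j q p \<alpha> vs))"
proof -
  have "cnj (cis (of_int (p - q) * \<theta>)) = cis (of_int (q - p) * \<theta>)" for \<theta>
  proof -
    have eq: "of_int (q - p) * \<theta> = - (of_int (p - q) * \<theta>)" by (simp add: algebra_simps)
    show ?thesis unfolding eq by (rule cis_cnj)
  qed
  then show ?thesis by (auto simp: fun_eq_iff proj_pq_def Let_def cnj_sum add.commute)
qed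

text \<open>By linearity it suffices to consider a form of pure type, on which the averages are known.\<close>

lemma
  fixes E :: "'e::real_inner set" and j :: "'e \<Rightarrow> 'e"
  assumes E: "orth_basis E" and j: "linear j" "\<And>v. j (j v) = - v" and \<alpha>: "alternating \<alpha>"
  shows proj_pq_in: "proj_pq j p q \<alpha> \<in> ext_pq j p q"
    and sum_proj_pq: "(\<Sum>p\<le>length vs. proj_pq j (int p) (int (length vs) - int p) \<alpha> vs) = \<alpha> vs"
proof -
  define trunc where "trunc k = (\<lambda>vs. if int (length vs) = k then \<alpha> vs else 0)" for k
  have trunc: "alternating (trunc k)" "deg_in k (trunc k)" for k
  proof -
    have "alternating (if int l = k then \<alpha> else 0)" for l using \<alpha> by (simp add: alternating_0)
    from alternating_by_length[OF this]
    have "alternating (\<lambda>vs. (if int (length vs) = k then \<alpha> else 0) vs)" .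
    moreover have "trunc k = (\<lambda>vs. (if int (length vs) = k then \<alpha> else 0) vs)"
      by (auto simp: trunc_def fun_eq_iff zero_fun_apply)
    ultimately show "alternating (trunc k)" by simp
    show "deg_in k (trunc k)" by (auto simp: deg_in_def trunc_def)
  qed
  have dec: "\<exists>\<beta>. (\<forall>p\<le>k. \<beta> p \<in> ext_pq j (int p) (int k - int p)) \<and> trunc (int k) = (\<Sum>p\<le>k. \<beta> p) \<and>
      (\<forall>p\<le>k. proj_pq j (int p) (int k - int p) \<alpha> = \<beta> p)" for k
  proof -
    obtain \<beta> where \<beta>: "\<forall>p\<le>k. \<beta> p \<in> ext_pq j (int p) (int k - int p)" "trunc (int k) = (\<Sum>p\<le>k. \<beta> p)"
      using alternating_in_sum_pq[OF E j trunc] unfolding sum_pq_def by blast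
    have "proj_pq j (int p) (int k - int p) \<alpha> = \<beta> p" if "p \<le> k" for p
    proof -
      have "proj_pq j (int p) (int k - int p) \<alpha> = proj_pq j (int p) (int k - int p) (trunc (int k))"
        using proj_pq_truncate[of j "int p" "int k - int p" \<alpha>] by (simp add: trunc_def)
      also have "\<dots> = (\<Sum>i\<le>k. if i = p then \<beta> i else 0)"
        unfolding \<beta>(2) proj_pq_sum using \<beta>(1) by (intro sum.cong refl) (auto simp: proj_pq_ext_pq)
      finally show ?thesis using that by simp
    qed
    then show ?thesis using \<beta> by blast
  qed
  show "proj_pq j p q \<alpha> \<in> ext_pq j p q"
  proof (cases "0 \<le> p \<and> 0 \<le> q")
    case True
    then have "nat p \<le> nat (p + q)" "int (nat p) = p" "int (nat (p + q)) - p = q" by auto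
    then show ?thesis using dec[of "nat (p + q)"] by metis
  next
    case False
    then have "proj_pq j p q \<alpha> = 0" by (auto simp: proj_pq_def fun_eq_iff zero_fun_apply)
    then show ?thesis by (simp add: cv.subspace_0[OF ext_pq_subspace])
  qed
  obtain \<beta> where \<beta>: "trunc (int (length vs)) = (\<Sum>p\<le>length vs. \<beta> p)"
    "\<forall>p\<le>length vs. proj_pq j (int p) (int (length vs) - int p) \<alpha> = \<beta> p"
    using dec[of "length vs"] by blast
  have "\<alpha> vs = trunc (int (length vs)) vs" by (simp add: trunc_def)
  also have "\<dots> = (\<Sum>p\<le>length vs. \<beta> p vs)" unfolding \<beta>(1) by (rule sum_ext_apply)
  finally show "(\<Sum>p\<le>length vs. proj_pq j (int p) (int (length vs) - int p) \<alpha> vs) = \<alpha> vs"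
    using \<beta>(2) by simp
qed

lemma ext_pq_wedge:
  fixes E :: "'e::real_inner set" and j :: "'e \<Rightarrow> 'e"
  assumes E: "orth_basis E" and j: "linear j" "\<And>v. j (j v) = - v"
    and \<alpha>: "\<alpha> \<in> ext_pq j p q" and \<beta>: "\<beta> \<in> ext_pq j r s"
  shows "ext_wedge \<alpha> \<beta> \<in> ext_pq j (p + r) (q + s)"
proof (cases "0 \<le> p \<and> 0 \<le> q \<and> 0 \<le> r \<and> 0 \<le> s")
  case True
  let ?\<omega> = "ext_wedge \<alpha> \<beta>"
  note w = ext_pq_weight[OF \<alpha>] ext_pq_weight[OF \<beta>]
  have alt: "alternating ?\<omega>" and wt: "has_weight j (p - q + (r - s)) ?\<omega>" and deg: "deg_in (p + q + (r + s)) ?\<omega>"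
    by (intro alternating_wedge has_weight_wedge deg_in_wedge; use w in blast)+
  have "proj_pq j (p + r) (q + s) ?\<omega> vs = ?\<omega> vs" for vs
  proof (cases "int (length vs) = p + q + (r + s)")
    case len: True
    have "?\<omega> (map (rot j \<theta>) vs) = (\<Sum>k\<in>{p - q + (r - s)}. ?\<omega> vs * cis (of_int k * \<theta>))" for \<theta>
    proof -
      have "ext_pull (rot j \<theta>) ?\<omega> vs = (cis (of_int (p - q + (r - s)) * \<theta>) *\<^sub>C ?\<omega>) vs"
        using wt unfolding has_weight_def by metis
      then show ?thesis by (simp add: ext_pull_def ext_fun_simps)
    qed
    then have "proj_pq j (p + r) (q + s) ?\<omega> vs = (if p + r - (q + s) \<in> {p - q + (r - s)} then ?\<omega> vs else 0)"
      using len True by (intro proj_pq_trig) auto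
    then show ?thesis by simp
  next
    case False
    then show ?thesis using deg by (auto simp: deg_in_def proj_pq_def)
  qed
  then have "proj_pq j (p + r) (q + s) ?\<omega> = ?\<omega>" by (rule ext)
  then show ?thesis using proj_pq_in[OF E j alt, of "p + r" "q + s"] by simp
next
  case False
  then have "\<alpha> = 0 \<or> \<beta> = 0" using \<alpha> \<beta> ext_pq_neg[of p q j] ext_pq_neg[of r s j] by (metis not_le singletonD)
  then show ?thesis using cv.subspace_0[OF ext_pq_subspace] by (elim disjE) simp_all
qed


subsection \<open>Components of the exterior derivative\<close>

text \<open>The frequencies of the exterior derivative of a form of pure type, relative to the weight of
  the form.\<close>

definition trig3 :: "(real \<Rightarrow> complex) \<Rightarrow> bool" where
  "trig3 f \<longleftrightarrow> (\<exists>K. \<forall>\<theta>. f \<theta> = (\<Sum>k\<in>{-3, -1, 1, 3}. K k * cis (of_int k * \<theta>)))"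

lemma trig3_add: "trig3 f \<Longrightarrow> trig3 g \<Longrightarrow> trig3 (\<lambda>\<theta>. f \<theta> + g \<theta>)"
proof -
  assume "trig3 f" "trig3 g"
  then obtain K L where "\<forall>\<theta>. f \<theta> = (\<Sum>k\<in>{-3, -1, 1, 3}. K k * cis (of_int k * \<theta>))"
    "\<forall>\<theta>. g \<theta> = (\<Sum>k\<in>{-3, -1, 1, 3}. L k * cis (of_int k * \<theta>))" by (auto simp: trig3_def)
  then show ?thesis unfolding trig3_def
    by (intro exI[of _ "\<lambda>k. K k + L k"]) (simp add: sum.distrib distrib_right)
qed

lemma trig3_cmult: "trig3 f \<Longrightarrow> trig3 (\<lambda>\<theta>. c * f \<theta>)"
proof -
  assume "trig3 f"
  then obtain K where K: "\<And>\<theta>. f \<theta> = (\<Sum>k\<in>{-3, -1, 1, 3}. K k * cis (of_int k * \<theta>))"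
    unfolding trig3_def by blast
  show ?thesis unfolding trig3_def
    by (intro exI[of _ "\<lambda>k. c * K k"] allI) (simp only: K sum_distrib_left mult.assoc)
qed

lemma trig3_multc: "trig3 f \<Longrightarrow> trig3 (\<lambda>\<theta>. f \<theta> * c)"
  using trig3_cmult[of f c] by (simp add: mult.commute)

lemma trig3_diff: "trig3 f \<Longrightarrow> trig3 g \<Longrightarrow> trig3 (\<lambda>\<theta>. f \<theta> - g \<theta>)"
  using trig3_add[of f, OF _ trig3_cmult[of g "-1"]] by simp

lemma trig3_0: "trig3 (\<lambda>\<theta>. 0)"
  unfolding trig3_def by (intro exI[of _ "\<lambda>_. 0"]) simp

lemma trig3_sum: "(\<And>i. i \<in> I \<Longrightarrow> trig3 (f i)) \<Longrightarrow> trig3 (\<lambda>\<theta>. \<Sum>i\<in>I. f i \<theta>)"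
  by (induction I rule: infinite_finite_induct) (simp_all add: trig3_0 trig3_add)

text \<open>Products of three trigonometric functions that occur when a rotated form is differentiated: one
  factor \<open>sin \<theta>\<close> from the derivative of \<open>R\<^sub>\<theta>\<close>, one from \<open>R\<^sub>-\<^sub>\<theta>\<close>, one from the rotated direction of
  differentiation.\<close>

lemma trig3_basic:
  "trig3 (\<lambda>\<theta>. of_real (cos \<theta>))" "trig3 (\<lambda>\<theta>. of_real (sin \<theta>))"
  "trig3 (\<lambda>\<theta>. of_real (sin \<theta> * cos \<theta> * cos \<theta>))" "trig3 (\<lambda>\<theta>. of_real (sin \<theta> * sin \<theta> * cos \<theta>))"
  "trig3 (\<lambda>\<theta>. of_real (sin \<theta> * sin \<theta> * sin \<theta>))"
proof -
  have z: "cis \<theta> \<noteq> 0" "cis (3 * \<theta>) = cis \<theta> ^ 3" "cis (- 3 * \<theta>) = 1 / cis \<theta> ^ 3" "cis (- 1 * \<theta>) = 1 / cis \<theta>" for \<theta>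
  proof -
    show "cis (3 * \<theta>) = cis \<theta> ^ 3" by (simp add: Complex.DeMoivre)
    show "cis \<theta> \<noteq> 0" by simp
    show "cis (- 1 * \<theta>) = 1 / cis \<theta>" by (simp add: cis_inverse flip: inverse_eq_divide)
    have "cis (- 3 * \<theta>) = inverse (cis (3 * \<theta>))" by (simp add: cis_inverse)
    then show "cis (- 3 * \<theta>) = 1 / cis \<theta> ^ 3" by (simp add: Complex.DeMoivre inverse_eq_divide)
  qed
  have c: "complex_of_real (cos \<theta>) = (cis \<theta> + 1 / cis \<theta>) / 2"
    and s: "complex_of_real (sin \<theta>) = (cis \<theta> - 1 / cis \<theta>) / (2 * \<i>)" for \<theta>
    unfolding inverse_eq_divide[symmetric] cis_inverse by (simp_all add: complex_eq_iff)
  have sum4: "(\<Sum>k\<in>{-3, -1, 1, 3}. K k * cis (of_int k * \<theta>)) =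
    K (-3) / cis \<theta> ^ 3 + K (-1) / cis \<theta> + K 1 * cis \<theta> + K 3 * cis \<theta> ^ 3" for K \<theta>
    using z(2,3,4)[of \<theta>] by simp
  show "trig3 (\<lambda>\<theta>. of_real (cos \<theta>))"
    unfolding trig3_def sum4
    by (intro exI[of _ "\<lambda>k. if k = 1 \<or> k = -1 then 1 / 2 else 0"]) (simp add: c field_simps)
  show "trig3 (\<lambda>\<theta>. of_real (sin \<theta>))"
    unfolding trig3_def sum4
    by (intro exI[of _ "\<lambda>k. if k = 1 then 1 / (2 * \<i>) else if k = -1 then - 1 / (2 * \<i>) else 0"]) (simp add: s field_simps)
  show "trig3 (\<lambda>\<theta>. of_real (sin \<theta> * cos \<theta> * cos \<theta>))"
    unfolding trig3_def sum4 of_real_mult c s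
    by (intro exI[of _ "\<lambda>k. if 0 < k then 1 / (8 * \<i>) else - 1 / (8 * \<i>)"])
      (simp add: field_simps power2_eq_square power3_eq_cube)
  show "trig3 (\<lambda>\<theta>. of_real (sin \<theta> * sin \<theta> * cos \<theta>))"
    unfolding trig3_def sum4 of_real_mult c s
    by (intro exI[of _ "\<lambda>k. if k = 3 \<or> k = -3 then - 1 / 8 else 1 / 8"])
      (simp add: field_simps power2_eq_square power3_eq_cube)
  show "trig3 (\<lambda>\<theta>. of_real (sin \<theta> * sin \<theta> * sin \<theta>))"
    unfolding trig3_def sum4 of_real_mult c s
    by (intro exI[of _ "\<lambda>k. if k = 3 then - 1 / (8 * \<i>) else if k = -3 then 1 / (8 * \<i>)
        else if k = 1 then 3 / (8 * \<i>) else - 3 / (8 * \<i>)"])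
      (simp add: field_simps power2_eq_square power3_eq_cube)
qed

lemma smooth_on_ident: "smooth_on S (\<lambda>x. x)"
proof (rule smooth_on_coinduct[where P = "\<lambda>f. f = (\<lambda>x. x) \<or> (\<exists>c. f = (\<lambda>x. c))"])
  fix f :: "'a \<Rightarrow> 'a" assume "f = (\<lambda>x. x) \<or> (\<exists>c. f = (\<lambda>x. c))"
  then show "(\<forall>x\<in>S. f differentiable (at x)) \<and>
      (\<forall>v. (\<lambda>x. fd f x v) = (\<lambda>x. x) \<or> (\<exists>c. (\<lambda>x. fd f x v) = (\<lambda>x. c)))"
  proof
    assume f: "f = (\<lambda>x. x)"
    have "fd f x = (\<lambda>v. v)" for x unfolding f by (rule fd_eq) (rule has_derivative_ident)
    then show ?thesis using f by auto
  qed auto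
qed simp

context
  fixes S :: "'e::real_inner set" and E :: "'e set" and j :: "'e \<Rightarrow> 'e \<Rightarrow> 'e" and \<omega> :: "'e \<Rightarrow> 'e ext"
  assumes E: "orth_basis E" and S: "open S"
    and j: "\<And>v. smooth_on S (\<lambda>u. j u v)" "\<And>u. u \<in> S \<Longrightarrow> linear (j u)" "\<And>u v. u \<in> S \<Longrightarrow> j u (j u v) = - v"
    and \<omega>: "smooth_ext S \<omega>" "\<And>u. u \<in> S \<Longrightarrow> alternating (\<omega> u)"
begin

lemma smooth_rot: "smooth_on S (\<lambda>u. rot (j u) \<theta> v)"
  unfolding rot_def
  by (rule smooth_on_add[OF S smooth_on_const smooth_on_bounded_linear[OF bounded_linear_scaleR_right S j(1)]])

lemma fd_rot: "u \<in> S \<Longrightarrow> fd (\<lambda>y. rot (j y) \<theta> v) u w = sin \<theta> *\<^sub>R fd (\<lambda>y. j y v) u w"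
proof -
  assume u: "u \<in> S"
  note d = smooth_on_differentiable[OF j(1) u]
  have 1: "(\<lambda>y. sin \<theta> *\<^sub>R j y v) differentiable (at u)"
    by (rule smooth_on_differentiable[OF smooth_on_bounded_linear[OF bounded_linear_scaleR_right S j(1)] u])
  show ?thesis
    unfolding rot_def fd_add[OF differentiable_const 1] fd_bounded_linear[OF bounded_linear_scaleR_right d] by simp
qed

lemma rot_fields: "map (\<lambda>W. W u) (map (\<lambda>x u. rot (j u) \<theta> x) vs) = map (rot (j u) \<theta>) vs"
  by simp

lemma smooth_pull_rot: "smooth_on S (\<lambda>u. \<omega> u (map (rot (j u) \<theta>) vs))"
proof -
  have "smooth_on S (\<lambda>u. \<omega> u (map (\<lambda>W. W u) (map (\<lambda>x u. rot (j u) \<theta> x) vs)))"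
    using smooth_rot by (intro smooth_on_eval[OF E S S _ smooth_on_ident \<omega>]) auto
  then show ?thesis unfolding rot_fields .
qed

text \<open>The components are finite sums of pullbacks by rotations, which depend smoothly on the point.\<close>

lemma smooth_ext_proj_pq: "smooth_ext S (\<lambda>u. proj_pq (j u) p q (\<omega> u))"
  unfolding smooth_ext_def
proof
  fix vs :: "'e list"
  let ?n = "2 * length vs + 5"
  have "smooth_on S (\<lambda>u. \<Sum>m<?n. (cis (of_int (q - p) * root_angle ?n m) / of_nat ?n) * \<omega> u (map (rot (j u) (root_angle ?n m)) vs))"
    by (rule smooth_on_sum[OF S smooth_on_cmult[OF S smooth_pull_rot]])
  moreover have "proj_pq (j u) p q (\<omega> u) vs =
      (\<Sum>m<?n. (cis (of_int (q - p) * root_angle ?n m) / of_nat ?n) * \<omega> u (map (rot (j u) (root_angle ?n m)) vs))"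
    if "0 \<le> p \<and> 0 \<le> q \<and> int (length vs) = p + q" for u
    using that by (simp add: proj_pq_def Let_def sum_divide_distrib)
  moreover have "(\<lambda>u. proj_pq (j u) p q (\<omega> u) vs) = (\<lambda>u. 0)" if "\<not> (0 \<le> p \<and> 0 \<le> q \<and> int (length vs) = p + q)"
    using that by (auto simp: proj_pq_def)
  ultimately show "smooth_on S (\<lambda>u. proj_pq (j u) p q (\<omega> u) vs)"
    using smooth_on_const by (cases "0 \<le> p \<and> 0 \<le> q \<and> int (length vs) = p + q") simp_all
qed

text \<open>The identity \<open>R\<^sub>\<theta>\<^sup>* \<omega> = exp (\<i> w \<theta>) \<omega>\<close> is differentiated in the direction \<open>R\<^sub>\<theta> z\<close>. Since
  \<open>R\<^sub>\<theta>\<close> depends on the point, there is a correction in which one argument \<open>x\<close> is replaced by \<open>sin \<theta> R\<^sub>-\<^sub>\<theta> (D J) x\<close>. Both terms are trigonometric polynomials of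
  degree at most 3 and of odd parity, times \<open>exp (\<i> w \<theta>)\<close>.\<close>

lemma ext_d_rot_trig:
  assumes weight: "\<And>u. u \<in> S \<Longrightarrow> has_weight (j u) w0 (\<omega> u)" and u: "u \<in> S"
  shows "\<exists>f. trig3 f \<and> (\<forall>\<theta>. ext_d \<omega> u (map (rot (j u) \<theta>) vs) = cis (of_int w0 * \<theta>) * f \<theta>)"
proof -
  let ?R = "\<lambda>\<theta>. rot (j u) \<theta>" and ?c = "\<lambda>\<theta>. cis (of_int w0 * \<theta>)"
  let ?J = "\<lambda>z x. fd (\<lambda>y. j y x) u z"
  let ?D = "\<lambda>z ws. fd (\<lambda>y. \<omega> y ws) u z"
  (* ?K is the endomorphism in the correction term; the derivative of rot (j y) \<theta> x in y is sin \<theta> times that of j y x. *)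
  let ?K = "\<lambda>\<theta> w x. sin \<theta> *\<^sub>R rot (j u) (- \<theta>) (?J (?R \<theta> w) x)"
  let ?t = "\<lambda>\<theta> w ws. ?D (?R \<theta> w) ws - der (\<omega> u) (map (\<lambda>x. (x, ?K \<theta> w x)) ws)"
  have alt: "alternating (\<omega> u)" and lj: "linear (j u)" and jj: "\<And>v. j u (j u v) = - v"
    using \<omega>(2) j(2,3) u by auto
  have lJ: "linear (\<lambda>z. ?J z x)" for x by (rule linear_fd[OF smooth_on_differentiable[OF j(1) u]])
  have lD: "linear (\<lambda>z. ?D z ws)" for ws by (rule linear_fd[OF smooth_ext_diff_at[OF \<omega>(1) u]])
  have pull: "\<omega> y (map (rot (j y) \<theta>) ws) = ?c \<theta> * \<omega> y ws" if "y \<in> S" for y \<theta> ws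
  proof -
    have "ext_pull (rot (j y) \<theta>) (\<omega> y) ws = (?c \<theta> *\<^sub>C \<omega> y) ws"
      using weight[OF that] unfolding has_weight_def by metis
    then show ?thesis by (simp add: ext_pull_def ext_fun_simps)
  qed
  have trm: "?D z (map (?R \<theta>) ws) = ?c \<theta> * ?D z ws -
      der (\<omega> u) (map (\<lambda>x. (?R \<theta> x, sin \<theta> *\<^sub>R ?J z x)) ws)" for z \<theta> ws
  proof -
    have "fd (\<lambda>y. \<omega> y (map (\<lambda>W. W y) (map (\<lambda>x u. rot (j u) \<theta> x) ws))) u z =
        fd (\<lambda>y. \<omega> y (map (\<lambda>W. W u) (map (\<lambda>x u. rot (j u) \<theta> x) ws))) u (fd (\<lambda>x. x) u z) +
        der (\<omega> u) (map (\<lambda>W. (W u, fd W u z)) (map (\<lambda>x u. rot (j u) \<theta> x) ws))"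
      using smooth_rot by (intro fd_eval[OF E S S _ smooth_on_ident \<omega>]) (auto simp: u)
    moreover have "fd (\<lambda>x. x) u = (\<lambda>v. v)" by (rule fd_eq) (rule has_derivative_ident)
    ultimately have "fd (\<lambda>y. \<omega> y (map (rot (j y) \<theta>) ws)) u z = ?D z (map (?R \<theta>) ws) +
        der (\<omega> u) (map (\<lambda>x. (?R \<theta> x, sin \<theta> *\<^sub>R ?J z x)) ws)"
      unfolding rot_fields by (simp add: o_def fd_rot[OF u])
    moreover have "fd (\<lambda>y. \<omega> y (map (rot (j y) \<theta>) ws)) u = fd (\<lambda>y. ?c \<theta> * \<omega> y ws) u"
      by (rule fd_cong[OF S u pull])
    ultimately show ?thesis by (simp add: fd_cmult[OF smooth_ext_diff_at[OF \<omega>(1) u]])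
  qed
  have der_c: "der (\<omega> u) (map (\<lambda>x. (?R \<theta> x, sin \<theta> *\<^sub>R ?J z x)) ws) =
      ?c \<theta> * der (\<omega> u) (map (\<lambda>x. (x, sin \<theta> *\<^sub>R rot (j u) (- \<theta>) (?J z x))) ws)" for z \<theta> ws
  proof -
    have inv: "?R \<theta> (sin \<theta> *\<^sub>R rot (j u) (- \<theta>) y) = sin \<theta> *\<^sub>R y" for y
      using rot_rot[OF lj jj, of \<theta> "- \<theta>" y] by (simp add: linear_scale[OF linear_rot[OF lj]]) (simp add: rot_def)
    have "der (\<omega> u) (map (\<lambda>x. (?R \<theta> x, sin \<theta> *\<^sub>R ?J z x)) ws) =
        der (ext_pull (?R \<theta>) (\<omega> u)) (map (\<lambda>x. (x, sin \<theta> *\<^sub>R rot (j u) (- \<theta>) (?J z x))) ws)"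
      by (simp add: der_pull inv o_def)
    also have "ext_pull (?R \<theta>) (\<omega> u) = ?c \<theta> *\<^sub>C \<omega> u" using weight[OF u] unfolding has_weight_def by blast
    finally show ?thesis by (simp only: der_cscale)
  qed
  have eq: "ext_d \<omega> u (map (?R \<theta>) vs) = ?c \<theta> * (\<Sum>i<length vs. (-1) ^ i * ?t \<theta> (vs ! i) (take i vs @ drop (Suc i) vs))" for \<theta>
  proof -
    have "ext_d \<omega> u (map (?R \<theta>) vs) = asum (\<lambda>w ws. ?D (?R \<theta> w) (map (?R \<theta>) ws)) vs"
      by (simp only: ext_d_asum asum_map)
    also have "\<dots> = asum (\<lambda>w ws. ?c \<theta> * ?t \<theta> w ws) vs" by (simp only: trm der_c right_diff_distrib)
    also have "\<dots> = ?c \<theta> * (\<Sum>i<length vs. (-1) ^ i * ?t \<theta> (vs ! i) (take i vs @ drop (Suc i) vs))"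
      unfolding asum_eq_sum sum_distrib_left by (simp only: mult.left_commute)
    finally show ?thesis .
  qed
  have der3: "trig3 (\<lambda>\<theta>. der (\<omega> u) (map (\<lambda>x. (x, ?K \<theta> w x)) ws))" for w ws
  proof -
    let ?d = "\<lambda>A. der (\<omega> u) (map (\<lambda>x. (x, A x)) ws)"
    have K: "?K \<theta> w x = ((sin \<theta> * cos \<theta> * cos \<theta>) *\<^sub>R ?J w x + (sin \<theta> * sin \<theta> * cos \<theta>) *\<^sub>R ?J (j u w) x) +
        ((sin \<theta> * sin \<theta> * cos \<theta>) *\<^sub>R (- j u (?J w x)) + (sin \<theta> * sin \<theta> * sin \<theta>) *\<^sub>R (- j u (?J (j u w) x)))" for \<theta> x
      by (simp add: rot_def linear_add[OF lJ] linear_scale[OF lJ] linear_add[OF lj] linear_scale[OF lj] algebra_simps)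
    have "?d (?K \<theta> w) = of_real (sin \<theta> * cos \<theta> * cos \<theta>) * ?d (\<lambda>x. ?J w x) + of_real (sin \<theta> * sin \<theta> * cos \<theta>) * ?d (\<lambda>x. ?J (j u w) x) +
        (of_real (sin \<theta> * sin \<theta> * cos \<theta>) * ?d (\<lambda>x. - j u (?J w x)) +
         of_real (sin \<theta> * sin \<theta> * sin \<theta>) * ?d (\<lambda>x. - j u (?J (j u w) x)))" for \<theta>
      unfolding K der_add[OF alt] der_scaleR[OF alt] ..
    then show ?thesis by (simp only:) (intro trig3_add trig3_multc trig3_basic)
  qed
  have D3: "trig3 (\<lambda>\<theta>. ?D (?R \<theta> w) ws)" for w ws
  proof -
    have "?D (?R \<theta> w) ws = of_real (cos \<theta>) * ?D w ws + of_real (sin \<theta>) * ?D (j u w) ws" for \<theta>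
      by (simp add: rot_def linear_add[OF lD] linear_scale[OF lD] scaleR_conv_of_real)
    then show ?thesis by (simp only:) (intro trig3_add trig3_multc trig3_basic)
  qed
  have "trig3 (\<lambda>\<theta>. \<Sum>i<length vs. (-1) ^ i * ?t \<theta> (vs ! i) (take i vs @ drop (Suc i) vs))"
    by (intro trig3_sum trig3_cmult trig3_diff der3 D3)
  with eq show ?thesis by blast
qed

text \<open>The total degree rises by one and the difference of the two degrees changes by \<open>-3\<close>, \<open>-1\<close>, \<open>1\<close> or
  \<open>3\<close>, which leaves four bidegrees.\<close>

lemma proj_pq_ext_d:
  assumes \<omega>pq: "\<And>u. u \<in> S \<Longrightarrow> \<omega> u \<in> ext_pq (j u) p q" and u: "u \<in> S"
    and r: "(r, s) \<notin> {(p - 1, q + 2), (p, q + 1), (p + 1, q), (p + 2, q - 1)}"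
  shows "proj_pq (j u) r s (ext_d \<omega> u) = 0"
proof (cases "0 \<le> p \<and> 0 \<le> q")
  case False
  have "\<omega> y = 0" if "y \<in> S" for y using \<omega>pq[OF that] ext_pq_neg[of p q "j y"] False by auto
  then have "ext_d \<omega> u = ext_d (\<lambda>y. 0) u" by (rule ext_d_cong[OF S u])
  also have "\<dots> = 0" by (simp add: ext_d_def fun_eq_iff zero_fun_apply)
  finally show ?thesis by (simp only: proj_pq_0)
next
  case True
  note w = ext_pq_weight[OF \<omega>pq]
  have "proj_pq (j u) r s (ext_d \<omega> u) vs = 0" for vs
  proof (cases "0 \<le> r \<and> 0 \<le> s \<and> int (length vs) = r + s")
    case len: True
    have z: "ext_d \<omega> u ws = 0" if "int (length ws) \<noteq> p + q + 1" for ws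
    proof -
      have "fd (\<lambda>y. \<omega> y (take i ws @ drop (Suc i) ws)) u = fd (\<lambda>y. 0) u" if "i < length ws" for i
        using w \<open>int (length ws) \<noteq> p + q + 1\<close> that by (intro fd_cong[OF S u]) (auto simp: deg_in_def)
      then show ?thesis by (simp add: ext_d_def)
    qed
    show ?thesis
    proof (cases "r + s = p + q + 1")
      case True': True
      obtain f where f: "trig3 f" "\<And>\<theta>. ext_d \<omega> u (map (rot (j u) \<theta>) vs) = cis (of_int (p - q) * \<theta>) * f \<theta>"
        using ext_d_rot_trig[of "p - q" u vs] w u by blast
      obtain K where K: "\<And>\<theta>. f \<theta> = (\<Sum>k\<in>{-3, -1, 1, 3}. K k * cis (of_int k * \<theta>))"
        using f(1) unfolding trig3_def by blast
      (* Relative frequencies -3, -1, 1, 3 are shifted by the weight p - q of the form. *)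
      let ?T = "(\<lambda>k. k + (p - q)) ` {-3, -1, 1, 3}"
      have "ext_d \<omega> u (map (rot (j u) \<theta>) vs) = (\<Sum>k\<in>?T. K (k - (p - q)) * cis (of_int k * \<theta>))" for \<theta>
      proof -
        have "ext_d \<omega> u (map (rot (j u) \<theta>) vs) = (\<Sum>k\<in>{-3, -1, 1, 3}. K k * (cis (of_int (p - q) * \<theta>) * cis (of_int k * \<theta>)))"
          unfolding f(2) K by (simp only: sum_distrib_left mult.left_commute)
        also have "\<dots> = (\<Sum>k\<in>{-3, -1, 1, 3}. K k * cis (of_int (k + (p - q)) * \<theta>))"
          by (simp only: cis_mult of_int_add distrib_right add.commute)
        also have "\<dots> = (\<Sum>k\<in>?T. K (k - (p - q)) * cis (of_int k * \<theta>))"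
          by (subst sum.reindex) (auto simp: inj_on_def)
        finally show ?thesis .
      qed
      then have "proj_pq (j u) r s (ext_d \<omega> u) vs = (if r - s \<in> ?T then K (r - s - (p - q)) else 0)"
        using len True True' by (intro proj_pq_trig) auto
      moreover have "r - s \<notin> ?T" using r True' by auto
      ultimately show ?thesis by simp
    next
      case False
      then show ?thesis using z len by (simp add: proj_pq_def Let_def)
    qed
  next
    case False
    then show ?thesis by (auto simp: proj_pq_def)
  qed
  then show ?thesis by (simp add: fun_eq_iff zero_fun_apply)
qed

end



section \<open>Differential forms on manifolds\<close>

lemma alternating_basis_zero:
  fixes E :: "'e::real_inner set" and \<alpha> :: "'e ext"
  assumes E: "orth_basis E" and \<alpha>: "alternating \<alpha>"
    and z: "\<And>ws. set ws \<subseteq> E \<Longrightarrow> length ws = length vs \<Longrightarrow> \<alpha> ws = 0"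
  shows "\<alpha> vs = 0"
  using \<alpha> z
proof (induction vs arbitrary: \<alpha>)
  case (Cons v vs)
  have "iota b \<alpha> vs = 0" if "b \<in> E" for b
    by (rule Cons.IH[OF alternating_iota[OF Cons.prems(1)]]) (simp add: iota_apply Cons.prems(2) that)
  moreover have "\<alpha> (v # vs) = (\<Sum>b\<in>E. coord b v *\<^sub>R \<alpha> (b # vs))"
    by (rule linear_expand[OF E alternating_linear_hd[OF Cons.prems(1)]])
  ultimately show ?case by (simp add: iota_apply)
qed simp

text \<open>Some basis vector is repeated among the arguments. This bounds the degrees, so that forms have only finitely many components.\<close>

lemma alternating_above_dim:
  fixes E :: "'e::real_inner set" and \<alpha> :: "'e ext"
  assumes E: "orth_basis E" and \<alpha>: "alternating \<alpha>" and vs: "card E < length vs"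
  shows "\<alpha> vs = 0"
proof (rule alternating_basis_zero[OF E \<alpha>])
  fix ws assume ws: "set ws \<subseteq> E" "length ws = length vs"
  have "\<not> distinct ws"
    using card_mono[OF orth_basis_finite[OF E] ws(1)] ws(2) vs by (auto dest: distinct_card)
  then obtain i j where "i < length ws" "j < length ws" "i \<noteq> j" "ws ! i = ws ! j"
    by (auto simp: distinct_conv_nth)
  then obtain i j where "i < j" "j < length ws" "ws ! i = ws ! j" by (metis linorder_neqE_nat)
  then show "\<alpha> ws = 0" using \<alpha> unfolding alternating_def by blast
qed

lemma form_apply:
  "(\<omega> + \<eta>) c u = \<omega> c u + \<eta> c u" "(a *\<^sub>C \<omega>) c u = a *\<^sub>C \<omega> c u" "(0 :: ('a, 'e) form) c u = 0"
  for \<omega> \<eta> :: "('a, 'e) form"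
  by (simp_all add: cscale_fun_def plus_fun_apply zero_fun_apply)

lemma sum_form_apply: "(\<Sum>i\<in>I. \<omega> i) c u = (\<Sum>i\<in>I. (\<omega> i :: ('a, 'e) form) c u)"
  by (induction I rule: infinite_finite_induct) (simp_all add: form_apply)

lemma pull_ext_apply: "pull_ext F \<omega> u vs = \<omega> (F u) (map (fd F u) vs)"
  by (simp add: pull_ext_def ext_pull_def)

subsection \<open>Charts\<close>

lemma param_in: "u \<in> cod c \<Longrightarrow> param c u \<in> fst c" and snd_param: "u \<in> cod c \<Longrightarrow> snd c (param c u) = u"
  by (auto simp: cod_def param_def inv_into_into f_inv_into_f)

locale manifold =
  fixes X :: "('a, 'e::real_inner) acm"
  assumes smooth_manifold: "smooth_manifold X"
begin

definition basis :: "'e set" where "basis = (SOME E. orth_basis E)"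

lemma basis: "orth_basis basis"
proof -
  obtain B :: "'e set" where "finite B" "span B = UNIV" using smooth_manifold by (auto simp: smooth_manifold_def)
  then obtain E :: "'e set" where "orth_basis E" by (rule orth_basis_exists)
  then show ?thesis unfolding basis_def by (rule someI)
qed

lemma chart: assumes "c \<in> atlas X"
  shows "openin (mtop X) (fst c)" "open (cod c)"
    "homeomorphic_map (subtopology (mtop X) (fst c)) (top_of_set (cod c)) (snd c)"
  using smooth_manifold assms by (auto simp: smooth_manifold_def)

lemma covered: "x \<in> topspace (mtop X) \<Longrightarrow> \<exists>c\<in>atlas X. x \<in> fst c"
  using smooth_manifold by (auto simp: smooth_manifold_def)

lemma chart_subset: "c \<in> atlas X \<Longrightarrow> fst c \<subseteq> topspace (mtop X)"
  using chart(1) openin_subset by blast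

lemma param_snd: assumes "c \<in> atlas X" "x \<in> fst c" shows "param c (snd c x) = x"
proof -
  have "inj_on (snd c) (fst c)"
    using homeomorphic_imp_injective_map[OF chart(3)[OF assms(1)]] chart_subset[OF assms(1)]
    by (simp add: inf_absorb2)
  then show ?thesis using assms(2) by (simp add: param_def)
qed

lemma in_locdom: "c \<in> atlas X \<Longrightarrow> u \<in> locdom c c' f \<longleftrightarrow> u \<in> cod c \<and> f (param c u) \<in> fst c'"
  using param_in[of u c] snd_param[of u c] param_snd[of c] by (force simp: locdom_def cod_def)

lemma open_locdom:
  assumes c: "c \<in> atlas X" and f: "continuous_map (mtop X) (mtop Y) f" and c': "openin (mtop Y) (fst c')"
  shows "open (locdom c c' f)"
proof -
  have "openin (mtop X) {x \<in> topspace (mtop X). f x \<in> fst c'}" by (rule openin_continuous_map_preimage[OF f c'])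
  then have "openin (subtopology (mtop X) (fst c)) (fst c \<inter> {x \<in> topspace (mtop X). f x \<in> fst c'})"
    by (rule openin_subtopology_Int2)
  moreover have "fst c \<inter> {x \<in> topspace (mtop X). f x \<in> fst c'} = fst c \<inter> f -` fst c'"
    using chart_subset[OF c] by auto
  moreover have "open_map (subtopology (mtop X) (fst c)) (top_of_set (cod c)) (snd c)"
    by (rule homeomorphic_imp_open_map[OF chart(3)[OF c]])
  ultimately have "openin (top_of_set (cod c)) (locdom c c' f)"
    by (simp add: locdom_def open_map_def)
  then show ?thesis using chart(2)[OF c] openin_open_eq by blast
qed

end

definition smooth_map :: "('a, 'e::real_inner) acm \<Rightarrow> ('b, 'f::real_inner) acm \<Rightarrow> ('a \<Rightarrow> 'b) \<Rightarrow> bool" where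
  "smooth_map X Y f \<longleftrightarrow> continuous_map (mtop X) (mtop Y) f \<and>
     (\<forall>c\<in>atlas X. \<forall>c'\<in>atlas Y. smooth_on (locdom c c' f) (locrep c c' f))"

lemma (in manifold) smooth_map_id: "smooth_map X X id"
  using smooth_manifold by (simp add: smooth_map_def smooth_manifold_def)

locale manifold_map = X: manifold X + Y: manifold Y
  for X :: "('a, 'e::real_inner) acm" and Y :: "('b, 'f::real_inner) acm" +
  fixes f :: "'a \<Rightarrow> 'b"
  assumes smooth_map: "smooth_map X Y f"
begin

lemma cont: "continuous_map (mtop X) (mtop Y) f"
  using smooth_map by (simp add: smooth_map_def)

lemma map_chart: assumes "c \<in> atlas X" "u \<in> cod c" obtains c' where "c' \<in> atlas Y" "u \<in> locdom c c' f"
proof -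
  have "f (param c u) \<in> topspace (mtop Y)"
    using param_in[OF assms(2)] X.chart_subset[OF assms(1)] cont by (auto simp: continuous_map_def)
  then show ?thesis using that Y.covered X.in_locdom[OF assms(1)] assms(2) by blast
qed

lemma open_dom: "c \<in> atlas X \<Longrightarrow> c' \<in> atlas Y \<Longrightarrow> open (locdom c c' f)"
  by (rule X.open_locdom[OF _ cont Y.chart(1)])

lemma smooth_rep: "c \<in> atlas X \<Longrightarrow> c' \<in> atlas Y \<Longrightarrow> smooth_on (locdom c c' f) (locrep c c' f)"
  using smooth_map by (simp add: smooth_map_def)

lemma rep_cod: "c \<in> atlas X \<Longrightarrow> u \<in> locdom c c' f \<Longrightarrow> locrep c c' f u \<in> cod c'"
  using X.in_locdom[of c u c' f] by (auto simp: locrep_def cod_def)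

lemma param_rep: "c \<in> atlas X \<Longrightarrow> c' \<in> atlas Y \<Longrightarrow> u \<in> locdom c c' f \<Longrightarrow> param c' (locrep c c' f u) = f (param c u)"
  using X.in_locdom[of c u c' f] by (simp add: locrep_def Y.param_snd)

lemma linear_rep: "c \<in> atlas X \<Longrightarrow> c' \<in> atlas Y \<Longrightarrow> u \<in> locdom c c' f \<Longrightarrow> linear (fd (locrep c c' f) u)"
  by (rule linear_fd[OF smooth_on_differentiable[OF smooth_rep]])

end

sublocale manifold \<subseteq> id: manifold_map X X id
  by unfold_locales (rule smooth_map_id)

text \<open>Pulling back along a composite is used for two morphisms, and for one morphism
  composed with a change of charts on either side.\<close>

locale manifold_map2 = f: manifold_map X Y f + g: manifold_map Y Z g
  for X :: "('a, 'e::real_inner) acm" and Y :: "('b, 'f::real_inner) acm" and Z :: "('c, 'g::real_inner) acm" and f g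
begin

lemma locdom_comp:
  assumes "c \<in> atlas X" "c' \<in> atlas Y" "u \<in> locdom c c' f"
  shows "locrep c c' f u \<in> locdom c' c'' g \<longleftrightarrow> u \<in> locdom c c'' (g \<circ> f)"
  using f.X.in_locdom[OF assms(1), of u c' f] f.X.in_locdom[OF assms(1), of u c'' "g \<circ> f"]
    f.Y.in_locdom[OF assms(2), of "locrep c c' f u" c'' g] f.rep_cod[OF assms(1,3)] f.param_rep[OF assms] assms(3)
  by simp

lemma fd_locrep_comp:
  assumes c: "c \<in> atlas X" "c' \<in> atlas Y" "c'' \<in> atlas Z"
    and u: "u \<in> locdom c c' f" "u \<in> locdom c c'' (g \<circ> f)"
  shows "locrep c c'' (g \<circ> f) u = locrep c' c'' g (locrep c c' f u)"
    "fd (locrep c c'' (g \<circ> f)) u = fd (locrep c' c'' g) (locrep c c' f u) \<circ> fd (locrep c c' f) u"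
proof -
  let ?W = "locdom c c' f \<inter> locdom c c'' (g \<circ> f)"
  have "open (locdom c c'' (g \<circ> f))"
    by (rule f.X.open_locdom[OF c(1) continuous_map_compose[OF f.cont g.cont] g.Y.chart(1)[OF c(3)]])
  then have W: "open ?W" "u \<in> ?W" using f.open_dom[OF c(1,2)] u by auto
  have eq: "locrep c c'' (g \<circ> f) y = locrep c' c'' g (locrep c c' f y)" if "y \<in> ?W" for y
    using f.param_rep[OF c(1,2), of y] that by (simp add: locrep_def[of c c''] locrep_def[of c' c''])
  show "locrep c c'' (g \<circ> f) u = locrep c' c'' g (locrep c c' f u)" by (rule eq[OF W(2)])
  have "fd (locrep c c'' (g \<circ> f)) u = fd (\<lambda>y. locrep c' c'' g (locrep c c' f y)) u" by (rule fd_cong[OF W eq])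
  also have "\<dots> = fd (locrep c' c'' g) (locrep c c' f u) \<circ> fd (locrep c c' f) u"
  proof -
    have v: "locrep c c' f u \<in> locdom c' c'' g" using locdom_comp[OF c(1,2) u(1), of c''] u(2) by simp
    show ?thesis
      using fd_compose[OF smooth_on_differentiable[OF f.smooth_rep[OF c(1,2)] u(1)]
          smooth_on_differentiable[OF g.smooth_rep[OF c(2,3)] v]] by (simp add: fun_eq_iff)
  qed
  finally show "fd (locrep c c'' (g \<circ> f)) u = fd (locrep c' c'' g) (locrep c c' f u) \<circ> fd (locrep c c' f) u" .
qed

lemma pull_ext_comp:
  assumes "c \<in> atlas X" "c' \<in> atlas Y" "c'' \<in> atlas Z"
    and "u \<in> locdom c c' f" "u \<in> locdom c c'' (g \<circ> f)"
  shows "pull_ext (locrep c c'' (g \<circ> f)) \<alpha> u = ext_pull (fd (locrep c c' f) u) (pull_ext (locrep c' c'' g) \<alpha> (locrep c c' f u))"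
  unfolding pull_ext_def fd_locrep_comp[OF assms] by (simp add: ext_pull_def fun_eq_iff)

end

subsection \<open>The algebra of forms and pullback\<close>

context manifold
begin

lemma formsD:
  assumes "\<omega> \<in> forms X"
  shows "c \<notin> atlas X \<or> u \<notin> cod c \<Longrightarrow> \<omega> c u = 0" "c \<in> atlas X \<Longrightarrow> u \<in> cod c \<Longrightarrow> alternating (\<omega> c u)"
    "c \<in> atlas X \<Longrightarrow> smooth_ext (cod c) (\<omega> c)"
    "c \<in> atlas X \<Longrightarrow> c' \<in> atlas X \<Longrightarrow> u \<in> locdom c c' id \<Longrightarrow> \<omega> c u = pull_ext (locrep c c' id) (\<omega> c') u"
proof -
  show "c \<notin> atlas X \<or> u \<notin> cod c \<Longrightarrow> \<omega> c u = 0" "c \<in> atlas X \<Longrightarrow> u \<in> cod c \<Longrightarrow> alternating (\<omega> c u)"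
    using assms unfolding forms_def by blast+
  show "c \<in> atlas X \<Longrightarrow> smooth_ext (cod c) (\<omega> c)" using assms unfolding forms_def smooth_ext_def by blast
  show "c \<in> atlas X \<Longrightarrow> c' \<in> atlas X \<Longrightarrow> u \<in> locdom c c' id \<Longrightarrow> \<omega> c u = pull_ext (locrep c c' id) (\<omega> c') u"
    using assms unfolding forms_def fun_eq_iff pull_ext_apply by blast
qed

lemma formsI:
  assumes "\<And>c u. c \<notin> atlas X \<or> u \<notin> cod c \<Longrightarrow> \<omega> c u = 0" "\<And>c u. c \<in> atlas X \<Longrightarrow> u \<in> cod c \<Longrightarrow> alternating (\<omega> c u)"
    "\<And>c. c \<in> atlas X \<Longrightarrow> smooth_ext (cod c) (\<omega> c)"
    "\<And>c c' u. c \<in> atlas X \<Longrightarrow> c' \<in> atlas X \<Longrightarrow> u \<in> locdom c c' id \<Longrightarrow> \<omega> c u = pull_ext (locrep c c' id) (\<omega> c') u"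
  shows "\<omega> \<in> forms X"
  unfolding forms_def
proof (intro CollectI conjI allI ballI impI)
  show "\<omega> c u = 0" if "c \<notin> atlas X \<or> u \<notin> cod c" for c u using assms(1)[OF that] .
  show "alternating (\<omega> c u)" if "c \<in> atlas X" "u \<in> cod c" for c u using assms(2)[OF that] .
  show "smooth_on (cod c) (\<lambda>u. \<omega> c u vs)" if "c \<in> atlas X" for c vs using smooth_extD[OF assms(3)[OF that]] .
  show "\<omega> c u vs = \<omega> c' (locrep c c' id u) (map (fd (locrep c c' id) u) vs)"
    if "c \<in> atlas X" "c' \<in> atlas X" "u \<in> locdom c c' id" for c c' u vs
    unfolding assms(4)[OF that] pull_ext_apply ..
qed

lemma form_eqI:
  assumes "\<omega> \<in> forms X" "\<eta> \<in> forms X" "\<And>c u. c \<in> atlas X \<Longrightarrow> u \<in> cod c \<Longrightarrow> \<omega> c u = \<eta> c u"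
  shows "\<omega> = \<eta>"
proof (intro ext)
  show "\<omega> c u vs = \<eta> c u vs" for c u vs
    using assms(3)[of c u] formsD(1)[OF assms(1), of c u] formsD(1)[OF assms(2), of c u] by metis
qed

lemma forms_subspace: "cv.subspace (forms X)"
proof (rule cv.subspaceI)
  show "0 \<in> forms X"
    by (rule formsI) (auto simp: form_apply alternating_0 smooth_ext_def smooth_on_const pull_ext_apply fun_eq_iff zero_fun_apply)
  show "\<omega> + \<eta> \<in> forms X" if "\<omega> \<in> forms X" "\<eta> \<in> forms X" for \<omega> \<eta>
  proof (rule formsI)
    show "(\<omega> + \<eta>) c u = pull_ext (locrep c c' id) ((\<omega> + \<eta>) c') u"
      if "c \<in> atlas X" "c' \<in> atlas X" "u \<in> locdom c c' id" for c c' u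
      using formsD(4)[OF \<open>\<omega> \<in> forms X\<close> that] formsD(4)[OF \<open>\<eta> \<in> forms X\<close> that]
      by (simp add: form_apply fun_eq_iff ext_fun_simps pull_ext_apply)
    show "smooth_ext (cod c) ((\<omega> + \<eta>) c)" if "c \<in> atlas X" for c
    proof -
      have "(\<omega> + \<eta>) c = (\<lambda>u. \<omega> c u + \<eta> c u)" by (simp add: fun_eq_iff form_apply)
      then show ?thesis using smooth_ext_add[OF chart(2)[OF that]] formsD(3) \<open>\<omega> \<in> forms X\<close> \<open>\<eta> \<in> forms X\<close> that by metis
    qed
  qed (use formsD(1,2)[OF that(1)] formsD(1,2)[OF that(2)] in \<open>auto simp: form_apply alternating_add\<close>)
  show "a *\<^sub>C \<omega> \<in> forms X" if "\<omega> \<in> forms X" for a \<omega>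
  proof (rule formsI)
    show "(a *\<^sub>C \<omega>) c u = pull_ext (locrep c c' id) ((a *\<^sub>C \<omega>) c') u"
      if "c \<in> atlas X" "c' \<in> atlas X" "u \<in> locdom c c' id" for c c' u
      using formsD(4)[OF \<open>\<omega> \<in> forms X\<close> that] by (simp add: form_apply fun_eq_iff ext_fun_simps pull_ext_apply)
    show "smooth_ext (cod c) ((a *\<^sub>C \<omega>) c)" if "c \<in> atlas X" for c
    proof -
      have "(a *\<^sub>C \<omega>) c = (\<lambda>u. a *\<^sub>C \<omega> c u)" by (simp add: fun_eq_iff form_apply)
      then show ?thesis using smooth_ext_cscale[OF chart(2)[OF that]] formsD(3) \<open>\<omega> \<in> forms X\<close> that by metis
    qed
  qed (use formsD(1,2)[OF that] in \<open>auto simp: form_apply alternating_cscale\<close>)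
qed

lemma wedge_forms: assumes "\<omega> \<in> forms X" "\<eta> \<in> forms X" shows "wedge \<omega> \<eta> \<in> forms X"
proof (rule formsI)
  show "smooth_ext (cod c) (wedge \<omega> \<eta> c)" if "c \<in> atlas X" for c
    unfolding wedge_def using that by (intro smooth_ext_wedge chart(2) formsD(3) assms)
  show "wedge \<omega> \<eta> c u = pull_ext (locrep c c' id) (wedge \<omega> \<eta> c') u"
    if "c \<in> atlas X" "c' \<in> atlas X" "u \<in> locdom c c' id" for c c' u
    using formsD(4)[OF assms(1) that] formsD(4)[OF assms(2) that]
    by (simp add: wedge_def pull_ext_def ext_wedge_pull)
qed (use formsD(1,2)[OF assms(1)] formsD(1,2)[OF assms(2)] in \<open>auto simp: wedge_def alternating_wedge\<close>)

lemma unit_form_forms: "unit_form X \<in> forms X"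
proof (rule formsI)
  show "smooth_ext (cod c) (unit_form X c)" if "c \<in> atlas X" for c
    unfolding smooth_ext_def
  proof
    show "smooth_on (cod c) (\<lambda>u. unit_form X c u vs)" for vs
      by (rule smooth_on_cong[OF chart(2)[OF that] smooth_on_const]) (simp add: unit_form_def that)
  qed
  show "unit_form X c u = pull_ext (locrep c c' id) (unit_form X c') u"
    if "c \<in> atlas X" "c' \<in> atlas X" "u \<in> locdom c c' id" for c c' u
    using that id.rep_cod[OF that(1,3)] in_locdom[OF that(1), of u c' id]
    by (simp add: unit_form_def pull_ext_def ext_pull_def ext_one_def fun_eq_iff)
qed (auto simp: unit_form_def alternating_one)

text \<open>Multiplication by the parity of the degree.\<close>

definition sgn_form :: "('a, 'e) form \<Rightarrow> ('a, 'e) form" where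
  "sgn_form \<omega> = (\<lambda>c u. ext_sign (\<omega> c u))"

lemma sgn_form_forms: assumes "\<omega> \<in> forms X" shows "sgn_form \<omega> \<in> forms X"
proof (rule formsI)
  show "smooth_ext (cod c) (sgn_form \<omega> c)" if "c \<in> atlas X" for c
    unfolding sgn_form_def using that by (intro smooth_ext_sign chart(2) formsD(3) assms)
  show "sgn_form \<omega> c u = pull_ext (locrep c c' id) (sgn_form \<omega> c') u"
    if "c \<in> atlas X" "c' \<in> atlas X" "u \<in> locdom c c' id" for c c' u
    using formsD(4)[OF assms that] by (simp add: sgn_form_def pull_ext_apply ext_sign_def fun_eq_iff)
qed (use formsD(1,2)[OF assms] in \<open>auto simp: sgn_form_def alternating_sign\<close>)

lemma conj_form_forms: assumes "\<omega> \<in> forms X" shows "conj_form \<omega> \<in> forms X"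
proof (rule formsI)
  show "conj_form \<omega> c u = 0" if "c \<notin> atlas X \<or> u \<notin> cod c" for c u
    using formsD(1)[OF assms that] by (simp add: conj_form_def zero_fun_apply zero_fun_def)
  show "alternating (conj_form \<omega> c u)" if "c \<in> atlas X" "u \<in> cod c" for c u
    using formsD(2)[OF assms that]
    by (auto simp: conj_form_def alternating_def linear_iff)
  show "smooth_ext (cod c) (conj_form \<omega> c)" if "c \<in> atlas X" for c
    using formsD(3)[OF assms that] chart(2)[OF that]
    by (simp add: conj_form_def smooth_ext_def smooth_on_bounded_linear[OF bounded_linear_cnj])
  show "conj_form \<omega> c u = pull_ext (locrep c c' id) (conj_form \<omega> c') u"
    if "c \<in> atlas X" "c' \<in> atlas X" "u \<in> locdom c c' id" for c c' u
    using formsD(4)[OF assms that] by (simp add: conj_form_def pull_ext_apply fun_eq_iff)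
qed

end

context manifold_map
begin

lemma pull_outside: "c \<notin> atlas X \<or> u \<notin> cod c \<Longrightarrow> pull X Y f \<omega> c u = 0"
  by (auto simp: pull_def fun_eq_iff zero_fun_apply)

text \<open>The value of \<open>pull\<close> uses an arbitrarily chosen chart of the target. The transformation rule of
  forms shows that every chart gives the same value, and that the values fit together.\<close>

lemma pull_eq:
  assumes \<omega>: "\<omega> \<in> forms Y" and c: "c \<in> atlas X" "c' \<in> atlas Y" and u: "u \<in> locdom c c' f"
  shows "pull X Y f \<omega> c u = pull_ext (locrep c c' f) (\<omega> c') u"
proof -
  interpret c: manifold_map2 X Y Y f id by unfold_locales
  define c1 where "c1 = (SOME c1. c1 \<in> atlas Y \<and> f (param c u) \<in> fst c1)"
  have uc: "u \<in> cod c" "f (param c u) \<in> fst c'" using u X.in_locdom[OF c(1), of u c' f] by simp_all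
  then have c1: "c1 \<in> atlas Y" "f (param c u) \<in> fst c1"
    unfolding c1_def using someI[of "\<lambda>c1. c1 \<in> atlas Y \<and> f (param c u) \<in> fst c1" c'] c(2) by auto
  have u1: "u \<in> locdom c c1 f" using X.in_locdom[OF c(1), of u c1 f] uc c1 by simp
  have v: "locrep c c1 f u \<in> locdom c1 c' id" using c.locdom_comp[OF c(1) c1(1) u1, of c'] u by simp
  have "pull X Y f \<omega> c u = ext_pull (fd (locrep c c1 f) u) (\<omega> c1 (locrep c c1 f u))"
    using c(1) uc(1) by (simp add: pull_def c1_def[symmetric] Let_def ext_pull_def)
  also have "\<dots> = ext_pull (fd (locrep c c1 f) u) (pull_ext (locrep c1 c' id) (\<omega> c') (locrep c c1 f u))"
    using Y.formsD(4)[OF \<omega> c1(1) c(2) v] by simp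
  also have "\<dots> = pull_ext (locrep c c' f) (\<omega> c') u"
    using c.pull_ext_comp[OF c(1) c1(1) c(2) u1, of "\<omega> c'"] u by simp
  finally show ?thesis .
qed

lemma pull_forms: assumes \<omega>: "\<omega> \<in> forms Y" shows "pull X Y f \<omega> \<in> forms X"
proof (rule X.formsI)
  show "alternating (pull X Y f \<omega> c u)" if c: "c \<in> atlas X" "u \<in> cod c" for c u
  proof -
    obtain c' where c': "c' \<in> atlas Y" "u \<in> locdom c c' f" using map_chart[OF c] .
    show ?thesis
      unfolding pull_eq[OF \<omega> c(1) c'] pull_ext_def
      by (intro alternating_pull linear_rep Y.formsD(2)[OF \<omega>] rep_cod c c')
  qed
  show "smooth_ext (cod c) (pull X Y f \<omega> c)" if c: "c \<in> atlas X" for c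
    unfolding smooth_ext_def
  proof (intro allI smooth_on_local)
    fix vs u assume "u \<in> cod c"
    from map_chart[OF c this] obtain c' where c': "c' \<in> atlas Y" "u \<in> locdom c c' f" .
    have "smooth_ext (locdom c c' f) (pull_ext (locrep c c' f) (\<omega> c'))"
      by (rule smooth_pull_ext[OF Y.basis open_dom[OF c c'(1)] Y.chart(2)[OF c'(1)] rep_cod[OF c]
            smooth_rep[OF c c'(1)] Y.formsD(3)[OF \<omega> c'(1)] Y.formsD(2)[OF \<omega> c'(1)]])
    then have "smooth_on (locdom c c' f) (\<lambda>u. pull X Y f \<omega> c u vs)"
      by (rule smooth_on_cong[OF open_dom[OF c c'(1)] smooth_extD]) (simp add: pull_eq[OF \<omega> c c'(1)])
    then show "\<exists>T. open T \<and> u \<in> T \<and> smooth_on T (\<lambda>u. pull X Y f \<omega> c u vs)"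
      using open_dom[OF c c'(1)] c'(2) by blast
  qed
  show "pull X Y f \<omega> c u = pull_ext (locrep c c' id) (pull X Y f \<omega> c') u"
    if c: "c \<in> atlas X" "c' \<in> atlas X" and u: "u \<in> locdom c c' id" for c c' u
  proof -
    interpret c: manifold_map2 X X Y id f by unfold_locales
    have uc: "u \<in> cod c" using u X.in_locdom[OF c(1), of u c' id] by simp
    obtain d where d: "d \<in> atlas Y" "u \<in> locdom c d f" using map_chart[OF c(1) uc] .
    then have v: "locrep c c' id u \<in> locdom c' d f" using c.locdom_comp[OF c u, of d] by simp
    have "pull X Y f \<omega> c u = pull_ext (locrep c d (f \<circ> id)) (\<omega> d) u" using pull_eq[OF \<omega> c(1) d] by simp
    also have "\<dots> = ext_pull (fd (locrep c c' id) u) (pull_ext (locrep c' d f) (\<omega> d) (locrep c c' id u))"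
      using d by (intro c.pull_ext_comp c u) auto
    also have "\<dots> = pull_ext (locrep c c' id) (pull X Y f \<omega> c') u"
      unfolding pull_ext_def[of "locrep c c' id"] pull_eq[OF \<omega> c(2) d(1) v] ..
    finally show ?thesis .
  qed
qed (rule pull_outside)

end

lemma (in manifold) pull_id: assumes "\<omega> \<in> forms X" shows "pull X X id \<omega> = \<omega>"
proof (rule form_eqI[OF id.pull_forms[OF assms] assms])
  fix c u assume c: "c \<in> atlas X" "u \<in> cod c"
  then have u: "u \<in> locdom c c id" using in_locdom[OF c(1), of u c id] param_in[OF c(2)] by simp
  show "pull X X id \<omega> c u = \<omega> c u" using id.pull_eq[OF assms c(1) c(1) u] formsD(4)[OF assms c(1) c(1) u] by simp
qed

lemma (in manifold_map2) pull_comp: assumes "\<omega> \<in> forms Z" shows "pull X Z (g \<circ> f) \<omega> = pull X Y f (pull Y Z g \<omega>)"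
proof (intro ext)
  fix c u vs
  show "pull X Z (g \<circ> f) \<omega> c u vs = pull X Y f (pull Y Z g \<omega>) c u vs"
  proof (cases "c \<in> atlas X \<and> u \<in> cod c")
    case True
    from f.map_chart[OF conjunct1[OF True] conjunct2[OF True]]
    obtain c' where c': "c' \<in> atlas Y" "u \<in> locdom c c' f" .
    define c2 where "c2 = (SOME c2. c2 \<in> atlas Z \<and> g (f (param c u)) \<in> fst c2)"
    obtain d where d: "d \<in> atlas Z" "locrep c c' f u \<in> locdom c' d g"
      using g.map_chart[OF c'(1) f.rep_cod[OF conjunct1[OF True] c'(2)]] .
    then have "g (f (param c u)) \<in> fst d"
      using f.Y.in_locdom[OF c'(1), of "locrep c c' f u" d g] f.param_rep[of c c' u] True c' by simp
    then have c2: "c2 \<in> atlas Z" "g (f (param c u)) \<in> fst c2"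
      unfolding c2_def using someI[of "\<lambda>c2. c2 \<in> atlas Z \<and> g (f (param c u)) \<in> fst c2" d] d(1) by auto
    have u2: "u \<in> locdom c c2 (g \<circ> f)" using f.X.in_locdom[of c u c2 "g \<circ> f"] True c2 by simp
    then have v: "locrep c c' f u \<in> locdom c' c2 g" using locdom_comp[of c c' u c2] True c' by simp
    have "pull X Z (g \<circ> f) \<omega> c u = pull_ext (locrep c c2 (g \<circ> f)) (\<omega> c2) u"
      using True by (simp add: pull_def c2_def[symmetric] Let_def pull_ext_def ext_pull_def)
    also have "\<dots> = ext_pull (fd (locrep c c' f) u) (pull_ext (locrep c' c2 g) (\<omega> c2) (locrep c c' f u))"
      using True c' c2 u2 by (intro pull_ext_comp) auto
    also have "\<dots> = pull_ext (locrep c c' f) (pull Y Z g \<omega> c') u"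
      unfolding pull_ext_def[of "locrep c c' f"] g.pull_eq[OF assms c'(1) c2(1) v] ..
    also have "\<dots> = pull X Y f (pull Y Z g \<omega>) c u"
      using True c' by (intro f.pull_eq[symmetric] g.pull_forms assms) auto
    finally show ?thesis by simp
  qed (auto simp: pull_def)
qed

subsection \<open>The exterior derivative of forms\<close>

context manifold
begin

lemma ext_diff_eq: "c \<in> atlas X \<Longrightarrow> u \<in> cod c \<Longrightarrow> ext_diff X \<omega> c u = ext_d (\<omega> c) u"
  by (simp add: ext_diff_def)

lemma ext_diff_forms: assumes \<omega>: "\<omega> \<in> forms X" shows "ext_diff X \<omega> \<in> forms X"
proof (rule formsI)
  show "ext_diff X \<omega> c u = 0" if "c \<notin> atlas X \<or> u \<notin> cod c" for c u using that by (auto simp: ext_diff_def)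
  show "alternating (ext_diff X \<omega> c u)" if "c \<in> atlas X" "u \<in> cod c" for c u
    unfolding ext_diff_eq[OF that] using that by (intro alternating_ext_d[of "cod c"] chart(2) formsD[OF \<omega>])
  show "smooth_ext (cod c) (ext_diff X \<omega> c)" if "c \<in> atlas X" for c
  proof -
    have "smooth_ext (cod c) (ext_d (\<omega> c))" by (rule smooth_ext_d[OF chart(2)[OF that] formsD(3)[OF \<omega> that]])
    then show ?thesis
      unfolding smooth_ext_def
      using smooth_on_cong[OF chart(2)[OF that], of "\<lambda>u. ext_d (\<omega> c) u vs" "\<lambda>u. ext_diff X \<omega> c u vs" for vs]
      by (simp add: ext_diff_eq[OF that])
  qed
  show "ext_diff X \<omega> c u = pull_ext (locrep c c' id) (ext_diff X \<omega> c') u"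
    if c: "c \<in> atlas X" "c' \<in> atlas X" and u: "u \<in> locdom c c' id" for c c' u
  proof -
    have uc: "u \<in> cod c" using u in_locdom[OF c(1), of u c' id] by simp
    have "ext_diff X \<omega> c u = ext_d (\<omega> c) u" by (rule ext_diff_eq[OF c(1) uc])
    also have "\<dots> = ext_d (pull_ext (locrep c c' id) (\<omega> c')) u"
      by (rule ext_d_cong[OF id.open_dom[OF c] u formsD(4)[OF \<omega> c]])
    also have "\<dots> = pull_ext (locrep c c' id) (ext_d (\<omega> c')) u"
      by (rule ext_d_pull[OF basis id.open_dom[OF c] chart(2)[OF c(2)] id.rep_cod[OF c(1)] id.smooth_rep[OF c]
            formsD(3)[OF \<omega> c(2)] formsD(2)[OF \<omega> c(2)] u])
    also have "\<dots> = pull_ext (locrep c c' id) (ext_diff X \<omega> c') u"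
      unfolding pull_ext_def ext_diff_eq[OF c(2) id.rep_cod[OF c(1) u]] ..
    finally show ?thesis .
  qed
qed

lemma lin_ext_diff: "lin_on (forms X) (ext_diff X)"
  unfolding lin_on_def
proof (intro conjI ballI allI)
  fix \<omega> \<eta> assume \<omega>: "\<omega> \<in> forms X" and \<eta>: "\<eta> \<in> forms X"
  have "ext_diff X (\<omega> + \<eta>) c u = (ext_diff X \<omega> + ext_diff X \<eta>) c u" if "c \<in> atlas X" "u \<in> cod c" for c u
    using ext_d_add[OF formsD(3)[OF \<omega> that(1)] formsD(3)[OF \<eta> that(1)] that(2)]
    by (simp add: ext_diff_eq[OF that] form_apply)
      (simp add: plus_fun_def)
  then show "ext_diff X (\<omega> + \<eta>) = ext_diff X \<omega> + ext_diff X \<eta>"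
    using \<omega> \<eta> by (intro form_eqI ext_diff_forms cv.subspace_add[OF forms_subspace])
next
  fix a \<omega> assume \<omega>: "\<omega> \<in> forms X"
  have "ext_diff X (a *\<^sub>C \<omega>) c u = (a *\<^sub>C ext_diff X \<omega>) c u" if "c \<in> atlas X" "u \<in> cod c" for c u
    using ext_d_cscale[OF formsD(3)[OF \<omega> that(1)] that(2)]
    by (simp add: ext_diff_eq[OF that] form_apply) (simp add: cscale_fun_def)
  then show "ext_diff X (a *\<^sub>C \<omega>) = a *\<^sub>C ext_diff X \<omega>"
    using \<omega> by (intro form_eqI ext_diff_forms cv.subspace_scale[OF forms_subspace])
qed

lemma ext_diff_ext_diff: assumes \<omega>: "\<omega> \<in> forms X" shows "ext_diff X (ext_diff X \<omega>) = 0"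
proof (rule form_eqI[OF ext_diff_forms[OF ext_diff_forms[OF \<omega>]] cv.subspace_0[OF forms_subspace]])
  fix c u assume c: "c \<in> atlas X" "u \<in> cod c"
  have "ext_diff X (ext_diff X \<omega>) c u = ext_d (ext_d (\<omega> c)) u"
    unfolding ext_diff_eq[OF c] by (rule ext_d_cong[OF chart(2)[OF c(1)] c(2) ext_diff_eq[OF c(1)]])
  then show "ext_diff X (ext_diff X \<omega>) c u = 0 c u"
    using ext_d_ext_d[OF chart(2)[OF c(1)] formsD(3)[OF \<omega> c(1)] c(2)]
    by (simp add: fun_eq_iff zero_fun_apply)
qed

lemma ext_diff_wedge:
  assumes \<omega>: "\<omega> \<in> forms X" and \<eta>: "\<eta> \<in> forms X"
  shows "ext_diff X (wedge \<omega> \<eta>) = wedge (ext_diff X \<omega>) \<eta> + wedge (sgn_form \<omega>) (ext_diff X \<eta>)"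
proof (rule form_eqI)
  show "ext_diff X (wedge \<omega> \<eta>) \<in> forms X"
    "wedge (ext_diff X \<omega>) \<eta> + wedge (sgn_form \<omega>) (ext_diff X \<eta>) \<in> forms X"
    using \<omega> \<eta> by (simp_all add: ext_diff_forms wedge_forms cv.subspace_add[OF forms_subspace] sgn_form_forms)
  fix c u assume c: "c \<in> atlas X" "u \<in> cod c"
  show "ext_diff X (wedge \<omega> \<eta>) c u = (wedge (ext_diff X \<omega>) \<eta> + wedge (sgn_form \<omega>) (ext_diff X \<eta>)) c u"
    using ext_d_wedge[OF chart(2)[OF c(1)] c(2) formsD(3)[OF \<omega> c(1)] formsD(3)[OF \<eta> c(1)]]
    by (simp add: ext_diff_eq[OF c] form_apply wedge_def sgn_form_def)
qed

lemma ext_diff_sgn: assumes \<omega>: "\<omega> \<in> forms X" shows "ext_diff X (sgn_form \<omega>) = - sgn_form (ext_diff X \<omega>)"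
proof (rule form_eqI)
  show "ext_diff X (sgn_form \<omega>) \<in> forms X" "- sgn_form (ext_diff X \<omega>) \<in> forms X"
    using \<omega> by (simp_all add: ext_diff_forms sgn_form_forms cv.subspace_neg[OF forms_subspace])
  fix c u assume c: "c \<in> atlas X" "u \<in> cod c"
  show "ext_diff X (sgn_form \<omega>) c u = (- sgn_form (ext_diff X \<omega>)) c u"
    using ext_d_sign[OF formsD(3)[OF \<omega> c(1)] c(2)] by (simp add: ext_diff_eq[OF c] sgn_form_def)
qed

lemma conj_ext_diff: assumes \<omega>: "\<omega> \<in> forms X" shows "conj_form (ext_diff X \<omega>) = ext_diff X (conj_form \<omega>)"
proof (rule form_eqI[OF conj_form_forms[OF ext_diff_forms[OF \<omega>]] ext_diff_forms[OF conj_form_forms[OF \<omega>]]])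
  fix c u assume c: "c \<in> atlas X" "u \<in> cod c"
  have "fd (\<lambda>y. cnj (\<omega> c y ws)) u v = cnj (fd (\<lambda>y. \<omega> c y ws) u v)" for ws v
    by (rule fd_bounded_linear[OF bounded_linear_cnj smooth_ext_diff_at[OF formsD(3)[OF \<omega> c(1)] c(2)]])
  then show "conj_form (ext_diff X \<omega>) c u = ext_diff X (conj_form \<omega>) c u"
    by (simp add: conj_form_def ext_diff_eq[OF c] ext_d_def fun_eq_iff)
qed

end

lemma (in manifold_map) pull_ext_diff:
  assumes \<omega>: "\<omega> \<in> forms Y" shows "pull X Y f (ext_diff Y \<omega>) = ext_diff X (pull X Y f \<omega>)"
proof (rule X.form_eqI)
  show "pull X Y f (ext_diff Y \<omega>) \<in> forms X" "ext_diff X (pull X Y f \<omega>) \<in> forms X"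
    using \<omega> by (simp_all add: pull_forms Y.ext_diff_forms X.ext_diff_forms)
  fix c u assume c: "c \<in> atlas X" "u \<in> cod c"
  obtain c' where c': "c' \<in> atlas Y" "u \<in> locdom c c' f" using map_chart[OF c] .
  have "ext_diff X (pull X Y f \<omega>) c u = ext_d (pull_ext (locrep c c' f) (\<omega> c')) u"
    unfolding X.ext_diff_eq[OF c]
    by (rule ext_d_cong[OF open_dom[OF c(1) c'(1)] c'(2) pull_eq[OF \<omega> c(1) c'(1)]])
  also have "\<dots> = pull_ext (locrep c c' f) (ext_d (\<omega> c')) u"
    by (rule ext_d_pull[OF Y.basis open_dom[OF c(1) c'(1)] Y.chart(2)[OF c'(1)] rep_cod[OF c(1)]
          smooth_rep[OF c(1) c'(1)] Y.formsD(3)[OF \<omega> c'(1)] Y.formsD(2)[OF \<omega> c'(1)] c'(2)])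
  also have "\<dots> = pull_ext (locrep c c' f) (ext_diff Y \<omega> c') u"
    unfolding pull_ext_def Y.ext_diff_eq[OF c'(1) rep_cod[OF c(1) c'(2)]] ..
  also have "\<dots> = pull X Y f (ext_diff Y \<omega>) c u"
    by (rule pull_eq[OF Y.ext_diff_forms[OF \<omega>] c(1) c', symmetric])
  finally show "pull X Y f (ext_diff Y \<omega>) c u = ext_diff X (pull X Y f \<omega>) c u" by simp
qed



section \<open>The bigrading and the components of the exterior derivative\<close>

text \<open>The components of a form. These agree with \<open>component\<close>, which is defined by a description, on all forms (see \<open>component_eq\<close>).\<close>

definition cpt :: "('a, 'e::real_inner) acm \<Rightarrow> int \<times> int \<Rightarrow> ('a, 'e) form \<Rightarrow> ('a, 'e) form" where
  "cpt X i \<omega> = (\<lambda>c u. proj_pq (acs X c u) (fst i) (snd i) (\<omega> c u))"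

definition dgr :: "int \<Rightarrow> ('a, 'e) form \<Rightarrow> ('a, 'e) form" where
  "dgr k \<omega> = (\<lambda>c u vs. if int (length vs) = k then \<omega> c u vs else 0)"

definition bidegrees :: "(int \<times> int) set" where
  "bidegrees = {(-1, 2), (0, 1), (1, 0), (2, -1)}"

abbreviation Dp :: "('a, 'e::real_inner) acm \<Rightarrow> int \<times> int \<Rightarrow> ('a, 'e) form \<Rightarrow> ('a, 'e) form" where
  "Dp X \<delta> \<equiv> d_part X (fst \<delta>) (snd \<delta>)"

lemma finite_bidegrees: "finite bidegrees" by (simp add: bidegrees_def)

text \<open>Identities between additive maps need only be checked on homogeneous elements.\<close>

lemma splits_ext:
  assumes s: "splits V P" and F: "add_on V F" and G: "add_on V G"
    and eq: "\<And>i x. x \<in> V \<Longrightarrow> P i x = x \<Longrightarrow> F x = G x" and x: "x \<in> V"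
  shows "F x = G x"
proof -
  let ?T = "{i. P i x \<noteq> 0}"
  have "F (\<Sum>i\<in>?T. P i x) = G (\<Sum>i\<in>?T. P i x)"
    using splits_closed[OF s x] splits_proj[OF s x] eq
    by (simp add: add_on_sum[OF F splits_subspace[OF s]] add_on_sum[OF G splits_subspace[OF s]])
  then show ?thesis unfolding splits_sum[OF s x] .
qed

locale almost_complex =
  fixes X :: "('a, 'e::real_inner) acm"
  assumes almost_complex: "almost_complex_manifold X"

sublocale almost_complex \<subseteq> manifold X
  using almost_complex by unfold_locales (simp add: almost_complex_manifold_def)

context almost_complex
begin

lemma acs_chart:
  assumes "c \<in> atlas X"
  shows "smooth_on (cod c) (\<lambda>u. acs X c u v)" "u \<in> cod c \<Longrightarrow> linear (acs X c u)"
    "u \<in> cod c \<Longrightarrow> acs X c u (acs X c u v) = - v"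
  using almost_complex assms unfolding almost_complex_manifold_def by blast+

lemma acs_transition:
  assumes "c \<in> atlas X" "c' \<in> atlas X" "u \<in> locdom c c' id"
  shows "fd (locrep c c' id) u (acs X c u v) = acs X c' (locrep c c' id u) (fd (locrep c c' id) u v)"
  using almost_complex assms unfolding almost_complex_manifold_def by blast

lemma cpt_in:
  assumes \<omega>: "\<omega> \<in> forms X" and c: "c \<in> atlas X" "u \<in> cod c"
  shows "cpt X i \<omega> c u \<in> ext_pq (acs X c u) (fst i) (snd i)"
  unfolding cpt_def by (rule proj_pq_in[OF basis acs_chart(2,3)[OF c] formsD(2)[OF \<omega> c]])

lemma cpt_forms: assumes \<omega>: "\<omega> \<in> forms X" shows "cpt X i \<omega> \<in> forms X"
proof (rule formsI)
  show "cpt X i \<omega> c u = 0" if "c \<notin> atlas X \<or> u \<notin> cod c" for c u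
    using formsD(1)[OF \<omega> that] by (simp add: cpt_def proj_pq_0)
  show "alternating (cpt X i \<omega> c u)" if "c \<in> atlas X" "u \<in> cod c" for c u
    using ext_pq_weight[OF cpt_in[OF \<omega> that]] by blast
  show "smooth_ext (cod c) (cpt X i \<omega> c)" if c: "c \<in> atlas X" for c
    unfolding cpt_def
    by (rule smooth_ext_proj_pq[OF basis chart(2)[OF c] acs_chart[OF c] formsD(3)[OF \<omega> c] formsD(2)[OF \<omega> c]])
  show "cpt X i \<omega> c u = pull_ext (locrep c c' id) (cpt X i \<omega> c') u"
    if c: "c \<in> atlas X" "c' \<in> atlas X" "u \<in> locdom c c' id" for c c' u
    unfolding cpt_def formsD(4)[OF \<omega> c] pull_ext_def
    by (rule proj_pq_pull, rule id.linear_rep[OF c], rule acs_transition[OF c])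
qed

lemma form_pq_iff: "\<omega> \<in> form_pq X i \<longleftrightarrow> \<omega> \<in> forms X \<and> cpt X i \<omega> = \<omega>"
proof (safe)
  assume \<omega>: "\<omega> \<in> form_pq X i"
  then show f: "\<omega> \<in> forms X" by (auto simp: form_pq_def split: prod.splits)
  show "cpt X i \<omega> = \<omega>"
  proof (rule form_eqI[OF cpt_forms[OF f] f])
    fix c u assume "c \<in> atlas X" "u \<in> cod c"
    then have "\<omega> c u \<in> ext_pq (acs X c u) (fst i) (snd i)" using \<omega> by (auto simp: form_pq_def split: prod.splits)
    then show "cpt X i \<omega> c u = \<omega> c u" by (simp add: cpt_def proj_pq_ext_pq)
  qed
next
  assume f: "\<omega> \<in> forms X" "cpt X i \<omega> = \<omega>"
  then have "\<omega> c u \<in> ext_pq (acs X c u) (fst i) (snd i)" if "c \<in> atlas X" "u \<in> cod c" for c u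
    using cpt_in[OF f(1) that, of i] by simp
  then show "\<omega> \<in> form_pq X i" using f(1) by (auto simp: form_pq_def split: prod.splits)
qed

lemma form_above_dim:
  assumes "\<omega> \<in> forms X" "card basis < length vs" shows "\<omega> c u vs = 0"
proof (cases "c \<in> atlas X \<and> u \<in> cod c")
  case True
  then show ?thesis using alternating_above_dim[OF basis formsD(2)[OF assms(1)] assms(2)] by blast
next
  case False
  then show ?thesis using formsD(1)[OF assms(1), of c u] by (simp add: zero_fun_apply)
qed

lemma form_length: "\<omega> \<in> forms X \<Longrightarrow> \<omega> c u vs \<noteq> 0 \<Longrightarrow> length vs \<le> card basis"
  using form_above_dim by (metis not_less)

lemma cpt_add: "cpt X i (\<omega> + \<eta>) = cpt X i \<omega> + cpt X i \<eta>"
  by (simp add: cpt_def fun_eq_iff form_apply proj_pq_add)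

lemma cpt_cscale: "cpt X i (a *\<^sub>C \<omega>) = a *\<^sub>C cpt X i \<omega>"
  by (simp add: cpt_def fun_eq_iff form_apply proj_pq_cscale)

lemma cpt_0: "cpt X i 0 = 0"
  by (simp add: cpt_def fun_eq_iff form_apply proj_pq_0)

lemma cpt_support:
  assumes \<omega>: "\<omega> \<in> forms X" shows "{i. cpt X i \<omega> \<noteq> 0} \<subseteq> {0..int (card basis)} \<times> {0..int (card basis)}"
proof
  fix i assume "i \<in> {i. cpt X i \<omega> \<noteq> 0}"
  then obtain c u vs where nz: "cpt X i \<omega> c u vs \<noteq> 0" by (force simp: fun_eq_iff zero_fun_apply)
  then have "0 \<le> fst i" "0 \<le> snd i" "int (length vs) = fst i + snd i"
    by (auto simp: cpt_def proj_pq_def split: if_splits)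
  moreover have "length vs \<le> card basis" by (rule form_length[OF cpt_forms[OF \<omega>] nz])
  ultimately show "i \<in> {0..int (card basis)} \<times> {0..int (card basis)}" by (cases i) auto
qed

lemma sum_cpt_eval:
  assumes \<omega>: "\<omega> \<in> forms X" and c: "c \<in> atlas X" "u \<in> cod c"
  shows "(\<Sum>p\<le>length vs. cpt X (int p, int (length vs) - int p) \<omega> c u vs) = \<omega> c u vs"
  unfolding cpt_def fst_conv snd_conv by (rule sum_proj_pq[OF basis acs_chart(2,3)[OF c] formsD(2)[OF \<omega> c]])

text \<open>Components vanish outside a square that depends on the dimension only, so a
  pointwise decomposition is a decomposition of forms.\<close>

lemma splits_cpt: "splits (forms X) (cpt X)"
  unfolding splits_def
proof (intro conjI allI ballI forms_subspace cpt_forms)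
  show "lin_on (forms X) (cpt X i)" for i by (simp add: lin_on_def cpt_add cpt_cscale)
  show "cpt X i (cpt X j \<omega>) = (if i = j then cpt X j \<omega> else 0)" if \<omega>: "\<omega> \<in> forms X" for i j \<omega>
  proof (rule form_eqI)
    show "cpt X i (cpt X j \<omega>) \<in> forms X" "(if i = j then cpt X j \<omega> else 0) \<in> forms X"
      using \<omega> by (simp_all add: cpt_forms cv.subspace_0[OF forms_subspace])
    fix c u assume c: "c \<in> atlas X" "u \<in> cod c"
    show "cpt X i (cpt X j \<omega>) c u = (if i = j then cpt X j \<omega> else 0) c u"
      using proj_pq_ext_pq[OF cpt_in[OF \<omega> c, of j], of "fst i" "snd i"]
      by (auto simp: cpt_def[of X i] form_apply prod_eq_iff)
  qed
  fix \<omega> assume \<omega>: "\<omega> \<in> forms X"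
  let ?B = "{0..int (card basis)} \<times> {0..int (card basis)}"
  show fin: "finite {i. cpt X i \<omega> \<noteq> 0}" using finite_subset[OF cpt_support[OF \<omega>]] by simp
  have "(\<Sum>i\<in>{i. cpt X i \<omega> \<noteq> 0}. cpt X i \<omega>) = (\<Sum>i\<in>?B. cpt X i \<omega>)"
    using cpt_support[OF \<omega>] by (intro sum.mono_neutral_left) auto
  also have "\<dots> = \<omega>"
  proof (rule form_eqI[OF cv.subspace_sum[OF forms_subspace cpt_forms[OF \<omega>]] \<omega>], rule ext)
    fix c u vs assume c: "c \<in> atlas X" "u \<in> cod c"
    show "(\<Sum>i\<in>?B. cpt X i \<omega>) c u vs = \<omega> c u vs"
    proof (cases "length vs \<le> card basis")
      case len: True
      let ?g = "\<lambda>p. (int p, int (length vs) - int p)"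
      have "(\<Sum>i\<in>?B. cpt X i \<omega>) c u vs = (\<Sum>i\<in>?B. cpt X i \<omega> c u vs)"
        by (simp add: sum_form_apply sum_ext_apply)
      also have "\<dots> = (\<Sum>i\<in>?g ` {..length vs}. cpt X i \<omega> c u vs)"
      proof (rule sum.mono_neutral_right)
        show "\<forall>i\<in>?B - ?g ` {..length vs}. cpt X i \<omega> c u vs = 0"
        proof
          fix i assume i: "i \<in> ?B - ?g ` {..length vs}"
          show "cpt X i \<omega> c u vs = 0"
          proof (rule ccontr)
            assume "cpt X i \<omega> c u vs \<noteq> 0"
            then have "0 \<le> fst i" "0 \<le> snd i" "int (length vs) = fst i + snd i"
              by (auto simp: cpt_def proj_pq_def split: if_splits)
            then have "i = ?g (nat (fst i))" "nat (fst i) \<le> length vs" by (auto simp: prod_eq_iff)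
            then show False using i by blast
          qed
        qed
      qed (use len in auto)
      also have "\<dots> = (\<Sum>p\<le>length vs. cpt X (?g p) \<omega> c u vs)"
        by (subst sum.reindex) (auto simp: inj_on_def)
      also have "\<dots> = \<omega> c u vs" by (rule sum_cpt_eval[OF \<omega> c])
      finally show ?thesis .
    next
      case False
      have "(\<Sum>i\<in>?B. cpt X i \<omega>) \<in> forms X" by (rule cv.subspace_sum[OF forms_subspace cpt_forms[OF \<omega>]])
      then show ?thesis using form_length[of "\<Sum>i\<in>?B. cpt X i \<omega>" c u vs] form_length[OF \<omega>, of c u vs] False by metis
    qed
  qed
  finally show "(\<Sum>i\<in>{i. cpt X i \<omega> \<noteq> 0}. cpt X i \<omega>) = \<omega>" .
qed

lemmas cpt_eqI = splits_eqI[OF splits_cpt]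
lemmas cpt_cpt = splits_proj[OF splits_cpt]
lemmas cpt_diff = add_on_diff[OF splits_add_on[OF splits_cpt] forms_subspace]
lemmas cpt_sum = add_on_sum[OF splits_add_on[OF splits_cpt] forms_subspace]

lemma component_eq: assumes \<omega>: "\<omega> \<in> forms X" shows "component X i \<omega> = cpt X i \<omega>"
proof -
  have "(THE \<eta>. (\<forall>i. \<eta> i \<in> form_pq X i) \<and> finite {i. \<eta> i \<noteq> 0} \<and> \<omega> = (\<Sum>i\<in>{i. \<eta> i \<noteq> 0}. \<eta> i)) = (\<lambda>i. cpt X i \<omega>)"
  proof (rule the_equality)
    have "cpt X i \<omega> \<in> form_pq X i" for i
      unfolding form_pq_iff using cpt_forms[OF \<omega>] cpt_cpt[OF \<omega>, of i i] by simp
    then show "(\<forall>i. cpt X i \<omega> \<in> form_pq X i) \<and> finite {i. cpt X i \<omega> \<noteq> 0} \<and> \<omega> = (\<Sum>i\<in>{i. cpt X i \<omega> \<noteq> 0}. cpt X i \<omega>)"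
      using splits_finite[OF splits_cpt \<omega>] splits_sum[OF splits_cpt \<omega>] by (intro conjI allI) auto
    fix \<eta> assume \<eta>: "(\<forall>i. \<eta> i \<in> form_pq X i) \<and> finite {i. \<eta> i \<noteq> 0} \<and> \<omega> = (\<Sum>i\<in>{i. \<eta> i \<noteq> 0}. \<eta> i)"
    then have "cpt X j \<omega> = (if j \<in> {i. \<eta> i \<noteq> 0} then \<eta> j else 0)" for j
      using splits_of_pieces[OF splits_cpt, of "{i. \<eta> i \<noteq> 0}" \<eta> j] form_pq_iff by auto
    then show "\<eta> = (\<lambda>i. cpt X i \<omega>)" by (auto simp: fun_eq_iff)
  qed
  then show ?thesis unfolding component_def by simp
qed

subsection \<open>The four components\<close>

lemma ext_diff_add_on: "add_on (forms X) (ext_diff X)"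
  by (rule lin_on_add_on[OF lin_ext_diff])

lemma d_part_sum:
  assumes \<omega>: "\<omega> \<in> forms X" and T: "finite T" "{i. cpt X i \<omega> \<noteq> 0} \<subseteq> T"
  shows "Dp X \<delta> \<omega> = (\<Sum>i\<in>T. cpt X (i + \<delta>) (ext_diff X (cpt X i \<omega>)))"
proof -
  have "Dp X \<delta> \<omega> = (\<Sum>i\<in>{i. cpt X i \<omega> \<noteq> 0}. cpt X (i + \<delta>) (ext_diff X (cpt X i \<omega>)))"
    unfolding d_part_def component_eq[OF \<omega>]
    by (intro sum.cong refl) (auto simp: component_eq ext_diff_forms cpt_forms \<omega> plus_prod_def)
  also have "\<dots> = (\<Sum>i\<in>T. cpt X (i + \<delta>) (ext_diff X (cpt X i \<omega>)))"
    using T add_on_0[OF ext_diff_add_on forms_subspace] by (intro sum.mono_neutral_left) (auto simp: cpt_0)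
  finally show ?thesis .
qed

lemma Dp_forms: assumes \<omega>: "\<omega> \<in> forms X" shows "Dp X \<delta> \<omega> \<in> forms X"
  unfolding d_part_sum[OF \<omega> splits_finite[OF splits_cpt \<omega>] subset_refl]
  by (intro cv.subspace_sum[OF forms_subspace] cpt_forms ext_diff_forms \<omega>)

lemma cpt_Dp: assumes \<omega>: "\<omega> \<in> forms X" shows "cpt X i (Dp X \<delta> \<omega>) = cpt X i (ext_diff X (cpt X (i - \<delta>) \<omega>))"
proof -
  let ?T = "insert (i - \<delta>) {i. cpt X i \<omega> \<noteq> 0}"
  have "finite ?T" using splits_finite[OF splits_cpt \<omega>] by simp
  note T = d_part_sum[OF \<omega> this]
  have f: "cpt X (j + \<delta>) (ext_diff X (cpt X j \<omega>)) \<in> forms X" for j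
    by (intro cpt_forms ext_diff_forms \<omega>)
  have "cpt X i (Dp X \<delta> \<omega>) = (\<Sum>j\<in>?T. cpt X i (cpt X (j + \<delta>) (ext_diff X (cpt X j \<omega>))))"
    by (subst T) (auto intro!: cpt_sum f)
  also have "\<dots> = (\<Sum>j\<in>?T. if j = i - \<delta> then cpt X i (ext_diff X (cpt X (i - \<delta>) \<omega>)) else 0)"
  proof (intro sum.cong refl)
    fix j
    have "i = j + \<delta> \<longleftrightarrow> j = i - \<delta>" by (auto simp: algebra_simps)
    then show "cpt X i (cpt X (j + \<delta>) (ext_diff X (cpt X j \<omega>))) =
        (if j = i - \<delta> then cpt X i (ext_diff X (cpt X (i - \<delta>) \<omega>)) else 0)"
      using cpt_cpt[OF ext_diff_forms[OF cpt_forms[OF \<omega>]], of i "j + \<delta>" j] by auto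
  qed
  also have "\<dots> = cpt X i (ext_diff X (cpt X (i - \<delta>) \<omega>))"
    using splits_finite[OF splits_cpt \<omega>] by simp
  finally show ?thesis .
qed

lemma lin_Dp: "lin_on (forms X) (Dp X \<delta>)"
  unfolding lin_on_def
proof (intro conjI ballI allI)
  note d = add_onD[OF ext_diff_add_on] lin_on_scale[OF lin_ext_diff]
  fix \<omega> \<eta> assume \<omega>: "\<omega> \<in> forms X" and \<eta>: "\<eta> \<in> forms X"
  note f = cv.subspace_add[OF forms_subspace \<omega> \<eta>] Dp_forms[OF \<omega>] Dp_forms[OF \<eta>]
  show "Dp X \<delta> (\<omega> + \<eta>) = Dp X \<delta> \<omega> + Dp X \<delta> \<eta>"
  proof (rule cpt_eqI)
    show "Dp X \<delta> (\<omega> + \<eta>) \<in> forms X" "Dp X \<delta> \<omega> + Dp X \<delta> \<eta> \<in> forms X"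
      using f by (auto intro: Dp_forms cv.subspace_add[OF forms_subspace])
    show "cpt X i (Dp X \<delta> (\<omega> + \<eta>)) = cpt X i (Dp X \<delta> \<omega> + Dp X \<delta> \<eta>)" for i
      unfolding cpt_Dp[OF f(1)] cpt_add cpt_Dp[OF \<omega>] cpt_Dp[OF \<eta>]
      by (simp only: d(1)[OF cpt_forms[OF \<omega>] cpt_forms[OF \<eta>]] cpt_add)
  qed
next
  fix a \<omega> assume \<omega>: "\<omega> \<in> forms X"
  note f = cv.subspace_scale[OF forms_subspace \<omega>]
  show "Dp X \<delta> (a *\<^sub>C \<omega>) = a *\<^sub>C Dp X \<delta> \<omega>"
  proof (rule cpt_eqI)
    show "Dp X \<delta> (a *\<^sub>C \<omega>) \<in> forms X" "a *\<^sub>C Dp X \<delta> \<omega> \<in> forms X"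
      using f \<omega> by (auto intro: Dp_forms cv.subspace_scale[OF forms_subspace])
    show "cpt X i (Dp X \<delta> (a *\<^sub>C \<omega>)) = cpt X i (a *\<^sub>C Dp X \<delta> \<omega>)" for i
      unfolding cpt_Dp[OF f] cpt_cscale cpt_Dp[OF \<omega>]
      by (simp only: lin_on_scale[OF lin_ext_diff cpt_forms[OF \<omega>]] cpt_cscale)
  qed
qed

lemma Dp_cpt: assumes \<omega>: "\<omega> \<in> forms X" shows "cpt X (i + \<delta>) (Dp X \<delta> \<omega>) = Dp X \<delta> (cpt X i \<omega>)"
proof (rule cpt_eqI)
  show "cpt X (i + \<delta>) (Dp X \<delta> \<omega>) \<in> forms X" "Dp X \<delta> (cpt X i \<omega>) \<in> forms X"
    by (intro cpt_forms Dp_forms \<omega>)+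
  fix j
  have e: "j = i + \<delta> \<longleftrightarrow> j - \<delta> = i" by (auto simp: algebra_simps)
  have z: "cpt X j (ext_diff X 0) = 0" using add_on_0[OF ext_diff_add_on forms_subspace] by (simp add: cpt_0)
  have "cpt X j (cpt X (i + \<delta>) (Dp X \<delta> \<omega>)) = (if j = i + \<delta> then cpt X j (Dp X \<delta> \<omega>) else 0)"
    using cpt_cpt[OF Dp_forms[OF \<omega>], of j "i + \<delta>" \<delta>] by simp
  then show "cpt X j (cpt X (i + \<delta>) (Dp X \<delta> \<omega>)) = cpt X j (Dp X \<delta> (cpt X i \<omega>))"
    using z by (auto simp: cpt_Dp[OF \<omega>] cpt_Dp[OF cpt_forms[OF \<omega>]] cpt_cpt[OF \<omega>] e)
qed

lemma Dp_pure: "\<omega> \<in> forms X \<Longrightarrow> cpt X i \<omega> = \<omega> \<Longrightarrow> Dp X \<delta> \<omega> = cpt X (i + \<delta>) (ext_diff X \<omega>)"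
  using Dp_cpt[of \<omega> i \<delta>] cpt_Dp[of \<omega> "i + \<delta>" \<delta>] by simp

lemma cpt_ext_diff_pure:
  assumes \<omega>: "\<omega> \<in> forms X" and j: "j - i \<notin> bidegrees"
  shows "cpt X j (ext_diff X (cpt X i \<omega>)) = 0"
proof (rule form_eqI[OF cpt_forms[OF ext_diff_forms[OF cpt_forms[OF \<omega>]]] cv.subspace_0[OF forms_subspace]])
  note f = cpt_forms[OF \<omega>, of i]
  fix c u assume c: "c \<in> atlas X" "u \<in> cod c"
  have r: "(fst j, snd j) \<notin> {(fst i - 1, snd i + 2), (fst i, snd i + 1), (fst i + 1, snd i), (fst i + 2, snd i - 1)}"
    using j by (cases i; cases j) (auto simp: bidegrees_def minus_prod_def)
  have "proj_pq (acs X c u) (fst j) (snd j) (ext_d (cpt X i \<omega> c) u) = 0"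
    by (rule proj_pq_ext_d[OF basis chart(2)[OF c(1)] acs_chart[OF c(1)] formsD(3)[OF f c(1)] formsD(2)[OF f c(1)]
          cpt_in[OF \<omega> c(1)] c(2) r])
  then show "cpt X j (ext_diff X (cpt X i \<omega>)) c u = 0 c u"
    by (simp add: cpt_def[of X j] ext_diff_eq[OF c] form_apply)
qed

text \<open>This is where it enters that \<open>d\<close> of a form of pure type has components in four bidegrees only.\<close>

lemma ext_diff_Dp: assumes \<omega>: "\<omega> \<in> forms X" shows "ext_diff X \<omega> = (\<Sum>\<delta>\<in>bidegrees. Dp X \<delta> \<omega>)"
proof (rule cpt_eqI[OF ext_diff_forms[OF \<omega>] cv.subspace_sum[OF forms_subspace Dp_forms[OF \<omega>]]])
  fix i
  let ?T = "{j. cpt X j \<omega> \<noteq> 0} \<union> (\<lambda>\<delta>. i - \<delta>) ` bidegrees"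
  have T: "finite ?T" using splits_finite[OF splits_cpt \<omega>] finite_bidegrees by simp
  have "cpt X i (ext_diff X \<omega>) = cpt X i (ext_diff X (\<Sum>j\<in>?T. cpt X j \<omega>))"
    using splits_sum_superset[OF splits_cpt \<omega> T] by simp
  also have "\<dots> = (\<Sum>j\<in>?T. cpt X i (ext_diff X (cpt X j \<omega>)))"
    by (simp only: add_on_sum[OF ext_diff_add_on forms_subspace cpt_forms[OF \<omega>]]
        cpt_sum[OF ext_diff_forms[OF cpt_forms[OF \<omega>]]])
  also have "\<dots> = (\<Sum>j\<in>(\<lambda>\<delta>. i - \<delta>) ` bidegrees. cpt X i (ext_diff X (cpt X j \<omega>)))"
  proof (rule sum.mono_neutral_right[OF T])
    show "\<forall>j\<in>?T - (\<lambda>\<delta>. i - \<delta>) ` bidegrees. cpt X i (ext_diff X (cpt X j \<omega>)) = 0"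
    proof
      fix j assume j: "j \<in> ?T - (\<lambda>\<delta>. i - \<delta>) ` bidegrees"
      have "i - j \<notin> bidegrees"
      proof
        assume "i - j \<in> bidegrees"
        then have "i - (i - j) \<in> (\<lambda>\<delta>. i - \<delta>) ` bidegrees" by (rule imageI)
        then show False using j by simp
      qed
      then show "cpt X i (ext_diff X (cpt X j \<omega>)) = 0" by (rule cpt_ext_diff_pure[OF \<omega>])
    qed
  qed simp
  also have "\<dots> = (\<Sum>\<delta>\<in>bidegrees. cpt X i (Dp X \<delta> \<omega>))"
    by (subst sum.reindex) (auto simp: inj_on_def cpt_Dp[OF \<omega>])
  also have "\<dots> = cpt X i (\<Sum>\<delta>\<in>bidegrees. Dp X \<delta> \<omega>)" by (rule cpt_sum[OF Dp_forms[OF \<omega>], symmetric])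
  finally show "cpt X i (ext_diff X \<omega>) = cpt X i (\<Sum>\<delta>\<in>bidegrees. Dp X \<delta> \<omega>)" .
qed

lemma cpt_ext_diff:
  assumes \<omega>: "\<omega> \<in> forms X"
  shows "cpt X i (ext_diff X \<omega>) = (\<Sum>\<delta>\<in>bidegrees. cpt X i (ext_diff X (cpt X (i - \<delta>) \<omega>)))"
  unfolding ext_diff_Dp[OF \<omega>] cpt_sum[OF Dp_forms[OF \<omega>]] cpt_Dp[OF \<omega>] ..

text \<open>The component of \<open>d (d x) = 0\<close> in bidegree \<open>\<sigma>\<close>, for \<open>x\<close> homogeneous.\<close>

lemma Dp_relation:
  assumes \<omega>: "\<omega> \<in> forms X"
  shows "(\<Sum>\<delta>\<in>{\<delta> \<in> bidegrees. \<sigma> - \<delta> \<in> bidegrees}. Dp X \<delta> (Dp X (\<sigma> - \<delta>) \<omega>)) = 0" (is "?S = 0")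
proof (rule cpt_eqI)
  have f: "Dp X \<delta> (Dp X \<epsilon> \<omega>) \<in> forms X" for \<delta> \<epsilon> by (intro Dp_forms \<omega>)
  show "?S \<in> forms X" by (rule cv.subspace_sum[OF forms_subspace f])
  show "0 \<in> forms X" by (rule cv.subspace_0[OF forms_subspace])
  fix i
  let ?x = "cpt X (i - \<sigma>) \<omega>"
  note x = cpt_forms[OF \<omega>, of "i - \<sigma>"]
  have "cpt X i ?S = (\<Sum>\<delta>\<in>{\<delta> \<in> bidegrees. \<sigma> - \<delta> \<in> bidegrees}. cpt X i (Dp X \<delta> (Dp X (\<sigma> - \<delta>) \<omega>)))"
    by (rule cpt_sum[OF f])
  also have "\<dots> = (\<Sum>\<delta>\<in>{\<delta> \<in> bidegrees. \<sigma> - \<delta> \<in> bidegrees}. cpt X i (ext_diff X (cpt X (i - \<delta>) (ext_diff X ?x))))"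
  proof (intro sum.cong refl)
    fix \<delta>
    have e: "i - \<delta> - (\<sigma> - \<delta>) = i - \<sigma>" by simp
    show "cpt X i (Dp X \<delta> (Dp X (\<sigma> - \<delta>) \<omega>)) = cpt X i (ext_diff X (cpt X (i - \<delta>) (ext_diff X ?x)))"
      unfolding cpt_Dp[OF Dp_forms[OF \<omega>]] cpt_Dp[OF \<omega>] e ..
  qed
  also have "\<dots> = (\<Sum>\<delta>\<in>bidegrees. cpt X i (ext_diff X (cpt X (i - \<delta>) (ext_diff X ?x))))"
  proof (rule sum.mono_neutral_left[OF finite_bidegrees])
    show "\<forall>\<delta>\<in>bidegrees - {\<delta> \<in> bidegrees. \<sigma> - \<delta> \<in> bidegrees}. cpt X i (ext_diff X (cpt X (i - \<delta>) (ext_diff X ?x))) = 0"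
    proof
      fix \<delta> assume "\<delta> \<in> bidegrees - {\<delta> \<in> bidegrees. \<sigma> - \<delta> \<in> bidegrees}"
      then have "i - \<delta> - (i - \<sigma>) \<notin> bidegrees" by simp
      then show "cpt X i (ext_diff X (cpt X (i - \<delta>) (ext_diff X ?x))) = 0"
        using cpt_ext_diff_pure[OF \<omega>] add_on_0[OF ext_diff_add_on forms_subspace] by (simp add: cpt_0)
    qed
  qed auto
  also have "\<dots> = cpt X i (ext_diff X (ext_diff X ?x))" by (rule cpt_ext_diff[OF ext_diff_forms[OF x], symmetric])
  also have "\<dots> = cpt X i 0" using ext_diff_ext_diff[OF x] by simp
  finally show "cpt X i ?S = cpt X i 0" .
qed

subsection \<open>The Leibniz rule for the components\<close>

lemma wedge_linear:
  "wedge (\<omega> + \<omega>') \<eta> = wedge \<omega> \<eta> + wedge \<omega>' \<eta>" "wedge \<omega> (\<eta> + \<eta>') = wedge \<omega> \<eta> + wedge \<omega> \<eta>'"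
  "wedge (a *\<^sub>C \<omega>) \<eta> = a *\<^sub>C wedge \<omega> \<eta>" "wedge \<omega> (a *\<^sub>C \<eta>) = a *\<^sub>C wedge \<omega> \<eta>"
  "wedge (- \<omega>) \<eta> = - wedge \<omega> \<eta>" "wedge \<omega> (- \<eta>) = - wedge \<omega> \<eta>" "wedge 0 \<eta> = 0" "wedge \<omega> 0 = 0"
  by (simp_all add: wedge_def fun_eq_iff form_apply)

lemma sgn_linear:
  "sgn_form (\<omega> + \<omega>') = sgn_form \<omega> + sgn_form \<omega>'" "sgn_form (sgn_form \<omega>) = \<omega>" "sgn_form (0 :: ('a, 'e) form) = 0"
  by (simp_all add: sgn_form_def fun_eq_iff form_apply)

lemma wedge_assoc: "wedge (wedge \<omega> \<eta>) \<zeta> = wedge \<omega> (wedge \<eta> \<zeta>)"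
  by (simp add: wedge_def ext_wedge_assoc)

lemma wedge_unit: assumes "\<omega> \<in> forms X" shows "wedge (unit_form X) \<omega> = \<omega>" "wedge \<omega> (unit_form X) = \<omega>"
proof -
  note f = wedge_forms[OF unit_form_forms assms] wedge_forms[OF assms unit_form_forms]
  show "wedge (unit_form X) \<omega> = \<omega>"
    by (rule form_eqI[OF f(1) assms]) (simp add: wedge_def unit_form_def ext_wedge_one_left)
  show "wedge \<omega> (unit_form X) = \<omega>"
    by (rule form_eqI[OF f(2) assms]) (simp add: wedge_def unit_form_def ext_wedge_one_right)
qed

lemma cpt_wedge:
  assumes \<omega>: "\<omega> \<in> form_pq X i" and \<eta>: "\<eta> \<in> form_pq X j"
  shows "wedge \<omega> \<eta> \<in> form_pq X (i + j)"
proof -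
  have "\<omega> c u \<in> ext_pq (acs X c u) (fst i) (snd i)" "\<eta> c u \<in> ext_pq (acs X c u) (fst j) (snd j)"
    if "c \<in> atlas X" "u \<in> cod c" for c u
    using \<omega> \<eta> that by (auto simp: form_pq_def split: prod.splits)
  then have "wedge \<omega> \<eta> c u \<in> ext_pq (acs X c u) (fst i + fst j) (snd i + snd j)"
    if "c \<in> atlas X" "u \<in> cod c" for c u
    unfolding wedge_def using that by (intro ext_pq_wedge[OF basis acs_chart(2,3)]) auto
  moreover have "wedge \<omega> \<eta> \<in> forms X" using wedge_forms \<omega> \<eta> by (simp add: form_pq_iff)
  ultimately show ?thesis by (cases i; cases j) (simp add: form_pq_def)
qed

lemma sgn_cpt: "cpt X i (sgn_form \<omega>) = sgn_form (cpt X i \<omega>)"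
  by (auto simp: cpt_def sgn_form_def proj_pq_def ext_sign_def fun_eq_iff Let_def sum_distrib_left mult_ac)

lemma Dp_sgn: assumes \<omega>: "\<omega> \<in> forms X" shows "Dp X \<delta> (sgn_form \<omega>) = - sgn_form (Dp X \<delta> \<omega>)"
proof (rule cpt_eqI)
  note f = Dp_forms[OF \<omega>]
  show "Dp X \<delta> (sgn_form \<omega>) \<in> forms X" "- sgn_form (Dp X \<delta> \<omega>) \<in> forms X"
    using f \<omega> by (auto intro: Dp_forms sgn_form_forms cv.subspace_neg[OF forms_subspace])
  have neg: "cpt X i (- \<eta>) = - cpt X i \<eta>" if "\<eta> \<in> forms X" for i \<eta>
    using cpt_diff[of 0 \<eta> i] that cv.subspace_0[OF forms_subspace] by (simp add: cpt_0)
  show "cpt X i (Dp X \<delta> (sgn_form \<omega>)) = cpt X i (- sgn_form (Dp X \<delta> \<omega>))" for i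
    unfolding cpt_Dp[OF sgn_form_forms[OF \<omega>]] neg[OF sgn_form_forms[OF f]] sgn_cpt cpt_Dp[OF \<omega>]
      ext_diff_sgn[OF cpt_forms[OF \<omega>]] neg[OF sgn_form_forms[OF ext_diff_forms[OF cpt_forms[OF \<omega>]]]] ..
qed

text \<open>Comparison of the components in bidegree \<open>i + j + \<delta>\<close> of the Leibniz rule for \<open>d\<close>.\<close>

lemma Dp_wedge_pure:
  assumes \<delta>: "\<delta> \<in> bidegrees" and \<omega>: "\<omega> \<in> form_pq X i" and \<eta>: "\<eta> \<in> form_pq X j"
  shows "Dp X \<delta> (wedge \<omega> \<eta>) = wedge (Dp X \<delta> \<omega>) \<eta> + wedge (sgn_form \<omega>) (Dp X \<delta> \<eta>)"
proof -
  have f: "\<omega> \<in> forms X" "\<eta> \<in> forms X" "cpt X i \<omega> = \<omega>" "cpt X j \<eta> = \<eta>" using \<omega> \<eta> by (simp_all add: form_pq_iff)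
  have D: "Dp X \<epsilon> \<zeta> \<in> form_pq X (k + \<epsilon>)" if "\<zeta> \<in> form_pq X k" for \<epsilon> \<zeta> k
    using that Dp_cpt[of \<zeta> k \<epsilon>] Dp_forms by (simp add: form_pq_iff)
  have s: "sgn_form \<omega> \<in> form_pq X i" using f sgn_form_forms by (simp add: form_pq_iff sgn_cpt)
  have wsum: "wedge (\<Sum>\<epsilon>\<in>S. \<alpha> \<epsilon>) \<beta> = (\<Sum>\<epsilon>\<in>S. wedge (\<alpha> \<epsilon>) \<beta>)" "wedge \<beta> (\<Sum>\<epsilon>\<in>S. \<alpha> \<epsilon>) = (\<Sum>\<epsilon>\<in>S. wedge \<beta> (\<alpha> \<epsilon>))"
    for S and \<alpha> :: "int \<times> int \<Rightarrow> ('a, 'e) form" and \<beta>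
    by (induction S rule: infinite_finite_induct) (simp_all add: wedge_linear)
  let ?t = "\<lambda>\<epsilon>. wedge (Dp X \<epsilon> \<omega>) \<eta> + wedge (sgn_form \<omega>) (Dp X \<epsilon> \<eta>)"
  have t: "?t \<epsilon> \<in> forms X" "cpt X (i + j + \<epsilon>) (?t \<epsilon>) = ?t \<epsilon>" for \<epsilon>
  proof -
    have "wedge (Dp X \<epsilon> \<omega>) \<eta> \<in> form_pq X (i + j + \<epsilon>)" "wedge (sgn_form \<omega>) (Dp X \<epsilon> \<eta>) \<in> form_pq X (i + j + \<epsilon>)"
      using cpt_wedge[OF D[OF \<omega>] \<eta>] cpt_wedge[OF s D[OF \<eta>]] by (simp_all add: ac_simps)
    then show "?t \<epsilon> \<in> forms X" "cpt X (i + j + \<epsilon>) (?t \<epsilon>) = ?t \<epsilon>"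
      by (simp_all add: form_pq_iff cpt_add cv.subspace_add[OF forms_subspace])
  qed
  have "ext_diff X (wedge \<omega> \<eta>) = (\<Sum>\<epsilon>\<in>bidegrees. ?t \<epsilon>)"
    unfolding ext_diff_wedge[OF f(1,2)] ext_diff_Dp[OF f(1)] ext_diff_Dp[OF f(2)] wsum by (simp only: sum.distrib)
  then have "Dp X \<delta> (wedge \<omega> \<eta>) = (\<Sum>\<epsilon>\<in>bidegrees. cpt X (i + j + \<delta>) (?t \<epsilon>))"
    using Dp_pure[of "wedge \<omega> \<eta>" "i + j" \<delta>] cpt_wedge[OF \<omega> \<eta>] cpt_sum[OF t(1)] by (simp add: form_pq_iff)
  also have "\<dots> = (\<Sum>\<epsilon>\<in>bidegrees. if \<epsilon> = \<delta> then ?t \<delta> else 0)"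
  proof (intro sum.cong refl)
    fix \<epsilon>
    show "cpt X (i + j + \<delta>) (?t \<epsilon>) = (if \<epsilon> = \<delta> then ?t \<delta> else 0)"
      using cpt_cpt[OF t(1), of "i + j + \<delta>" "i + j + \<epsilon>" \<epsilon>] t(2)[of \<epsilon>] by auto
  qed
  also have "\<dots> = ?t \<delta>" using \<delta> finite_bidegrees by simp
  finally show ?thesis .
qed

lemma Dp_wedge:
  assumes \<delta>: "\<delta> \<in> bidegrees" and \<omega>: "\<omega> \<in> forms X" and \<eta>: "\<eta> \<in> forms X"
  shows "Dp X \<delta> (wedge \<omega> \<eta>) = wedge (Dp X \<delta> \<omega>) \<eta> + wedge (sgn_form \<omega>) (Dp X \<delta> \<eta>)"
proof -
  note D = add_onD[OF lin_on_add_on[OF lin_Dp]]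
  have 1: "Dp X \<delta> (wedge \<omega>' \<eta>) = wedge (Dp X \<delta> \<omega>') \<eta> + wedge (sgn_form \<omega>') (Dp X \<delta> \<eta>)"
    if \<omega>': "\<omega>' \<in> form_pq X i" for \<omega>' i
  proof -
    have f: "\<omega>' \<in> forms X" using \<omega>' by (simp add: form_pq_iff)
    show ?thesis
    proof (rule splits_ext[OF splits_cpt _ _ _ \<eta>])
      show "add_on (forms X) (\<lambda>\<eta>. Dp X \<delta> (wedge \<omega>' \<eta>))"
        by (simp add: add_on_def wedge_linear D wedge_forms f)
      show "add_on (forms X) (\<lambda>\<eta>. wedge (Dp X \<delta> \<omega>') \<eta> + wedge (sgn_form \<omega>') (Dp X \<delta> \<eta>))"
        by (simp add: add_on_def wedge_linear D add_ac)
      show "Dp X \<delta> (wedge \<omega>' x) = wedge (Dp X \<delta> \<omega>') x + wedge (sgn_form \<omega>') (Dp X \<delta> x)"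
        if "x \<in> forms X" "cpt X i x = x" for i x
        using Dp_wedge_pure[OF \<delta> \<omega>'] that form_pq_iff by blast
    qed
  qed
  show ?thesis
  proof (rule splits_ext[OF splits_cpt _ _ _ \<omega>])
    show "add_on (forms X) (\<lambda>\<omega>. Dp X \<delta> (wedge \<omega> \<eta>))"
      by (simp add: add_on_def wedge_linear D wedge_forms \<eta>)
    show "add_on (forms X) (\<lambda>\<omega>. wedge (Dp X \<delta> \<omega>) \<eta> + wedge (sgn_form \<omega>) (Dp X \<delta> \<eta>))"
      by (simp add: add_on_def wedge_linear sgn_linear D add_ac)
    show "Dp X \<delta> (wedge x \<eta>) = wedge (Dp X \<delta> x) \<eta> + wedge (sgn_form x) (Dp X \<delta> \<eta>)"
      if "x \<in> forms X" "cpt X i x = x" for i x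
      using 1 that form_pq_iff by blast
  qed
qed

subsection \<open>Conjugation\<close>

lemma conj_cpt: "conj_form (cpt X i \<omega>) = cpt X (prod.swap i) (conj_form \<omega>)"
  by (simp add: conj_form_def cpt_def proj_pq_cnj fun_eq_iff)

lemma conj_Dp: assumes \<omega>: "\<omega> \<in> forms X" shows "conj_form (Dp X \<delta> \<omega>) = Dp X (prod.swap \<delta>) (conj_form \<omega>)"
proof (rule cpt_eqI)
  show "conj_form (Dp X \<delta> \<omega>) \<in> forms X" "Dp X (prod.swap \<delta>) (conj_form \<omega>) \<in> forms X"
    using \<omega> by (simp_all add: conj_form_forms Dp_forms del: fst_swap snd_swap)
  fix i
  have sw: "prod.swap (i - prod.swap \<delta>) = prod.swap i - \<delta>" by (simp add: prod_eq_iff)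
  have "cpt X i (conj_form (Dp X \<delta> \<omega>)) = conj_form (cpt X (prod.swap i) (Dp X \<delta> \<omega>))"
    by (simp add: conj_cpt)
  also have "\<dots> = cpt X i (ext_diff X (conj_form (cpt X (prod.swap i - \<delta>) \<omega>)))"
    by (simp add: cpt_Dp[OF \<omega>] conj_cpt conj_ext_diff[OF cpt_forms[OF \<omega>]])
  also have "\<dots> = cpt X i (Dp X (prod.swap \<delta>) (conj_form \<omega>))"
    unfolding cpt_Dp[OF conj_form_forms[OF \<omega>]] conj_cpt sw[symmetric] swap_swap ..
  finally show "cpt X i (conj_form (Dp X \<delta> \<omega>)) = cpt X i (Dp X (prod.swap \<delta>) (conj_form \<omega>))" .
qed

subsection \<open>Total degree\<close>

lemma dgr_forms: assumes \<omega>: "\<omega> \<in> forms X" shows "dgr k \<omega> \<in> forms X"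
proof (rule formsI)
  show "dgr k \<omega> c u = 0" if "c \<notin> atlas X \<or> u \<notin> cod c" for c u
    using formsD(1)[OF \<omega> that] by (simp add: dgr_def fun_eq_iff zero_fun_apply)
  show "alternating (dgr k \<omega> c u)" if "c \<in> atlas X" "u \<in> cod c" for c u
  proof -
    have "alternating (if int l = k then \<omega> c u else 0)" for l using formsD(2)[OF \<omega> that] by (simp add: alternating_0)
    from alternating_by_length[OF this]
    have "alternating (\<lambda>vs. (if int (length vs) = k then \<omega> c u else 0) vs)" .
    moreover have "dgr k \<omega> c u = (\<lambda>vs. (if int (length vs) = k then \<omega> c u else 0) vs)"
      by (auto simp: dgr_def fun_eq_iff zero_fun_apply)
    ultimately show ?thesis by simp
  qed
  show "smooth_ext (cod c) (dgr k \<omega> c)" if "c \<in> atlas X" for c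
    unfolding smooth_ext_def
  proof
    show "smooth_on (cod c) (\<lambda>u. dgr k \<omega> c u vs)" for vs
      using smooth_extD[OF formsD(3)[OF \<omega> that], of vs]
      by (cases "int (length vs) = k") (simp_all add: dgr_def smooth_on_const)
  qed
  show "dgr k \<omega> c u = pull_ext (locrep c c' id) (dgr k \<omega> c') u"
    if "c \<in> atlas X" "c' \<in> atlas X" "u \<in> locdom c c' id" for c c' u
    using formsD(4)[OF \<omega> that] by (simp add: dgr_def pull_ext_apply fun_eq_iff)
qed

lemma dgr_add: "dgr k (\<omega> + \<eta>) = dgr k \<omega> + dgr k \<eta>" and dgr_cscale: "dgr k (a *\<^sub>C \<omega>) = a *\<^sub>C dgr k \<omega>"
  for \<omega> \<eta> :: "('a, 'e) form"
  by (auto simp: dgr_def fun_eq_iff form_apply ext_fun_simps)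

lemma form_deg_iff: "\<omega> \<in> form_deg X k \<longleftrightarrow> \<omega> \<in> forms X \<and> dgr k \<omega> = \<omega>"
  by (auto simp: form_deg_def dgr_def fun_eq_iff)

lemma splits_dgr: "splits (forms X) dgr"
  unfolding splits_def
proof (intro conjI allI ballI forms_subspace dgr_forms)
  show "lin_on (forms X) (dgr k)" for k by (simp add: lin_on_def dgr_add dgr_cscale)
  show "dgr k (dgr l \<omega>) = (if k = l then dgr l \<omega> else 0)" for k l and \<omega> :: "('a, 'e) form"
    by (auto simp: dgr_def fun_eq_iff zero_fun_apply)
  fix \<omega> assume \<omega>: "\<omega> \<in> forms X"
  let ?B = "{0..int (card basis)}"
  have sub: "{k. dgr k \<omega> \<noteq> 0} \<subseteq> ?B"
  proof
    fix k assume "k \<in> {k. dgr k \<omega> \<noteq> 0}"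
    then obtain c u vs where "dgr k \<omega> c u vs \<noteq> 0" by (force simp: fun_eq_iff zero_fun_apply)
    then show "k \<in> ?B" using form_length[OF \<omega>, of c u vs] by (auto simp: dgr_def split: if_splits)
  qed
  show "finite {k. dgr k \<omega> \<noteq> 0}" using finite_subset[OF sub] by simp
  have "(\<Sum>k\<in>{k. dgr k \<omega> \<noteq> 0}. dgr k \<omega>) = (\<Sum>k\<in>?B. dgr k \<omega>)"
    using sub by (intro sum.mono_neutral_left) auto
  also have "\<dots> = \<omega>"
  proof (intro ext)
    fix c u vs
    have "(\<Sum>k\<in>?B. dgr k \<omega>) c u vs = (\<Sum>k\<in>?B. dgr k \<omega> c u vs)" by (simp add: sum_form_apply sum_ext_apply)
    also have "\<dots> = (if int (length vs) \<in> ?B then \<omega> c u vs else 0)"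
      by (simp add: dgr_def)
    also have "\<dots> = \<omega> c u vs" using form_length[OF \<omega>, of c u vs] by auto
    finally show "(\<Sum>k\<in>?B. dgr k \<omega>) c u vs = \<omega> c u vs" .
  qed
  finally show "(\<Sum>k\<in>{k. dgr k \<omega> \<noteq> 0}. dgr k \<omega>) = \<omega>" .
qed

lemma ext_diff_dgr: assumes \<omega>: "\<omega> \<in> forms X" shows "ext_diff X (dgr k \<omega>) = dgr (k + 1) (ext_diff X \<omega>)"
proof (rule form_eqI[OF ext_diff_forms[OF dgr_forms[OF \<omega>]] dgr_forms[OF ext_diff_forms[OF \<omega>]]])
  fix c u assume c: "c \<in> atlas X" "u \<in> cod c"
  have "ext_d (dgr k \<omega> c) u vs = (if int (length vs) = k + 1 then ext_d (\<omega> c) u vs else 0)" for vs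
  proof (cases "int (length vs) = k + 1")
    case True
    then have "i < length vs \<Longrightarrow> (int (min (length vs) i + (length vs - Suc i)) = k)" for i by auto
    then show ?thesis using True by (auto simp: ext_d_def dgr_def intro!: sum.cong)
  next
    case False
    then have "i < length vs \<Longrightarrow> (int (min (length vs) i + (length vs - Suc i)) \<noteq> k)" for i by auto
    then show ?thesis using False by (auto simp: ext_d_def dgr_def intro!: sum.neutral)
  qed
  then show "ext_diff X (dgr k \<omega>) c u = dgr (k + 1) (ext_diff X \<omega>) c u"
    by (simp add: ext_diff_eq[OF c] fun_eq_iff dgr_def[of "k + 1"])
qed

lemma dgr_eq_iff_cpt:
  assumes \<omega>: "\<omega> \<in> forms X" shows "dgr k \<omega> = \<omega> \<longleftrightarrow> (\<forall>i. i \<notin> {(r, s). r + s = k} \<longrightarrow> cpt X i \<omega> = 0)"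
proof
  assume d: "dgr k \<omega> = \<omega>"
  have "\<omega> c u vs = 0" if "int (length vs) \<noteq> k" for c u vs
    using that fun_cong[OF fun_cong[OF fun_cong[OF d, of c], of u], of vs] by (simp add: dgr_def)
  then show "\<forall>i. i \<notin> {(r, s). r + s = k} \<longrightarrow> cpt X i \<omega> = 0"
    by (auto simp: cpt_def proj_pq_def fun_eq_iff zero_fun_apply Let_def)
next
  assume z: "\<forall>i. i \<notin> {(r, s). r + s = k} \<longrightarrow> cpt X i \<omega> = 0"
  have "\<omega> c u vs = 0" if len: "int (length vs) \<noteq> k" and c: "c \<in> atlas X" "u \<in> cod c" for c u vs
  proof -
    have "cpt X (int p, int (length vs) - int p) \<omega> c u vs = 0" for p
      using z len by (simp add: form_apply zero_fun_apply)
    then show ?thesis using sum_cpt_eval[OF \<omega> c, of vs] by simp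
  qed
  then show "dgr k \<omega> = \<omega>"
    by (intro form_eqI[OF dgr_forms[OF \<omega>] \<omega>]) (auto simp: dgr_def fun_eq_iff)
qed

end

subsection \<open>Morphisms\<close>

locale ac_map = X: almost_complex X + Y: almost_complex Y
  for X :: "('a, 'e::real_inner) acm" and Y :: "('b, 'f::real_inner) acm" +
  fixes f :: "'a \<Rightarrow> 'b"
  assumes morphism: "acm_morphism X Y f"

sublocale ac_map \<subseteq> manifold_map X Y f
  using morphism by unfold_locales (simp add: acm_morphism_def smooth_map_def)

context ac_map
begin

lemma acs_map:
  assumes "c \<in> atlas X" "c' \<in> atlas Y" "u \<in> locdom c c' f"
  shows "fd (locrep c c' f) u (acs X c u v) = acs Y c' (locrep c c' f u) (fd (locrep c c' f) u v)"
  using morphism assms unfolding acm_morphism_def by blast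

lemma pull_at: 
  assumes \<omega>: "\<omega> \<in> forms Y" and c: "c \<in> atlas X" "u \<in> cod c"
  obtains c' where "c' \<in> atlas Y" "u \<in> locdom c c' f" "\<And>\<eta>. \<eta> \<in> forms Y \<Longrightarrow> pull X Y f \<eta> c u = pull_ext (locrep c c' f) (\<eta> c') u"
  using map_chart[OF c] pull_eq c(1) by metis

lemma lin_pull: "lin_on (forms Y) (pull X Y f)"
  unfolding lin_on_def by (auto simp: fun_eq_iff pull_def Let_def form_apply ext_fun_simps)

lemma pull_wedge:
  assumes "\<omega> \<in> forms Y" "\<eta> \<in> forms Y"
  shows "pull X Y f (wedge \<omega> \<eta>) = wedge (pull X Y f \<omega>) (pull X Y f \<eta>)"
proof (rule X.form_eqI)
  show "pull X Y f (wedge \<omega> \<eta>) \<in> forms X" "wedge (pull X Y f \<omega>) (pull X Y f \<eta>) \<in> forms X"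
    using assms by (simp_all add: pull_forms X.wedge_forms Y.wedge_forms)
  fix c u assume c: "c \<in> atlas X" "u \<in> cod c"
  obtain c' where "\<And>\<eta>. \<eta> \<in> forms Y \<Longrightarrow> pull X Y f \<eta> c u = pull_ext (locrep c c' f) (\<eta> c') u"
    using pull_at[OF assms(1) c] by blast
  then show "pull X Y f (wedge \<omega> \<eta>) c u = wedge (pull X Y f \<omega>) (pull X Y f \<eta>) c u"
    using assms Y.wedge_forms[OF assms] by (simp add: wedge_def[of "pull X Y f \<omega>"] pull_ext_def) (simp add: wedge_def ext_wedge_pull)
qed

lemma pull_unit: "pull X Y f (unit_form Y) = unit_form X"
proof (rule X.form_eqI[OF pull_forms[OF Y.unit_form_forms] X.unit_form_forms])
  fix c u assume c: "c \<in> atlas X" "u \<in> cod c"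
  obtain c' where c': "c' \<in> atlas Y" "u \<in> locdom c c' f" using map_chart[OF c] .
  show "pull X Y f (unit_form Y) c u = unit_form X c u"
    using pull_eq[OF Y.unit_form_forms c(1) c'] rep_cod[OF c(1) c'(2)] c c'
    by (simp add: unit_form_def pull_ext_def ext_pull_def ext_one_def fun_eq_iff)
qed

lemma pull_conj: assumes "\<omega> \<in> forms Y" shows "pull X Y f (conj_form \<omega>) = conj_form (pull X Y f \<omega>)"
  by (auto simp: fun_eq_iff pull_def Let_def conj_form_def zero_fun_apply)

lemma pull_cpt: assumes \<omega>: "\<omega> \<in> forms Y" shows "pull X Y f (cpt Y i \<omega>) = cpt X i (pull X Y f \<omega>)"
proof (rule X.form_eqI)
  show "pull X Y f (cpt Y i \<omega>) \<in> forms X" "cpt X i (pull X Y f \<omega>) \<in> forms X"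
    using \<omega> by (simp_all add: pull_forms X.cpt_forms Y.cpt_forms)
  fix c u assume c: "c \<in> atlas X" "u \<in> cod c"
  obtain c' where c': "c' \<in> atlas Y" "u \<in> locdom c c' f" using map_chart[OF c] .
  show "pull X Y f (cpt Y i \<omega>) c u = cpt X i (pull X Y f \<omega>) c u"
    unfolding pull_eq[OF Y.cpt_forms[OF \<omega>] c(1) c'] cpt_def[of X] pull_eq[OF \<omega> c(1) c'] pull_ext_def
    unfolding cpt_def
    by (rule sym, rule proj_pq_pull, rule linear_rep[OF c(1) c'], rule acs_map[OF c(1) c'])
qed

lemma pull_Dp: assumes \<omega>: "\<omega> \<in> forms Y" shows "pull X Y f (Dp Y \<delta> \<omega>) = Dp X \<delta> (pull X Y f \<omega>)"
proof (rule X.cpt_eqI)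
  show "pull X Y f (Dp Y \<delta> \<omega>) \<in> forms X" "Dp X \<delta> (pull X Y f \<omega>) \<in> forms X"
    using \<omega> by (simp_all add: pull_forms X.Dp_forms Y.Dp_forms)
  show "cpt X i (pull X Y f (Dp Y \<delta> \<omega>)) = cpt X i (Dp X \<delta> (pull X Y f \<omega>))" for i
    unfolding pull_cpt[OF Y.Dp_forms[OF \<omega>], symmetric] Y.cpt_Dp[OF \<omega>] X.cpt_Dp[OF pull_forms[OF \<omega>]]
      pull_cpt[OF \<omega>, symmetric] pull_ext_diff[OF Y.cpt_forms[OF \<omega>], symmetric]
      pull_cpt[OF Y.ext_diff_forms[OF Y.cpt_forms[OF \<omega>]]] ..
qed

lemma pull_dgr: "pull X Y f (dgr k \<omega>) = dgr k (pull X Y f \<omega>)"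
  by (auto simp: fun_eq_iff pull_def Let_def dgr_def zero_fun_apply)

end



section \<open>The algebra of four operators\<close>

definition msum :: "'v::complex_vector set \<Rightarrow> 'v set \<Rightarrow> 'v set" where
  "msum S T = {x + y |x y. x \<in> S \<and> y \<in> T}"

text \<open>Subspaces that contain the components of their elements.\<close>

definition stable :: "('i \<Rightarrow> 'v \<Rightarrow> 'v) \<Rightarrow> 'v set \<Rightarrow> bool" where
  "stable P S \<longleftrightarrow> (\<forall>i. \<forall>x\<in>S. P i x \<in> S)"

lemma stableD: "stable P S \<Longrightarrow> x \<in> S \<Longrightarrow> P i x \<in> S"
  by (simp add: stable_def)

lemma subspace_msum: "cv.subspace S \<Longrightarrow> cv.subspace T \<Longrightarrow> cv.subspace (msum S T)"
  unfolding msum_def by (rule cv.subspace_sums)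

lemma msumI: "x \<in> S \<Longrightarrow> y \<in> T \<Longrightarrow> x + y \<in> msum S T"
  unfolding msum_def by blast

lemma msum_left: "cv.subspace T \<Longrightarrow> x \<in> S \<Longrightarrow> x \<in> msum S T"
  using msumI[of x S 0 T] cv.subspace_0 by auto

lemma msum_right: "cv.subspace S \<Longrightarrow> x \<in> T \<Longrightarrow> x \<in> msum S T"
  using msumI[of 0 S x T] cv.subspace_0 by auto

lemma msum_leI: "cv.subspace U \<Longrightarrow> S \<subseteq> U \<Longrightarrow> T \<subseteq> U \<Longrightarrow> msum S T \<subseteq> U"
  unfolding msum_def using cv.subspace_add by blast

lemma msum_map:
  assumes "add_on U h" "S \<subseteq> U" "T \<subseteq> U" "\<And>x. x \<in> S \<Longrightarrow> h x \<in> S'" "\<And>x. x \<in> T \<Longrightarrow> h x \<in> T'"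
    and x: "x \<in> msum S T"
  shows "h x \<in> msum S' T'"
proof -
  obtain y z where "x = y + z" "y \<in> S" "z \<in> T" using x unfolding msum_def by blast
  moreover from this have "h (y + z) = h y + h z" using assms(2,3) by (intro add_onD[OF assms(1)]) auto
  ultimately show ?thesis using assms(4)[of y] assms(5)[of z] msumI[of "h y" S' "h z" T'] by simp
qed

text \<open>The properties of \<open>(mubar, delbar)\<close> and of \<open>(mu, del)\<close> on which the definition of the iterated
  cohomology \<open>H\<^sub>E (H\<^sub>D)\<close> depends. The space \<open>dolZ / dolB\<close> is this cohomology in terms of forms: a class
  is represented by \<open>x\<close> with \<open>D x = 0\<close> and \<open>E x\<close> exact for \<open>D\<close>.\<close>

locale dolbeault_pair =
  fixes V :: "'v::complex_vector set" and P :: "int \<times> int \<Rightarrow> 'v \<Rightarrow> 'v" and D E :: "'v \<Rightarrow> 'v"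
    and \<delta> \<epsilon> :: "int \<times> int"
  assumes splits: "splits V P"
    and lin: "lin_on V D" "lin_on V E"
    and closed: "x \<in> V \<Longrightarrow> D x \<in> V" "x \<in> V \<Longrightarrow> E x \<in> V"
    and shift: "x \<in> V \<Longrightarrow> P (i + \<delta>) (D x) = D (P i x)" "x \<in> V \<Longrightarrow> P (i + \<epsilon>) (E x) = E (P i x)"
    and square: "x \<in> V \<Longrightarrow> D (D x) = 0" "x \<in> V \<Longrightarrow> D (E x) = - E (D x)"
      "x \<in> V \<Longrightarrow> D x = 0 \<Longrightarrow> E (E x) \<in> D ` V"
begin

definition dolZ where "dolZ = {x \<in> V. D x = 0 \<and> E x \<in> D ` V}"
definition dolB where "dolB = msum (E ` {x \<in> V. D x = 0}) (D ` V)"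

lemma subspaces:
  "cv.subspace V" "cv.subspace {x \<in> V. D x = 0}" "cv.subspace (D ` V)" "cv.subspace dolZ" "cv.subspace dolB"
  and zero: "D 0 = 0" "E 0 = 0"
proof -
  note V = splits_subspace[OF splits]
  show "cv.subspace V" by (rule V)
  show K: "cv.subspace {x \<in> V. D x = 0}" by (rule kernel_subspace[OF lin(1) V])
  show I: "cv.subspace (D ` V)" by (rule image_subspace[OF lin(1) V])
  show 0: "D 0 = 0" "E 0 = 0" using add_on_0[OF lin_on_add_on V] lin by blast+
  show "cv.subspace dolZ"
  proof (rule cv.subspaceI)
    show "0 \<in> dolZ" using cv.subspace_0[OF I] cv.subspace_0[OF V] 0 by (simp add: dolZ_def)
    show "x + y \<in> dolZ" if "x \<in> dolZ" "y \<in> dolZ" for x y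
      using that cv.subspace_add[OF V, of x y] cv.subspace_add[OF I, of "E x" "E y"] add_onD[OF lin_on_add_on[OF lin(1)], of x y]
        add_onD[OF lin_on_add_on[OF lin(2)], of x y] by (simp add: dolZ_def)
    show "c *\<^sub>C x \<in> dolZ" if "x \<in> dolZ" for c x
      using that cv.subspace_scale[OF V, of x c] cv.subspace_scale[OF I, of "E x" c] lin_on_scale[OF lin(1), of x c]
        lin_on_scale[OF lin(2), of x c] by (simp add: dolZ_def)
  qed
  show "cv.subspace dolB" unfolding dolB_def
    by (rule subspace_msum[OF image_subspace[OF lin_on_subset[OF lin(2)] K] I]) simp
qed

lemma dolB_sub: "D ` V \<subseteq> dolB" "dolB \<subseteq> dolZ" "dolZ \<subseteq> {x \<in> V. D x = 0}" "D ` V \<subseteq> {x \<in> V. D x = 0}"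
proof -
  show "D ` V \<subseteq> dolB" unfolding dolB_def
    using msum_right[OF image_subspace[OF lin_on_subset[OF lin(2)] subspaces(2)]] by blast
  show "dolB \<subseteq> dolZ" unfolding dolB_def
  proof (rule msum_leI[OF subspaces(4)])
    show "E ` {x \<in> V. D x = 0} \<subseteq> dolZ" using closed square(2,3) by (auto simp: dolZ_def zero)
    have "E (D x) \<in> D ` V" if "x \<in> V" for x
    proof -
      have "D (- E x) = E (D x)"
        using square(2)[OF that] add_on_diff[OF lin_on_add_on[OF lin(1)] subspaces(1) cv.subspace_0[OF subspaces(1)], of "E x"]
          closed(2)[OF that] by (simp add: zero)
      then show ?thesis using cv.subspace_neg[OF subspaces(1) closed(2)[OF that]] by (metis imageI)
    qed
    then show "D ` V \<subseteq> dolZ" using closed square(1) by (auto simp: dolZ_def)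
  qed
  show "dolZ \<subseteq> {x \<in> V. D x = 0}" by (auto simp: dolZ_def)
  show "D ` V \<subseteq> {x \<in> V. D x = 0}" using closed square(1) by auto
qed

lemma stable: "stable P {x \<in> V. D x = 0}" "stable P (D ` V)" "stable P dolZ" "stable P dolB"
proof -
  note cl = splits_closed[OF splits]
  have 0: "P i 0 = 0" for i by (rule add_on_0[OF splits_add_on[OF splits] subspaces(1)])
  have K: "D (P i x) = 0" if "x \<in> V" "D x = 0" for i x using shift(1)[OF that(1), of i] that 0 by simp
  have I: "P i (D x) \<in> D ` V" if "x \<in> V" for i x using shift(1)[OF that, of "i - \<delta>"] cl[OF that] by simp
  show "stable P {x \<in> V. D x = 0}" using K cl by (simp add: stable_def)
  show "stable P (D ` V)" using I by (auto simp: stable_def)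
  have "E (P i x) \<in> D ` V" if "x \<in> V" "E x \<in> D ` V" for i x
  proof -
    obtain y where y: "E x = D y" "y \<in> V" using \<open>E x \<in> D ` V\<close> by blast
    show ?thesis using shift(2)[OF that(1), of i] I[OF y(2), of "i + \<epsilon>"] y(1) by simp
  qed
  then show "stable P dolZ" using K cl by (auto simp: stable_def dolZ_def)
  have EK: "P i (E x) \<in> E ` {x \<in> V. D x = 0}" if "x \<in> V" "D x = 0" for i x
    using shift(2)[OF that(1), of "i - \<epsilon>"] K[OF that, of "i - \<epsilon>"] cl[OF that(1), of "i - \<epsilon>"] by simp
  show "stable P dolB" unfolding stable_def dolB_def
  proof (intro allI ballI)
    fix i x assume x: "x \<in> msum (E ` {x \<in> V. D x = 0}) (D ` V)"
    have "E ` {x \<in> V. D x = 0} \<subseteq> V" "D ` V \<subseteq> V" using closed by auto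
    moreover have "P i y \<in> E ` {x \<in> V. D x = 0}" if "y \<in> E ` {x \<in> V. D x = 0}" for y
    proof -
      from that obtain z where "y = E z" "z \<in> V" "D z = 0" by blast
      then show ?thesis using EK by metis
    qed
    moreover have "P i y \<in> D ` V" if "y \<in> D ` V" for y
    proof -
      from that obtain z where "y = D z" "z \<in> V" by blast
      then show ?thesis using I by metis
    qed
    ultimately show "P i x \<in> msum (E ` {x \<in> V. D x = 0}) (D ` V)"
      by (rule msum_map[OF splits_add_on[OF splits, of i] _ _ _ _ x])
  qed
qed

end

text \<open>The linear algebra of an almost complex manifold. The family \<open>D\<close> consists of the components of the
  exterior derivative; \<open>square\<close> is the part of bidegree \<open>\<sigma>\<close> of \<open>d\<^sup>2 = 0\<close>. Exchanging the gradings
  exchanges \<open>mb\<close> with \<open>mm\<close> and \<open>db\<close> with \<open>dl\<close>.\<close>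

locale almost_double_complex =
  fixes V :: "'v::complex_vector set" and P :: "int \<times> int \<Rightarrow> 'v \<Rightarrow> 'v" and D :: "int \<times> int \<Rightarrow> 'v \<Rightarrow> 'v"
  assumes splits: "splits V P"
    and lin: "lin_on V (D \<delta>)"
    and closed: "x \<in> V \<Longrightarrow> D \<delta> x \<in> V"
    and shift: "x \<in> V \<Longrightarrow> P (i + \<delta>) (D \<delta> x) = D \<delta> (P i x)"
    and square: "x \<in> V \<Longrightarrow> (\<Sum>\<delta>\<in>{\<delta> \<in> bidegrees. \<sigma> - \<delta> \<in> bidegrees}. D \<delta> (D (\<sigma> - \<delta>) x)) = 0"
begin

abbreviation "mb \<equiv> D (-1, 2)"
abbreviation "db \<equiv> D (0, 1)"
abbreviation "dl \<equiv> D (1, 0)"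
abbreviation "mm \<equiv> D (2, -1)"
abbreviation "dd \<equiv> (\<lambda>x. \<Sum>\<delta>\<in>bidegrees. D \<delta> x)"

lemmas V = splits_subspace[OF splits]
lemmas V_simps [simp] = cv.subspace_0[OF V] cv.subspace_add[OF V] cv.subspace_neg[OF V] cv.subspace_diff[OF V]
  cv.subspace_scale[OF V] closed splits_closed[OF splits]
lemmas D_simps [simp] = add_on_0[OF lin_on_add_on[OF lin] V] add_onD[OF lin_on_add_on[OF lin]]
  add_on_diff[OF lin_on_add_on[OF lin] V]
lemmas P_simps [simp] = add_on_0[OF splits_add_on[OF splits] V] add_onD[OF splits_add_on[OF splits]]

lemma D_neg [simp]: "x \<in> V \<Longrightarrow> D \<delta> (- x) = - D \<delta> x"
  using add_on_diff[OF lin_on_add_on[OF lin] V, of 0 x] by simp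

text \<open>In total, \<open>d\<^sup>2 = 0\<close> has parts in the seven bidegrees from \<open>(-2, 4)\<close> to \<open>(4, -2)\<close>.\<close>

lemma relations:
  assumes x: "x \<in> V"
  shows "mb (mb x) = 0" "mb (db x) = - db (mb x)" "db (db x) = - (mb (dl x) + dl (mb x))"
    "dl (db x) + db (dl x) = - (mb (mm x) + mm (mb x))" "dl (dl x) = - (mm (db x) + db (mm x))"
    "mm (dl x) = - dl (mm x)" "mm (mm x) = 0"
proof -
  have s: "{\<delta> \<in> bidegrees. (-2, 4) - \<delta> \<in> bidegrees} = {(-1, 2)}"
    "{\<delta> \<in> bidegrees. (-1, 3) - \<delta> \<in> bidegrees} = {(-1, 2), (0, 1)}"
    "{\<delta> \<in> bidegrees. (0, 2) - \<delta> \<in> bidegrees} = {(-1, 2), (0, 1), (1, 0)}"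
    "{\<delta> \<in> bidegrees. (1, 1) - \<delta> \<in> bidegrees} = {(-1, 2), (0, 1), (1, 0), (2, -1)}"
    "{\<delta> \<in> bidegrees. (2, 0) - \<delta> \<in> bidegrees} = {(0, 1), (1, 0), (2, -1)}"
    "{\<delta> \<in> bidegrees. (3, -1) - \<delta> \<in> bidegrees} = {(1, 0), (2, -1)}"
    "{\<delta> \<in> bidegrees. (4, -2) - \<delta> \<in> bidegrees} = {(2, -1)}"
    by (auto simp: bidegrees_def)
  note q = square[OF x]
  show "mb (mb x) = 0" using q[of "(-2, 4)"] unfolding s by simp
  show "mb (db x) = - db (mb x)" using q[of "(-1, 3)"] unfolding s by (simp add: eq_neg_iff_add_eq_0)
  show "db (db x) = - (mb (dl x) + dl (mb x))"
    using q[of "(0, 2)"] unfolding s eq_neg_iff_add_eq_0 by (simp add: add_ac)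
  show "dl (db x) + db (dl x) = - (mb (mm x) + mm (mb x))"
    using q[of "(1, 1)"] unfolding s eq_neg_iff_add_eq_0 by (simp add: add_ac)
  show "dl (dl x) = - (mm (db x) + db (mm x))"
    using q[of "(2, 0)"] unfolding s eq_neg_iff_add_eq_0 by (simp add: add_ac)
  show "mm (dl x) = - dl (mm x)" using q[of "(3, -1)"] unfolding s by (simp add: eq_neg_iff_add_eq_0 add_ac)
  show "mm (mm x) = 0" using q[of "(4, -2)"] unfolding s by simp
qed

lemma dolbeault_pairs:
  "dolbeault_pair V P mb db (-1, 2) (0, 1)" "dolbeault_pair V P mm dl (2, -1) (1, 0)"
proof -
  have 1: "db (db x) \<in> mb ` V" if "x \<in> V" "mb x = 0" for x
    using relations(3)[OF that(1)] that by (intro image_eqI[of _ _ "- dl x"]) simp_all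
  have 2: "dl (dl x) \<in> mm ` V" if "x \<in> V" "mm x = 0" for x
    using relations(5)[OF that(1)] that by (intro image_eqI[of _ _ "- db x"]) simp_all
  show "dolbeault_pair V P mb db (-1, 2) (0, 1)"
    by unfold_locales (use relations 1 shift in \<open>simp_all add: splits lin\<close>)
  show "dolbeault_pair V P mm dl (2, -1) (1, 0)"
    by unfold_locales (use relations 2 shift in \<open>simp_all add: splits lin\<close>)
qed

sublocale dol: dolbeault_pair V P mb db "(-1, 2)" "(0, 1)" by (rule dolbeault_pairs)
sublocale dolbar: dolbeault_pair V P mm dl "(2, -1)" "(1, 0)" by (rule dolbeault_pairs)

text \<open>The subcomplex \<open>A_s\<close>, the subspace \<open>I_q\<close> by which \<open>A_q\<close> is formed, and cocycles and coboundaries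
  of the Bott--Chern (\<open>bc\<close>), Aeppli (\<open>ae\<close>) and de Rham (\<open>dr\<close>) cohomologies, in terms of elements of \<open>V\<close>.\<close>

definition sdc where "sdc = {x \<in> V. mb x = 0 \<and> db (db x) = 0 \<and> dl (dl x) = 0 \<and> mm x = 0}"
definition bcZ where "bcZ = {x \<in> sdc. dl x = 0 \<and> db x = 0}"
definition bcB where "bcB = (\<lambda>x. dl (db x)) ` sdc"
definition qdc where
  "qdc = msum (msum (msum (mb ` V) ((\<lambda>x. db (db x)) ` V)) ((\<lambda>x. dl (dl x)) ` V)) (mm ` V)"
definition aeZ where "aeZ = {x \<in> V. dl (db x) \<in> qdc}"
definition aeB where "aeB = msum (msum (dl ` V) (db ` V)) qdc"
definition drZ where "drZ = {x \<in> V. dd x = 0}"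
definition drB where "drB = dd ` V"

lemma lin2: "lin_on V (\<lambda>x. D \<delta> (D \<epsilon> x))"
  by (simp add: lin_on_def lin_on_scale[OF lin])

lemma linear_dd: "lin_on V dd"
  by (simp add: lin_on_def lin_on_scale[OF lin] sum.distrib cv.scale_sum_right)

lemma subspace_sdc: "cv.subspace sdc"
  unfolding sdc_def by (rule cv.subspaceI) (simp_all add: lin_on_scale[OF lin])

lemma subspace_bcZ: "cv.subspace bcZ"
  unfolding bcZ_def sdc_def by (rule cv.subspaceI) (simp_all add: lin_on_scale[OF lin])

lemma sdc_V: "sdc \<subseteq> V" by (auto simp: sdc_def)

lemma subspace_bcB: "cv.subspace bcB"
  unfolding bcB_def by (rule image_subspace[OF lin_on_subset[OF lin2 sdc_V] subspace_sdc])

lemma subspace_qdc: "cv.subspace qdc"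
  unfolding qdc_def by (intro subspace_msum image_subspace[OF lin V] image_subspace[OF lin2 V])

lemma subspace_aeZ: "cv.subspace aeZ"
  unfolding aeZ_def
  by (rule cv.subspaceI)
    (simp_all add: lin_on_scale[OF lin] cv.subspace_0[OF subspace_qdc] cv.subspace_add[OF subspace_qdc] cv.subspace_scale[OF subspace_qdc])

lemma subspace_aeB: "cv.subspace aeB"
  unfolding aeB_def by (intro subspace_msum image_subspace[OF lin V] subspace_qdc)

lemma subspace_drZ: "cv.subspace drZ"
  unfolding drZ_def by (rule kernel_subspace[OF linear_dd V])

lemma subspace_drB: "cv.subspace drB"
  unfolding drB_def by (rule image_subspace[OF linear_dd V])

lemma qdcI: "x \<in> V \<Longrightarrow> mb x \<in> qdc" "x \<in> V \<Longrightarrow> db (db x) \<in> qdc" "x \<in> V \<Longrightarrow> dl (dl x) \<in> qdc" "x \<in> V \<Longrightarrow> mm x \<in> qdc"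
proof -
  note i = image_subspace[OF lin V] image_subspace[OF lin2 V]
  note m = subspace_msum[OF i(1) i(2)] subspace_msum[OF subspace_msum[OF i(1) i(2)] i(2)]
  show "x \<in> V \<Longrightarrow> mb x \<in> qdc" unfolding qdc_def
    by (rule msum_left[OF i(1)], rule msum_left[OF i(2)], rule msum_left[OF i(2)], rule imageI)
  show "x \<in> V \<Longrightarrow> db (db x) \<in> qdc" unfolding qdc_def
    by (rule msum_left[OF i(1)], rule msum_left[OF i(2)], rule msum_right[OF i(1)], rule imageI)
  show "x \<in> V \<Longrightarrow> dl (dl x) \<in> qdc" unfolding qdc_def
    by (rule msum_left[OF i(1)], rule msum_right[OF m(1)], rule imageI)
  show "x \<in> V \<Longrightarrow> mm x \<in> qdc" unfolding qdc_def
    by (rule msum_right[OF m(2)], rule imageI)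
qed

lemma qdc_leI:
  assumes "cv.subspace U" "\<And>x. x \<in> V \<Longrightarrow> mb x \<in> U" "\<And>x. x \<in> V \<Longrightarrow> db (db x) \<in> U"
    "\<And>x. x \<in> V \<Longrightarrow> dl (dl x) \<in> U" "\<And>x. x \<in> V \<Longrightarrow> mm x \<in> U"
  shows "qdc \<subseteq> U"
  unfolding qdc_def using assms by (intro msum_leI[OF assms(1)]) auto

lemma qdc_V: "qdc \<subseteq> V" by (rule qdc_leI[OF V]) simp_all

lemma qdc_induct:
  assumes x: "x \<in> qdc" and h: "add_on V h" and U: "cv.subspace U" and g: "\<And>x. x \<in> V \<Longrightarrow> h (mb x) \<in> U" "\<And>x. x \<in> V \<Longrightarrow> h (db (db x)) \<in> U"
    "\<And>x. x \<in> V \<Longrightarrow> h (dl (dl x)) \<in> U" "\<And>x. x \<in> V \<Longrightarrow> h (mm x) \<in> U"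
  shows "h x \<in> U"
proof -
  obtain a b c e where "x = mb a + db (db b) + dl (dl c) + mm e" "a \<in> V" "b \<in> V" "c \<in> V" "e \<in> V"
    using x unfolding qdc_def msum_def by blast
  then show ?thesis using g cv.subspace_add[OF U] by (simp add: add_onD[OF h])
qed

lemma dl_db_qdc: assumes "x \<in> V" shows "dl (db x) + db (dl x) \<in> qdc"
  unfolding relations(4)[OF assms] using assms
  by (intro cv.subspace_neg cv.subspace_add subspace_qdc qdcI) simp_all

lemma db_dl_qdc_iff: "x \<in> V \<Longrightarrow> db (dl x) \<in> qdc \<longleftrightarrow> dl (db x) \<in> qdc"
  using dl_db_qdc[of x] cv.subspace_diff[OF subspace_qdc, of "dl (db x) + db (dl x)" "dl (db x)"]
    cv.subspace_diff[OF subspace_qdc, of "dl (db x) + db (dl x)" "db (dl x)"] by auto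

text \<open>On each of the four generating images a relation moves \<open>dl\<close> inwards. The only longer
  case is \<open>dl (db (db x))\<close>, where \<open>dl\<close> and \<open>db\<close> are interchanged twice.\<close>

lemma dl_qdc: assumes "x \<in> qdc" shows "dl x \<in> qdc"
proof (rule qdc_induct[OF assms lin_on_add_on[OF lin] subspace_qdc])
  fix x assume x: "x \<in> V"
  have "dl (mb x) = - db (db x) - mb (dl x)" using relations(3)[OF x] by simp
  then show "dl (mb x) \<in> qdc" using x by (simp add: cv.subspace_diff[OF subspace_qdc] cv.subspace_neg[OF subspace_qdc] qdcI)
  show "dl (mm x) \<in> qdc" using relations(6)[OF x] qdcI(4)[of "dl x"] x cv.subspace_neg[OF subspace_qdc] by fastforce
  show "dl (dl (dl x)) \<in> qdc" using x by (simp add: qdcI)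
  have c: "dl (db (db x)) + db (dl (db x)) \<in> qdc" using dl_db_qdc[of "db x"] x by simp
  have d: "dl (db x) = - (mb (mm x) + mm (mb x)) - db (dl x)" unfolding eq_diff_eq by (rule relations(4)[OF x])
  have "db (dl (db x)) = - (db (mb (mm x)) + db (mm (mb x))) - db (db (dl x))" unfolding d using x by simp
  moreover have "db (mb (mm x)) = - mb (db (mm x))" using relations(2)[of "mm x"] x by simp
  moreover have "db (mm (mb x)) = - dl (dl (mb x)) - mm (db (mb x))" using relations(5)[of "mb x"] x by simp
  ultimately have "db (dl (db x)) \<in> qdc"
    using x by (simp add: cv.subspace_diff[OF subspace_qdc] cv.subspace_neg[OF subspace_qdc] cv.subspace_add[OF subspace_qdc] qdcI)
  from cv.subspace_diff[OF subspace_qdc c this] show "dl (db (db x)) \<in> qdc" by simp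
qed

text \<open>Here \<open>dl (dl x)\<close> is the longer case; after interchanging \<open>db\<close> and \<open>dl\<close> it reduces to \<open>dl_qdc\<close>.\<close>

lemma db_qdc: assumes "x \<in> qdc" shows "db x \<in> qdc"
proof (rule qdc_induct[OF assms lin_on_add_on[OF lin] subspace_qdc])
  fix x assume x: "x \<in> V"
  have "db (mm x) = - dl (dl x) - mm (db x)" using relations(5)[OF x] by simp
  then show "db (mm x) \<in> qdc" using x by (simp add: cv.subspace_diff[OF subspace_qdc] cv.subspace_neg[OF subspace_qdc] qdcI)
  have "db (mb x) = - mb (db x)" using relations(2)[OF x] by simp
  then show "db (mb x) \<in> qdc" using x by (simp add: cv.subspace_neg[OF subspace_qdc] qdcI)
  show "db (db (db x)) \<in> qdc" using x by (simp add: qdcI)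
  have "dl (db (dl x)) \<in> qdc \<Longrightarrow> db (dl (dl x)) \<in> qdc" using db_dl_qdc_iff[of "dl x"] x by simp
  moreover have d: "db (dl x) = - (mb (mm x) + mm (mb x)) - dl (db x)" unfolding eq_diff_eq add.commute[of "db (dl x)"] by (rule relations(4)[OF x])
  have "dl (db (dl x)) = - (dl (mb (mm x)) + dl (mm (mb x))) - dl (dl (db x))" unfolding d using x by simp
  then have "dl (db (dl x)) \<in> qdc"
    using x by (simp add: cv.subspace_diff[OF subspace_qdc] cv.subspace_neg[OF subspace_qdc] cv.subspace_add[OF subspace_qdc] qdcI dl_qdc)
  ultimately show "db (dl (dl x)) \<in> qdc" by simp
qed

lemma sdc_props:
  assumes "x \<in> sdc"
  shows "dl (db x) = - db (dl x)" "mb (dl x) = 0" "mm (db x) = 0" "mb (db x) = 0" "mm (dl x) = 0"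
proof -
  have x: "x \<in> V" "mb x = 0" "db (db x) = 0" "dl (dl x) = 0" "mm x = 0" using assms by (auto simp: sdc_def)
  show "dl (db x) = - db (dl x)" using relations(4)[OF x(1)] x by (simp add: eq_neg_iff_add_eq_0)
  show "mb (dl x) = 0" using relations(3)[OF x(1)] x by simp
  show "mm (db x) = 0" using relations(5)[OF x(1)] x by simp
  show "mb (db x) = 0" using relations(2)[OF x(1)] x by simp
  show "mm (dl x) = 0" using relations(6)[OF x(1)] x by simp
qed

lemma bcZ_sdc: "bcZ \<subseteq> sdc" by (auto simp: bcZ_def)

lemma bcB_bcZ: "bcB \<subseteq> bcZ"
proof
  fix y assume "y \<in> bcB"
  then obtain x where x: "y = dl (db x)" "x \<in> sdc" by (auto simp: bcB_def)
  have xV: "x \<in> V" "db (db x) = 0" "dl (dl x) = 0" using x by (auto simp: sdc_def)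
  note s = sdc_props[OF x(2)]
  have "mb y = 0" using relations(3)[of "db x"] xV s by (simp add: x)
  moreover have "mm y = 0" using relations(6)[of "db x"] xV s by (simp add: x)
  moreover have "dl y = 0" using relations(5)[of "db x"] xV s by (simp add: x)
  moreover have "db y = 0" using relations(3)[of "dl x"] xV s by (simp add: x(1))
  ultimately show "y \<in> bcZ" using xV x(1) by (simp add: bcZ_def sdc_def)
qed

lemma dd_eq: "dd x = mb x + db x + dl x + mm x"
  by (simp add: bidegrees_def add_ac)

lemma bcZ_sub: "bcZ \<subseteq> dol.dolZ" "bcZ \<subseteq> dolbar.dolZ" "bcZ \<subseteq> drZ"
  using cv.subspace_0[OF dol.subspaces(3)] cv.subspace_0[OF dolbar.subspaces(3)] unfolding dd_eq drZ_def dol.dolZ_def dolbar.dolZ_def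
  by (auto simp: bcZ_def sdc_def)

text \<open>For \<open>x\<close> in \<open>sdc\<close> one has \<open>dl (db x) = - db (dl x) = d (db x)\<close>, where \<open>mb (dl x) = 0\<close> and
  \<open>mm (db x) = 0\<close>.\<close>

lemma bcB_sub: "bcB \<subseteq> dol.dolB" "bcB \<subseteq> dolbar.dolB" "bcB \<subseteq> drB"
proof -
  have *: "dl (db x) \<in> dol.dolB \<and> dl (db x) \<in> dolbar.dolB \<and> dl (db x) \<in> drB" if x: "x \<in> sdc" for x
  proof (intro conjI)
    have xV: "x \<in> V" "db (db x) = 0" "dl (dl x) = 0" using x by (auto simp: sdc_def)
    note s = sdc_props[OF x]
    have "dl (db x) = db (- dl x)" using xV s by simp
    then have "dl (db x) \<in> db ` {x \<in> V. mb x = 0}" using xV s by (intro image_eqI[of _ _ "- dl x"]) simp_all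
    then show "dl (db x) \<in> dol.dolB" unfolding dol.dolB_def by (rule msum_left[OF dol.subspaces(3)])
    have "dl (db x) \<in> dl ` {x \<in> V. mm x = 0}" using xV s by (intro image_eqI[of _ _ "db x"]) simp_all
    then show "dl (db x) \<in> dolbar.dolB" unfolding dolbar.dolB_def by (rule msum_left[OF dolbar.subspaces(3)])
    have "dl (db x) = dd (db x)" unfolding dd_eq using xV s by simp
    then show "dl (db x) \<in> drB" unfolding drB_def by (rule image_eqI) (use xV in simp)
  qed
  show "bcB \<subseteq> dol.dolB" "bcB \<subseteq> dolbar.dolB" "bcB \<subseteq> drB" using * by (auto simp: bcB_def)
qed

text \<open>If \<open>db x = mb y\<close> then \<open>dl (db x) = dl (mb y)\<close> lies in \<open>qdc\<close>, and symmetrically.\<close>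

lemma dolZ_sub: "dol.dolZ \<subseteq> aeZ" "dolbar.dolZ \<subseteq> aeZ"
proof -
  show "dol.dolZ \<subseteq> aeZ" using dl_qdc qdcI(1) by (auto simp: dol.dolZ_def aeZ_def)
  show "dolbar.dolZ \<subseteq> aeZ" using db_qdc qdcI(4) by (auto simp: dolbar.dolZ_def aeZ_def simp flip: db_dl_qdc_iff)
qed

text \<open>For a closed \<open>x\<close> the term \<open>db x\<close> can be expressed by the three others, all of which \<open>dl\<close> maps to \<open>qdc\<close>.\<close>

lemma drZ_sub: "drZ \<subseteq> aeZ"
proof
  fix x assume "x \<in> drZ"
  then have x: "x \<in> V" "mb x + db x + dl x + mm x = 0" unfolding drZ_def dd_eq by auto
  then have "db x = - mb x - dl x - mm x" by (simp add: algebra_simps eq_neg_iff_add_eq_0)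
  then have "dl (db x) = - dl (mb x) - dl (dl x) - dl (mm x)" using x by simp
  then show "x \<in> aeZ"
    using x by (simp add: aeZ_def cv.subspace_diff[OF subspace_qdc] cv.subspace_neg[OF subspace_qdc] qdcI dl_qdc)
qed

lemma aeBI: "x \<in> V \<Longrightarrow> dl x \<in> aeB" "x \<in> V \<Longrightarrow> db x \<in> aeB" "x \<in> qdc \<Longrightarrow> x \<in> aeB"
proof -
  note i = image_subspace[OF lin V]
  show "x \<in> V \<Longrightarrow> dl x \<in> aeB" unfolding aeB_def
    by (rule msum_left[OF subspace_qdc], rule msum_left[OF i], rule imageI)
  show "x \<in> V \<Longrightarrow> db x \<in> aeB" unfolding aeB_def
    by (rule msum_left[OF subspace_qdc], rule msum_right[OF i], rule imageI)
  show "x \<in> qdc \<Longrightarrow> x \<in> aeB" unfolding aeB_def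
    by (rule msum_right[OF subspace_msum[OF i i]])
qed

lemma aeB_leI:
  assumes "cv.subspace U" "\<And>x. x \<in> V \<Longrightarrow> dl x \<in> U" "\<And>x. x \<in> V \<Longrightarrow> db x \<in> U" "qdc \<subseteq> U"
  shows "aeB \<subseteq> U"
  unfolding aeB_def using assms by (intro msum_leI[OF assms(1)]) auto

lemma qdc_aeB: "qdc \<subseteq> aeB" using aeBI(3) by blast

lemma aeB_aeZ: "aeB \<subseteq> aeZ"
proof (rule aeB_leI[OF subspace_aeZ])
  show "dl x \<in> aeZ" if "x \<in> V" for x
    using that db_dl_qdc_iff[of "dl x"] db_qdc[OF qdcI(3)] by (simp add: aeZ_def)
  show "db x \<in> aeZ" if "x \<in> V" for x
    using that dl_qdc[OF qdcI(2)] by (simp add: aeZ_def)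
  show "qdc \<subseteq> aeZ" using dl_qdc db_qdc qdc_V by (auto simp: aeZ_def)
qed

lemma dolB_sub: "dol.dolB \<subseteq> aeB" "dolbar.dolB \<subseteq> aeB"
  unfolding dol.dolB_def dolbar.dolB_def
  by (intro msum_leI[OF subspace_aeB]; use aeBI qdcI in auto)+

lemma drB_sub: "drB \<subseteq> aeB"
  unfolding drB_def dd_eq using aeBI qdcI by (auto intro!: cv.subspace_add[OF subspace_aeB])

lemma drB_drZ: "(\<And>x. x \<in> V \<Longrightarrow> dd (dd x) = 0) \<Longrightarrow> drB \<subseteq> drZ"
  unfolding drB_def drZ_def by (auto intro!: cv.subspace_sum[OF V])

lemma shift': "x \<in> V \<Longrightarrow> P i (D \<delta> x) = D \<delta> (P (i - \<delta>) x)"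
  using shift[of x "i - \<delta>" \<delta>] by simp

lemma stable_sdc: "stable P sdc"
  unfolding stable_def sdc_def by (simp flip: shift)

lemma stable_bcZ: "stable P bcZ"
  unfolding stable_def bcZ_def sdc_def by (simp flip: shift)

lemma stable_bcB: "stable P bcB"
  using stable_sdc sdc_V unfolding stable_def bcB_def by (auto simp: shift' subset_iff)

lemma stable_qdc: "stable P qdc"
  unfolding stable_def
proof (intro allI ballI)
  fix i x assume "x \<in> qdc"
  then show "P i x \<in> qdc"
    by (rule qdc_induct[OF _ splits_add_on[OF splits] subspace_qdc]) (simp_all add: shift' qdcI)
qed

lemma stable_aeZ: "stable P aeZ"
  using stable_qdc unfolding stable_def aeZ_def by (simp flip: shift)

lemma stable_aeB: "stable P aeB"
  unfolding stable_def
proof (intro allI ballI)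
  fix i x assume "x \<in> aeB"
  then obtain a b c where x: "x = dl a + db b + c" "a \<in> V" "b \<in> V" "c \<in> qdc"
    unfolding aeB_def msum_def by blast
  have "P i x = dl (P (i - (1, 0)) a) + db (P (i - (0, 1)) b) + P i c"
    using x qdc_V by (simp add: shift' subset_iff del: diff_Pair)
  also have "\<dots> \<in> aeB"
    using x stableD[OF stable_qdc] by (intro cv.subspace_add[OF subspace_aeB] aeBI) simp_all
  finally show "P i x \<in> aeB" .
qed

end

text \<open>Pullbacks preserve the bidegrees, whereas conjugation exchanges them; the permutation \<open>\<tau>\<close> covers
  both cases.\<close>

locale adc_map = A: almost_double_complex V P D + B: almost_double_complex V' P' D'
  for V :: "'v::complex_vector set" and P D and V' :: "'w::complex_vector set" and P' D' +
  fixes h :: "'v \<Rightarrow> 'w" and \<tau> :: "int \<times> int \<Rightarrow> int \<times> int"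
  assumes add: "add_on V h" and maps: "x \<in> V \<Longrightarrow> h x \<in> V'"
    and twist: "\<tau> = id \<or> \<tau> = prod.swap"
    and commute: "x \<in> V \<Longrightarrow> h (D \<delta> x) = D' (\<tau> \<delta>) (h x)"
begin

lemma h_simps [simp]: "h 0 = 0" "x \<in> V \<Longrightarrow> y \<in> V \<Longrightarrow> h (x + y) = h x + h y"
  "x \<in> V \<Longrightarrow> y \<in> V \<Longrightarrow> h (x - y) = h x - h y"
  using add_on_0[OF add A.V] add_onD[OF add] add_on_diff[OF add A.V] by auto

lemma h_neg: "x \<in> V \<Longrightarrow> h (- x) = - h x"
  using h_simps(3)[of 0 x] by simp

lemma ops: 
  "\<tau> = id \<Longrightarrow> x \<in> V \<Longrightarrow> B.mb (h x) = h (A.mb x) \<and> B.db (h x) = h (A.db x) \<and> B.dl (h x) = h (A.dl x) \<and> B.mm (h x) = h (A.mm x)"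
  "\<tau> = prod.swap \<Longrightarrow> x \<in> V \<Longrightarrow> B.mb (h x) = h (A.mm x) \<and> B.db (h x) = h (A.dl x) \<and> B.dl (h x) = h (A.db x) \<and> B.mm (h x) = h (A.mb x)"
  by (simp_all add: commute)

lemma sdc: assumes "x \<in> A.sdc" shows "h x \<in> B.sdc"
  using twist assms by (auto simp: A.sdc_def B.sdc_def ops maps)

lemma bcZ: assumes "x \<in> A.bcZ" shows "h x \<in> B.bcZ"
  using twist sdc[of x] assms by (auto simp: A.bcZ_def B.bcZ_def A.sdc_def ops)

lemma bcB: assumes "x \<in> A.bcB" shows "h x \<in> B.bcB"
proof -
  obtain y where y: "x = A.dl (A.db y)" "y \<in> A.sdc" using assms by (auto simp: A.bcB_def)
  have yV: "y \<in> V" using y by (auto simp: A.sdc_def)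
  from twist show ?thesis
  proof
    assume "\<tau> = id"
    then have "h x = B.dl (B.db (h y))" using yV y by (simp add: ops)
    then show ?thesis using sdc[OF y(2)] by (auto simp: B.bcB_def)
  next
    assume t: "\<tau> = prod.swap"
    have "h x = h (- A.db (A.dl y))" using A.sdc_props(1)[OF y(2)] y by simp
    also have "\<dots> = - h (A.db (A.dl y))" using yV by (simp add: h_neg)
    also have "\<dots> = - B.dl (B.db (h y))" using t yV by (simp add: ops)
    finally have "h x = - B.dl (B.db (h y))" .
    moreover have "B.dl (B.db (h y)) \<in> B.bcB" using sdc[OF y(2)] by (auto simp: B.bcB_def)
    ultimately show ?thesis using cv.subspace_neg[OF B.subspace_bcB] by simp
  qed
qed

lemma qdc: assumes "x \<in> A.qdc" shows "h x \<in> B.qdc"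
  by (rule A.qdc_induct[OF assms add B.subspace_qdc]; use twist in \<open>elim disjE\<close>)
    (auto simp flip: ops(1) ops(2) simp: maps intro: B.qdcI)

lemma aeZ: assumes "x \<in> A.aeZ" shows "h x \<in> B.aeZ"
proof -
  have x: "x \<in> V" "A.dl (A.db x) \<in> A.qdc" using assms by (auto simp: A.aeZ_def)
  then have q: "h (A.dl (A.db x)) \<in> B.qdc" "h (A.db (A.dl x)) \<in> B.qdc" using qdc A.db_dl_qdc_iff by auto
  from twist show ?thesis
  proof
    assume "\<tau> = id" then show ?thesis using q x by (simp add: B.aeZ_def ops maps)
  next
    assume "\<tau> = prod.swap" then show ?thesis using q x by (simp add: B.aeZ_def ops maps)
  qed
qed

lemma aeB: assumes "x \<in> A.aeB" shows "h x \<in> B.aeB"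
proof -
  obtain a b c where x: "x = A.dl a + A.db b + c" "a \<in> V" "b \<in> V" "c \<in> A.qdc"
    using assms unfolding A.aeB_def msum_def by blast
  then have cV: "c \<in> V" using A.qdc_V by auto
  have "h (A.dl a) \<in> B.aeB \<and> h (A.db b) \<in> B.aeB"
    using twist
  proof
    assume "\<tau> = id" then show ?thesis using x by (simp flip: ops(1) add: maps B.aeBI)
  next
    assume "\<tau> = prod.swap" then show ?thesis using x by (simp flip: ops(2) add: maps B.aeBI)
  qed
  moreover have "h x = h (A.dl a) + h (A.db b) + h c" using x cV by simp
  ultimately show ?thesis using qdc[OF x(4)] B.aeBI(3) cv.subspace_add[OF B.subspace_aeB] by simp
qed

lemma dol:
  assumes "\<tau> = id"
  shows "x \<in> A.dol.dolZ \<Longrightarrow> h x \<in> B.dol.dolZ" "x \<in> A.dol.dolB \<Longrightarrow> h x \<in> B.dol.dolB"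
    "x \<in> A.dolbar.dolZ \<Longrightarrow> h x \<in> B.dolbar.dolZ" "x \<in> A.dolbar.dolB \<Longrightarrow> h x \<in> B.dolbar.dolB"
proof -
  note o = ops(1)[OF assms]
  have i: "h y \<in> B.mb ` V'" if "y \<in> A.mb ` V" for y using that o maps by force
  have j: "h y \<in> B.mm ` V'" if "y \<in> A.mm ` V" for y using that o maps by force
  show "x \<in> A.dol.dolZ \<Longrightarrow> h x \<in> B.dol.dolZ" using i maps by (auto simp: A.dol.dolZ_def B.dol.dolZ_def o)
  show "x \<in> A.dolbar.dolZ \<Longrightarrow> h x \<in> B.dolbar.dolZ" using j maps by (auto simp: A.dolbar.dolZ_def B.dolbar.dolZ_def o)
  have k: "h y \<in> B.db ` {x \<in> V'. B.mb x = 0}" if "y \<in> A.db ` {x \<in> V. A.mb x = 0}" for y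
  proof -
    from that obtain z where z: "y = A.db z" "z \<in> V" "A.mb z = 0" by blast
    then show ?thesis using o[OF z(2)] maps by (intro image_eqI[of _ _ "h z"]) auto
  qed
  have l: "h y \<in> B.dl ` {x \<in> V'. B.mm x = 0}" if "y \<in> A.dl ` {x \<in> V. A.mm x = 0}" for y
  proof -
    from that obtain z where z: "y = A.dl z" "z \<in> V" "A.mm z = 0" by blast
    then show ?thesis using o[OF z(2)] maps by (intro image_eqI[of _ _ "h z"]) auto
  qed
  show "x \<in> A.dol.dolB \<Longrightarrow> h x \<in> B.dol.dolB" unfolding A.dol.dolB_def B.dol.dolB_def
    by (rule msum_map[OF add _ _ k i]) auto
  show "x \<in> A.dolbar.dolB \<Longrightarrow> h x \<in> B.dolbar.dolB" unfolding A.dolbar.dolB_def B.dolbar.dolB_def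
    by (rule msum_map[OF add _ _ l j]) auto
qed

lemma dr:
  assumes "\<tau> = id"
  shows "x \<in> A.drZ \<Longrightarrow> h x \<in> B.drZ" "x \<in> A.drB \<Longrightarrow> h x \<in> B.drB"
proof -
  have d: "B.dd (h x) = h (A.dd x)" if "x \<in> V" for x
    using ops(1)[OF assms that] that unfolding A.dd_eq B.dd_eq by simp
  show "x \<in> A.drZ \<Longrightarrow> h x \<in> B.drZ" using d maps by (auto simp: A.drZ_def B.drZ_def)
  assume "x \<in> A.drB"
  then obtain y where y: "x = A.dd y" "y \<in> V" unfolding A.drB_def by blast
  then have "h x = B.dd (h y)" using d by metis
  then show "h x \<in> B.drB" unfolding B.drB_def by (rule image_eqI) (rule maps[OF y(2)])
qed

end



section \<open>The cohomologies as quotients of spaces of forms\<close>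

text \<open>Cocycles and coboundaries of a differential on a quotient, computed with representatives.\<close>

lemma represents_cocyc:
  assumes r: "represents Z B Q q" and E: "\<And>x. x \<in> Z \<Longrightarrow> D' (q x) = q (E x)" "\<And>x. x \<in> Z \<Longrightarrow> E x \<in> Z"
  shows "cocyc Q D' = q ` {x \<in> Z. E x \<in> B}"
  using E represents_eq_zero[OF r] unfolding cocyc_def represents_carrier[OF r] by auto

lemma represents_cobd:
  assumes r: "represents Z B Q q" and E: "\<And>x. x \<in> Z \<Longrightarrow> D' (q x) = q (E x)"
  shows "cobd Q D' = q ` E ` Z"
  using E unfolding cobd_def represents_carrier[OF r] by (auto simp: image_iff)

lemma represents_set_add:
  assumes r: "represents Z B Q q" and S: "S \<subseteq> Z" "T \<subseteq> Z"
  shows "q ` S <+>\<^bsub>Q\<^esub> q ` T = q ` msum S T"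
proof -
  have "q ` S <+>\<^bsub>Q\<^esub> q ` T = (\<Union>x\<in>S. \<Union>y\<in>T. {q x \<oplus>\<^bsub>Q\<^esub> q y})" by (auto simp: set_add_def')
  also have "\<dots> = (\<Union>x\<in>S. \<Union>y\<in>T. {q (x + y)})"
    using S represents_add[OF r] by (intro SUP_cong refl) auto
  also have "\<dots> = q ` msum S T" by (auto simp: msum_def)
  finally show ?thesis .
qed

lemma represents_image_msum:
  assumes r: "represents Z B Q q" and S: "S \<subseteq> Z" shows "q ` msum S B = q ` S"
proof (intro subset_antisym subsetI)
  note B = represents_subspaces(2,3)[OF r]
  fix t assume "t \<in> q ` msum S B"
  then obtain x b where x: "t = q (x + b)" "x \<in> S" "b \<in> B" by (auto simp: msum_def)
  then have "q (x + b) = q x"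
    using S B represents_eq[OF r, of "x + b" x] cv.subspace_add[OF represents_subspaces(1)[OF r], of x b] by auto
  then show "t \<in> q ` S" using x by auto
next
  fix t assume "t \<in> q ` S"
  then show "t \<in> q ` msum S B" using msum_left[OF represents_subspaces(2)[OF r]] by blast
qed

text \<open>The four operators as one family indexed by bidegree.\<close>

definition Dop :: "('a, 'e::real_inner) acm \<Rightarrow> int \<times> int \<Rightarrow> ('a, 'e) form \<Rightarrow> ('a, 'e) form" where
  "Dop X \<delta> = d_part X (fst \<delta>) (snd \<delta>)"

lemma Dop_simps: "Dop X (-1, 2) = mubar X" "Dop X (0, 1) = delbar X" "Dop X (1, 0) = del X" "Dop X (2, -1) = mu X"
  by (simp_all add: Dop_def mubar_def delbar_def del_def mu_def)

sublocale almost_complex \<subseteq> adc: almost_double_complex "forms X" "cpt X" "Dop X"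
  rewrites "Dop X (-1, 2) = mubar X" and "Dop X (0, 1) = delbar X" and "Dop X (1, 0) = del X" and "Dop X (2, -1) = mu X"
proof -
  show "almost_double_complex (forms X) (cpt X) (Dop X)"
    by unfold_locales (simp_all only: Dop_def splits_cpt lin_Dp Dp_forms Dp_cpt Dp_relation)
qed (rule Dop_simps)+

text \<open>The class of a form in \<open>A_q\<close> and in the Bott--Chern, Aeppli, de Rham and (iterated) Dolbeault
  cohomologies. These maps are defined for all forms, but are meaningful only on the respective cocycles.\<close>

definition qI :: "('a, 'e::real_inner) acm \<Rightarrow> ('a, 'e) form \<Rightarrow> ('a, 'e) form set" where
  "qI X \<omega> = I_q X +>\<^bsub>\<A> X\<^esub> \<omega>"

definition qBC :: "('a, 'e::real_inner) acm \<Rightarrow> ('a, 'e) form \<Rightarrow> ('a, 'e) form set" where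
  "qBC X \<omega> = BC_B X +>\<^bsub>A_s X\<^esub> \<omega>"

definition qA :: "('a, 'e::real_inner) acm \<Rightarrow> ('a, 'e) form \<Rightarrow> ('a, 'e) form set set" where
  "qA X \<omega> = AE_B X +>\<^bsub>A_q X\<^esub> qI X \<omega>"

definition qdR :: "('a, 'e::real_inner) acm \<Rightarrow> ('a, 'e) form \<Rightarrow> ('a, 'e) form set" where
  "qdR X \<omega> = cobd (\<A> X) (ext_diff X) +>\<^bsub>\<A> X\<^esub> \<omega>"

definition q1 :: "('a, 'e::real_inner) acm \<Rightarrow> (('a, 'e) form \<Rightarrow> ('a, 'e) form) \<Rightarrow> ('a, 'e) form \<Rightarrow> ('a, 'e) form set" where
  "q1 X D \<omega> = cobd (\<A> X) D +>\<^bsub>\<A> X\<^esub> \<omega>"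

definition q2 :: "('a, 'e::real_inner) acm \<Rightarrow> (('a, 'e) form \<Rightarrow> ('a, 'e) form) \<Rightarrow> (('a, 'e) form \<Rightarrow> ('a, 'e) form) \<Rightarrow>
    ('a, 'e) form \<Rightarrow> ('a, 'e) form set set" where
  "q2 X D E \<omega> = cobd (H1 X D) (to_H1 X D E) +>\<^bsub>H1 X D\<^esub> q1 X D \<omega>"

context almost_complex
begin

lemma form_alg_simps:
  "carrier (\<A> X) = forms X" "mult (\<A> X) = wedge" "\<one>\<^bsub>\<A> X\<^esub> = unit_form X" "\<zero>\<^bsub>\<A> X\<^esub> = 0"
  "\<omega> \<oplus>\<^bsub>\<A> X\<^esub> \<eta> = \<omega> + \<eta>" "a \<odot>\<^bsub>\<A> X\<^esub> \<omega> = a *\<^sub>C \<omega>"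
  by (simp_all add: form_alg_def cscale_fun_def cscale_complex_def)

lemma represents_alg: "represents (forms X) {0} (\<A> X) id"
  unfolding represents_def by (auto simp: form_alg_simps forms_subspace cv.subspace_0 cv.subspace_def)

lemma A_s_simps:
  "carrier (A_s X) = adc.sdc" "mult (A_s X) = wedge" "\<one>\<^bsub>A_s X\<^esub> = unit_form X" "\<zero>\<^bsub>A_s X\<^esub> = 0"
  "\<omega> \<oplus>\<^bsub>A_s X\<^esub> \<eta> = \<omega> + \<eta>" "a \<odot>\<^bsub>A_s X\<^esub> \<omega> = a *\<^sub>C \<omega>"
  using form_alg_simps by (auto simp: A_s_def adc.sdc_def cocyc_def)

lemma represents_A_s: "represents adc.sdc {0} (A_s X) id"
  using adc.subspace_sdc unfolding represents_def by (auto simp: A_s_simps cv.subspace_0 cv.subspace_def)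

lemma BC_sets: "BC_Z X = adc.bcZ" "BC_B X = adc.bcB"
  by (auto simp: BC_Z_def BC_B_def bc_cocyc_def bc_cobd_def cocyc_def cobd_def A_s_simps adc.bcZ_def adc.bcB_def)

lemma represents_BC: "represents adc.bcZ adc.bcB (H_BC X) (qBC X)"
  using represents_subquot[OF represents_A_s adc.subspace_bcZ adc.subspace_bcB _ adc.bcB_bcZ adc.bcZ_sdc]
    cv.subspace_0[OF adc.subspace_bcB]
  by (simp add: H_BC_def BC_sets qBC_def[abs_def])

lemma set_add_alg: "S <+>\<^bsub>\<A> X\<^esub> T = msum S T"
  unfolding set_add_def' msum_def by (auto simp: form_alg_simps)

lemma I_q_eq: "I_q X = adc.qdc"
  by (simp add: I_q_def set_add_alg adc.qdc_def cobd_def form_alg_simps o_def)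

lemma represents_A_q: "represents (forms X) adc.qdc (A_q X) (qI X)"
  using represents_subquot[OF represents_alg forms_subspace adc.subspace_qdc _ adc.qdc_V subset_refl]
    cv.subspace_0[OF adc.subspace_qdc]
  by (simp add: A_q_def I_q_eq qI_def[abs_def])

end

locale ac_pair = X: almost_complex X + Y: almost_complex Y
  for X :: "('a, 'e::real_inner) acm" and Y :: "('b, 'f::real_inner) acm"
begin

lemma BC_induced:
  assumes h: "add_on Y.adc.bcZ h" "\<And>x. x \<in> Y.adc.bcZ \<Longrightarrow> h x \<in> X.adc.bcZ" "\<And>x. x \<in> Y.adc.bcB \<Longrightarrow> h x \<in> X.adc.bcB"
    and x: "x \<in> Y.adc.bcZ"
  shows "induced (A_s X) (BC_B X) h (qBC Y x) = qBC X (h x)"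
proof -
  have "induced (A_s X) (BC_B X) h ((id ` Y.adc.bcB) +>\<^bsub>A_s Y\<^esub> id x) = qBC X (h x)"
    by (rule induced_coset[OF Y.represents_A_s Y.adc.subspace_bcZ Y.adc.subspace_bcB Y.adc.bcB_bcZ Y.adc.bcZ_sdc X.represents_BC h])
      (simp_all add: x qBC_def)
  then show ?thesis by (simp add: qBC_def Y.BC_sets)
qed

lemma to_q_coset:
  assumes h: "add_on (forms Y) h" "\<And>x. x \<in> forms Y \<Longrightarrow> h x \<in> forms X" "\<And>x. x \<in> Y.adc.qdc \<Longrightarrow> h x \<in> X.adc.qdc"
    and x: "x \<in> forms Y"
  shows "to_q X h (qI Y x) = qI X (h x)"
proof -
  have "induced (\<A> X) (I_q X) h ((id ` Y.adc.qdc) +>\<^bsub>\<A> Y\<^esub> id x) = qI X (h x)"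
    by (rule induced_coset[OF Y.represents_alg Y.forms_subspace Y.adc.subspace_qdc Y.adc.qdc_V subset_refl X.represents_A_q h])
      (simp_all add: x qI_def)
  then show ?thesis by (simp add: qI_def to_q_def Y.I_q_eq)
qed

end

sublocale almost_complex \<subseteq> self: ac_pair X X
  by unfold_locales

context almost_complex
begin

lemma AE_sets: "AE_Z X = qI X ` adc.aeZ" "AE_B X = qI X ` adc.aeB"
proof -
  have 1: "to_q X (del X) (qI X x) = qI X (del X x)" if "x \<in> forms X" for x
    by (rule self.to_q_coset[OF lin_on_add_on[OF adc.dolbar.lin(2)] adc.dolbar.closed(2) adc.dl_qdc that])
  have 2: "to_q X (delbar X) (qI X x) = qI X (delbar X x)" if "x \<in> forms X" for x
    by (rule self.to_q_coset[OF lin_on_add_on[OF adc.dol.lin(2)] adc.dol.closed(2) adc.db_qdc that])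
  have d: "del X ` forms X \<subseteq> forms X" "delbar X ` forms X \<subseteq> forms X"
    using adc.dolbar.closed(2) adc.dol.closed(2) by auto
  show "AE_Z X = qI X ` adc.aeZ"
    unfolding AE_Z_def ae_cocyc_def adc.aeZ_def
    by (rule represents_cocyc[OF represents_A_q]) (simp_all add: 1 2 adc.dolbar.closed(2) adc.dol.closed(2))
  have "AE_B X = qI X ` del X ` forms X <+>\<^bsub>A_q X\<^esub> qI X ` delbar X ` forms X"
    unfolding AE_B_def ae_cobd_def
    by (intro arg_cong2[where f = "set_add (A_q X)"] represents_cobd[OF represents_A_q] 1 2)
  also have "\<dots> = qI X ` msum (del X ` forms X) (delbar X ` forms X)"
    by (rule represents_set_add[OF represents_A_q d])
  also have "\<dots> = qI X ` adc.aeB"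
    unfolding adc.aeB_def by (rule represents_image_msum[OF represents_A_q msum_leI[OF forms_subspace d], symmetric])
  finally show "AE_B X = qI X ` adc.aeB" .
qed

lemma aeZ_forms: "adc.aeZ \<subseteq> forms X" by (auto simp: adc.aeZ_def)

lemma represents_A: "represents adc.aeZ adc.aeB (H_A X) (qA X)"
  using represents_subquot[OF represents_A_q adc.subspace_aeZ adc.subspace_aeB adc.qdc_aeB adc.aeB_aeZ aeZ_forms]
  by (simp add: H_A_def AE_sets qA_def[abs_def])

lemma dR_sets: "cocyc (\<A> X) (ext_diff X) = adc.drZ" "cobd (\<A> X) (ext_diff X) = adc.drB"
proof -
  have "ext_diff X x = (\<Sum>\<delta>\<in>bidegrees. Dop X \<delta> x)" if "x \<in> forms X" for x
    using ext_diff_Dp[OF that] by (simp add: Dop_def)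
  then show "cocyc (\<A> X) (ext_diff X) = adc.drZ" "cobd (\<A> X) (ext_diff X) = adc.drB"
    by (auto simp: cocyc_def cobd_def adc.drZ_def adc.drB_def form_alg_simps intro!: image_cong)
qed

lemma drB_drZ: "adc.drB \<subseteq> adc.drZ"
proof -
  have "cobd (\<A> X) (ext_diff X) \<subseteq> cocyc (\<A> X) (ext_diff X)"
    by (auto simp: cocyc_def cobd_def form_alg_simps ext_diff_forms ext_diff_ext_diff)
  then show ?thesis by (simp add: dR_sets)
qed

lemma drZ_forms: "adc.drZ \<subseteq> forms X" by (auto simp: adc.drZ_def)

lemma represents_dR: "represents adc.drZ adc.drB (H_dR X) (qdR X)"
  using represents_subquot[OF represents_alg adc.subspace_drZ adc.subspace_drB _ drB_drZ drZ_forms]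
    cv.subspace_0[OF adc.subspace_drB]
  by (simp add: H_dR_def cohom_def dR_sets qdR_def[abs_def])

end

context ac_pair
begin

lemma A_induced:
  assumes h: "add_on (forms Y) h" "\<And>x. x \<in> forms Y \<Longrightarrow> h x \<in> forms X" "\<And>x. x \<in> Y.adc.qdc \<Longrightarrow> h x \<in> X.adc.qdc"
    and h': "\<And>x. x \<in> Y.adc.aeZ \<Longrightarrow> h x \<in> X.adc.aeZ" "\<And>x. x \<in> Y.adc.aeB \<Longrightarrow> h x \<in> X.adc.aeB"
    and x: "x \<in> Y.adc.aeZ"
  shows "induced (A_q X) (AE_B X) (to_q X h) (qA Y x) = qA X (h x)"
proof -
  have e: "AE_B X +>\<^bsub>A_q X\<^esub> to_q X h (qI Y y) = qA X (h y)" if "y \<in> Y.adc.aeZ" for y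
    using to_q_coset[OF h, of y] that Y.aeZ_forms by (auto simp: qA_def)
  have "induced (A_q X) (AE_B X) (to_q X h) ((qI Y ` Y.adc.aeB) +>\<^bsub>A_q Y\<^esub> qI Y x) = qA X (h x)"
    by (rule induced_coset[OF Y.represents_A_q Y.adc.subspace_aeZ Y.adc.subspace_aeB Y.adc.aeB_aeZ Y.aeZ_forms X.represents_A
      add_on_subset[OF h(1) Y.aeZ_forms] h' _ x]) (assumption | rule e)+
  then show ?thesis by (simp add: qA_def Y.AE_sets)
qed

lemma dR_induced:
  assumes h: "add_on Y.adc.drZ h" "\<And>x. x \<in> Y.adc.drZ \<Longrightarrow> h x \<in> X.adc.drZ" "\<And>x. x \<in> Y.adc.drB \<Longrightarrow> h x \<in> X.adc.drB"
    and x: "x \<in> Y.adc.drZ"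
  shows "induced (\<A> X) (cobd (\<A> X) (ext_diff X)) h (qdR Y x) = qdR X (h x)"
proof -
  have "induced (\<A> X) (cobd (\<A> X) (ext_diff X)) h ((id ` Y.adc.drB) +>\<^bsub>\<A> Y\<^esub> id x) = qdR X (h x)"
    by (rule induced_coset[OF Y.represents_alg Y.adc.subspace_drZ Y.adc.subspace_drB Y.drB_drZ Y.drZ_forms X.represents_dR h])
      (simp_all add: x qdR_def)
  then show ?thesis by (simp add: qdR_def Y.dR_sets)
qed

end

text \<open>Dolbeault cohomology and its conjugate are treated together; the inclusions record how the pair
  compares with Bott--Chern and Aeppli cocycles and coboundaries.\<close>

locale dolbeault = almost_complex X + dp: dolbeault_pair "forms X" "cpt X" D E \<delta> \<epsilon>
  for X :: "('a, 'e::real_inner) acm" and D E \<delta> \<epsilon> +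
  assumes im_D: "D ` forms X \<subseteq> adc.qdc"
    and BC: "adc.bcZ \<subseteq> dp.dolZ" "adc.bcB \<subseteq> dp.dolB"
    and AE: "dp.dolZ \<subseteq> adc.aeZ" "dp.dolB \<subseteq> adc.aeB"
begin

lemma H1_sets: "cocyc (\<A> X) D = {x \<in> forms X. D x = 0}" "cobd (\<A> X) D = D ` forms X"
  by (simp_all add: cocyc_def cobd_def form_alg_simps)

lemma represents_H1: "represents {x \<in> forms X. D x = 0} (D ` forms X) (H1 X D) (q1 X D)"
  using represents_subquot[OF represents_alg dp.subspaces(2,3) _ dp.dolB_sub(4)] cv.subspace_0[OF dp.subspaces(3)]
  by (simp add: H1_def cohom_def H1_sets q1_def[abs_def])

lemma to_H1_E: "x \<in> forms X \<Longrightarrow> D x = 0 \<Longrightarrow> to_H1 X D E (q1 X D x) = q1 X D (E x)"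
proof -
  assume x: "x \<in> forms X" "D x = 0"
  have "induced (\<A> X) (cobd (\<A> X) D) E ((id ` D ` forms X) +>\<^bsub>\<A> X\<^esub> id x) = q1 X D (E x)"
  proof (rule induced_coset[OF represents_alg dp.subspaces(2,3) dp.dolB_sub(4) _ represents_H1])
    show "add_on {x \<in> forms X. D x = 0} E" by (rule add_on_subset[OF lin_on_add_on[OF dp.lin(2)]]) auto
    show "E y \<in> {x \<in> forms X. D x = 0}" if "y \<in> {x \<in> forms X. D x = 0}" for y
      using that dp.closed(2) dp.square(2) by (simp add: dp.zero)
    show "E y \<in> D ` forms X" if "y \<in> D ` forms X" for y
      using that dp.dolB_sub(1,2) by (auto simp: dp.dolZ_def)
  qed (use x in \<open>auto simp: q1_def\<close>)
  then show "to_H1 X D E (q1 X D x) = q1 X D (E x)" by (simp add: to_H1_def q1_def H1_sets)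
qed

lemma H2_sets:
  "cocyc (H1 X D) (to_H1 X D E) = q1 X D ` dp.dolZ" "cobd (H1 X D) (to_H1 X D E) = q1 X D ` dp.dolB"
proof -
  have E: "E x \<in> {x \<in> forms X. D x = 0}" if "x \<in> {x \<in> forms X. D x = 0}" for x
    using that dp.closed(2) dp.square(2) by (simp add: dp.zero)
  show "cocyc (H1 X D) (to_H1 X D E) = q1 X D ` dp.dolZ"
    using represents_cocyc[OF represents_H1 _ E, of "to_H1 X D E"] to_H1_E by (simp add: dp.dolZ_def conj_assoc)
  have "cobd (H1 X D) (to_H1 X D E) = q1 X D ` E ` {x \<in> forms X. D x = 0}"
    by (rule represents_cobd[OF represents_H1]) (simp add: to_H1_E)
  also have "\<dots> = q1 X D ` dp.dolB"
    unfolding dp.dolB_def using E by (intro represents_image_msum[OF represents_H1, symmetric]) blast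
  finally show "cobd (H1 X D) (to_H1 X D E) = q1 X D ` dp.dolB" .
qed

lemma represents_H2: "represents dp.dolZ dp.dolB (H2 X D E) (q2 X D E)"
  using represents_subquot[OF represents_H1 dp.subspaces(4,5) dp.dolB_sub(1,2,3)]
  by (simp add: H2_def cohom_def H2_sets q2_def[abs_def])

lemma BC_to_H2_coset: assumes x: "x \<in> adc.bcZ" shows "BC_to_H2 X D E (qBC X x) = q2 X D E x"
proof -
  have "induced (H1 X D) (cobd (H1 X D) (to_H1 X D E)) (\<lambda>\<omega>. cobd (\<A> X) D +>\<^bsub>\<A> X\<^esub> \<omega>)
      ((id ` adc.bcB) +>\<^bsub>A_s X\<^esub> id x) = q2 X D E (id x)"
    by (rule induced_coset[OF represents_A_s adc.subspace_bcZ adc.subspace_bcB adc.bcB_bcZ adc.bcZ_sdc represents_H2])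
      (use BC x in \<open>auto simp: q2_def q1_def add_on_def\<close>)
  then show ?thesis by (simp add: BC_to_H2_def qBC_def BC_sets)
qed

lemma H2_to_A_coset: assumes x: "x \<in> dp.dolZ" shows "H2_to_A X (q2 X D E x) = qA X x"
proof -
  have "to_q X id (q1 X D y) = qI X y" if y: "y \<in> forms X" "D y = 0" for y
  proof -
    have "induced (\<A> X) (I_q X) id ((id ` D ` forms X) +>\<^bsub>\<A> X\<^esub> id y) = qI X (id y)"
      by (rule induced_coset[OF represents_alg dp.subspaces(2,3) dp.dolB_sub(4) _ represents_A_q])
        (use im_D y in \<open>auto simp: qI_def add_on_def\<close>)
    then show ?thesis by (simp add: to_q_def q1_def H1_sets)
  qed
  then have "AE_B X +>\<^bsub>A_q X\<^esub> to_q X id (q1 X D y) = qA X y" if "y \<in> dp.dolZ" for y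
    using that dp.dolB_sub(3) by (auto simp: qA_def)
  then have "induced (A_q X) (AE_B X) (to_q X id) ((q1 X D ` dp.dolB) +>\<^bsub>H1 X D\<^esub> q1 X D x) = qA X (id x)"
    using AE x
    by (intro induced_coset[OF represents_H1 dp.subspaces(4,5) dp.dolB_sub(2) _ represents_A]) (auto simp: add_on_def dp.dolZ_def)
  then show ?thesis by (simp add: H2_to_A_def q2_def H2_sets)
qed

end

sublocale almost_complex \<subseteq> dol: dolbeault X "mubar X" "delbar X" "(-1, 2)" "(0, 1)"
  by (intro dolbeault.intro dolbeault_axioms.intro image_subsetI)
    (rule almost_complex_axioms adc.dol.dolbeault_pair_axioms adc.qdcI(1) adc.bcZ_sub(1) adc.bcB_sub(1) adc.dolZ_sub(1) adc.dolB_sub(1); assumption?)+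

sublocale almost_complex \<subseteq> dolbar: dolbeault X "mu X" "del X" "(2, -1)" "(1, 0)"
  by (intro dolbeault.intro dolbeault_axioms.intro image_subsetI)
    (rule almost_complex_axioms adc.dolbar.dolbeault_pair_axioms adc.qdcI(4) adc.bcZ_sub(2) adc.bcB_sub(2) adc.dolZ_sub(2) adc.dolB_sub(2); assumption?)+



subsection \<open>Gradings and filtrations\<close>

context almost_complex
begin

lemma splits_sets: "splits adc.bcZ (cpt X)" "splits adc.aeZ (cpt X)"
proof -
  have sub: "adc.bcZ \<subseteq> forms X" "adc.aeZ \<subseteq> forms X"
    using adc.bcZ_sdc adc.sdc_V by (auto simp: adc.aeZ_def)
  show "splits adc.bcZ (cpt X)"
    by (rule splits_restrict[OF splits_cpt adc.subspace_bcZ sub(1) stableD[OF adc.stable_bcZ]])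
  show "splits adc.aeZ (cpt X)"
    by (rule splits_restrict[OF splits_cpt adc.subspace_aeZ sub(2) stableD[OF adc.stable_aeZ]])
qed

lemma form_pq_Int: "S \<subseteq> forms X \<Longrightarrow> S \<inter> form_pq X i = {x \<in> S. cpt X i x = x}"
  by (auto simp: form_pq_iff)

lemma bcZ_forms: "adc.bcZ \<subseteq> forms X" using adc.bcZ_sdc adc.sdc_V by blast

lemma H_BC_pq_eq: "H_BC_pq X i = qBC X ` {x \<in> adc.bcZ. cpt X i x = x}"
  by (simp add: H_BC_pq_def subquot_gr_def BC_sets qBC_def[abs_def] form_pq_Int[OF bcZ_forms])

lemma H_A_pq_eq: "H_A_pq X i = qA X ` {x \<in> adc.aeZ. cpt X i x = x}"
proof -
  have "A_q_pq X i = qI X ` (forms X \<inter> form_pq X i)"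
    by (simp add: A_q_pq_def subquot_gr_def qI_def[abs_def])
  from subquot_gr_image[where G = "form_pq X" and G' = "A_q_pq X" and i = i, OF represents_A_q adc.subspace_aeZ order_trans[OF adc.qdc_aeB adc.aeB_aeZ] aeZ_forms this, of adc.aeB]
  show ?thesis by (simp add: H_A_pq_def AE_sets qA_def[abs_def] form_pq_Int[OF aeZ_forms])
qed

lemma graded_BC: "graded_space (H_BC X) (H_BC_pq X)"
  by (rule graded_space_represents[OF represents_BC splits_sets(1) stableD[OF adc.stable_bcB] H_BC_pq_eq])

lemma graded_A: "graded_space (H_A X) (H_A_pq X)"
  by (rule graded_space_represents[OF represents_A splits_sets(2) stableD[OF adc.stable_aeB] H_A_pq_eq])

end

lemma (in dolbeault) H2_pq_eq: "H2_pq X D E i = q2 X D E ` {x \<in> dp.dolZ. cpt X i x = x}"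
proof -
  have K: "{x \<in> forms X. D x = 0} \<subseteq> forms X" "dp.dolZ \<subseteq> forms X" using dp.dolB_sub(3) by auto
  have "cohom_gr (\<A> X) D (form_pq X) i = q1 X D ` ({x \<in> forms X. D x = 0} \<inter> form_pq X i)"
    by (simp add: cohom_gr_def subquot_gr_def q1_def[abs_def] H1_sets)
  from subquot_gr_image[where G = "form_pq X" and G' = "cohom_gr (\<A> X) D (form_pq X)" and i = i, OF represents_H1 dp.subspaces(4) order_trans[OF dp.dolB_sub(1,2)] dp.dolB_sub(3) this, of dp.dolB]
  show ?thesis by (simp add: H2_pq_def cohom_gr_def H2_sets q2_def[abs_def] form_pq_Int[OF K(2)])
qed

lemma (in dolbeault) graded_H2: "graded_space (H2 X D E) (H2_pq X D E)"
proof (rule graded_space_represents[OF represents_H2 _ stableD[OF dp.stable(4)] H2_pq_eq])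
  show "splits dp.dolZ (cpt X)"
    using dp.dolB_sub(3) by (intro splits_restrict[OF splits_cpt dp.subspaces(4) _ stableD[OF dp.stable(3)]]) auto
qed

text \<open>The elements that are supported in \<open>S\<close>, up to a component at \<open>j\<close> that is annihilated by \<open>D\<close>.\<close>

definition filtered :: "(int \<times> int \<Rightarrow> 'v \<Rightarrow> 'v::complex_vector) \<Rightarrow> ('v \<Rightarrow> 'v) \<Rightarrow> 'v set \<Rightarrow> (int \<times> int) set \<Rightarrow> int \<times> int \<Rightarrow> 'v set" where
  "filtered P D V S j = {x \<in> V. (\<forall>i. i \<notin> insert j S \<longrightarrow> P i x = 0) \<and> D (P j x) = 0}"

lemma filtered_sum:
  assumes s: "splits V P" and D: "lin_on V D" and j: "j \<notin> S"
  shows "msum {x \<in> V. D x = 0 \<and> P j x = x} {x \<in> V. \<forall>i. i \<notin> S \<longrightarrow> P i x = 0} = filtered P D V S j"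
proof (intro subset_antisym subsetI)
  note V = splits_subspace[OF s]
  fix x assume "x \<in> msum {x \<in> V. D x = 0 \<and> P j x = x} {x \<in> V. \<forall>i. i \<notin> S \<longrightarrow> P i x = 0}"
  then obtain a b where x: "x = a + b" and a: "a \<in> V" "D a = 0" "P j a = a" and b: "b \<in> V" "\<And>i. i \<notin> S \<Longrightarrow> P i b = 0"
    unfolding msum_def by blast
  have P: "P i x = P i a + P i b" for i unfolding x by (rule add_onD[OF splits_add_on[OF s] a(1) b(1)])
  have "P i a = 0" if "i \<noteq> j" for i using splits_proj[OF s a(1), of i j] that a(3) by simp
  then show "x \<in> filtered P D V S j"
    using P a b j cv.subspace_add[OF V a(1) b(1)] by (auto simp: filtered_def x)
next
  note V = splits_subspace[OF s]
  fix x assume "x \<in> filtered P D V S j"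
  then have x: "x \<in> V" "\<And>i. i \<notin> insert j S \<Longrightarrow> P i x = 0" "D (P j x) = 0" unfolding filtered_def by blast+
  note P = splits_closed[OF s x(1), of j]
  have "P i (x - P j x) = P i x - (if i = j then P j x else 0)" for i
    using add_on_diff[OF splits_add_on[OF s] V x(1) P] splits_proj[OF s x(1)] by simp
  then have "\<forall>i. i \<notin> S \<longrightarrow> P i (x - P j x) = 0" using x(2) by auto
  moreover have "x - P j x \<in> V" using x(1) P by (rule cv.subspace_diff[OF V])
  ultimately have "P j x + (x - P j x) \<in> msum {x \<in> V. D x = 0 \<and> P j x = x} {x \<in> V. \<forall>i. i \<notin> S \<longrightarrow> P i x = 0}"
    using P x(3) splits_proj[OF s x(1), of j j] by (intro msumI) auto
  then show "x \<in> msum {x \<in> V. D x = 0 \<and> P j x = x} {x \<in> V. \<forall>i. i \<notin> S \<longrightarrow> P i x = 0}" by simp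
qed

lemma filtered_subspace: 
  assumes s: "splits V P" and D: "lin_on V D" shows "cv.subspace (filtered P D V S j)"
proof -
  note V = splits_subspace[OF s]
  have "lin_on V (\<lambda>x. D (P j x))"
    using splits_lin[OF s] D splits_closed[OF s] by (simp add: lin_on_def)
  from cv.subspace_inter[OF splits_supp_subspace[OF s, of "insert j S"] kernel_subspace[OF this V]]
  show ?thesis by (rule back_subst[where P = cv.subspace]) (auto simp: filtered_def)
qed

context almost_complex
begin

lemma form_F_eq: "form_F X p k = filtered (cpt X) (mubar X) (forms X) {(r, s). r + s = k \<and> p < r} (p, k - p)"
  and form_Fbar_eq: "form_Fbar X p k = filtered (cpt X) (mu X) (forms X) {(r, s). r + s = k \<and> p < s} (k - p, p)"
proof -
  have sum: "sum_of (\<A> X) (form_pq X) S = {x \<in> forms X. \<forall>i. i \<notin> S \<longrightarrow> cpt X i x = 0}" for S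
  proof -
    have "form_pq X i = id ` {x \<in> forms X. cpt X i x = x}" for i by (auto simp: form_pq_iff)
    from sum_of_represents[OF represents_alg splits_cpt this] show ?thesis by simp
  qed
  have K: "cocyc (\<A> X) D \<inter> form_pq X j = {x \<in> forms X. D x = 0 \<and> cpt X j x = x}" for D j
    by (auto simp: cocyc_def form_alg_simps form_pq_iff)
  show "form_F X p k = filtered (cpt X) (mubar X) (forms X) {(r, s). r + s = k \<and> p < r} (p, k - p)"
    unfolding form_F_def set_add_alg sum K by (rule filtered_sum[OF splits_cpt adc.dol.lin(1)]) simp
  show "form_Fbar X p k = filtered (cpt X) (mu X) (forms X) {(r, s). r + s = k \<and> p < s} (k - p, p)"
    unfolding form_Fbar_def set_add_alg sum K by (rule filtered_sum[OF splits_cpt adc.dolbar.lin(1)]) simp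
qed

lemma subspace_F: "cv.subspace (form_F X p k)" "cv.subspace (form_Fbar X p k)"
  unfolding form_F_eq form_Fbar_eq by (intro filtered_subspace[OF splits_cpt] adc.dol.lin adc.dolbar.lin)+

lemma form_F_iff:
  "x \<in> form_F X p k \<longleftrightarrow> x \<in> forms X \<and> (\<forall>i. i \<notin> {(r, s). r + s = k \<and> p \<le> r} \<longrightarrow> cpt X i x = 0) \<and> mubar X (cpt X (p, k - p) x) = 0"
  "x \<in> form_Fbar X p k \<longleftrightarrow> x \<in> forms X \<and> (\<forall>i. i \<notin> {(r, s). r + s = k \<and> p \<le> s} \<longrightarrow> cpt X i x = 0) \<and> mu X (cpt X (k - p, p) x) = 0"
proof -
  have "insert (p, k - p) {(r, s). r + s = k \<and> p < r} = {(r, s). r + s = k \<and> p \<le> r}"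
    "insert (k - p, p) {(r, s). r + s = k \<and> p < s} = {(r, s). r + s = k \<and> p \<le> s}" by auto
  then show "x \<in> form_F X p k \<longleftrightarrow> x \<in> forms X \<and> (\<forall>i. i \<notin> {(r, s). r + s = k \<and> p \<le> r} \<longrightarrow> cpt X i x = 0) \<and> mubar X (cpt X (p, k - p) x) = 0"
    "x \<in> form_Fbar X p k \<longleftrightarrow> x \<in> forms X \<and> (\<forall>i. i \<notin> {(r, s). r + s = k \<and> p \<le> s} \<longrightarrow> cpt X i x = 0) \<and> mu X (cpt X (k - p, p) x) = 0"
    unfolding form_F_eq form_Fbar_eq filtered_def by simp_all
qed

lemma form_F_mono: "form_F X (p + 1) k \<subseteq> form_F X p k" "form_Fbar X (p + 1) k \<subseteq> form_Fbar X p k"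
  by (auto simp: form_F_iff adc.dol.zero adc.dolbar.zero)

lemma form_F_deg: "form_F X p k \<subseteq> form_deg X k" "form_Fbar X p k \<subseteq> form_deg X k"
  by (auto simp: form_F_iff form_deg_iff dgr_eq_iff_cpt)

lemma dR_gr_eq:
  "H_dR_deg X k = qdR X ` (adc.drZ \<inter> form_deg X k)" "dR_F X p k = qdR X ` (adc.drZ \<inter> form_F X p k)"
  "dR_Fbar X p k = qdR X ` (adc.drZ \<inter> form_Fbar X p k)"
  by (simp_all add: H_dR_deg_def dR_F_def dR_Fbar_def cohom_gr_def subquot_gr_def dR_sets qdR_def[abs_def])

text \<open>De Rham cohomology is graded by degree only: \<open>d\<close> is homogeneous for the degree but not for the type.\<close>

lemma bifiltered_dR: "bifiltered_space (H_dR X) (H_dR_deg X) (dR_F X) (dR_Fbar X)"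
  unfolding bifiltered_space_def
proof (intro conjI allI)
  have Z: "dgr k x \<in> adc.drZ" if "x \<in> adc.drZ" for k x
    using that ext_diff_dgr[of x k] dgr_forms[of x k] by (auto simp: cocyc_def form_alg_simps dgr_def fun_eq_iff zero_fun_apply simp flip: dR_sets)
  have B: "dgr k x \<in> adc.drB" if "x \<in> adc.drB" for k x
  proof -
    from that obtain y where y: "y \<in> forms X" "x = ext_diff X y" by (auto simp: cobd_def form_alg_simps simp flip: dR_sets)
    then have "dgr k x = ext_diff X (dgr (k - 1) y)" using ext_diff_dgr[OF y(1), of "k - 1"] by simp
    then show ?thesis using dgr_forms[OF y(1)] by (auto simp: cobd_def form_alg_simps simp flip: dR_sets)
  qed
  have G: "H_dR_deg X k = qdR X ` {x \<in> adc.drZ. dgr k x = x}" for k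
    using drZ_forms by (auto simp: dR_gr_eq form_deg_iff)
  show "graded_space (H_dR X) (H_dR_deg X)"
    by (rule graded_space_represents[OF represents_dR splits_restrict[OF splits_dgr adc.subspace_drZ drZ_forms Z] B G])
  show "submodule (dR_F X p k) \<C> (H_dR X)" "submodule (dR_Fbar X p k) \<C> (H_dR X)" for p k
    unfolding dR_gr_eq by (intro represents_submodule[OF represents_dR] cv.subspace_inter adc.subspace_drZ subspace_F Int_lower1)+
  show "dR_F X (p + 1) k \<subseteq> dR_F X p k" "dR_Fbar X (p + 1) k \<subseteq> dR_Fbar X p k" for p k
    unfolding dR_gr_eq using form_F_mono by blast+
  show "dR_F X p k \<subseteq> H_dR_deg X k" "dR_Fbar X p k \<subseteq> H_dR_deg X k" for p k
    unfolding dR_gr_eq using form_F_deg by blast+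
qed

lemma fil_BC: "sum_of (H_BC X) (H_BC_pq X) S = qBC X ` {x \<in> adc.bcZ. \<forall>i. i \<notin> S \<longrightarrow> cpt X i x = 0}"
  by (rule sum_of_represents[OF represents_BC splits_sets(1) H_BC_pq_eq])

lemma fil_A: "sum_of (H_A X) (H_A_pq X) S = qA X ` {x \<in> adc.aeZ. \<forall>i. i \<notin> S \<longrightarrow> cpt X i x = 0}"
  by (rule sum_of_represents[OF represents_A splits_sets(2) H_A_pq_eq])

subsection \<open>The natural transformations\<close>

lemma BC_to_dR_coset: assumes x: "x \<in> adc.bcZ" shows "BC_to_dR X (qBC X x) = qdR X x"
proof -
  have "induced (\<A> X) (cobd (\<A> X) (ext_diff X)) id ((id ` adc.bcB) +>\<^bsub>A_s X\<^esub> id x) = qdR X (id x)"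
    by (rule induced_coset[OF represents_A_s adc.subspace_bcZ adc.subspace_bcB adc.bcB_bcZ adc.bcZ_sdc represents_dR])
      (use adc.bcZ_sub(3) adc.bcB_sub(3) x in \<open>auto simp: qdR_def add_on_def\<close>)
  then show ?thesis by (simp add: BC_to_dR_def qBC_def BC_sets)
qed

lemma dR_to_A_coset: assumes x: "x \<in> adc.drZ" shows "dR_to_A X (qdR X x) = qA X x"
proof -
  have "induced (A_q X) (AE_B X) (\<lambda>\<omega>. I_q X +>\<^bsub>\<A> X\<^esub> \<omega>) ((id ` adc.drB) +>\<^bsub>\<A> X\<^esub> id x) = qA X (id x)"
    by (rule induced_coset[OF represents_alg adc.subspace_drZ adc.subspace_drB drB_drZ drZ_forms represents_A])
      (use adc.drZ_sub adc.drB_sub x in \<open>auto simp: qA_def qI_def add_on_def\<close>)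
  then show ?thesis by (simp add: dR_to_A_def qdR_def dR_sets)
qed

lemma lin_id: "lin_on V (\<lambda>x. x)" by (simp add: lin_on_def)

text \<open>The components of a Bott--Chern cocycle are annihilated by \<open>mubar\<close> and \<open>mu\<close>, which is the condition at
  the boundary piece of the filtrations.\<close>

lemma BC_to_dR_hom:
  "bifiltered_hom (H_BC X) (tot (H_BC X) (H_BC_pq X)) (fil1 (H_BC X) (H_BC_pq X)) (fil2 (H_BC X) (H_BC_pq X))
     (H_dR X) (H_dR_deg X) (dR_F X) (dR_Fbar X) (BC_to_dR X)"
  unfolding bifiltered_hom_def graded_hom_def
proof (intro conjI allI)
  show "linear_hom (H_BC X) (H_dR X) (BC_to_dR X)"
    using adc.bcZ_sub(3) BC_to_dR_coset by (intro linear_hom_represents[OF represents_BC represents_dR lin_id]) auto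
  note f = bcZ_forms adc.bcZ_sub(3)
  show "BC_to_dR X ` tot (H_BC X) (H_BC_pq X) k \<subseteq> H_dR_deg X k" for k
    unfolding tot_def fil_BC dR_gr_eq using f by (auto simp: BC_to_dR_coset form_deg_iff dgr_eq_iff_cpt subset_iff)
  have z: "mubar X (cpt X i x) = 0 \<and> mu X (cpt X i x) = 0" if "x \<in> adc.bcZ" for x i
    using stableD[OF adc.stable_bcZ that, of i] by (auto simp: adc.bcZ_def adc.sdc_def)
  show "BC_to_dR X ` fil1 (H_BC X) (H_BC_pq X) p k \<subseteq> dR_F X p k" for p k
    unfolding fil1_def fil_BC dR_gr_eq using f z by (auto simp: BC_to_dR_coset form_F_iff subset_iff)
  show "BC_to_dR X ` fil2 (H_BC X) (H_BC_pq X) p k \<subseteq> dR_Fbar X p k" for p k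
    unfolding fil2_def fil_BC dR_gr_eq using f z by (auto simp: BC_to_dR_coset form_F_iff subset_iff)
qed

text \<open>A class in the degree or filtration piece has a representative with the corresponding support, and
  the filtrations of Aeppli cohomology are the sums of the pieces in this support.\<close>

lemma dR_to_A_hom:
  "bifiltered_hom (H_dR X) (H_dR_deg X) (dR_F X) (dR_Fbar X)
     (H_A X) (tot (H_A X) (H_A_pq X)) (fil1 (H_A X) (H_A_pq X)) (fil2 (H_A X) (H_A_pq X)) (dR_to_A X)"
  unfolding bifiltered_hom_def graded_hom_def
proof (intro conjI allI)
  show "linear_hom (H_dR X) (H_A X) (dR_to_A X)"
    using adc.drZ_sub dR_to_A_coset by (intro linear_hom_represents[OF represents_dR represents_A lin_id]) auto
  note f = drZ_forms adc.drZ_sub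
  show "dR_to_A X ` H_dR_deg X k \<subseteq> tot (H_A X) (H_A_pq X) k" for k
    unfolding tot_def fil_A dR_gr_eq using f by (auto simp: dR_to_A_coset form_deg_iff dgr_eq_iff_cpt subset_iff)
  show "dR_to_A X ` dR_F X p k \<subseteq> fil1 (H_A X) (H_A_pq X) p k" for p k
    unfolding fil1_def fil_A dR_gr_eq using f by (auto simp: dR_to_A_coset form_F_iff subset_iff)
  show "dR_to_A X ` dR_Fbar X p k \<subseteq> fil2 (H_A X) (H_A_pq X) p k" for p k
    unfolding fil2_def fil_A dR_gr_eq using f by (auto simp: dR_to_A_coset form_F_iff subset_iff)
qed

end

lemma (in dolbeault) BC_to_H2_hom: "graded_hom (H_BC X) (H_BC_pq X) (H2 X D E) (H2_pq X D E) (BC_to_H2 X D E)"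
  unfolding graded_hom_def
proof (intro conjI allI)
  show "linear_hom (H_BC X) (H2 X D E) (BC_to_H2 X D E)"
    using BC(1) BC_to_H2_coset by (intro linear_hom_represents[OF represents_BC represents_H2 lin_id]) auto
  show "BC_to_H2 X D E ` H_BC_pq X i \<subseteq> H2_pq X D E i" for i
    unfolding H_BC_pq_eq H2_pq_eq using BC(1) BC_to_H2_coset by auto
qed

lemma (in dolbeault) H2_to_A_hom: "graded_hom (H2 X D E) (H2_pq X D E) (H_A X) (H_A_pq X) (H2_to_A X)"
  unfolding graded_hom_def
proof (intro conjI allI)
  show "linear_hom (H2 X D E) (H_A X) (H2_to_A X)"
    using AE(1) H2_to_A_coset by (intro linear_hom_represents[OF represents_H2 represents_A lin_id]) auto
  show "H2_to_A X ` H2_pq X D E i \<subseteq> H_A_pq X i" for i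
    unfolding H_A_pq_eq H2_pq_eq using AE(1) H2_to_A_coset by auto
qed

subsection \<open>Conjugation\<close>

context almost_complex
begin

sublocale conj: adc_map "forms X" "cpt X" "Dop X" "forms X" "cpt X" "Dop X" conj_form prod.swap
proof unfold_locales
  show "add_on (forms X) conj_form" by (simp add: add_on_def conj_form_def fun_eq_iff form_apply ext_fun_simps)
  show "conj_form (Dop X \<delta> x) = Dop X (prod.swap \<delta>) (conj_form x)" if "x \<in> forms X" for x \<delta>
    using conj_Dp[OF that] by (simp add: Dop_def)
qed (auto simp: conj_form_forms)

lemma conj_conj: "conj_form (conj_form \<omega>) = \<omega>" and conj_cscale: "conj_form (a *\<^sub>C \<omega>) = cnj a *\<^sub>C conj_form \<omega>"
  for \<omega> :: "('a, 'e) form"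
  by (simp_all add: conj_form_def fun_eq_iff form_apply ext_fun_simps)

lemma BC_conj_coset: "x \<in> adc.bcZ \<Longrightarrow> BC_conj X (qBC X x) = qBC X (conj_form x)"
  unfolding BC_conj_def by (rule self.BC_induced[OF add_on_subset[OF conj.add bcZ_forms] conj.bcZ conj.bcB])

lemma A_conj_coset: "x \<in> adc.aeZ \<Longrightarrow> A_conj X (qA X x) = qA X (conj_form x)"
  unfolding A_conj_def by (rule self.A_induced[OF conj.add conj.maps conj.qdc conj.aeZ conj.aeB])

end

lemma antilinear_iso_represents:
  assumes r: "represents Z B Q q" and c: "add_on Z c" "\<And>x. x \<in> Z \<Longrightarrow> c x \<in> Z" "\<And>x. x \<in> Z \<Longrightarrow> c (c x) = x"
    "\<And>a x. x \<in> Z \<Longrightarrow> c (a *\<^sub>C x) = cnj a *\<^sub>C c x"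
    and C: "\<And>x. x \<in> Z \<Longrightarrow> C (q x) = q (c x)"
    and ST: "S \<subseteq> Z" "T \<subseteq> Z" "c ` S \<subseteq> T" "c ` T \<subseteq> S"
  shows "antilinear_iso_on Q (q ` S) (q ` T) C"
  unfolding antilinear_iso_on_def
proof (intro conjI)
  show "bij_betw C (q ` S) (q ` T)"
    using ST c(2,3) by (intro bij_betw_byWitness[of _ C]) (auto simp: C subset_iff)
  show "\<forall>x\<in>q ` S. \<forall>y\<in>q ` S. C (x \<oplus>\<^bsub>Q\<^esub> y) = C x \<oplus>\<^bsub>Q\<^esub> C y"
    using ST(1) c(1,2) cv.subspace_add[OF represents_subspaces(1)[OF r]]
    by (auto simp: represents_add[OF r] C add_onD subset_iff)
  show "\<forall>a. \<forall>x\<in>q ` S. C (a \<odot>\<^bsub>Q\<^esub> x) = cnj a \<odot>\<^bsub>Q\<^esub> C x"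
    using ST(1) c(2,4) cv.subspace_scale[OF represents_subspaces(1)[OF r]]
    by (auto simp: represents_smult[OF r] C subset_iff)
qed

context almost_complex
begin

lemma conj_antilinear_iso:
  "antilinear_iso_on (H_BC X) (H_BC_pq X (p, q)) (H_BC_pq X (q, p)) (BC_conj X)"
  "antilinear_iso_on (H_A X) (H_A_pq X (p, q)) (H_A_pq X (q, p)) (A_conj X)"
proof -
  have c: "cpt X (b, a) (conj_form x) = conj_form (cpt X (a, b) x)" for a b x by (simp add: conj_cpt)
  show "antilinear_iso_on (H_BC X) (H_BC_pq X (p, q)) (H_BC_pq X (q, p)) (BC_conj X)" unfolding H_BC_pq_eq
    by (rule antilinear_iso_represents[OF represents_BC add_on_subset[OF conj.add bcZ_forms], OF conj.bcZ conj_conj conj_cscale BC_conj_coset])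
      (auto simp: c conj.bcZ)
  show "antilinear_iso_on (H_A X) (H_A_pq X (p, q)) (H_A_pq X (q, p)) (A_conj X)" unfolding H_A_pq_eq
    by (rule antilinear_iso_represents[OF represents_A add_on_subset[OF conj.add aeZ_forms], OF conj.aeZ conj_conj conj_cscale A_conj_coset])
      (auto simp: c conj.aeZ)
qed

end

subsection \<open>Functoriality\<close>

sublocale ac_map \<subseteq> ac_pair X Y
  by unfold_locales

context ac_map
begin

sublocale pb: adc_map "forms Y" "cpt Y" "Dop Y" "forms X" "cpt X" "Dop X" "pull X Y f" id
  rewrites "Dop X (-1, 2) = mubar X" and "Dop X (0, 1) = delbar X" and "Dop X (1, 0) = del X" and "Dop X (2, -1) = mu X"
    and "Dop Y (-1, 2) = mubar Y" and "Dop Y (0, 1) = delbar Y" and "Dop Y (1, 0) = del Y" and "Dop Y (2, -1) = mu Y"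
proof -
  show "adc_map (forms Y) (cpt Y) (Dop Y) (forms X) (cpt X) (Dop X) (pull X Y f) id"
  proof unfold_locales
    show "add_on (forms Y) (pull X Y f)" by (rule lin_on_add_on[OF lin_pull])
    show "pull X Y f (Dop Y \<delta> x) = Dop X (id \<delta>) (pull X Y f x)" if "x \<in> forms Y" for x \<delta>
      using pull_Dp[OF that] by (simp add: Dop_def)
  qed (auto simp: pull_forms)
qed (rule Dop_simps)+

lemma BC_pull_coset: "x \<in> Y.adc.bcZ \<Longrightarrow> BC_pull X Y f (qBC Y x) = qBC X (pull X Y f x)"
  unfolding BC_pull_def by (rule BC_induced[OF add_on_subset[OF pb.add Y.bcZ_forms] pb.bcZ pb.bcB])

lemma A_pull_coset: "x \<in> Y.adc.aeZ \<Longrightarrow> A_pull X Y f (qA Y x) = qA X (pull X Y f x)"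
  unfolding A_pull_def by (rule A_induced[OF pb.add pb.maps pb.qdc pb.aeZ pb.aeB])

lemma dR_pull_coset: "x \<in> Y.adc.drZ \<Longrightarrow> dR_pull X Y f (qdR Y x) = qdR X (pull X Y f x)"
  unfolding dR_pull_def by (rule dR_induced[OF add_on_subset[OF pb.add Y.drZ_forms] pb.dr(1)[OF refl] pb.dr(2)[OF refl]])

end

locale dolbeault_map = ac_map X Y f + X: dolbeault X D E \<delta> \<epsilon> + Y: dolbeault Y D' E' \<delta> \<epsilon>
  for X :: "('a, 'e::real_inner) acm" and Y :: "('b, 'f::real_inner) acm" and f D E D' E' \<delta> \<epsilon> +
  assumes pull_D: "\<omega> \<in> forms Y \<Longrightarrow> pull X Y f (D' \<omega>) = D (pull X Y f \<omega>)"
    and pull_dolZ: "\<omega> \<in> Y.dp.dolZ \<Longrightarrow> pull X Y f \<omega> \<in> X.dp.dolZ"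
    and pull_dolB: "\<omega> \<in> Y.dp.dolB \<Longrightarrow> pull X Y f \<omega> \<in> X.dp.dolB"
begin

lemma H2_pull_coset: assumes x: "x \<in> Y.dp.dolZ" shows "H2_pull X D E Y f (q2 Y D' E' x) = q2 X D E (pull X Y f x)"
proof -
  let ?h = "pull X Y f"
  have K: "?h y \<in> {x \<in> forms X. D x = 0}" if "y \<in> {x \<in> forms Y. D' x = 0}" for y
    using that pull_D[of y] pb.maps[of y] pb.h_simps(1) by simp
  have "to_H1 X D ?h (q1 Y D' y) = q1 X D (?h y)" if y: "y \<in> {x \<in> forms Y. D' x = 0}" for y
  proof -
    have "induced (\<A> X) (cobd (\<A> X) D) ?h ((id ` D' ` forms Y) +>\<^bsub>\<A> Y\<^esub> id y) = q1 X D (?h y)"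
    proof (rule induced_coset[OF Y.represents_alg Y.dp.subspaces(2,3) Y.dp.dolB_sub(4) _ X.represents_H1])
      show "add_on {x \<in> forms Y. D' x = 0} ?h" by (rule add_on_subset[OF pb.add]) auto
      show "?h y \<in> D ` forms X" if "y \<in> D' ` forms Y" for y
        using that pull_D pb.maps by (auto simp: image_iff)
    qed (use y K in \<open>auto simp: q1_def\<close>)
    then show ?thesis by (simp add: to_H1_def q1_def Y.H1_sets)
  qed
  then have e: "cobd (H1 X D) (to_H1 X D E) +>\<^bsub>H1 X D\<^esub> to_H1 X D ?h (q1 Y D' y) = q2 X D E (?h y)" if "y \<in> Y.dp.dolZ" for y
    using that Y.dp.dolB_sub(3) by (auto simp: q2_def)
  have "induced (H1 X D) (cobd (H1 X D) (to_H1 X D E)) (to_H1 X D ?h) ((q1 Y D' ` Y.dp.dolB) +>\<^bsub>H1 Y D'\<^esub> q1 Y D' x) = q2 X D E (?h x)"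
    using Y.dp.dolB_sub(3)
    by (intro induced_coset[OF Y.represents_H1 Y.dp.subspaces(4,5) Y.dp.dolB_sub(2,3) X.represents_H2 _ _ _ _ x] e pull_dolZ pull_dolB
        add_on_subset[OF pb.add]) auto
  then show ?thesis by (simp add: H2_pull_def q2_def Y.H2_sets)
qed

lemma H2_pull_hom: "graded_hom (H2 Y D' E') (H2_pq Y D' E') (H2 X D E) (H2_pq X D E) (H2_pull X D E Y f)"
  unfolding graded_hom_def
proof (intro conjI allI)
  have f: "Y.dp.dolZ \<subseteq> forms Y" using Y.dp.dolB_sub(3) by auto
  show "linear_hom (H2 Y D' E') (H2 X D E) (H2_pull X D E Y f)"
    by (rule linear_hom_represents[OF Y.represents_H2 X.represents_H2 lin_on_subset[OF lin_pull f], OF pull_dolZ H2_pull_coset])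
  show "H2_pull X D E Y f ` H2_pq Y D' E' i \<subseteq> H2_pq X D E i" for i
    unfolding Y.H2_pq_eq X.H2_pq_eq using f pull_dolZ H2_pull_coset by (auto simp: subset_iff simp flip: pull_cpt)
qed

end

sublocale ac_map \<subseteq> dol: dolbeault_map X Y f "mubar X" "delbar X" "mubar Y" "delbar Y" "(-1, 2)" "(0, 1)"
proof (intro dolbeault_map.intro dolbeault_map_axioms.intro ac_map_axioms X.dol.dolbeault_axioms Y.dol.dolbeault_axioms)
  show "pull X Y f (mubar Y \<omega>) = mubar X (pull X Y f \<omega>)" if "\<omega> \<in> forms Y" for \<omega>
    using pull_Dp[OF that, of "(-1, 2)"] by (simp add: mubar_def)
qed (rule pb.dol(1,2)[OF refl]; assumption)+

sublocale ac_map \<subseteq> dolbar: dolbeault_map X Y f "mu X" "del X" "mu Y" "del Y" "(2, -1)" "(1, 0)"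
proof (intro dolbeault_map.intro dolbeault_map_axioms.intro ac_map_axioms X.dolbar.dolbeault_axioms Y.dolbar.dolbeault_axioms)
  show "pull X Y f (mu Y \<omega>) = mu X (pull X Y f \<omega>)" if "\<omega> \<in> forms Y" for \<omega>
    using pull_Dp[OF that, of "(2, -1)"] by (simp add: mu_def)
qed (rule pb.dol(3,4)[OF refl]; assumption)+

context ac_map
begin

lemma BC_pull_graded: "graded_hom (H_BC Y) (H_BC_pq Y) (H_BC X) (H_BC_pq X) (BC_pull X Y f)"
  unfolding graded_hom_def
proof (intro conjI allI)
  show "linear_hom (H_BC Y) (H_BC X) (BC_pull X Y f)"
    by (rule linear_hom_represents[OF Y.represents_BC X.represents_BC lin_on_subset[OF lin_pull Y.bcZ_forms], OF pb.bcZ BC_pull_coset])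
  show "BC_pull X Y f ` H_BC_pq Y i \<subseteq> H_BC_pq X i" for i
    unfolding Y.H_BC_pq_eq X.H_BC_pq_eq using Y.bcZ_forms pb.bcZ BC_pull_coset by (auto simp: subset_iff simp flip: pull_cpt)
qed

lemma A_pull_graded: "graded_hom (H_A Y) (H_A_pq Y) (H_A X) (H_A_pq X) (A_pull X Y f)"
  unfolding graded_hom_def
proof (intro conjI allI)
  show "linear_hom (H_A Y) (H_A X) (A_pull X Y f)"
    by (rule linear_hom_represents[OF Y.represents_A X.represents_A lin_on_subset[OF lin_pull Y.aeZ_forms], OF pb.aeZ A_pull_coset])
  show "A_pull X Y f ` H_A_pq Y i \<subseteq> H_A_pq X i" for i
    unfolding Y.H_A_pq_eq X.H_A_pq_eq using Y.aeZ_forms pb.aeZ A_pull_coset by (auto simp: subset_iff simp flip: pull_cpt)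
qed

lemma dR_pull_hom:
  "bifiltered_hom (H_dR Y) (H_dR_deg Y) (dR_F Y) (dR_Fbar Y) (H_dR X) (H_dR_deg X) (dR_F X) (dR_Fbar X) (dR_pull X Y f)"
  unfolding bifiltered_hom_def graded_hom_def
proof (intro conjI allI)
  note Z = pb.dr(1)[OF refl]
  show "linear_hom (H_dR Y) (H_dR X) (dR_pull X Y f)"
    by (rule linear_hom_represents[OF Y.represents_dR X.represents_dR lin_on_subset[OF lin_pull Y.drZ_forms], OF Z dR_pull_coset])
  have im: "dR_pull X Y f ` qdR Y ` (Y.adc.drZ \<inter> G) \<subseteq> qdR X ` (X.adc.drZ \<inter> G')"
    if "\<And>x. x \<in> G \<Longrightarrow> x \<in> forms Y \<Longrightarrow> pull X Y f x \<in> G'" for G G'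
    using that Z dR_pull_coset Y.drZ_forms by (auto simp: subset_iff)
  note p = pull_cpt[symmetric] pull_forms pb.h_simps(1)
  have op: "mubar X (pull X Y f x) = pull X Y f (mubar Y x)" "mu X (pull X Y f x) = pull X Y f (mu Y x)" if "x \<in> forms Y" for x
    using pb.ops(1)[OF refl that] by simp_all
  show "dR_pull X Y f ` H_dR_deg Y k \<subseteq> H_dR_deg X k" for k
    unfolding X.dR_gr_eq Y.dR_gr_eq
    by (rule im) (simp add: X.form_deg_iff Y.form_deg_iff pull_forms flip: pull_dgr)
  show "dR_pull X Y f ` dR_F Y q k \<subseteq> dR_F X q k" for q k
    unfolding X.dR_gr_eq Y.dR_gr_eq
    by (rule im) (simp add: X.form_F_iff Y.form_F_iff p op Y.cpt_forms)
  show "dR_pull X Y f ` dR_Fbar Y q k \<subseteq> dR_Fbar X q k" for q k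
    unfolding X.dR_gr_eq Y.dR_gr_eq
    by (rule im) (simp add: X.form_F_iff Y.form_F_iff p op Y.cpt_forms)
qed

end



section \<open>Products\<close>

context almost_complex
begin

lemmas ops_closed = adc.dol.closed adc.dolbar.closed
lemmas ops_neg = adc.D_neg[of _ "(-1, 2)", unfolded Dop_simps] adc.D_neg[of _ "(0, 1)", unfolded Dop_simps]
  adc.D_neg[of _ "(1, 0)", unfolded Dop_simps] adc.D_neg[of _ "(2, -1)", unfolded Dop_simps]
lemmas ops_add = lin_on_add_on[OF adc.dol.lin(1), THEN add_onD] lin_on_add_on[OF adc.dol.lin(2), THEN add_onD]
  lin_on_add_on[OF adc.dolbar.lin(1), THEN add_onD] lin_on_add_on[OF adc.dolbar.lin(2), THEN add_onD]

lemma leibniz: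
  assumes "\<omega> \<in> forms X" "\<eta> \<in> forms X"
  shows "mubar X (wedge \<omega> \<eta>) = wedge (mubar X \<omega>) \<eta> + wedge (sgn_form \<omega>) (mubar X \<eta>)"
    "delbar X (wedge \<omega> \<eta>) = wedge (delbar X \<omega>) \<eta> + wedge (sgn_form \<omega>) (delbar X \<eta>)"
    "del X (wedge \<omega> \<eta>) = wedge (del X \<omega>) \<eta> + wedge (sgn_form \<omega>) (del X \<eta>)"
    "mu X (wedge \<omega> \<eta>) = wedge (mu X \<omega>) \<eta> + wedge (sgn_form \<omega>) (mu X \<eta>)"
  using Dp_wedge[OF _ assms, of "(-1, 2)"] Dp_wedge[OF _ assms, of "(0, 1)"] Dp_wedge[OF _ assms, of "(1, 0)"]
    Dp_wedge[OF _ assms, of "(2, -1)"]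
  by (simp_all add: bidegrees_def mubar_def delbar_def del_def mu_def)

lemma ops_sgn:
  assumes "\<omega> \<in> forms X"
  shows "mubar X (sgn_form \<omega>) = - sgn_form (mubar X \<omega>)" "delbar X (sgn_form \<omega>) = - sgn_form (delbar X \<omega>)"
    "del X (sgn_form \<omega>) = - sgn_form (del X \<omega>)" "mu X (sgn_form \<omega>) = - sgn_form (mu X \<omega>)"
  using Dp_sgn[OF assms, of "(-1, 2)"] Dp_sgn[OF assms, of "(0, 1)"] Dp_sgn[OF assms, of "(1, 0)"]
    Dp_sgn[OF assms, of "(2, -1)"]
  by (simp_all add: mubar_def delbar_def del_def mu_def)

lemma sgn_neg: "sgn_form (- \<omega>) = - sgn_form \<omega>" for \<omega> :: "('a, 'e) form"
  by (simp add: sgn_form_def fun_eq_iff form_apply)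

lemmas calc = leibniz ops_sgn ops_closed ops_neg ops_add sgn_neg wedge_linear sgn_linear wedge_forms sgn_form_forms
  adc.dol.zero adc.dolbar.zero cv.subspace_neg[OF forms_subspace] cv.subspace_add[OF forms_subspace]

lemma wedge_sdc:
  assumes "z \<in> adc.bcZ" "x \<in> adc.sdc" shows "wedge z x \<in> adc.sdc" "wedge x z \<in> adc.sdc"
  using assms by (simp_all add: adc.bcZ_def adc.sdc_def calc)

lemma wedge_bcZ: assumes "z \<in> adc.bcZ" "w \<in> adc.bcZ" shows "wedge z w \<in> adc.bcZ"
  using assms by (simp add: adc.bcZ_def adc.sdc_def calc)

text \<open>For a cocycle \<open>z\<close>, \<open>del (delbar (z \<and> x)) = z \<and> del (delbar x)\<close>: the sign operator occurs twice and cancels.\<close>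

lemma wedge_bcB:
  assumes z: "z \<in> adc.bcZ" and y: "y \<in> adc.bcB" shows "wedge z y \<in> adc.bcB" "wedge y z \<in> adc.bcB"
proof -
  obtain x where x: "x \<in> adc.sdc" "y = del X (delbar X x)" using y by (auto simp: adc.bcB_def)
  have "wedge z y = del X (delbar X (wedge z x))" "wedge y z = del X (delbar X (wedge x z))"
    using z x by (simp_all add: adc.bcZ_def adc.sdc_def calc)
  then show "wedge z y \<in> adc.bcB" "wedge y z \<in> adc.bcB"
    using wedge_sdc[OF z x(1)] by (simp_all add: adc.bcB_def)
qed

text \<open>An element \<open>a\<close> of \<open>A_s\<close> commutes, up to sign, with \<open>mubar\<close>, \<open>mu\<close> and with the squares of \<open>del\<close> and
  \<open>delbar\<close>; in the squares, the two mixed terms cancel.\<close>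

lemma wedge_qdc: assumes a: "a \<in> adc.sdc" and x: "x \<in> adc.qdc" shows "wedge a x \<in> adc.qdc"
proof (rule adc.qdc_induct[OF x _ adc.subspace_qdc])
  have aF: "a \<in> forms X" "mubar X a = 0" "delbar X (delbar X a) = 0" "del X (del X a) = 0" "mu X a = 0"
    using a by (auto simp: adc.sdc_def)
  show "add_on (forms X) (wedge a)" by (simp add: add_on_def wedge_linear)
  fix y assume y: "y \<in> forms X"
  have "wedge a (mubar X y) = mubar X (wedge (sgn_form a) y)" using aF y by (simp add: calc)
  then show "wedge a (mubar X y) \<in> adc.qdc" using adc.qdcI(1)[of "wedge (sgn_form a) y"] aF y wedge_forms sgn_form_forms by simp
  have "wedge a (mu X y) = mu X (wedge (sgn_form a) y)" using aF y by (simp add: calc)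
  then show "wedge a (mu X y) \<in> adc.qdc" using adc.qdcI(4)[of "wedge (sgn_form a) y"] aF y wedge_forms sgn_form_forms by simp
  have "wedge a (delbar X (delbar X y)) = delbar X (delbar X (wedge a y))" using aF y by (simp add: calc)
  then show "wedge a (delbar X (delbar X y)) \<in> adc.qdc" using adc.qdcI(2)[of "wedge a y"] aF y wedge_forms by simp
  have "wedge a (del X (del X y)) = del X (del X (wedge a y))" using aF y by (simp add: calc)
  then show "wedge a (del X (del X y)) \<in> adc.qdc" using adc.qdcI(3)[of "wedge a y"] aF y wedge_forms by simp
qed

lemma wedge_aeZ: assumes z: "z \<in> adc.bcZ" and w: "w \<in> adc.aeZ" shows "wedge z w \<in> adc.aeZ"
proof -
  have zF: "z \<in> forms X" "del X z = 0" "delbar X z = 0" using z by (auto simp: adc.bcZ_def adc.sdc_def)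
  have wF: "w \<in> forms X" "del X (delbar X w) \<in> adc.qdc" using w by (auto simp: adc.aeZ_def)
  have "del X (delbar X (wedge z w)) = wedge z (del X (delbar X w))" using zF wF(1) by (simp add: calc)
  then show ?thesis using wedge_qdc[of z] z wF zF adc.bcZ_sdc wedge_forms by (auto simp: adc.aeZ_def)
qed

lemma wedge_aeB: assumes z: "z \<in> adc.bcZ" and w: "w \<in> adc.aeB" shows "wedge z w \<in> adc.aeB"
proof -
  have zF: "z \<in> forms X" "del X z = 0" "delbar X z = 0" using z by (auto simp: adc.bcZ_def adc.sdc_def)
  obtain a b c where w': "w = del X a + delbar X b + c" "a \<in> forms X" "b \<in> forms X" "c \<in> adc.qdc"
    using w unfolding adc.aeB_def msum_def by blast
  then have "wedge z w = del X (wedge (sgn_form z) a) + delbar X (wedge (sgn_form z) b) + wedge z c"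
    using zF by (simp add: calc)
  moreover have "wedge z c \<in> adc.qdc" using wedge_qdc w' z adc.bcZ_sdc by blast
  ultimately show ?thesis using w' zF
    by (simp only:) (intro cv.subspace_add[OF adc.subspace_aeB] adc.aeBI wedge_forms sgn_form_forms)
qed

text \<open>For \<open>y = del (delbar x)\<close> the product \<open>y \<and> w\<close> equals
  \<open>del (delbar x \<and> w) + delbar (s x \<and> del w) - x \<and> delbar (del w)\<close>, and the last term lies in the ideal as \<open>w\<close>
  is an Aeppli cocycle; here \<open>s\<close> is the sign operator.
  Hence the module structure does not depend on the Bott--Chern representative.\<close>

lemma wedge_bcB_aeZ: assumes y: "y \<in> adc.bcB" and w: "w \<in> adc.aeZ" shows "wedge y w \<in> adc.aeB"
proof -
  obtain x where x: "x \<in> adc.sdc" "y = del X (delbar X x)" using y by (auto simp: adc.bcB_def)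
  have xF: "x \<in> forms X" using x adc.sdc_V by blast
  have wF: "w \<in> forms X" "del X (delbar X w) \<in> adc.qdc" using w by (auto simp: adc.aeZ_def)
  then have q: "delbar X (del X w) \<in> adc.qdc" using adc.db_dl_qdc_iff by blast
  have 1: "del X (wedge (delbar X x) w) = wedge y w + wedge (sgn_form (delbar X x)) (del X w)"
    using xF wF(1) x(2) by (simp add: calc)
  have 2: "delbar X (wedge (sgn_form x) (del X w)) = - wedge (sgn_form (delbar X x)) (del X w) + wedge x (delbar X (del X w))"
    using xF wF(1) by (simp add: calc)
  have "wedge y w = del X (wedge (delbar X x) w) + delbar X (wedge (sgn_form x) (del X w)) - wedge x (delbar X (del X w))"
    unfolding 1 2 by simp
  also have "\<dots> \<in> adc.aeB"
    using wedge_qdc[OF x(1) q] xF wF(1)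
    by (intro cv.subspace_add[OF adc.subspace_aeB] cv.subspace_diff[OF adc.subspace_aeB] adc.aeBI) (simp_all add: calc)
  finally show ?thesis .
qed

text \<open>The Leibniz rule for \<open>1 = 1 \<and> 1\<close> gives \<open>D 1 = D 1 + D 1\<close>.\<close>

lemma unit_bcZ: "unit_form X \<in> adc.bcZ"
proof -
  have s: "sgn_form (unit_form X) = unit_form X"
    by (auto simp: sgn_form_def unit_form_def ext_sign_def ext_one_def fun_eq_iff zero_fun_apply)
  have "Dp X \<delta> (unit_form X) = 0" if "\<delta> \<in> bidegrees" for \<delta>
    using Dp_wedge[OF that unit_form_forms unit_form_forms] wedge_unit[OF unit_form_forms]
      wedge_unit[OF Dp_forms[OF unit_form_forms]] by (simp add: s)
  from this[of "(-1, 2)"] this[of "(0, 1)"] this[of "(1, 0)"] this[of "(2, -1)"] show ?thesis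
    using unit_form_forms by (simp add: bidegrees_def adc.bcZ_def adc.sdc_def mubar_def delbar_def del_def mu_def)
      (simp add: adc.dol.zero adc.dolbar.zero flip: mubar_def delbar_def del_def mu_def)
qed

lemma unit_pq: "unit_form X \<in> form_pq X (0, 0)"
proof -
  have "ext_one \<in> ext_pq (acs X c u) 0 0" for c u
    unfolding ext_pq_span by (rule cv.span_base) force
  then show ?thesis using unit_form_forms by (auto simp: form_pq_def unit_form_def)
qed

lemma wedge_graded_comm:
  assumes \<omega>: "\<omega> \<in> form_pq X (p, q)" and \<eta>: "\<eta> \<in> form_pq X (r, s)"
  shows "wedge \<omega> \<eta> = (-1) powi ((p + q) * (r + s)) *\<^sub>C wedge \<eta> \<omega>"
proof (rule form_eqI)
  have f: "\<omega> \<in> forms X" "\<eta> \<in> forms X" using \<omega> \<eta> by (auto simp: form_pq_iff)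
  then show "wedge \<omega> \<eta> \<in> forms X" "(-1) powi ((p + q) * (r + s)) *\<^sub>C wedge \<eta> \<omega> \<in> forms X"
    by (simp_all add: wedge_forms cv.subspace_scale[OF forms_subspace])
  fix c u assume "c \<in> atlas X" "u \<in> cod c"
  then have "\<omega> c u \<in> ext_pq (acs X c u) p q" "\<eta> c u \<in> ext_pq (acs X c u) r s" using \<omega> \<eta> by (auto simp: form_pq_def)
  then have "deg_in (p + q) (\<omega> c u)" "deg_in (r + s) (\<eta> c u)" using ext_pq_weight by blast+
  from ext_wedge_comm[OF this] show "wedge \<omega> \<eta> c u = ((-1) powi ((p + q) * (r + s)) *\<^sub>C wedge \<eta> \<omega>) c u"
    by (simp add: wedge_def form_apply)
qed

subsection \<open>The algebra and the module\<close>

lemma qBC_set: "x \<in> adc.bcZ \<Longrightarrow> qBC X x = {y. y - x \<in> adc.bcB}"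
  using coset_image[OF represents_A_s adc.subspace_bcB order_trans[OF adc.bcB_bcZ adc.bcZ_sdc], of x] adc.bcZ_sdc
  by (auto simp: qBC_def BC_sets)

lemma qBC_bcZ: "x \<in> adc.bcZ \<Longrightarrow> y - x \<in> adc.bcB \<Longrightarrow> y \<in> adc.bcZ"
  by (rule translate_subset[OF adc.subspace_bcZ adc.bcB_bcZ])

lemma BC_mult: assumes x: "x \<in> adc.bcZ" and y: "y \<in> adc.bcZ" shows "qBC X x \<otimes>\<^bsub>H_BC X\<^esub> qBC X y = qBC X (wedge x y)"
proof -
  have *: "adc.bcB +>\<^bsub>A_s X\<^esub> wedge a b = qBC X (wedge x y)" if a: "a - x \<in> adc.bcB" and b: "b - y \<in> adc.bcB" for a b
  proof -
    note Z = qBC_bcZ[OF x a] qBC_bcZ[OF y b]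
    have "wedge a b - wedge x y = wedge a (b - y) + wedge (a - x) y"
      using wedge_linear(2)[of a "b - y" y] wedge_linear(1)[of "a - x" x y] by (simp add: algebra_simps)
    also have "\<dots> \<in> adc.bcB" by (rule cv.subspace_add[OF adc.subspace_bcB wedge_bcB(1)[OF Z(1) b] wedge_bcB(2)[OF y a]])
    finally have "qBC X (wedge a b) = qBC X (wedge x y)"
      using represents_eq[OF represents_BC wedge_bcZ[OF Z] wedge_bcZ[OF x y]] by simp
    then show ?thesis by (simp add: qBC_def BC_sets)
  qed
  have "x - x \<in> adc.bcB" "y - y \<in> adc.bcB" using cv.subspace_0[OF adc.subspace_bcB] by simp_all
  then have ne: "{a. a - x \<in> adc.bcB} \<noteq> {}" "{b. b - y \<in> adc.bcB} \<noteq> {}" by blast+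
  have "(\<Union>a\<in>{a. a - x \<in> adc.bcB}. \<Union>b\<in>{b. b - y \<in> adc.bcB}. adc.bcB +>\<^bsub>A_s X\<^esub> wedge a b) =
      (\<Union>a\<in>{a. a - x \<in> adc.bcB}. \<Union>b\<in>{b. b - y \<in> adc.bcB}. qBC X (wedge x y))"
    by (intro SUP_cong refl *) simp_all
  also have "\<dots> = qBC X (wedge x y)" by (simp only: UN_constant ne if_False)
  finally show ?thesis
    unfolding H_BC_def subquot_def rcoset_mult_def BC_sets qBC_set[OF x] qBC_set[OF y] by (simp add: A_s_simps)
qed

lemma BC_one: "\<one>\<^bsub>H_BC X\<^esub> = qBC X (unit_form X)"
  by (simp add: H_BC_def subquot_def qBC_def A_s_simps)

lemma BC_algebra: "bigraded_comm_algebra (H_BC X) (H_BC_pq X)"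
  unfolding bigraded_comm_algebra_def
proof (intro conjI allI ballI)
  note r = represents_BC and c = represents_carrier[OF represents_BC] and Z = adc.subspace_bcZ
  note [simp] = c represents_add[OF r] represents_smult[OF r] BC_mult wedge_bcZ cv.subspace_add[OF Z] cv.subspace_scale[OF Z]
    BC_one unit_bcZ wedge_linear
  show "Ring.ring (H_BC X)"
  proof (rule ringI)
    show "abelian_group (H_BC X)" using represents_module[OF r] by (simp add: Module.module_def)
    show "Group.monoid (H_BC X)"
      using bcZ_forms wedge_unit by (intro monoidI) (auto simp: wedge_assoc)
  qed auto
  show "graded_space (H_BC X) (H_BC_pq X)" by (rule graded_BC)
  show "(a \<odot>\<^bsub>H_BC X\<^esub> x) \<otimes>\<^bsub>H_BC X\<^esub> y = a \<odot>\<^bsub>H_BC X\<^esub> (x \<otimes>\<^bsub>H_BC X\<^esub> y)"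
    "x \<otimes>\<^bsub>H_BC X\<^esub> (a \<odot>\<^bsub>H_BC X\<^esub> y) = a \<odot>\<^bsub>H_BC X\<^esub> (x \<otimes>\<^bsub>H_BC X\<^esub> y)"
    if "x \<in> carrier (H_BC X)" "y \<in> carrier (H_BC X)" for a x y
    using that by auto
  show "\<one>\<^bsub>H_BC X\<^esub> \<in> H_BC_pq X (0, 0)" using unit_pq unit_bcZ by (auto simp: H_BC_pq_eq form_pq_iff)
  fix p q r s x y assume "x \<in> H_BC_pq X (p, q)" "y \<in> H_BC_pq X (r, s)"
  then obtain \<omega> \<eta> where *: "x = qBC X \<omega>" "y = qBC X \<eta>" "\<omega> \<in> adc.bcZ" "\<eta> \<in> adc.bcZ"
    "\<omega> \<in> form_pq X (p, q)" "\<eta> \<in> form_pq X (r, s)"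
    using bcZ_forms by (auto simp: H_BC_pq_eq form_pq_iff)
  have "wedge \<omega> \<eta> \<in> form_pq X (p + r, q + s)" using cpt_wedge[OF *(5,6)] by simp
  then show "x \<otimes>\<^bsub>H_BC X\<^esub> y \<in> H_BC_pq X (p + r, q + s)"
    using * by (auto simp: H_BC_pq_eq form_pq_iff)
  show "x \<otimes>\<^bsub>H_BC X\<^esub> y = (-1) powi ((p + q) * (r + s)) \<odot>\<^bsub>H_BC X\<^esub> (y \<otimes>\<^bsub>H_BC X\<^esub> x)"
    using * wedge_graded_comm[OF *(5,6)] by simp
qed

text \<open>The action is a union over all representatives of the class of \<open>x\<close>. By \<open>wedge_bcB_aeZ\<close> they all
  contribute the same class.\<close>

lemma BC_act_coset:
  assumes x: "x \<in> adc.bcZ" and w: "w \<in> adc.aeZ" shows "BC_act X (qBC X x) (qA X w) = qA X (wedge x w)"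
proof -
  have "induced (A_q X) (AE_B X) (to_q X (wedge a)) (qA X w) = qA X (wedge x w)" if a: "a - x \<in> adc.bcB" for a
  proof -
    note aZ = qBC_bcZ[OF x a]
    have "induced (A_q X) (AE_B X) (to_q X (wedge a)) (qA X w) = qA X (wedge a w)"
    proof (rule self.A_induced[OF _ _ _ _ _ w])
      show "add_on (forms X) (wedge a)" by (simp add: add_on_def wedge_linear)
      show "wedge a y \<in> forms X" if "y \<in> forms X" for y using that aZ bcZ_forms wedge_forms by blast
      show "wedge a y \<in> adc.qdc" if "y \<in> adc.qdc" for y using that aZ adc.bcZ_sdc wedge_qdc by blast
    qed (use aZ wedge_aeZ wedge_aeB in blast)+
    moreover have "wedge a w - wedge x w \<in> adc.aeB"
      using wedge_bcB_aeZ[OF a w] wedge_linear(1)[of "a - x" x w] by simp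
    ultimately show ?thesis using represents_eq[OF represents_A wedge_aeZ[OF aZ w] wedge_aeZ[OF x w]] by simp
  qed
  moreover have "x - x \<in> adc.bcB" using cv.subspace_0[OF adc.subspace_bcB] by simp
  ultimately show ?thesis unfolding BC_act_def qBC_set[OF x] by blast
qed

lemma A_module: "bigraded_module (H_BC X) (H_BC_pq X) (H_A X) (H_A_pq X) (BC_act X)"
  unfolding bigraded_module_def
proof (intro conjI allI ballI)
  note c = represents_carrier[OF represents_BC] represents_carrier[OF represents_A]
  note [simp] = BC_act_coset wedge_aeZ wedge_bcZ BC_mult BC_one unit_bcZ
  show "graded_space (H_A X) (H_A_pq X)" by (rule graded_A)
  show "linear_hom (H_A X) (H_A X) (BC_act X a)" if "a \<in> carrier (H_BC X)" for a
  proof -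
    from that obtain z where z: "z \<in> adc.bcZ" "a = qBC X z" unfolding c by blast
    have "lin_on adc.aeZ (wedge z)" by (simp add: lin_on_def wedge_linear)
    from linear_hom_represents[OF represents_A represents_A this] show ?thesis using z by simp
  qed
  show "linear_hom (H_BC X) (H_A X) (\<lambda>a. BC_act X a x)" if "x \<in> carrier (H_A X)" for x
  proof -
    from that obtain w where w: "w \<in> adc.aeZ" "x = qA X w" unfolding c by blast
    have "lin_on adc.bcZ (\<lambda>z. wedge z w)" by (simp add: lin_on_def wedge_linear)
    from linear_hom_represents[OF represents_BC represents_A this] show ?thesis using w by simp
  qed
  show "BC_act X (a \<otimes>\<^bsub>H_BC X\<^esub> b) x = BC_act X a (BC_act X b x)"
    if "a \<in> carrier (H_BC X)" "b \<in> carrier (H_BC X)" "x \<in> carrier (H_A X)" for a b x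
    using that unfolding c by (auto simp: wedge_assoc)
  show "BC_act X \<one>\<^bsub>H_BC X\<^esub> x = x" if "x \<in> carrier (H_A X)" for x
    using that aeZ_forms wedge_unit unfolding c by auto
  fix p q r s a x assume "a \<in> H_BC_pq X (p, q)" "x \<in> H_A_pq X (r, s)"
  then obtain \<omega> \<eta> where *: "a = qBC X \<omega>" "x = qA X \<eta>" "\<omega> \<in> adc.bcZ" "\<eta> \<in> adc.aeZ"
    "\<omega> \<in> form_pq X (p, q)" "\<eta> \<in> form_pq X (r, s)"
    using bcZ_forms aeZ_forms by (auto simp: H_BC_pq_eq H_A_pq_eq form_pq_iff)
  have "wedge \<omega> \<eta> \<in> form_pq X (p + r, q + s)" using cpt_wedge[OF *(5,6)] by simp
  then show "BC_act X a x \<in> H_A_pq X (p + r, q + s)"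
    using * by (auto simp: H_A_pq_eq form_pq_iff)
qed

end

context ac_map
begin

lemma BC_pull_algebra_hom: "bigraded_algebra_hom (H_BC Y) (H_BC_pq Y) (H_BC X) (H_BC_pq X) (BC_pull X Y f)"
  unfolding bigraded_algebra_hom_def
proof (intro conjI BC_pull_graded ring_hom_memI)
  note c = represents_carrier[OF Y.represents_BC] represents_carrier[OF X.represents_BC]
  note [simp] = BC_pull_coset pb.bcZ
  show "BC_pull X Y f x \<in> carrier (H_BC X)" if "x \<in> carrier (H_BC Y)" for x
    using that unfolding c by auto
  show "BC_pull X Y f (x \<otimes>\<^bsub>H_BC Y\<^esub> y) = BC_pull X Y f x \<otimes>\<^bsub>H_BC X\<^esub> BC_pull X Y f y"
    if "x \<in> carrier (H_BC Y)" "y \<in> carrier (H_BC Y)" for x y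
    using that Y.bcZ_forms unfolding c by (auto simp: Y.BC_mult X.BC_mult Y.wedge_bcZ pull_wedge subset_iff)
  show "BC_pull X Y f (x \<oplus>\<^bsub>H_BC Y\<^esub> y) = BC_pull X Y f x \<oplus>\<^bsub>H_BC X\<^esub> BC_pull X Y f y"
    if "x \<in> carrier (H_BC Y)" "y \<in> carrier (H_BC Y)" for x y
    using BC_pull_graded that by (simp add: graded_hom_def linear_hom_def)
  show "BC_pull X Y f \<one>\<^bsub>H_BC Y\<^esub> = \<one>\<^bsub>H_BC X\<^esub>"
    by (simp add: X.BC_one Y.BC_one Y.unit_bcZ pull_unit)
qed

lemma pull_act:
  assumes "a \<in> carrier (H_BC Y)" "x \<in> carrier (H_A Y)"
  shows "A_pull X Y f (BC_act Y a x) = BC_act X (BC_pull X Y f a) (A_pull X Y f x)"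
  using assms Y.bcZ_forms Y.aeZ_forms unfolding represents_carrier[OF Y.represents_BC] represents_carrier[OF Y.represents_A]
  by (auto simp: BC_pull_coset A_pull_coset Y.BC_act_coset X.BC_act_coset Y.wedge_aeZ pb.bcZ pb.aeZ pull_wedge subset_iff)

end


subsection \<open>Composition of morphisms\<close>

locale ac_map2 = f: ac_map X Y f + g: ac_map Y Z g
  for X :: "('a, 'e::real_inner) acm" and Y :: "('b, 'f::real_inner) acm" and Z :: "('c, 'g::real_inner) acm" and f g

sublocale ac_map2 \<subseteq> manifold_map2 X Y Z f g
  by unfold_locales

text \<open>Locally the composite factors through a chart of the intermediate manifold, where the chain rule applies.\<close>

lemma (in ac_map2) morphism_comp: "acm_morphism X Z (g \<circ> f)"
  unfolding acm_morphism_def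
proof (intro conjI ballI allI)
  show "continuous_map (mtop X) (mtop Z) (g \<circ> f)" by (rule continuous_map_compose[OF f.cont g.cont])
  fix c c'' assume c: "c \<in> atlas X" "c'' \<in> atlas Z"
  have oW: "open (locdom c c'' (g \<circ> f))"
    by (rule f.X.open_locdom[OF c(1) continuous_map_compose[OF f.cont g.cont] g.Y.chart(1)[OF c(2)]])
  have cc: "u \<in> cod c" if "u \<in> locdom c c'' (g \<circ> f)" for u using that f.X.in_locdom[OF c(1), of u c'' "g \<circ> f"] by simp
  show "smooth_on (locdom c c'' (g \<circ> f)) (locrep c c'' (g \<circ> f))"
  proof (rule smooth_on_local)
    fix u assume u: "u \<in> locdom c c'' (g \<circ> f)"
    obtain c' where c': "c' \<in> atlas Y" "u \<in> locdom c c' f" using f.map_chart[OF c(1) cc[OF u]] .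
    let ?W = "locdom c c' f \<inter> locdom c c'' (g \<circ> f)"
    have W: "open ?W" using f.open_dom[OF c(1) c'(1)] oW by blast
    have sm: "smooth_on ?W (\<lambda>y. locrep c' c'' g (locrep c c' f y))"
    proof (rule smooth_on_compose[OF f.Y.basis W g.open_dom[OF c'(1) c(2)] _ _ g.smooth_rep[OF c'(1) c(2)]])
      show "smooth_on ?W (locrep c c' f)" by (rule smooth_on_subset[OF f.smooth_rep[OF c(1) c'(1)]]) simp
      show "locrep c c' f y \<in> locdom c' c'' g" if "y \<in> ?W" for y
        using locdom_comp[OF c(1) c'(1), of y c''] that by simp
    qed
    have "smooth_on ?W (locrep c c'' (g \<circ> f))"
    proof (rule smooth_on_cong[OF W sm])
      show "locrep c c'' (g \<circ> f) y = locrep c' c'' g (locrep c c' f y)" if "y \<in> ?W" for y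
        using fd_locrep_comp(1)[OF c(1) c'(1) c(2), of y] that by simp
    qed
    moreover have "u \<in> ?W" using u c' by simp
    ultimately show "\<exists>U. open U \<and> u \<in> U \<and> smooth_on U (locrep c c'' (g \<circ> f))" using W by (intro exI[of _ ?W] conjI)
  qed
  fix u v assume u: "u \<in> locdom c c'' (g \<circ> f)"
  obtain c' where c': "c' \<in> atlas Y" "u \<in> locdom c c' f" using f.map_chart[OF c(1) cc[OF u]] .
  have w: "locrep c c' f u \<in> locdom c' c'' g" using locdom_comp[OF c(1) c', of c''] u by simp
  show "fd (locrep c c'' (g \<circ> f)) u (acs X c u v) = acs Z c'' (locrep c c'' (g \<circ> f) u) (fd (locrep c c'' (g \<circ> f)) u v)"
    unfolding fd_locrep_comp[OF c(1) c'(1) c(2) c'(2) u] o_apply f.acs_map[OF c(1) c'] g.acs_map[OF c'(1) c(2) w] ..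
qed

sublocale ac_map2 \<subseteq> gf: ac_map X Z "g \<circ> f"
  by unfold_locales (rule morphism_comp)

lemma (in almost_complex) morphism_id: "acm_morphism X X id"
  using smooth_map_id acs_transition by (simp add: acm_morphism_def smooth_map_def)

sublocale almost_complex \<subseteq> idm: ac_map X X id
  by unfold_locales (rule morphism_id)

section \<open>The functors, the transformations and the diagram\<close>

lemma (in almost_complex) structure_and_diagram:
  "bigraded_comm_algebra (H_BC X) (H_BC_pq X)"
  "bigraded_module (H_BC X) (H_BC_pq X) (H_A X) (H_A_pq X) (BC_act X)"
  "graded_space (H_Dol X) (H_Dol_pq X)" "graded_space (H_Dolbar X) (H_Dolbar_pq X)"
  "x \<in> carrier (H_BC X) \<Longrightarrow> BC_pull X X id x = x"
  "y \<in> carrier (H_A X) \<Longrightarrow> A_pull X X id y = y"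
  "y \<in> carrier (H_Dol X) \<Longrightarrow> Dol_pull X X id y = y"
  "y \<in> carrier (H_Dolbar X) \<Longrightarrow> Dolbar_pull X X id y = y"
  "x \<in> carrier (H_dR X) \<Longrightarrow> dR_pull X X id x = x"
  "x \<in> carrier (H_BC X) \<Longrightarrow> H2_to_A X (BC_to_Dol X x) = dR_to_A X (BC_to_dR X x)"
  "x \<in> carrier (H_BC X) \<Longrightarrow> H2_to_A X (BC_to_Dolbar X x) = dR_to_A X (BC_to_dR X x)"
proof -
  note c = represents_carrier[OF represents_BC] represents_carrier[OF represents_A] represents_carrier[OF represents_dR]
    represents_carrier[OF dol.represents_H2] represents_carrier[OF dolbar.represents_H2]
  note f = bcZ_forms[THEN subsetD] aeZ_forms[THEN subsetD] drZ_forms[THEN subsetD] adc.bcZ_sub[THEN subsetD]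
    adc.dolZ_sub[THEN subsetD]
  show "bigraded_comm_algebra (H_BC X) (H_BC_pq X)" by (rule BC_algebra)
  show "bigraded_module (H_BC X) (H_BC_pq X) (H_A X) (H_A_pq X) (BC_act X)" by (rule A_module)
  show "graded_space (H_Dol X) (H_Dol_pq X)" by (rule dol.graded_H2)
  show "graded_space (H_Dolbar X) (H_Dolbar_pq X)" by (rule dolbar.graded_H2)
  show "x \<in> carrier (H_BC X) \<Longrightarrow> BC_pull X X id x = x"
    unfolding c using f by (auto simp: idm.BC_pull_coset pull_id)
  show "y \<in> carrier (H_A X) \<Longrightarrow> A_pull X X id y = y"
    unfolding c using f by (auto simp: idm.A_pull_coset pull_id)
  show "y \<in> carrier (H_Dol X) \<Longrightarrow> Dol_pull X X id y = y"
    unfolding c using f by (auto simp: idm.dol.H2_pull_coset pull_id)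
  show "y \<in> carrier (H_Dolbar X) \<Longrightarrow> Dolbar_pull X X id y = y"
    unfolding c using f by (auto simp: idm.dolbar.H2_pull_coset pull_id)
  show "x \<in> carrier (H_dR X) \<Longrightarrow> dR_pull X X id x = x"
    unfolding c using f by (auto simp: idm.dR_pull_coset pull_id)
  show "x \<in> carrier (H_BC X) \<Longrightarrow> H2_to_A X (BC_to_Dol X x) = dR_to_A X (BC_to_dR X x)"
    unfolding c using f by (auto simp: dol.BC_to_H2_coset dol.H2_to_A_coset BC_to_dR_coset dR_to_A_coset)
  show "x \<in> carrier (H_BC X) \<Longrightarrow> H2_to_A X (BC_to_Dolbar X x) = dR_to_A X (BC_to_dR X x)"
    unfolding c using f by (auto simp: dolbar.BC_to_H2_coset dolbar.H2_to_A_coset BC_to_dR_coset dR_to_A_coset)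
qed

lemma (in ac_map) naturality:
  "x \<in> carrier (H_BC Y) \<Longrightarrow> BC_to_Dol X (BC_pull X Y f x) = Dol_pull X Y f (BC_to_Dol Y x)"
  "x \<in> carrier (H_BC Y) \<Longrightarrow> BC_to_Dolbar X (BC_pull X Y f x) = Dolbar_pull X Y f (BC_to_Dolbar Y x)"
  "x \<in> carrier (H_BC Y) \<Longrightarrow> BC_to_dR X (BC_pull X Y f x) = dR_pull X Y f (BC_to_dR Y x)"
  "x \<in> carrier (H_BC Y) \<Longrightarrow> BC_conj X (BC_pull X Y f x) = BC_pull X Y f (BC_conj Y x)"
  "y \<in> carrier (H_Dol Y) \<Longrightarrow> H2_to_A X (Dol_pull X Y f y) = A_pull X Y f (H2_to_A Y y)"
  "y \<in> carrier (H_Dolbar Y) \<Longrightarrow> H2_to_A X (Dolbar_pull X Y f y) = A_pull X Y f (H2_to_A Y y)"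
  "x \<in> carrier (H_dR Y) \<Longrightarrow> dR_to_A X (dR_pull X Y f x) = A_pull X Y f (dR_to_A Y x)"
  "y \<in> carrier (H_A Y) \<Longrightarrow> A_conj X (A_pull X Y f y) = A_pull X Y f (A_conj Y y)"
proof -
  note c = represents_carrier[OF Y.represents_BC] represents_carrier[OF Y.represents_A] represents_carrier[OF Y.represents_dR]
    represents_carrier[OF Y.dol.represents_H2] represents_carrier[OF Y.dolbar.represents_H2]
  note f = Y.bcZ_forms[THEN subsetD] Y.aeZ_forms[THEN subsetD] Y.adc.bcZ_sub[THEN subsetD]
    Y.adc.dolZ_sub[THEN subsetD] Y.adc.drZ_sub[THEN subsetD]
  note BC = Y.dol.BC_to_H2_coset Y.dolbar.BC_to_H2_coset Y.BC_to_dR_coset Y.BC_conj_coset X.dol.BC_to_H2_coset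
    X.dolbar.BC_to_H2_coset X.BC_to_dR_coset X.BC_conj_coset BC_pull_coset pb.bcZ X.conj.bcZ Y.conj.bcZ
    dol.H2_pull_coset dolbar.H2_pull_coset dR_pull_coset pull_conj
  note A = Y.dol.H2_to_A_coset Y.dolbar.H2_to_A_coset Y.dR_to_A_coset Y.A_conj_coset X.dol.H2_to_A_coset
    X.dolbar.H2_to_A_coset X.dR_to_A_coset X.A_conj_coset A_pull_coset pb.aeZ pb.dol[OF refl] pb.dr[OF refl] X.conj.aeZ Y.conj.aeZ
    dol.H2_pull_coset dolbar.H2_pull_coset dR_pull_coset pull_conj
  show "x \<in> carrier (H_BC Y) \<Longrightarrow> BC_to_Dol X (BC_pull X Y f x) = Dol_pull X Y f (BC_to_Dol Y x)"
    "x \<in> carrier (H_BC Y) \<Longrightarrow> BC_to_Dolbar X (BC_pull X Y f x) = Dolbar_pull X Y f (BC_to_Dolbar Y x)"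
    "x \<in> carrier (H_BC Y) \<Longrightarrow> BC_to_dR X (BC_pull X Y f x) = dR_pull X Y f (BC_to_dR Y x)"
    "x \<in> carrier (H_BC Y) \<Longrightarrow> BC_conj X (BC_pull X Y f x) = BC_pull X Y f (BC_conj Y x)"
    unfolding c using f by (auto simp: BC)
  show "y \<in> carrier (H_Dol Y) \<Longrightarrow> H2_to_A X (Dol_pull X Y f y) = A_pull X Y f (H2_to_A Y y)"
    "y \<in> carrier (H_Dolbar Y) \<Longrightarrow> H2_to_A X (Dolbar_pull X Y f y) = A_pull X Y f (H2_to_A Y y)"
    "x \<in> carrier (H_dR Y) \<Longrightarrow> dR_to_A X (dR_pull X Y f x) = A_pull X Y f (dR_to_A Y x)"
    "y \<in> carrier (H_A Y) \<Longrightarrow> A_conj X (A_pull X Y f y) = A_pull X Y f (A_conj Y y)"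
    unfolding c using f by (auto simp: A)
qed

lemma (in ac_map2) functoriality:
  "x \<in> carrier (H_BC Z) \<Longrightarrow> BC_pull X Z (g \<circ> f) x = BC_pull X Y f (BC_pull Y Z g x)"
  "y \<in> carrier (H_A Z) \<Longrightarrow> A_pull X Z (g \<circ> f) y = A_pull X Y f (A_pull Y Z g y)"
  "y \<in> carrier (H_Dol Z) \<Longrightarrow> Dol_pull X Z (g \<circ> f) y = Dol_pull X Y f (Dol_pull Y Z g y)"
  "y \<in> carrier (H_Dolbar Z) \<Longrightarrow> Dolbar_pull X Z (g \<circ> f) y = Dolbar_pull X Y f (Dolbar_pull Y Z g y)"
  "x \<in> carrier (H_dR Z) \<Longrightarrow> dR_pull X Z (g \<circ> f) x = dR_pull X Y f (dR_pull Y Z g x)"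
proof -
  note c = represents_carrier[OF g.Y.represents_BC] represents_carrier[OF g.Y.represents_A] represents_carrier[OF g.Y.represents_dR]
    represents_carrier[OF g.Y.dol.represents_H2] represents_carrier[OF g.Y.dolbar.represents_H2]
  note f = g.Y.bcZ_forms[THEN subsetD] g.Y.aeZ_forms[THEN subsetD] g.Y.drZ_forms[THEN subsetD] g.Y.adc.dolZ_sub[THEN subsetD]
  note s = pull_comp gf.BC_pull_coset f.BC_pull_coset g.BC_pull_coset g.pb.bcZ gf.A_pull_coset f.A_pull_coset g.A_pull_coset g.pb.aeZ
    gf.dol.H2_pull_coset f.dol.H2_pull_coset g.dol.H2_pull_coset gf.dolbar.H2_pull_coset f.dolbar.H2_pull_coset
    g.dolbar.H2_pull_coset gf.dR_pull_coset f.dR_pull_coset g.dR_pull_coset g.pb.dol[OF refl] g.pb.dr[OF refl]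
  show "x \<in> carrier (H_BC Z) \<Longrightarrow> BC_pull X Z (g \<circ> f) x = BC_pull X Y f (BC_pull Y Z g x)"
    "y \<in> carrier (H_A Z) \<Longrightarrow> A_pull X Z (g \<circ> f) y = A_pull X Y f (A_pull Y Z g y)"
    "y \<in> carrier (H_Dol Z) \<Longrightarrow> Dol_pull X Z (g \<circ> f) y = Dol_pull X Y f (Dol_pull Y Z g y)"
    "y \<in> carrier (H_Dolbar Z) \<Longrightarrow> Dolbar_pull X Z (g \<circ> f) y = Dolbar_pull X Y f (Dolbar_pull Y Z g y)"
    "x \<in> carrier (H_dR Z) \<Longrightarrow> dR_pull X Z (g \<circ> f) x = dR_pull X Y f (dR_pull Y Z g x)"
    unfolding c using f by (auto simp: s)
qed


theorem theorem28:
  shows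
    "(\<forall>X :: ('a, 'e::real_inner) acm. almost_complex_manifold X \<longrightarrow>
        bigraded_comm_algebra (H_BC X) (H_BC_pq X) \<and>
        bigraded_module (H_BC X) (H_BC_pq X) (H_A X) (H_A_pq X) (BC_act X) \<and>
        graded_space (H_Dol X) (H_Dol_pq X) \<and>
        graded_space (H_Dolbar X) (H_Dolbar_pq X) \<and>
        bifiltered_space (H_dR X) (H_dR_deg X) (dR_F X) (dR_Fbar X) \<and>
        (\<forall>x\<in>carrier (H_BC X). BC_pull X X id x = x) \<and>
        (\<forall>x\<in>carrier (H_A X). A_pull X X id x = x) \<and>
        (\<forall>x\<in>carrier (H_Dol X). Dol_pull X X id x = x) \<and>
        (\<forall>x\<in>carrier (H_Dolbar X). Dolbar_pull X X id x = x) \<and>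
        (\<forall>x\<in>carrier (H_dR X). dR_pull X X id x = x) \<and>
        graded_hom (H_BC X) (H_BC_pq X) (H_Dol X) (H_Dol_pq X) (BC_to_Dol X) \<and>
        graded_hom (H_BC X) (H_BC_pq X) (H_Dolbar X) (H_Dolbar_pq X) (BC_to_Dolbar X) \<and>
        bifiltered_hom
          (H_BC X) (tot (H_BC X) (H_BC_pq X)) (fil1 (H_BC X) (H_BC_pq X)) (fil2 (H_BC X) (H_BC_pq X))
          (H_dR X) (H_dR_deg X) (dR_F X) (dR_Fbar X) (BC_to_dR X) \<and>
        graded_hom (H_Dol X) (H_Dol_pq X) (H_A X) (H_A_pq X) (H2_to_A X) \<and>
        graded_hom (H_Dolbar X) (H_Dolbar_pq X) (H_A X) (H_A_pq X) (H2_to_A X) \<and>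
        bifiltered_hom
          (H_dR X) (H_dR_deg X) (dR_F X) (dR_Fbar X)
          (H_A X) (tot (H_A X) (H_A_pq X)) (fil1 (H_A X) (H_A_pq X)) (fil2 (H_A X) (H_A_pq X))
          (dR_to_A X) \<and>
        (\<forall>x\<in>carrier (H_BC X).
           H2_to_A X (BC_to_Dol X x) = dR_to_A X (BC_to_dR X x) \<and>
           H2_to_A X (BC_to_Dolbar X x) = dR_to_A X (BC_to_dR X x)) \<and>
        (\<forall>p q. antilinear_iso_on (H_BC X) (H_BC_pq X (p, q)) (H_BC_pq X (q, p)) (BC_conj X)) \<and>
        (\<forall>p q. antilinear_iso_on (H_A X) (H_A_pq X (p, q)) (H_A_pq X (q, p)) (A_conj X)))
   \<and> (\<forall>(X :: ('a, 'e) acm) (Y :: ('b, 'f::real_inner) acm) f.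
        almost_complex_manifold X \<and> almost_complex_manifold Y \<and> acm_morphism X Y f \<longrightarrow>
        bigraded_algebra_hom (H_BC Y) (H_BC_pq Y) (H_BC X) (H_BC_pq X) (BC_pull X Y f) \<and>
        graded_hom (H_A Y) (H_A_pq Y) (H_A X) (H_A_pq X) (A_pull X Y f) \<and>
        (\<forall>a\<in>carrier (H_BC Y). \<forall>x\<in>carrier (H_A Y).
           A_pull X Y f (BC_act Y a x) = BC_act X (BC_pull X Y f a) (A_pull X Y f x)) \<and>
        graded_hom (H_Dol Y) (H_Dol_pq Y) (H_Dol X) (H_Dol_pq X) (Dol_pull X Y f) \<and>
        graded_hom (H_Dolbar Y) (H_Dolbar_pq Y) (H_Dolbar X) (H_Dolbar_pq X) (Dolbar_pull X Y f) \<and>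
        bifiltered_hom (H_dR Y) (H_dR_deg Y) (dR_F Y) (dR_Fbar Y)
          (H_dR X) (H_dR_deg X) (dR_F X) (dR_Fbar X) (dR_pull X Y f) \<and>
        (\<forall>x\<in>carrier (H_BC Y).
           BC_to_Dol X (BC_pull X Y f x) = Dol_pull X Y f (BC_to_Dol Y x) \<and>
           BC_to_Dolbar X (BC_pull X Y f x) = Dolbar_pull X Y f (BC_to_Dolbar Y x) \<and>
           BC_to_dR X (BC_pull X Y f x) = dR_pull X Y f (BC_to_dR Y x) \<and>
           BC_conj X (BC_pull X Y f x) = BC_pull X Y f (BC_conj Y x)) \<and>
        (\<forall>x\<in>carrier (H_Dol Y). H2_to_A X (Dol_pull X Y f x) = A_pull X Y f (H2_to_A Y x)) \<and>
        (\<forall>x\<in>carrier (H_Dolbar Y).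
           H2_to_A X (Dolbar_pull X Y f x) = A_pull X Y f (H2_to_A Y x)) \<and>
        (\<forall>x\<in>carrier (H_dR Y). dR_to_A X (dR_pull X Y f x) = A_pull X Y f (dR_to_A Y x)) \<and>
        (\<forall>x\<in>carrier (H_A Y). A_conj X (A_pull X Y f x) = A_pull X Y f (A_conj Y x)))
   \<and> (\<forall>(X :: ('a, 'e) acm) (Y :: ('b, 'f) acm) (Z :: ('c, 'g::real_inner) acm) f g.
        almost_complex_manifold X \<and> almost_complex_manifold Y \<and> almost_complex_manifold Z \<and>
        acm_morphism X Y f \<and> acm_morphism Y Z g \<longrightarrow>
        (\<forall>x\<in>carrier (H_BC Z). BC_pull X Z (g \<circ> f) x = BC_pull X Y f (BC_pull Y Z g x)) \<and>
        (\<forall>x\<in>carrier (H_A Z). A_pull X Z (g \<circ> f) x = A_pull X Y f (A_pull Y Z g x)) \<and>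
        (\<forall>x\<in>carrier (H_Dol Z). Dol_pull X Z (g \<circ> f) x = Dol_pull X Y f (Dol_pull Y Z g x)) \<and>
        (\<forall>x\<in>carrier (H_Dolbar Z).
           Dolbar_pull X Z (g \<circ> f) x = Dolbar_pull X Y f (Dolbar_pull Y Z g x)) \<and>
        (\<forall>x\<in>carrier (H_dR Z). dR_pull X Z (g \<circ> f) x = dR_pull X Y f (dR_pull Y Z g x)))"
  proof (rule conjI[OF allI[OF impI] conjI[OF allI[OF allI[OF allI[OF impI]]] allI[OF allI[OF allI[OF allI[OF allI[OF impI]]]]]]],
    goal_cases)
  case (1 X)
  then interpret almost_complex X by unfold_locales
  show ?case
    by (intro conjI ballI allI structure_and_diagram bifiltered_dR dol.BC_to_H2_hom dolbar.BC_to_H2_hom BC_to_dR_hom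
        dol.H2_to_A_hom dolbar.H2_to_A_hom dR_to_A_hom conj_antilinear_iso)
next
  case (2 X Y f)
  then interpret ac_map X Y f by unfold_locales blast+
  show ?case
    by (intro conjI ballI BC_pull_algebra_hom A_pull_graded pull_act dol.H2_pull_hom dolbar.H2_pull_hom dR_pull_hom naturality)
next
  case (3 X Y Z f g)
  then interpret ac_map2 X Y Z f g by unfold_locales blast+
  show ?case by (intro conjI ballI functoriality)
qed

end
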